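(* Let $f:\mathbb Q[\alpha][[h]]\to\prod_{k\in\mathbb N^*}\mathbb Q[[h]]$, $x\mapsto(x|_{\alpha=k})_{k\in\mathbb N^*}$ (an injective map), and let $g:\widehat R\to\prod_{r\in\mathbb N^*}\widehat R_r$, $g(x)=\big((ev_r\times\tfrac{1}{FC_r})(x)\big)_{r\in\mathbb N^*}$, where $(ev_r\times\frac{1}{FC_r})(x)=ev_r(x)\cdot FC_r(x)^{-1}$. Then the map $\Phi=g\circ f^{-1}:\mathrm{Im}(f|_{\widehat R})\to\prod_{r\in\mathbb N^*}\widehat R_r$ is such that for every $0$-framed knot $\mathcal K$ in $S^3$, $$\{ADO_r(A,\mathcal K)\}_{r\in\mathbb N^*}=\Phi\big(\{J_n(q^2,\mathcal K)\}_{n\in\mathbb N^*}\big),\qquad q=e^h.$$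
   Context: $\mathbb N^*=\{1,2,\dots\}$. Knots are oriented, framed, in $S^3$. For $r\in\mathbb N^*$, $\zeta_{2r}=e^{i\pi/r}$. $\{n\}=q^n-q^{-n}$, $[n]=\{n\}/\{1\}$, $[n]!=\prod_{i=1}^n[i]$, $\binom{n}{k}_q=\frac{[n]!}{[n-k]![k]!}$. $A$ is a formal variable, also written $q^\alpha$ or $\zeta_{2r}^\alpha$; $\{\alpha+k\}_q=q^kA-q^{-k}A^{-1}$ and $\{\alpha+k;n\}_q=\prod_{i=0}^{n-1}\{\alpha+k-i\}_q$ (similarly with $q$ replaced by $\zeta_{2r}$). Rings and maps. $R=\mathbb Z[q^{\pm1},A^{\pm1}]$, $I_n\subset R$ is the ideal generated by $\{\alpha+l;n\}_q$, $l\in\mathbb Z$, and $\widehat R=\varprojlim_n R/I_n$, a subring of $\mathbb Q[\alpha][[h]]$ via $q=e^h$, $A=e^{\alpha h}$; $f|_{\widehat R}$ is the restriction of $f$ to this subring, and $f^{-1}$ is the inverse of the injective map $f$ on its image. $R_r=\mathbb Z[\zeta_{2r},A^{\pm1}]$, $I\subset R_r$ is the ideal generated by $A^r-A^{-r}$, and $\widehat R_r=\varprojlim_n R_r/I^n$. The evaluation $ev:R\to R_r$, $q\mapsto\zeta_{2r}$, $A\mapsto A$ sends $I_{rn}$ to $I^n$ and induces $ev_r:\widehat R\to\widehat R_r$, $(a_n)_n\mapsto(ev(a_{rn}))_n$. For $r=1$ ($\zeta_2=-1$), $\widehat R_1=\varprojlim_n\mathbb Z[A^{\pm1}]/((A-A^{-1})^n)$.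 Let $g_r:\widehat R_1\to\varprojlim_n\mathbb Z[A^{\pm1}]/((A^r-A^{-r})^n)$ be induced by $A\mapsto A^r$; its target maps to $\widehat R_r$. $FC_r:=g_r\circ ev_1$. ADO invariant. Write $\zeta=\zeta_{2r}$. Let $V$ be the module with basis $v_0,\dots,v_{r-1}$ over $\mathbb Z[\zeta,A^{\pm1}]$ with $Ev_0=0$, $Ev_i=v_{i-1}$, $F^{(n)}v_i=\binom{n+i}{n}_{\zeta}\{\alpha-i;n\}_{\zeta}\,v_{n+i}$ (zero if $n+i\ge r$), $Kv_i=\zeta^{\alpha-2i}v_i$, $\zeta^{\frac{H\otimes H}{2}}(v_i\otimes v_j)=\zeta^{\frac{\alpha^2}{2}}\zeta^{-(i+j)\alpha}\zeta^{2ij}v_i\otimes v_j$ ($\zeta^{\alpha^2/2}$ a formal invertible symbol). With $R$-matrix $\zeta^{\frac{H\otimes H}{2}}\sum_{n=0}^{r-1}\zeta^{\frac{n(n-1)}{2}}E^n\otimes F^{(n)}$, its inverse, and pivotal element $K^{1-r}$, the Reshetikhin–Turaev operator of a 1-1 tangle with closure $\mathcal K$ is a scalar on $V$; this scalar is $ADO_r(A,\mathcal K)$, in $\mathbb Z[\zeta,A^{\pm1}]\subset\widehat R_r$ for $0$-framed $\mathcal K$. Colored Jones polynomials. $J_n(q^2,\mathcal K)\in\mathbb Z[q^{\pm1}]\subset\mathbb Q[[h]]$ (via $q=e^h$) is the scalar by which the Reshetikhin–Turaev operator of a 1-1 tangle with $0$-framed closure $\mathcal K$ acts on the $(n+1)$-dimensional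 irreducible representation of quantum $\mathfrak{sl}_2$, using $q^{\frac{H\otimes H}{2}}\sum_{n\ge 0}\frac{\{1\}^nq^{n(n-1)/2}}{[n]!}E^n\otimes F^n$ as $R$-matrix and pivotal element $K=q^H$, where $[E,F]=\frac{K-K^{-1}}{q-q^{-1}}$ (so $J_n(\text{unknot})=1$). *)

theory Defs
  imports
    "HOL-Library.Poly_Mapping"
    "HOL-Library.FuncSet"
    "HOL-Library.Product_Plus"
    "HOL-Computational_Algebra.Formal_Power_Series"
    "HOL-Computational_Algebra.Polynomial"
    "HOL-Algebra.QuotRing"
    "HOL-Algebra.Ideal_Product"
    "HOL-Algebra.Generated_Rings"
    "HOL-Algebra.Algebraic_Closure_Type"
    "Jordan_Normal_Form.Matrix"
    "HOL.Complex"
begin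

section \<open>Oriented tangle diagrams\<close>

text \<open>
  Diagrams are read from bottom to top. A slice \<open>(u, G, w)\<close> consists of an elementary piece \<open>G\<close>
  with vertical strands \<open>u\<close> on its left and \<open>w\<close> on its right. The six elementary pieces generate
  all oriented framed tangles (with the blackboard framing): a crossing with another
  orientation is obtained by rotating an upward crossing with cups and caps.
\<close>

datatype orient = Up | Down

datatype piece =
    PosX    \<comment> \<open>positive crossing of two upward strands\<close>
  | NegX    \<comment> \<open>negative crossing of two upward strands\<close>
  | CupUD | CupDU | CapUD | CapDU

fun src :: "piece \<Rightarrow> orient list" where
  "src PosX = [Up, Up]" | "src NegX = [Up, Up]"
| "src CupUD = []" | "src CupDU = []"
| "src CapUD = [Up, Down]" | "src CapDU = [Down, Up]"

fun tgt :: "piece \<Rightarrow> orient list" where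
  "tgt PosX = [Up, Up]" | "tgt NegX = [Up, Up]"
| "tgt CupUD = [Up, Down]" | "tgt CupDU = [Down, Up]"
| "tgt CapUD = []" | "tgt CapDU = []"

type_synonym slice = "orient list \<times> piece \<times> orient list"

fun tangle :: "orient list \<Rightarrow> slice list \<Rightarrow> orient list \<Rightarrow> bool" where
  "tangle s [] t \<longleftrightarrow> s = t"
| "tangle s ((u, G, w) # D) t \<longleftrightarrow> s = u @ src G @ w \<and> tangle (u @ tgt G @ w) D t"

text \<open>The point \<open>(l, p)\<close> is the \<open>p\<close>-th strand at height \<open>l\<close>; the arcs of a slice join such points.\<close>

fun piece_arcs :: "nat \<Rightarrow> nat \<Rightarrow> piece \<Rightarrow> ((nat \<times> nat) \<times> (nat \<times> nat)) set" where
  "piece_arcs l k PosX = {((l, k), (Suc l, Suc k)), ((l, Suc k), (Suc l, k))}"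
| "piece_arcs l k NegX = {((l, k), (Suc l, Suc k)), ((l, Suc k), (Suc l, k))}"
| "piece_arcs l k CupUD = {((Suc l, k), (Suc l, Suc k))}"
| "piece_arcs l k CupDU = {((Suc l, k), (Suc l, Suc k))}"
| "piece_arcs l k CapUD = {((l, k), (l, Suc k))}"
| "piece_arcs l k CapDU = {((l, k), (l, Suc k))}"

fun slice_arcs :: "nat \<Rightarrow> slice \<Rightarrow> ((nat \<times> nat) \<times> (nat \<times> nat)) set" where
  "slice_arcs l (u, G, w) =
     {((l, p), (Suc l, p)) | p. p < length u}
   \<union> piece_arcs l (length u) G
   \<union> {((l, length u + length (src G) + p), (Suc l, length u + length (tgt G) + p)) | p. p < length w}"

definition arcs :: "slice list \<Rightarrow> ((nat \<times> nat) \<times> (nat \<times> nat)) set" where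
  "arcs D = (\<Union>l<length D. slice_arcs l (D ! l))"

text \<open>A 1-1 tangle whose closure has a single component: every point is connected to the bottom endpoint.\<close>

definition closure_is_knot :: "slice list \<Rightarrow> bool" where
  "closure_is_knot D \<longleftrightarrow> tangle [Up] D [Up] \<and>
     (\<forall>x\<in>Field (arcs D). ((0, 0), x) \<in> (arcs D \<union> (arcs D)\<inverse>)\<^sup>*)"

fun piece_sign :: "piece \<Rightarrow> int" where
  "piece_sign PosX = 1" | "piece_sign NegX = - 1" | "piece_sign _ = 0"

text \<open>The writhe is the framing number of the closure.\<close>

definition writhe :: "slice list \<Rightarrow> int" where
  "writhe D = (\<Sum>(u, G, w)\<leftarrow>D. piece_sign G)"

definition zero_framed_knot :: "slice list \<Rightarrow> bool" where
  "zero_framed_knot D \<longleftrightarrow> closure_is_knot D \<and> writhe D = 0"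


section \<open>The Reshetikhin--Turaev operator\<close>

text \<open>
  \<open>V\<close> is free with basis \<open>v\<^sub>0, \<dots>, v\<^bsub>N-1\<^esub>\<close>; an upward strand carries \<open>V\<close>, a downward strand its dual
  with the dual basis. Matrices act on column vectors, and \<open>v\<^sub>i \<otimes> v\<^sub>j\<close> has index \<open>i * N + j\<close>.
\<close>

definition kron :: "'a::times mat \<Rightarrow> 'a mat \<Rightarrow> 'a mat" where
  "kron A B = mat (dim_row A * dim_row B) (dim_col A * dim_col B)
     (\<lambda>(i, j). A $$ (i div dim_row B, j div dim_col B) * B $$ (i mod dim_row B, j mod dim_col B))"

definition mat_inv :: "nat \<Rightarrow> 'a::comm_ring_1 mat \<Rightarrow> 'a mat" where
  "mat_inv n M = inv\<^bsub>ring_mat TYPE('a) n ()\<^esub> M"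

definition swap_mat :: "nat \<Rightarrow> 'a::comm_ring_1 mat" where
  "swap_mat N = mat (N * N) (N * N)
     (\<lambda>(p, s). if p div N = s mod N \<and> p mod N = s div N then 1 else 0)"

text \<open>
  \<open>R\<close> is the matrix of the R-matrix on \<open>V \<otimes> V\<close> and \<open>g\<close> that of the pivotal element. The caps are
  \<open>f \<otimes> v \<mapsto> f v\<close> and \<open>v \<otimes> f \<mapsto> f (g v)\<close>, the cups \<open>1 \<mapsto> \<Sum>\<^sub>i v\<^sub>i \<otimes> v\<^sub>i\<^sup>*\<close> and \<open>1 \<mapsto> \<Sum>\<^sub>i v\<^sub>i\<^sup>* \<otimes> g\<^sup>-\<^sup>1 v\<^sub>i\<close>.
\<close>

fun piece_op :: "nat \<Rightarrow> 'a::comm_ring_1 mat \<Rightarrow> 'a mat \<Rightarrow> piece \<Rightarrow> 'a mat" where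
  "piece_op N R g PosX = swap_mat N * R"
| "piece_op N R g NegX = mat_inv (N * N) R * swap_mat N"
| "piece_op N R g CupUD = mat (N * N) 1 (\<lambda>(p, _). if p div N = p mod N then 1 else 0)"
| "piece_op N R g CupDU = mat (N * N) 1 (\<lambda>(p, _). mat_inv N g $$ (p mod N, p div N))"
| "piece_op N R g CapDU = mat 1 (N * N) (\<lambda>(_, p). if p div N = p mod N then 1 else 0)"
| "piece_op N R g CapUD = mat 1 (N * N) (\<lambda>(_, p). g $$ (p mod N, p div N))"

definition slice_op :: "nat \<Rightarrow> 'a::comm_ring_1 mat \<Rightarrow> 'a mat \<Rightarrow> slice \<Rightarrow> 'a mat" where
  "slice_op N R g = (\<lambda>(u, G, w).
     kron (kron (1\<^sub>m (N ^ length u)) (piece_op N R g G)) (1\<^sub>m (N ^ length w)))"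

fun rt_op :: "nat \<Rightarrow> 'a::comm_ring_1 mat \<Rightarrow> 'a mat \<Rightarrow> orient list \<Rightarrow> slice list \<Rightarrow> 'a mat" where
  "rt_op N R g s [] = 1\<^sub>m (N ^ length s)"
| "rt_op N R g s ((u, G, w) # D) = rt_op N R g (u @ tgt G @ w) D * slice_op N R g (u, G, w)"

text \<open>
  The matrix of \<open>\<Theta> (\<Sum>\<^sub>m c\<^sub>m E\<^sub>m \<otimes> F\<^sub>m)\<close>, where \<open>\<Theta> (v\<^sub>i \<otimes> v\<^sub>j) = \<theta> i j (v\<^sub>i \<otimes> v\<^sub>j)\<close>. Below \<open>E\<^sub>m = E\<^sup>m\<close>
  vanishes for \<open>m \<ge> N\<close>.
\<close>

definition r_matrix ::
  "nat \<Rightarrow> (nat \<Rightarrow> nat \<Rightarrow> 'a::comm_ring_1) \<Rightarrow> (nat \<Rightarrow> 'a) \<Rightarrow> (nat \<Rightarrow> 'a mat) \<Rightarrow> (nat \<Rightarrow> 'a mat) \<Rightarrow> 'a mat" where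
  "r_matrix N \<theta> c E F = mat (N * N) (N * N)
     (\<lambda>(p, s). \<theta> (p div N) (p mod N) * (\<Sum>m<N. c m * kron (E m) (F m) $$ (p, s)))"


section \<open>Quantum integers\<close>

text \<open>The argument \<open>pw\<close> is the function \<open>k \<mapsto> q\<^sup>k\<close>.\<close>

definition qbr :: "(int \<Rightarrow> 'a::idom_divide) \<Rightarrow> int \<Rightarrow> 'a" where
  "qbr pw n = pw n - pw (- n)"

definition qint :: "(int \<Rightarrow> 'a::idom_divide) \<Rightarrow> int \<Rightarrow> 'a" where
  "qint pw n = qbr pw n div qbr pw 1"

definition qfact :: "(int \<Rightarrow> 'a::idom_divide) \<Rightarrow> nat \<Rightarrow> 'a" where
  "qfact pw n = (\<Prod>i=1..n. qint pw (int i))"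

definition qbinom :: "(int \<Rightarrow> 'a::idom_divide) \<Rightarrow> nat \<Rightarrow> nat \<Rightarrow> 'a" where
  "qbinom pw n k = qfact pw n div (qfact pw (n - k) * qfact pw k)"


section \<open>Colored Jones polynomials\<close>

text \<open>
  They are computed in \<open>\<rat>[[h]]\<close> with \<open>q = e\<^sup>h\<close>. On the irreducible module of dimension \<open>n + 1\<close>,
  in the basis with \<open>E v\<^sub>i = v\<^bsub>i-1\<^esub>\<close>, one has \<open>F v\<^sub>i = [i+1] [n-i] v\<^bsub>i+1\<^esub>\<close> and \<open>H v\<^sub>i = (n - 2i) v\<^sub>i\<close>.
\<close>

definition q_h :: "int \<Rightarrow> rat fps" where
  "q_h k = fps_exp (of_int k)"

definition jones_E :: "nat \<Rightarrow> rat fps mat" where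
  "jones_E n = mat (n + 1) (n + 1) (\<lambda>(k, i). if i = k + 1 then 1 else 0)"

definition jones_F :: "nat \<Rightarrow> rat fps mat" where
  "jones_F n = mat (n + 1) (n + 1)
     (\<lambda>(k, i). if k = i + 1 then qint q_h (int i + 1) * qint q_h (int n - int i) else 0)"

definition jones_K :: "nat \<Rightarrow> rat fps mat" where
  "jones_K n = mat (n + 1) (n + 1) (\<lambda>(k, i). if k = i then q_h (int n - 2 * int i) else 0)"

definition jones_R :: "nat \<Rightarrow> rat fps mat" where
  "jones_R n = r_matrix (n + 1)
     (\<lambda>i j. fps_exp ((of_nat n - 2 * of_nat i) * (of_nat n - 2 * of_nat j) / 2))
     (\<lambda>m. (qbr q_h 1 ^ m * q_h (int m * (int m - 1) div 2)) div qfact q_h m)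
     (\<lambda>m. jones_E n ^\<^sub>m m) (\<lambda>m. jones_F n ^\<^sub>m m)"

definition colored_jones :: "nat \<Rightarrow> slice list \<Rightarrow> rat fps" where
  "colored_jones n D =
     (THE c. rt_op (n + 1) (jones_R n) (jones_K n) [Up] D = c \<cdot>\<^sub>m 1\<^sub>m (n + 1))"


section \<open>ADO invariants\<close>

definition zeta :: "nat \<Rightarrow> complex" where
  "zeta r = cis (pi / real r)"

abbreviation zeta_pow :: "nat \<Rightarrow> int \<Rightarrow> complex" where
  "zeta_pow r k \<equiv> zeta r powi k"

text \<open>
  Laurent polynomials in \<open>A\<close> are finitely supported functions of the exponent of \<open>A\<close>. In the type
  \<open>int \<Rightarrow>\<^sub>0 int \<Rightarrow>\<^sub>0 complex\<close> the outer exponent is that of the formal symbol for \<open>\<zeta>\<close> to the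
  power \<open>\<alpha>\<^sup>2/2\<close>.
\<close>

type_synonym laurentA = "int \<Rightarrow>\<^sub>0 complex"

definition Amon :: "int \<Rightarrow> complex \<Rightarrow> laurentA" where
  "Amon b c = Poly_Mapping.single b c"

definition const_t :: "laurentA \<Rightarrow> int \<Rightarrow>\<^sub>0 laurentA" where
  "const_t p = Poly_Mapping.single 0 p"

definition zeta_alpha :: "nat \<Rightarrow> int \<Rightarrow> nat \<Rightarrow> laurentA" where
  "zeta_alpha r k n = (\<Prod>i<n. Amon 1 (zeta_pow r (k - int i)) - Amon (- 1) (zeta_pow r (- (k - int i))))"

definition ado_E :: "nat \<Rightarrow> (int \<Rightarrow>\<^sub>0 laurentA) mat" where
  "ado_E r = mat r r (\<lambda>(k, i). if i = k + 1 then 1 else 0)"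

definition ado_F :: "nat \<Rightarrow> nat \<Rightarrow> (int \<Rightarrow>\<^sub>0 laurentA) mat" where
  "ado_F r n = mat r r
     (\<lambda>(k, i). if k = n + i
       then const_t (Amon 0 (qbinom (zeta_pow r) (n + i) n) * zeta_alpha r (- int i) n) else 0)"

definition ado_R :: "nat \<Rightarrow> (int \<Rightarrow>\<^sub>0 laurentA) mat" where
  "ado_R r = r_matrix r
     (\<lambda>i j. Poly_Mapping.single 1 (Amon (- int (i + j)) (zeta_pow r (2 * int i * int j))))
     (\<lambda>n. const_t (Amon 0 (zeta_pow r (int n * (int n - 1) div 2))))
     (\<lambda>n. ado_E r ^\<^sub>m n) (ado_F r)"

text \<open>\<open>K\<^bsup>1-r\<^esup> v\<^sub>i = A\<^bsup>1-r\<^esup> \<zeta>\<^bsup>-2i(1-r)\<^esup> v\<^sub>i\<close>\<close>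

definition ado_pivot :: "nat \<Rightarrow> (int \<Rightarrow>\<^sub>0 laurentA) mat" where
  "ado_pivot r = mat r r
     (\<lambda>(k, i). if k = i then const_t (Amon (1 - int r) (zeta_pow r (- 2 * int i * (1 - int r)))) else 0)"

definition ADO :: "nat \<Rightarrow> slice list \<Rightarrow> laurentA" where
  "ADO r D = (THE c. rt_op r (ado_R r) (ado_pivot r) [Up] D = const_t c \<cdot>\<^sub>m 1\<^sub>m r)"


section \<open>Inverse limits of quotient rings\<close>

text \<open>
  For a descending sequence of ideals, a coset of \<open>I (n + 1)\<close> projects to the coset of \<open>I n\<close> that
  contains it, so the subset condition expresses compatibility.
\<close>

definition inverse_limit :: "('a, 'm) ring_scheme \<Rightarrow> (nat \<Rightarrow> 'a set) \<Rightarrow> (nat \<Rightarrow> 'a set) ring" where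
  "inverse_limit R I = \<lparr>
     carrier = {s. \<forall>n. s n \<in> carrier (R Quot I n) \<and> s (Suc n) \<subseteq> s n},
     monoid.mult = (\<lambda>s t n. s n \<otimes>\<^bsub>R Quot I n\<^esub> t n),
     one = (\<lambda>n. \<one>\<^bsub>R Quot I n\<^esub>),
     ring.zero = (\<lambda>n. \<zero>\<^bsub>R Quot I n\<^esub>),
     add = (\<lambda>s t n. s n \<oplus>\<^bsub>R Quot I n\<^esub> t n)\<rparr>"

text \<open>
  The map \<open>(a\<^sub>n)\<^sub>n \<mapsto> (\<phi> a\<^bsub>k n\<^esub>)\<^sub>n\<close> into the inverse limit of the \<open>S Quot J n\<close>: the image of a coset
  under \<open>\<phi>\<close> is enlarged to a full coset of \<open>J n\<close>.
\<close>

definition limit_map ::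
  "('b, 'm) ring_scheme \<Rightarrow> (nat \<Rightarrow> 'b set) \<Rightarrow> (nat \<Rightarrow> nat) \<Rightarrow> ('a \<Rightarrow> 'b) \<Rightarrow> (nat \<Rightarrow> 'a set) \<Rightarrow> (nat \<Rightarrow> 'b set)" where
  "limit_map S J k \<phi> s = (\<lambda>n. J n <+>\<^bsub>S\<^esub> \<phi> ` s (k n))"

definition ideal_power :: "('a, 'm) ring_scheme \<Rightarrow> 'a set \<Rightarrow> nat \<Rightarrow> 'a set" where
  "ideal_power R I n = I [^]\<^bsub>ideals_set R\<^esub> n"

definition to_limit :: "('a, 'm) ring_scheme \<Rightarrow> (nat \<Rightarrow> 'a set) \<Rightarrow> 'a \<Rightarrow> (nat \<Rightarrow> 'a set)" where
  "to_limit R I a = (\<lambda>n. I n +>\<^bsub>R\<^esub> a)"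


section \<open>The generic ring and its completion\<close>

text \<open>The exponent \<open>(a, b)\<close> stands for \<open>q\<^sup>a A\<^sup>b\<close>.\<close>

type_synonym laurent_qA = "(int \<times> int) \<Rightarrow>\<^sub>0 int"

definition RqA :: "laurent_qA ring" where
  "RqA = ring_of_type_algebra"

definition q_alpha :: "int \<Rightarrow> nat \<Rightarrow> laurent_qA" where
  "q_alpha k n = (\<Prod>i<n. Poly_Mapping.single (k - int i, 1) 1
                        - Poly_Mapping.single (- (k - int i), - 1) 1)"

definition In :: "nat \<Rightarrow> laurent_qA set" where
  "In n = Idl\<^bsub>RqA\<^esub> (range (\<lambda>l. q_alpha l n))"

definition Rhat :: "(nat \<Rightarrow> laurent_qA set) ring" where
  "Rhat = inverse_limit RqA In"

text \<open>
  \<open>\<rat>[\<alpha>][[h]]\<close> is the type \<open>rat poly fps\<close>; \<open>q\<^sup>a A\<^sup>b\<close> is sent to \<open>e\<close> to the power \<open>(a + b \<alpha>) h\<close>.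
\<close>

definition exp_series :: "laurent_qA \<Rightarrow> rat poly fps" where
  "exp_series p = (\<Sum>(a, b)\<in>Poly_Mapping.keys p. of_int (Poly_Mapping.lookup p (a, b)) *
     Abs_fps (\<lambda>n. smult (1 / fact n) ([:of_int a, of_int b:] ^ n)))"

text \<open>
  The embedding of \<open>Rhat\<close> into \<open>\<rat>[\<alpha>][[h]]\<close>; elements of \<open>In n\<close> are sent to multiples of \<open>h\<^sup>n\<close>.
\<close>

definition Rhat_series :: "(nat \<Rightarrow> laurent_qA set) \<Rightarrow> rat poly fps" where
  "Rhat_series s = (THE x. \<forall>n. \<forall>a\<in>s n. fps_cutoff n x = fps_cutoff n (exp_series a))"


section \<open>The completions at roots of unity\<close>

definition Rr :: "nat \<Rightarrow> laurentA ring" where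
  "Rr r = ring_of_type_algebra
     \<lparr>carrier := generate_ring ring_of_type_algebra {Amon 0 (zeta r), Amon 1 1, Amon (- 1) 1}\<rparr>"

text \<open>
  \<open>ideal_A m r\<close> is the ideal of \<open>Rr m\<close> generated by \<open>A\<^sup>r - A\<^bsup>-r\<^esup>\<close>. Note that \<open>Rr 1 = \<int>[A\<^sup>\<plusminus>\<^sup>1]\<close>, since \<open>zeta 1 = -1\<close>.
\<close>

definition ideal_A :: "nat \<Rightarrow> nat \<Rightarrow> laurentA set" where
  "ideal_A m r = Idl\<^bsub>Rr m\<^esub> {Amon (int r) 1 - Amon (- int r) 1}"

definition Rr_hat :: "nat \<Rightarrow> (nat \<Rightarrow> laurentA set) ring" where
  "Rr_hat r = inverse_limit (Rr r) (ideal_power (Rr r) (ideal_A r r))"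

definition ev :: "nat \<Rightarrow> laurent_qA \<Rightarrow> laurentA" where
  "ev r p = (\<Sum>(a, b)\<in>Poly_Mapping.keys p.
     Amon b (of_int (Poly_Mapping.lookup p (a, b)) * zeta_pow r a))"

definition ev_hat :: "nat \<Rightarrow> (nat \<Rightarrow> laurent_qA set) \<Rightarrow> (nat \<Rightarrow> laurentA set)" where
  "ev_hat r = limit_map (Rr r) (ideal_power (Rr r) (ideal_A r r)) (\<lambda>n. r * n) (ev r)"

definition subst_A :: "nat \<Rightarrow> laurentA \<Rightarrow> laurentA" where
  "subst_A r p = (\<Sum>b\<in>Poly_Mapping.keys p. Amon (int r * b) (Poly_Mapping.lookup p b))"

definition g_sub :: "nat \<Rightarrow> (nat \<Rightarrow> laurentA set) \<Rightarrow> (nat \<Rightarrow> laurentA set)" where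
  "g_sub r = limit_map (Rr 1) (ideal_power (Rr 1) (ideal_A 1 r)) (\<lambda>n. n) (subst_A r)"

text \<open>The target of \<open>g_sub r\<close> is mapped to \<open>Rr_hat r\<close> by the inclusion of \<open>Rr 1\<close> in \<open>Rr r\<close>.\<close>

definition FC :: "nat \<Rightarrow> (nat \<Rightarrow> laurent_qA set) \<Rightarrow> (nat \<Rightarrow> laurentA set)" where
  "FC r x = limit_map (Rr r) (ideal_power (Rr r) (ideal_A r r)) (\<lambda>n. n) (\<lambda>a. a)
     (g_sub r (ev_hat 1 x))"

definition ADO_hat :: "nat \<Rightarrow> slice list \<Rightarrow> (nat \<Rightarrow> laurentA set)" where
  "ADO_hat r D = to_limit (Rr r) (ideal_power (Rr r) (ideal_A r r)) (ADO r D)"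


section \<open>The map from colored Jones polynomials to ADO invariants\<close>

text \<open>Families indexed by the positive integers are extensional functions on \<open>{1..}\<close>.\<close>

definition f_map :: "rat poly fps \<Rightarrow> nat \<Rightarrow> rat fps" where
  "f_map x = (\<lambda>k\<in>{1..}. Abs_fps (\<lambda>n. poly (fps_nth x n) (of_nat k)))"

definition f_Rhat :: "(nat \<Rightarrow> laurent_qA set) \<Rightarrow> nat \<Rightarrow> rat fps" where
  "f_Rhat x = f_map (Rhat_series x)"

definition f_Rhat_inv :: "(nat \<Rightarrow> rat fps) \<Rightarrow> (nat \<Rightarrow> laurent_qA set)" where
  "f_Rhat_inv = inv_into (carrier Rhat) f_Rhat"

text \<open>Meaningful for those \<open>x\<close> for which every \<open>FC r x\<close> is invertible.\<close>

definition g_map :: "(nat \<Rightarrow> laurent_qA set) \<Rightarrow> nat \<Rightarrow> (nat \<Rightarrow> laurentA set)" where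
  "g_map x = (\<lambda>r\<in>{1..}. ev_hat r x \<otimes>\<^bsub>Rr_hat r\<^esub> inv\<^bsub>Rr_hat r\<^esub> FC r x)"

definition Phi :: "(nat \<Rightarrow> rat fps) \<Rightarrow> nat \<Rightarrow> (nat \<Rightarrow> laurentA set)" where
  "Phi y = g_map (f_Rhat_inv y)"

definition jones_family :: "slice list \<Rightarrow> nat \<Rightarrow> rat fps" where
  "jones_family D = (\<lambda>n\<in>{1..}. colored_jones n D)"

definition ADO_family :: "slice list \<Rightarrow> nat \<Rightarrow> (nat \<Rightarrow> laurentA set)" where
  "ADO_family D = (\<lambda>r\<in>{1..}. ADO_hat r D)"

end

theory Submission
  imports Defs
begin

text \<open>
  The generic Verma module over \<open>\<int>[q\<^sup>\<plusminus>\<^sup>1, A\<^sup>\<plusminus>\<^sup>1]\<close> turns a diagram into a state sum over labellings of its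
  strands by natural numbers; let \<open>Z\<^sub>M\<close> be the sum over labels below \<open>M\<close>. Along a knot, a large label
  forces a crossing at which the label jumps far, and the weight of such a crossing lies in a deep ideal
  \<open>I\<^sub>n\<close>; hence \<open>Z\<^sub>M\<close> converges to an element \<open>x\<close> of the completion. For \<open>A = q\<^sup>k\<close> the labels up to \<open>k\<close>
  split off, so \<open>x\<close> specializes to the colored Jones polynomials. For \<open>q = \<zeta>\<^bsub>2r\<^esub>\<close>, write the labels in
  base \<open>r\<close>: Lucas' theorem for Gaussian binomials kills carries, conservation of the digit sums excludes
  borrows, and \<open>Z\<^bsub>rM\<^esub>\<close> becomes the product of the state sum over labels below \<open>r\<close>, which is the ADO
  invariant, and of \<open>Z\<^sub>M\<close> at the root of unity of order \<open>2\<close> with \<open>A\<close> replaced by \<open>A\<^sup>r\<close>, which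
  approximates \<open>FC r x\<close>. The latter is a unit, because modulo \<open>A\<^sup>r - A\<^bsup>-r\<^esup>\<close> only the labelling by
  zeros survives.

  An element of the completion is determined by its power series by an argument of Habiro: if the series
  vanishes, the element is small for the powers of the augmentation ideal. Since
  \<open>\<int>[q\<^sup>\<plusminus>\<^sup>1, A\<^sup>\<plusminus>\<^sup>1]\<close> modulo powers of \<open>q\<^bsup>2M\<^esup> - 1\<close> and \<open>\<Prod>i<M. A\<^sup>2 - q\<^bsup>2i\<^esup>\<close> is \<open>p\<close>-adically separated,
  this smallness passes from \<open>M\<close> to \<open>p M\<close> for every prime \<open>p\<close>, and for \<open>M = N!\<close> the two elements generate
  an ideal that controls \<open>I\<^sub>N\<close>.
\<close>

section \<open>Gaussian binomials\<close>

text \<open>The descriptions by \<open>THE\<close> and \<open>inv_into\<close> in the definitions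
  shape the proof. A diagram must first be shown to act by a scalar; commutation with E and K
  settles this, which is why coproduct actions are carried along. And the preimage of a Jones family
  is the constructed element only once the completion is known to embed into power series; the
  p-adic argument serves this purpose. One state sum over an arbitrary commutative ring serves
  everywhere, because it is polynomial in its parameters and so commutes with ring homomorphisms. At
  roots of unity quotients of quantum factorials degenerate to 0/0; therefore Gaussian binomials are
  defined by the Pascal recursion and their identities are proved without division. The ADO pivot
  K^(1-r) is what the factorization leaves over: the generic pivot scalar A splits as A^(1-r) times
  A^r, and the second factor is the generic scalar after A has become A^r. Likewise the higher
  digits see Q = q^2 only through its r-th power 1. This agrees with zeta_2 = -1, whose square is 1,
  and explains why the evaluation at zeta_2 enters \<open>FC\<close>.\<close>

fun gb :: "'a::comm_ring_1 \<Rightarrow> nat \<Rightarrow> nat \<Rightarrow> 'a" where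
  "gb Q n 0 = 1"
| "gb Q 0 (Suc k) = 0"
| "gb Q (Suc n) (Suc k) = gb Q n k + Q ^ Suc k * gb Q n (Suc k)"

lemma gb_eq_0: "n < k \<Longrightarrow> gb Q n k = 0"
  by (induction Q n k rule: gb.induct) auto

lemma gb_self [simp]: "gb Q n n = 1"
  by (induction n) (auto simp: gb_eq_0)

text \<open>The mirror image of the defining Pascal rule. Comparing the two rules yields
  \<open>gb_Suc_Suc_prod\<close>, and both are used for the commutation relation in
  \<open>fcoef_Suc\<close>.\<close>

lemma gb_Suc_Suc': "k \<le> n \<Longrightarrow> gb Q (Suc n) (Suc k) = Q ^ (n - k) * gb Q n k + gb Q n (Suc k)"
proof (induction n arbitrary: k)
  case 0
  then show ?case by simp
next
  case (Suc n)
  show ?case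
  proof (cases k)
    case 0
    have "gb Q (Suc (Suc n)) (Suc 0) = 1 + Q * gb Q (Suc n) (Suc 0)" by simp
    also have "\<dots> = 1 + Q * (Q ^ n + gb Q n (Suc 0))"
      using Suc.IH[of 0] by simp
    also have "\<dots> = Q ^ Suc n + gb Q (Suc n) (Suc 0)"
      by (simp add: algebra_simps)
    finally show ?thesis using 0 by simp
  next
    case (Suc k')
    show ?thesis
    proof (cases "k = Suc n")
      case True
      then show ?thesis by (simp add: gb_eq_0)
    next
      case False
      then have k: "k' < n" "k = Suc k'" using Suc Suc.prems by auto
      have 1: "gb Q (Suc n) (Suc k') = Q ^ (n - k') * gb Q n k' + gb Q n (Suc k')"
        using Suc.IH[of k'] k by simp
      have 2: "gb Q (Suc n) (Suc (Suc k')) = Q ^ (n - Suc k') * gb Q n (Suc k') + gb Q n (Suc (Suc k'))"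
        using Suc.IH[of "Suc k'"] k by simp
      have e: "Q ^ Suc (Suc k') * Q ^ (n - Suc k') = Q ^ (n - k') * Q ^ Suc k'"
        using k by (simp add: power_add[symmetric] del: power_Suc)
      have "gb Q (Suc (Suc n)) (Suc k) = gb Q (Suc n) (Suc k') + Q ^ Suc (Suc k') * gb Q (Suc n) (Suc (Suc k'))"
        using k by simp
      also have "\<dots> = Q ^ (n - k') * gb Q n k' + gb Q n (Suc k')
          + ((Q ^ Suc (Suc k') * Q ^ (n - Suc k')) * gb Q n (Suc k') + Q ^ Suc (Suc k') * gb Q n (Suc (Suc k')))"
        unfolding 1 2 by (simp add: algebra_simps)
      also have "\<dots> = Q ^ (n - k') * (gb Q n k' + Q ^ Suc k' * gb Q n (Suc k'))
          + (gb Q n (Suc k') + Q ^ Suc (Suc k') * gb Q n (Suc (Suc k')))"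
        unfolding e by (simp add: algebra_simps)
      also have "\<dots> = Q ^ (Suc n - k) * gb Q (Suc n) k + gb Q (Suc n) (Suc k)"
        using k by simp
      finally show ?thesis .
    qed
  qed
qed

text \<open>Eliminating \<open>gb Q n (Suc k)\<close> between the two Pascal rules gives the
  factorial quotient formula in a form without division, meaningful even where
  \<open>1 - Q ^ Suc k\<close> is zero.\<close>

lemma gb_Suc_Suc_prod: "(1 - Q ^ Suc k) * gb Q (Suc n) (Suc k) = (1 - Q ^ Suc n) * gb Q n k"
proof (cases "k \<le> n")
  case True
  have e: "Q ^ Suc k * Q ^ (n - k) = Q ^ Suc n"
    using True by (simp add: power_add[symmetric] del: power_Suc)
  have "(1 - Q ^ Suc k) * gb Q (Suc n) (Suc k)
    = gb Q n k + Q ^ Suc k * gb Q n (Suc k) - Q ^ Suc k * (Q ^ (n - k) * gb Q n k + gb Q n (Suc k))"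
    using gb_Suc_Suc'[OF True, of Q] by (simp add: algebra_simps)
  also have "\<dots> = gb Q n k - (Q ^ Suc k * Q ^ (n - k)) * gb Q n k"
    by (simp add: algebra_simps)
  finally show ?thesis unfolding e by (simp add: algebra_simps)
qed (simp add: gb_eq_0)

text \<open>Over a field with Q elements both sides count flags of subspaces. Since quantum
  factorials may vanish here, the identity is carried through the Pascal rule by induction on
  \<open>n\<close>.\<close>

lemma gb_mult: "m \<le> n \<Longrightarrow> k \<le> m \<Longrightarrow> gb Q n m * gb Q m k = gb Q n k * gb Q (n - k) (m - k)"
proof (induction n arbitrary: m k)
  case 0
  then show ?case by simp
next
  case (Suc n)
  show ?case
  proof (cases k)
    case 0
    then show ?thesis by simp
  next
    case (Suc k')
    then obtain m' where m: "m = Suc m'" using Suc.prems by (cases m) auto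
    show ?thesis
    proof (cases "k = m")
      case True then show ?thesis by simp
    next
      case False
      then have km: "k \<le> m'" using Suc.prems m by simp
      obtain d where d: "m' = k + d" using km le_Suc_ex by blast
      have nd: "Suc n - k = Suc (n - k)" "Suc m' - k = Suc d" "m' \<le> n"
        using Suc.prems m d by auto
      have A: "gb Q n m' * gb Q m' k = gb Q n k * gb Q (n - k) d"
        using Suc.IH[of m' k] km nd d by simp
      have B: "gb Q n m' * gb Q m' k' = gb Q n k' * gb Q (n - k') (Suc d)"
        using Suc.IH[of m' k'] nd(3) d Suc by simp
      have C: "gb Q n (Suc m') * gb Q (Suc m') k = gb Q n k * gb Q (n - k) (Suc d)"
        if "Suc m' \<le> n" using Suc.IH[of "Suc m'" k] that km nd by simp
      have C': "gb Q n (Suc m') * gb Q (Suc m') k = gb Q n k * gb Q (n - k) (Suc d)"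
        using C nd(3) d by (cases "Suc m' \<le> n") (auto simp: gb_eq_0)
      have p: "gb Q (Suc m') k = gb Q m' k' + Q ^ k * gb Q m' k" using Suc by simp
      have e: "Q ^ Suc m' = Q ^ k * Q ^ Suc d" using d by (simp add: power_add mult_ac)
      have nk: "n - k' = Suc (n - k)" using nd d Suc by simp
      have "gb Q (Suc n) m * gb Q m k
          = gb Q n m' * gb Q (Suc m') k + Q ^ Suc m' * (gb Q n (Suc m') * gb Q (Suc m') k)"
        unfolding m by (simp add: algebra_simps)
      also have "\<dots> = gb Q n m' * gb Q m' k' + Q ^ k * (gb Q n m' * gb Q m' k)
          + Q ^ Suc m' * (gb Q n (Suc m') * gb Q (Suc m') k)"
        by (subst p) (simp add: algebra_simps)
      also have "\<dots> = gb Q n k' * gb Q (n - k') (Suc d) + Q ^ k * (gb Q n k * gb Q (n - k) d)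
          + Q ^ Suc m' * (gb Q n k * gb Q (n - k) (Suc d))"
        unfolding A B C' ..
      also have "\<dots> = gb Q n k' * gb Q (n - k') (Suc d)
          + Q ^ k * gb Q n k * (gb Q (n - k) d + Q ^ Suc d * gb Q (n - k) (Suc d))"
        unfolding e by (simp add: algebra_simps)
      also have "\<dots> = gb Q (Suc n) k * gb Q (Suc n - k) (m - k)"
        using Suc unfolding nk nd m by (simp add: algebra_simps)
      finally show ?thesis .
    qed
  qed
qed

text \<open>Gauss's binomial theorem, with signs chosen so that suitable values of \<open>x\<close>
  hit a zero factor of the product; this is how sums of Gaussian binomials are evaluated
  later.\<close>

lemma gb_binomial:
  "(\<Prod>i<m. 1 - x * Q ^ i) = (\<Sum>b\<le>m. (- 1) ^ b * Q ^ (b * (b - 1) div 2) * gb Q m b * x ^ b)"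
proof (induction m)
  case 0
  then show ?case by simp
next
  case (Suc m)
  define c where "c b = (- 1) ^ b * Q ^ (b * (b - 1) div 2) * x ^ b" for b :: nat
  have c_Suc: "c (Suc b) = - x * Q ^ b * c b" for b
  proof -
    have "Suc b * (Suc b - 1) div 2 = b + b * (b - 1) div 2"
      by (cases b) (auto simp: algebra_simps)
    then show ?thesis unfolding c_def by (simp add: power_add mult_ac)
  qed
  have "(\<Sum>b\<le>Suc m. c b * gb Q (Suc m) b) = c 0 + (\<Sum>b\<le>m. c (Suc b) * gb Q (Suc m) (Suc b))"
    by (subst sum.atMost_Suc_shift) simp
  also have "(\<Sum>b\<le>m. c (Suc b) * gb Q (Suc m) (Suc b))
      = (\<Sum>b\<le>m. - x * Q ^ m * (c b * gb Q m b)) + (\<Sum>b\<le>m. c (Suc b) * gb Q m (Suc b))"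
    unfolding sum.distrib[symmetric]
  proof (rule sum.cong[OF refl], goal_cases)
    case (1 b)
    then have "b \<le> m" by simp
    have e: "Q ^ m = Q ^ b * Q ^ (m - b)" using 1 by (simp add: power_add[symmetric])
    show ?case unfolding gb_Suc_Suc'[OF \<open>b \<le> m\<close>] by (simp add: c_Suc e algebra_simps)
  qed
  also have "c 0 + (\<dots>) = - x * Q ^ m * (\<Sum>b\<le>m. c b * gb Q m b) + (\<Sum>b\<le>Suc m. c b * gb Q m b)"
    by (simp only: sum.atMost_Suc_shift sum_distrib_left gb.simps mult_1_right add_ac)
  also have "(\<Sum>b\<le>Suc m. c b * gb Q m b) = (\<Sum>b\<le>m. c b * gb Q m b)" by (simp add: gb_eq_0)
  finally have *: "(\<Sum>b\<le>Suc m. c b * gb Q (Suc m) b) = (1 - x * Q ^ m) * (\<Sum>b\<le>m. c b * gb Q m b)"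
    by (simp add: algebra_simps)
  have "(\<Prod>i<m. 1 - x * Q ^ i) = (\<Sum>b\<le>m. c b * gb Q m b)"
    unfolding Suc.IH c_def by (simp add: mult_ac)
  then have "(\<Prod>i<Suc m. 1 - x * Q ^ i) = (1 - x * Q ^ m) * (\<Sum>b\<le>m. c b * gb Q m b)" by simp
  also have "\<dots> = (\<Sum>b\<le>Suc m. (- 1) ^ b * Q ^ (b * (b - 1) div 2) * gb Q (Suc m) b * x ^ b)"
    using *[symmetric] unfolding c_def by (simp only: mult_ac)
  finally show ?case .
qed

text \<open>A sign-free form of the hypothesis that \<open>Q\<close> is a primitive \<open>r\<close>-th root of unity, usable in any ring.\<close>

definition qroot :: "nat \<Rightarrow> 'a::comm_ring_1 \<Rightarrow> bool" where
  "qroot r Q \<longleftrightarrow> 0 < r \<and> Q ^ r = 1 \<and> (\<forall>b. 0 < b \<and> b < r \<longrightarrow> gb Q r b = 0)"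

section \<open>Gaussian binomials at roots of unity: Lucas' theorem and products over full
  periods\<close>

lemma qroot_power: "qroot r Q \<Longrightarrow> Q ^ (r * k + j) = Q ^ j"
  by (simp add: qroot_def power_add power_mult)

text \<open>The inner entries of row \<open>r\<close> vanish, so row \<open>r + n\<close> is row
  \<open>n\<close> plus its translate by \<open>r\<close>. This is a single step of Lucas'
  theorem.\<close>

lemma qroot_gb_add:
  assumes "qroot r Q"
  shows "gb Q (r + n) k = gb Q n k + (if k < r then 0 else gb Q n (k - r))"
proof (induction n arbitrary: k)
  case 0
  consider "k = 0" | "0 < k" "k < r" | "k = r" "0 < k" | "r < k" by linarith
  then show ?case
  proof cases
    case 2
    then obtain k' where "k = Suc k'" by (cases k) auto
    then show ?thesis using assms 2 by (simp add: qroot_def)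
  next
    case 3
    then obtain k' where "k = Suc k'" by (cases k) auto
    then show ?thesis using 3 by (simp del: gb.simps(3))
  next
    case 4
    then obtain k' where "k = Suc k'" by (cases k) auto
    moreover obtain d where "k - r = Suc d" using 4 by (cases "k - r") auto
    ultimately show ?thesis using 4 by (simp add: gb_eq_0)
  qed (use assms in \<open>auto simp: qroot_def\<close>)
next
  case (Suc n)
  show ?case
  proof (cases k)
    case 0
    then show ?thesis using assms by (auto simp: qroot_def)
  next
    case (Suc k')
    have "gb Q (r + Suc n) k = gb Q (r + n) k' + Q ^ k * gb Q (r + n) k" using Suc by simp
    also have "\<dots> = gb Q (Suc n) k + ((if k' < r then 0 else gb Q n (k' - r)) + Q ^ k * (if k < r then 0 else gb Q n (k - r)))"
      unfolding Suc.IH using Suc by (simp add: algebra_simps)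
    also have "(if k' < r then 0 else gb Q n (k' - r)) + Q ^ k * (if k < r then 0 else gb Q n (k - r))
        = (if k < r then 0 else gb Q (Suc n) (k - r))"
    proof (cases "k < r")
      case True then show ?thesis using Suc by auto
    next
      case False
      have e: "Q ^ k = Q ^ (k - r)" using qroot_power[OF assms, of 1 "k - r"] False by simp
      show ?thesis
      proof (cases "k = r")
        case True then show ?thesis using Suc assms e by (auto simp: qroot_def)
      next
        case F: False
        then obtain d where "k = Suc (r + d)" using False by (metis less_iff_Suc_add linorder_neqE_nat add_Suc_right)
        then show ?thesis using Suc F e by auto
      qed
    qed
    finally show ?thesis .
  qed
qed

text \<open>The lower digits keep the parameter \<open>Q\<close>, while the higher ones only see
  \<open>Q ^ r = 1\<close>; hence the ordinary binomial \<open>gb 1\<close> in the second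
  factor.\<close>

lemma qroot_gb_Lucas:
  assumes "qroot r Q" "n0 < r" "k0 < r"
  shows "gb Q (n0 + r * n1) (k0 + r * k1) = gb Q n0 k0 * gb 1 n1 k1"
proof (induction n1 arbitrary: k1)
  case 0
  show ?case using assms by (cases k1) (auto simp: gb_eq_0)
next
  case (Suc n1)
  have "gb Q (n0 + r * Suc n1) (k0 + r * k1) = gb Q (r + (n0 + r * n1)) (k0 + r * k1)"
    by (simp add: algebra_simps)
  also have "\<dots> = gb Q n0 k0 * gb 1 n1 k1 +
     (if k0 + r * k1 < r then 0 else gb Q (n0 + r * n1) (k0 + r * k1 - r))"
    unfolding qroot_gb_add[OF assms(1)] Suc.IH ..
  also have "\<dots> = gb Q n0 k0 * gb 1 (Suc n1) k1"
  proof (cases k1)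
    case 0 then show ?thesis using assms by simp
  next
    case (Suc k)
    have "k0 + r * k1 - r = k0 + r * k" using Suc by simp
    then show ?thesis using Suc Suc.IH[of k] by (simp add: algebra_simps)
  qed
  finally show ?case .
qed

text \<open>Only the terms 0 and \<open>r\<close> of the binomial theorem survive. The sign
  \<open>s\<close> of the second is read off at \<open>x = 1\<close>, where the factor with
  \<open>i = 0\<close> is zero.\<close>

lemma qroot_prod:
  assumes "qroot r Q"
  shows "(\<Prod>i<r. 1 - x * Q ^ i) = 1 - x ^ r"
proof -
  have r: "0 < r" using assms by (simp add: qroot_def)
  define s where "s = (- 1) ^ r * Q ^ (r * (r - 1) div 2)"
  have *: "(\<Prod>i<r. 1 - y * Q ^ i) = 1 + s * y ^ r" for y
  proof -
    have "(\<Prod>i<r. 1 - y * Q ^ i) = (\<Sum>b\<in>{0, r}. (- 1) ^ b * Q ^ (b * (b - 1) div 2) * gb Q r b * y ^ b)"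
      unfolding gb_binomial
    proof (rule sum.mono_neutral_right)
      show "\<forall>i\<in>{..r} - {0, r}. (- 1) ^ i * Q ^ (i * (i - 1) div 2) * gb Q r i * y ^ i = 0"
        using assms by (auto simp: qroot_def)
    qed auto
    then show ?thesis using r by (simp add: s_def)
  qed
  have "(\<Prod>i<r. 1 - 1 * Q ^ i) = (0 :: 'a)"
    using r by (intro prod_zero) (auto intro!: bexI[of _ 0])
  then have "s = - 1" using *[of 1] by (simp add: add_eq_0_iff)
  then show ?thesis using * by simp
qed

text \<open>The evaluation at 1 gives -1 for the product of the \<open>- (Q ^ i)\<close>, and the
  product in question is its inverse. It is the sign that a full block of \<open>r\<close> factors
  contributes to \<open>gcoef\<close>.\<close>

lemma qroot_prod_neg:
  assumes "qroot r Q" "Q * Qi = 1"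
  shows "(\<Prod>i<r. - (Qi ^ i)) = - (1 :: 'a::comm_ring_1)"
proof -
  have r: "0 < r" using assms by (simp add: qroot_def)
  have Qi: "Q ^ i * Qi ^ i = 1" for i
    using assms(2) by (simp add: power_mult_distrib[symmetric])
  define s where "s = (\<Prod>i<r. - (Q ^ i))"
  have s: "s = (- 1) ^ r * Q ^ (r * (r - 1) div 2)"
  proof -
    have "(\<Prod>i<m. - (Q ^ i)) = (- 1) ^ m * Q ^ (m * (m - 1) div 2)" for m
    proof (induction m)
      case (Suc m)
      have "Suc m * (Suc m - 1) div 2 = m + m * (m - 1) div 2"
        by (cases m) (auto simp: algebra_simps)
      then show ?case using Suc by (simp add: power_add mult_ac)
    qed simp
    then show ?thesis by (simp add: s_def)
  qed
  have "(\<Sum>b\<in>{..r}. (- 1) ^ b * Q ^ (b * (b - 1) div 2) * gb Q r b * 1 ^ b)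
      = (\<Sum>b\<in>{0, r}. (- 1) ^ b * Q ^ (b * (b - 1) div 2) * gb Q r b * 1 ^ b)"
    by (rule sum.mono_neutral_right) (use assms(1) in \<open>auto simp: qroot_def\<close>)
  moreover have "(\<Prod>i<r. 1 - 1 * Q ^ i) = (0 :: 'a)"
    using r by (intro prod_zero) (auto intro!: bexI[of _ 0])
  ultimately have "s = - 1" using gb_binomial[of 1 Q r] r s by (simp add: add_eq_0_iff)
  moreover have "s * (\<Prod>i<r. - (Qi ^ i)) = 1"
    unfolding s_def prod.distrib[symmetric] using Qi by simp
  ultimately have "- (\<Prod>i<r. - (Qi ^ i)) = 1" by (simp only: mult_minus1)
  then show ?thesis by (metis add.inverse_inverse)
qed

section \<open>State sums\<close>

text \<open>
  In \<open>Par Q Qi A Ai G Gi T Ti\<close>, \<open>Q\<close> stands for \<open>q\<^sup>2\<close>, the pivotal element is \<open>v\<^sub>i \<mapsto> G Q\<^sup>-\<^sup>i v\<^sub>i\<close>, and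
  \<open>T\<close> is \<open>q\<close> to the power \<open>\<alpha>\<^sup>2/2\<close>; \<open>Qi\<close>, \<open>Ai\<close>, \<open>Gi\<close>, \<open>Ti\<close> are the inverses.
\<close>

datatype 'a par = Par (pQ: 'a) (pQi: 'a) (pA: 'a) (pAi: 'a) (pG: 'a) (pGi: 'a) (pT: 'a) (pTi: 'a)

definition valid :: "'a::comm_ring_1 par \<Rightarrow> bool" where
  "valid P \<longleftrightarrow> pQ P * pQi P = 1 \<and> pA P * pAi P = 1 \<and> pG P * pGi P = 1 \<and> pT P * pTi P = 1"

text \<open>
  The matrix coefficient of \<open>q\<^bsup>n(n-1)/2\<^esup> F\<^bsup>(n)\<^esup>\<close> at \<open>v\<^sub>j\<close>; written with \<open>Q\<close> and \<open>A\<^sup>-\<^sup>2\<close>, all signs and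
  odd powers of \<open>q\<close> disappear.
\<close>

definition fcoef :: "'a::comm_ring_1 par \<Rightarrow> nat \<Rightarrow> nat \<Rightarrow> 'a" where
  "fcoef P n j = pA P ^ n * pQi P ^ (n * j) * gb (pQ P) (n + j) n *
     (\<Prod>k<n. 1 - pQ P ^ (j + k) * (pAi P)\<^sup>2)"

text \<open>Coefficients of the inverse of the quasi-R-matrix; the extra factor is (-1)^n
  q^(-n(n-1)).\<close>

definition gcoef :: "'a::comm_ring_1 par \<Rightarrow> nat \<Rightarrow> nat \<Rightarrow> 'a" where
  "gcoef P n j = (\<Prod>k<n. - (pQi P ^ k)) * fcoef P n j"

text \<open>Inputs are \<open>i\<close>, \<open>j\<close>, outputs before the flip are
  \<open>i - n\<close>, \<open>j + n\<close>. The diagonal part acts after the jump, hence the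
  exponent of Q, while the exponent of A depends only on the preserved sum
  \<open>i + j\<close>.\<close>

definition wpos :: "'a::comm_ring_1 par \<Rightarrow> nat \<Rightarrow> nat \<Rightarrow> nat \<Rightarrow> 'a" where
  "wpos P i j n = pT P * pAi P ^ (i + j) * pQ P ^ ((i - n) * (j + n)) * fcoef P n j"

text \<open>In the inverse the diagonal part acts first, so its exponent uses the labels before the
  jump.\<close>

definition wneg :: "'a::comm_ring_1 par \<Rightarrow> nat \<Rightarrow> nat \<Rightarrow> nat \<Rightarrow> 'a" where
  "wneg P i j n = pTi P * pA P ^ (i + j) * pQi P ^ (i * j) * gcoef P n j"

text \<open>Outgoing labels come first, as in matrix entries, and the flip is included: a positive
  crossing sends [a, b] to [b + n, a - n], a negative one to [b - n, a + n]. Given equal sums, the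
  inequality keeps the truncated subtractions exact.\<close>

fun pw :: "'a::comm_ring_1 par \<Rightarrow> piece \<Rightarrow> nat list \<Rightarrow> nat list \<Rightarrow> 'a" where
  "pw P PosX [c, d] [a, b] = (if b \<le> c \<and> c + d = a + b then wpos P a b (c - b) else 0)"
| "pw P NegX [c, d] [a, b] = (if a \<le> d \<and> c + d = a + b then wneg P b a (d - a) else 0)"
| "pw P CupUD [c, d] [] = (if c = d then 1 else 0)"
| "pw P CupDU [c, d] [] = (if c = d then pGi P * pQ P ^ c else 0)"
| "pw P CapDU [] [a, b] = (if a = b then 1 else 0)"
| "pw P CapUD [] [a, b] = (if a = b then pG P * pQi P ^ a else 0)"
| "pw P _ _ _ = 0"

definition labels :: "nat \<Rightarrow> nat \<Rightarrow> nat list set" where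
  "labels N k = {x. length x = k \<and> set x \<subseteq> {..<N}}"

fun sw :: "'a::comm_ring_1 par \<Rightarrow> slice \<Rightarrow> nat list \<Rightarrow> nat list \<Rightarrow> 'a" where
  "sw P (u, G, w) z x =
    (if take (length u) z = take (length u) x \<and>
        drop (length u + length (tgt G)) z = drop (length u + length (src G)) x
     then pw P G (take (length (tgt G)) (drop (length u) z)) (take (length (src G)) (drop (length u) x))
     else 0)"

fun Zsum :: "nat \<Rightarrow> 'a::comm_ring_1 par \<Rightarrow> slice list \<Rightarrow> nat list \<Rightarrow> nat list \<Rightarrow> 'a" where
  "Zsum N P [] x y = (if x = y then 1 else 0)"
| "Zsum N P ((u, G, w) # D) x y =
     (\<Sum>z\<in>labels N (length (u @ tgt G @ w)). sw P (u, G, w) z x * Zsum N P D z y)"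

lemma finite_labels [simp]: "finite (labels N k)"
  unfolding labels_def by (rule finite_subset[OF _ finite_lists_length_eq[of "{..<N}" k]]) auto

subsection \<open>The identities behind invertibility and equivariance of the R-matrix\<close>

lemma gb_sym: "k \<le> n \<Longrightarrow> gb Q n k = gb Q n (n - k)"
proof (induction n arbitrary: k)
  case 0
  then show ?case by simp
next
  case (Suc n)
  show ?case
  proof (cases k)
    case 0 then show ?thesis by (simp del: gb.simps(3))
  next
    case (Suc k')
    show ?thesis
    proof (cases "k' = n")
      case True then show ?thesis using Suc by (simp del: gb.simps(3))
    next
      case False
      then have k: "k' < n" using Suc Suc.prems by simp
      then obtain d where d: "n = Suc (k' + d)" by (metis less_iff_Suc_add)
      have 1: "gb Q n k' = gb Q n (Suc d)" using Suc.IH[of k'] d by (simp del: gb.simps(3))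
      have 2: "gb Q n (Suc k') = gb Q n d" using Suc.IH[of "Suc k'"] d by (simp del: gb.simps(3))
      have "gb Q (Suc n) (Suc d) = Q ^ (n - d) * gb Q n d + gb Q n (Suc d)"
        using d by (intro gb_Suc_Suc') simp
      also have "n - d = Suc k'" using d by simp
      finally show ?thesis using Suc 1 2 d by (simp del: power_Suc)
    qed
  qed
qed

context
  fixes P :: "'a::comm_ring_1 par"
  assumes valid: "valid P"
begin

lemma Q_inv: "pQ P * pQi P = 1" "pQi P * pQ P = 1"
  and A_inv: "pA P * pAi P = 1" "pAi P * pA P = 1"
  and G_inv: "pG P * pGi P = 1" "pGi P * pG P = 1"
  and T_inv: "pT P * pTi P = 1" "pTi P * pT P = 1"
  using valid by (simp_all add: valid_def mult.commute)

lemma Q_cancel [simp]: "pQ P ^ n * pQi P ^ n = 1" "pQ P ^ n * (pQi P ^ n * x) = x"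
  using Q_inv by (simp_all add: power_mult_distrib[symmetric] mult.assoc[symmetric])

lemma A_cancel [simp]: "pA P ^ n * pAi P ^ n = 1" "pA P ^ n * (pAi P ^ n * x) = x"
  using A_inv by (simp_all add: power_mult_distrib[symmetric] mult.assoc[symmetric])

lemma fcoef_0 [simp]: "fcoef P 0 j = 1"
  by (simp add: fcoef_def)

text \<open>This is the commutator of E with the divided power F^(n+1), applied to v_j; the value 0
  for \<open>j = 0\<close> reflects E v_0 = 0. After the common factor
  \<open>c * (A * Qi ^ j)\<close> is removed, the coefficient of 1 and that of A^(-2) are one Pascal
  rule each.\<close>

lemma fcoef_Suc:
  "fcoef P (Suc n) j - (case j of 0 \<Rightarrow> 0 | Suc j' \<Rightarrow> fcoef P (Suc n) j')
    = fcoef P n j * (pA P * pQi P ^ j - pAi P * pQ P ^ (j + n))"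
proof -
  define Q Qi A a where "Q = pQ P" and "Qi = pQi P" and "A = pA P" and "a = (pAi P)\<^sup>2"
  define p where "p = (\<Prod>k<n. 1 - Q ^ (j + k) * a)"
  define c where "c = A ^ n * Qi ^ (n * j) * p"
  have QQ: "Q ^ m * Qi ^ m = 1" for m by (simp add: Q_def Qi_def)
  have Aa: "A * a = pAi P"
    unfolding A_def a_def power2_eq_square using A_inv by (simp add: mult.assoc[symmetric])
  have f: "fcoef P n j = c * gb Q (n + j) n"
    by (simp add: fcoef_def c_def p_def Q_def Qi_def A_def a_def mult_ac)
  have f1: "fcoef P (Suc n) j = c * (A * Qi ^ j) * (gb Q (Suc (n + j)) (Suc n) * (1 - Q ^ (j + n) * a))"
    unfolding fcoef_def c_def p_def Q_def[symmetric] Qi_def[symmetric] A_def[symmetric] a_def[symmetric]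
    by (simp add: power_add mult_ac del: gb.simps)
  have rhs: "A * Qi ^ j - pAi P * Q ^ (j + n) = (A * Qi ^ j) * (1 - Q ^ (2 * j + n) * a)"
  proof -
    have e: "Q ^ (2 * j + n) = Q ^ j * Q ^ (j + n)" by (simp add: power_add[symmetric] mult_2 add_ac)
    have "(A * Qi ^ j) * (1 - Q ^ (2 * j + n) * a) = A * Qi ^ j - (A * a) * ((Q ^ j * Qi ^ j) * Q ^ (j + n))"
      unfolding e by (simp add: algebra_simps)
    then show ?thesis unfolding Aa QQ by simp
  qed
  have rhs': "fcoef P n j * (pA P * pQi P ^ j - pAi P * pQ P ^ (j + n))
     = c * (A * Qi ^ j) * (gb Q (n + j) n * (1 - Q ^ (2 * j + n) * a))"
    using rhs unfolding f Q_def Qi_def A_def by (simp add: mult_ac)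
  show ?thesis
  proof (cases j)
    case 0
    then show ?thesis unfolding rhs' f1 by (simp add: gb_eq_0)
  next
    case (Suc j')
    have P1: "gb Q (Suc (n + j)) (Suc n) = gb Q (n + j) n + Q ^ Suc n * gb Q (n + j) (Suc n)" by simp
    have P2: "gb Q (Suc (n + j)) (Suc n) = Q ^ j * gb Q (n + j) n + gb Q (n + j) (Suc n)"
      using gb_Suc_Suc'[of n "n + j" Q] by simp
    have pr: "(\<Prod>k<Suc n. 1 - Q ^ (j' + k) * a) = p * (1 - Q ^ j' * a)"
      unfolding p_def by (subst prod.lessThan_Suc_shift) (simp add: Suc mult.commute)
    have q: "Qi ^ (Suc n * j') = Q ^ Suc n * Qi ^ (n * j) * Qi ^ j"
    proof -
      have "Suc n * j = Suc n * j' + Suc n" using Suc by simp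
      then have "Qi ^ (n * j) * Qi ^ j = Qi ^ (Suc n * j') * Qi ^ Suc n"
        by (metis power_add mult_Suc add.commute)
      then have "Q ^ Suc n * Qi ^ (n * j) * Qi ^ j = (Q ^ Suc n * Qi ^ Suc n) * Qi ^ (Suc n * j')"
        by (metis mult.assoc mult.commute)
      then show ?thesis unfolding QQ by simp
    qed
    have f2: "fcoef P (Suc n) j' = c * (A * Qi ^ j) * (Q ^ Suc n * gb Q (n + j) (Suc n) * (1 - Q ^ j' * a))"
    proof -
      have "fcoef P (Suc n) j' = A ^ Suc n * Qi ^ (Suc n * j') * gb Q (n + j) (Suc n) * (p * (1 - Q ^ j' * a))"
        using Suc pr unfolding fcoef_def Q_def Qi_def A_def a_def
        by (simp del: prod.lessThan_Suc power_Suc gb.simps mult_Suc)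
      then show ?thesis unfolding q c_def by (simp add: mult_ac)
    qed
    have e1: "Q ^ Suc n * Q ^ j' = Q ^ (j + n)" using Suc by (simp add: power_add mult_ac)
    have e2: "Q ^ (2 * j + n) = Q ^ j * Q ^ (j + n)" by (simp add: power_add[symmetric] mult_2 add_ac)
    have "gb Q (Suc (n + j)) (Suc n) * (1 - Q ^ (j + n) * a)
        - Q ^ Suc n * gb Q (n + j) (Suc n) * (1 - Q ^ j' * a)
        = gb Q (Suc (n + j)) (Suc n) - Q ^ Suc n * gb Q (n + j) (Suc n)
          - a * (Q ^ (j + n) * gb Q (Suc (n + j)) (Suc n) - (Q ^ Suc n * Q ^ j') * gb Q (n + j) (Suc n))"
      by (simp add: algebra_simps del: power_Suc gb.simps)
    also have "gb Q (Suc (n + j)) (Suc n) - Q ^ Suc n * gb Q (n + j) (Suc n) = gb Q (n + j) n"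
      unfolding P1 by simp
    also have "Q ^ (j + n) * gb Q (Suc (n + j)) (Suc n) - (Q ^ Suc n * Q ^ j') * gb Q (n + j) (Suc n)
       = Q ^ (2 * j + n) * gb Q (n + j) n"
      unfolding P2 e1 e2 by (simp add: algebra_simps)
    finally have k: "gb Q (Suc (n + j)) (Suc n) * (1 - Q ^ (j + n) * a)
        - Q ^ Suc n * gb Q (n + j) (Suc n) * (1 - Q ^ j' * a) = gb Q (n + j) n * (1 - Q ^ (2 * j + n) * a)"
      by (simp add: algebra_simps)
    show ?thesis unfolding rhs' k[symmetric] f1 using f2 Suc by (simp add: algebra_simps del: power_Suc gb.simps)
  qed
qed

text \<open>Composition of divided powers. The factor Q^(-ab) arises half from the powers
  q^(n(n-1)/2) included in \<open>fcoef\<close> and half from replacing the symmetric quantum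
  binomial by \<open>gb\<close>.\<close>

lemma fcoef_mult:
  "fcoef P a (j + b) * fcoef P b j
    = fcoef P (a + b) j * (pQi P ^ (a * b) * gb (pQ P) (a + b) b)"
proof -
  have g: "gb (pQ P) (a + (j + b)) a * gb (pQ P) (b + j) b = gb (pQ P) (a + b + j) (a + b) * gb (pQ P) (a + b) b"
  proof -
    have "gb (pQ P) (a + b + j) (b + j) * gb (pQ P) (b + j) b
        = gb (pQ P) (a + b + j) b * gb (pQ P) (a + b + j - b) (b + j - b)"
      by (rule gb_mult) auto
    moreover have "gb (pQ P) (a + b + j) (a + b) * gb (pQ P) (a + b) b
        = gb (pQ P) (a + b + j) b * gb (pQ P) (a + b + j - b) (a + b - b)"
      by (rule gb_mult) auto
    moreover have "gb (pQ P) (a + (j + b)) a = gb (pQ P) (a + b + j) (b + j)"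
      by (subst gb_sym) (auto simp: add_ac)
    moreover have "gb (pQ P) (a + j) a = gb (pQ P) (a + j) j"
      by (subst gb_sym) (auto simp: add_ac)
    ultimately show ?thesis by (simp add: add_ac)
  qed
  have p: "(\<Prod>k<a + b. 1 - pQ P ^ (j + k) * (pAi P)\<^sup>2)
     = (\<Prod>k<b. 1 - pQ P ^ (j + k) * (pAi P)\<^sup>2) * (\<Prod>k<a. 1 - pQ P ^ (j + b + k) * (pAi P)\<^sup>2)"
    by (induction a) (auto simp: add_ac mult_ac)
  have q: "pQi P ^ (a * (j + b)) * pQi P ^ (b * j) = pQi P ^ ((a + b) * j) * pQi P ^ (a * b)"
    by (simp add: power_add[symmetric] algebra_simps)
  have "fcoef P a (j + b) * fcoef P b j = pA P ^ (a + b)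
     * (pQi P ^ (a * (j + b)) * pQi P ^ (b * j))
     * (gb (pQ P) (a + (j + b)) a * gb (pQ P) (b + j) b)
     * ((\<Prod>k<b. 1 - pQ P ^ (j + k) * (pAi P)\<^sup>2) * (\<Prod>k<a. 1 - pQ P ^ (j + b + k) * (pAi P)\<^sup>2))"
    unfolding fcoef_def power_add by (simp only: mult_ac)
  then show ?thesis unfolding g p[symmetric] q fcoef_def by (simp only: mult_ac)
qed

text \<open>The binomial theorem at x = Q^(-(m-1)), where the last factor of the product is
  zero.\<close>

lemma inverse_sum:
  "(\<Sum>b\<le>m. (\<Prod>k<b. - (pQi P ^ k)) * (pQi P ^ ((m - b) * b) * gb (pQ P) m b)) = (if m = 0 then 1 else 0)"
proof (cases m)
  case (Suc m')
  have sg: "(\<Prod>k<b. - (x ^ k)) = (- 1) ^ b * x ^ (b * (b - 1) div 2)" for b and x :: 'a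
  proof (induction b)
    case (Suc b)
    have "Suc b * (Suc b - 1) div 2 = b + b * (b - 1) div 2"
      by (cases b) (auto simp: algebra_simps)
    then show ?case using Suc by (simp add: power_add mult_ac)
  qed simp
  have "(\<Prod>k<b. - (pQi P ^ k)) * (pQi P ^ ((m - b) * b) * gb (pQ P) m b)
     = (- 1) ^ b * pQ P ^ (b * (b - 1) div 2) * gb (pQ P) m b * (pQi P ^ m') ^ b" if "b \<le> m" for b
  proof -
    have "pQi P ^ (b * (b - 1) div 2) * pQi P ^ ((m - b) * b) = pQ P ^ (b * (b - 1) div 2) * (pQi P ^ m') ^ b"
    proof -
      have "even (b * (b - 1))" by (cases b) auto
      then obtain t where t: "b * (b - 1) = 2 * t" by (elim evenE)
      obtain d where d: "m = b + d" using \<open>b \<le> m\<close> le_Suc_ex by blast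
      have e: "m' * b = t + (t + d * b)"
      proof -
        have "m' * b = (m - 1) * b" using Suc by simp
        also have "\<dots> = b * (b - 1) + d * b" unfolding d by (cases b) (auto simp: algebra_simps)
        finally show ?thesis unfolding t by simp
      qed
      have "(pQi P ^ m') ^ b = pQi P ^ t * pQi P ^ (t + d * b)"
        unfolding power_mult[symmetric] e power_add ..
      then show ?thesis unfolding t d by (simp add: power_add)
    qed
    then show ?thesis unfolding sg by (simp add: mult_ac)
  qed
  then have "(\<Sum>b\<le>m. (\<Prod>k<b. - (pQi P ^ k)) * (pQi P ^ ((m - b) * b) * gb (pQ P) m b))
     = (\<Prod>i<m. 1 - pQi P ^ m' * pQ P ^ i)"
    unfolding gb_binomial by (intro sum.cong) auto
  also have "\<dots> = 0"
    by (rule prod_zero) (auto intro!: bexI[of _ m'] simp: Suc mult.commute[of "pQi P ^ m'"])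
  finally show ?thesis using Suc by simp
qed simp

text \<open>The two one-sided inverse relations of the quasi-R-matrix in degree \<open>m\<close>:
  \<open>fcoef_mult\<close> pulls out \<open>fcoef P m j\<close>, and \<open>inverse_sum\<close>
  evaluates what remains.\<close>

lemma gcoef_fcoef_sum:
  "(\<Sum>b\<le>m. fcoef P (m - b) (j + b) * gcoef P b j) = (if m = 0 then 1 else 0)"
  "(\<Sum>b\<le>m. gcoef P b (j + (m - b)) * fcoef P (m - b) j) = (if m = 0 then 1 else 0)"
proof -
  have "(\<Sum>b\<le>m. fcoef P (m - b) (j + b) * gcoef P b j)
     = (\<Sum>b\<le>m. fcoef P m j * ((\<Prod>k<b. - (pQi P ^ k)) * (pQi P ^ ((m - b) * b) * gb (pQ P) m b)))"
  proof (rule sum.cong[OF refl], goal_cases)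
    case (1 b)
    then have "fcoef P (m - b) (j + b) * fcoef P b j = fcoef P m j * (pQi P ^ ((m - b) * b) * gb (pQ P) m b)"
      using fcoef_mult[of "m - b" j b] by simp
    moreover have "fcoef P (m - b) (j + b) * gcoef P b j
        = (\<Prod>k<b. - (pQi P ^ k)) * (fcoef P (m - b) (j + b) * fcoef P b j)"
      unfolding gcoef_def by (simp only: mult_ac)
    ultimately show ?case by (simp only: mult_ac)
  qed
  then show "(\<Sum>b\<le>m. fcoef P (m - b) (j + b) * gcoef P b j) = (if m = 0 then 1 else 0)"
    unfolding sum_distrib_left[symmetric] inverse_sum by auto
  have "(\<Sum>b\<le>m. gcoef P b (j + (m - b)) * fcoef P (m - b) j)
     = (\<Sum>b\<le>m. fcoef P m j * ((\<Prod>k<b. - (pQi P ^ k)) * (pQi P ^ ((m - b) * b) * gb (pQ P) m b)))"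
  proof (rule sum.cong[OF refl], goal_cases)
    case (1 b)
    then have "fcoef P b (j + (m - b)) * fcoef P (m - b) j
        = fcoef P m j * (pQi P ^ ((m - b) * b) * gb (pQ P) m (m - b))"
      using fcoef_mult[of b j "m - b"] by (simp add: mult.commute)
    moreover have "gb (pQ P) m (m - b) = gb (pQ P) m b" using 1 by (subst gb_sym) auto
    moreover have "gcoef P b (j + (m - b)) * fcoef P (m - b) j
        = (\<Prod>k<b. - (pQi P ^ k)) * (fcoef P b (j + (m - b)) * fcoef P (m - b) j)"
      unfolding gcoef_def by (simp only: mult_ac)
    ultimately show ?case by (simp only: mult_ac)
  qed
  then show "(\<Sum>b\<le>m. gcoef P b (j + (m - b)) * fcoef P (m - b) j) = (if m = 0 then 1 else 0)"
    unfolding sum_distrib_left[symmetric] inverse_sum by auto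
qed

end

section \<open>Kronecker products\<close>

lemma dim_kron [simp]:
  "dim_row (kron A B) = dim_row A * dim_row B" "dim_col (kron A B) = dim_col A * dim_col B"
  by (auto simp: kron_def)

lemma index_kron:
  "i < dim_row A * dim_row B \<Longrightarrow> j < dim_col A * dim_col B \<Longrightarrow>
   kron A B $$ (i, j) = A $$ (i div dim_row B, j div dim_col B) * B $$ (i mod dim_row B, j mod dim_col B)"
  by (simp add: kron_def)

lemma div_mod_less: "i < a * b \<Longrightarrow> i div b < a" "i < a * b \<Longrightarrow> i mod b < (b::nat)"
  by (simp add: less_mult_imp_div_less) (cases "b = 0"; simp)

lemma mult_add_less: "i < a \<Longrightarrow> j < b \<Longrightarrow> i * b + j < a * (b::nat)"
  using mult_le_mono1[of "Suc i" a b] by simp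

lemma sum_div_mod:
  fixes f :: "nat \<Rightarrow> nat \<Rightarrow> 'b::comm_monoid_add"
  shows "(\<Sum>k<a * b. f (k div b) (k mod b)) = (\<Sum>i<a. \<Sum>j<b. f i j)"
proof -
  have "(\<Sum>k<a * b. f (k div b) (k mod b)) = (\<Sum>(i, j)\<in>{..<a} \<times> {..<b}. f i j)"
    by (intro sum.reindex_bij_witness[of _ "\<lambda>(i, j). i * b + j" "\<lambda>k. (k div b, k mod b)"])
       (auto simp: div_mod_less mult_add_less)
  then show ?thesis by (simp add: sum.cartesian_product)
qed

lemma index_mult_kron:
  fixes M :: "'a::comm_ring_1 mat"
  assumes "p < dim_row M" "s < dim_col U * dim_col V" "dim_col M = dim_row U * dim_row V"
  shows "(M * kron U V) $$ (p, s) = (\<Sum>i<dim_row U. \<Sum>j<dim_row V.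
     M $$ (p, i * dim_row V + j) * (U $$ (i, s div dim_col V) * V $$ (j, s mod dim_col V)))"
proof -
  have "(M * kron U V) $$ (p, s) = (\<Sum>k<dim_row U * dim_row V. M $$ (p, k) * kron U V $$ (k, s))"
    using assms by (simp add: scalar_prod_def atLeast0LessThan)
  also have "\<dots> = (\<Sum>k<dim_row U * dim_row V.
     M $$ (p, (k div dim_row V) * dim_row V + k mod dim_row V) *
     (U $$ (k div dim_row V, s div dim_col V) * V $$ (k mod dim_row V, s mod dim_col V)))"
    by (rule sum.cong) (auto simp: index_kron assms)
  also note sum_div_mod[of "\<lambda>i j. M $$ (p, i * dim_row V + j) * (U $$ (i, s div dim_col V) * V $$ (j, s mod dim_col V))"]
  finally show ?thesis .
qed

lemma index_kron_mult:
  fixes M :: "'a::comm_ring_1 mat"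
  assumes "p < dim_row U * dim_row V" "s < dim_col M" "dim_row M = dim_col U * dim_col V"
  shows "(kron U V * M) $$ (p, s) = (\<Sum>i<dim_col U. \<Sum>j<dim_col V.
     (U $$ (p div dim_row V, i) * V $$ (p mod dim_row V, j)) * M $$ (i * dim_col V + j, s))"
proof -
  have "(kron U V * M) $$ (p, s) = (\<Sum>k<dim_col U * dim_col V. kron U V $$ (p, k) * M $$ (k, s))"
    using assms by (simp add: scalar_prod_def atLeast0LessThan)
  also have "\<dots> = (\<Sum>k<dim_col U * dim_col V.
     (U $$ (p div dim_row V, k div dim_col V) * V $$ (p mod dim_row V, k mod dim_col V)) *
     M $$ ((k div dim_col V) * dim_col V + k mod dim_col V, s))"
    by (rule sum.cong) (auto simp: index_kron assms)
  also note sum_div_mod[of "\<lambda>i j. (U $$ (p div dim_row V, i) * V $$ (p mod dim_row V, j)) * M $$ (i * dim_col V + j, s)"]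
  finally show ?thesis .
qed

lemma kron_mult:
  fixes A B C D :: "'a::comm_ring_1 mat"
  assumes "dim_col A = dim_row C" "dim_col B = dim_row D"
  shows "kron A B * kron C D = kron (A * C) (B * D)"
proof (rule eq_matI)
  fix i j assume ij: "i < dim_row (kron (A * C) (B * D))" "j < dim_col (kron (A * C) (B * D))"
  then have i: "i < dim_row A * dim_row B" and j: "j < dim_col C * dim_col D" by auto
  note i' = div_mod_less[OF i] and j' = div_mod_less[OF j]
  have "(kron A B * kron C D) $$ (i, j) = (\<Sum>k<dim_row C. \<Sum>l<dim_row D.
     kron A B $$ (i, k * dim_row D + l) * (C $$ (k, j div dim_col D) * D $$ (l, j mod dim_col D)))"
    using i j assms by (subst index_mult_kron) auto
  also have "\<dots> = (\<Sum>k<dim_row C. \<Sum>l<dim_row D.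
     (A $$ (i div dim_row B, k) * C $$ (k, j div dim_col D)) * (B $$ (i mod dim_row B, l) * D $$ (l, j mod dim_col D)))"
  proof (intro sum.cong refl, goal_cases)
    case (1 k l)
    then have "k * dim_row D + l < dim_row C * dim_row D" by (intro mult_add_less) auto
    moreover have "(k * dim_row D + l) div dim_row D = k" "(k * dim_row D + l) mod dim_row D = l"
      using 1 by auto
    ultimately show ?case using i assms by (simp add: index_kron mult_ac)
  qed
  also have "\<dots> = (\<Sum>k<dim_row C. A $$ (i div dim_row B, k) * C $$ (k, j div dim_col D)) *
      (\<Sum>l<dim_row D. B $$ (i mod dim_row B, l) * D $$ (l, j mod dim_col D))"
    by (simp add: sum_product)
  also have "\<dots> = kron (A * C) (B * D) $$ (i, j)"
    using ij i' j' assms by (simp add: index_kron scalar_prod_def atLeast0LessThan)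
  finally show "(kron A B * kron C D) $$ (i, j) = kron (A * C) (B * D) $$ (i, j)" .
qed auto

lemma kron_assoc: "kron (kron A B) C = kron A (kron B (C :: 'a::comm_ring_1 mat))"
proof (rule eq_matI)
  fix i j assume "i < dim_row (kron A (kron B C))" "j < dim_col (kron A (kron B C))"
  then have i: "i < dim_row A * dim_row B * dim_row C" and j: "j < dim_col A * dim_col B * dim_col C"
    by (auto simp: mult.assoc)
  note i' = div_mod_less[OF i] and j' = div_mod_less[OF j]
  have i2: "i < dim_row A * (dim_row B * dim_row C)" and j2: "j < dim_col A * (dim_col B * dim_col C)"
    using i j by (auto simp: mult.assoc)
  note i2' = div_mod_less[OF i2] and j2' = div_mod_less[OF j2]
  have m: "k mod (c * b) div c = k div c mod b" "k mod (c * b) mod c = k mod c" for k b c :: nat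
    by (cases "c = 0"; simp add: mod_mult2_eq)+
  show "kron (kron A B) C $$ (i, j) = kron A (kron B C) $$ (i, j)"
    using i j i2 j2 i' j' i2' j2'
    by (simp add: index_kron m div_mult2_eq mult.commute[of "dim_row B"] mult.commute[of "dim_col B"] mult.assoc)
qed (auto simp: mult.assoc)

lemma kron_one [simp]: "kron (1\<^sub>m a) (1\<^sub>m b) = (1\<^sub>m (a * b) :: 'a::comm_ring_1 mat)"
proof (rule eq_matI)
  fix i j assume "i < dim_row (1\<^sub>m (a * b) :: 'a mat)" "j < dim_col (1\<^sub>m (a * b) :: 'a mat)"
  then have ij: "i < a * b" "j < a * b" by auto
  have "(i div b = j div b \<and> i mod b = j mod b) = (i = j)" by (metis div_mult_mod_eq)
  then show "kron (1\<^sub>m a) (1\<^sub>m b) $$ (i, j) = (1\<^sub>m (a * b) :: 'a mat) $$ (i, j)"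
    using ij div_mod_less[OF ij(1)] div_mod_less[OF ij(2)] by (auto simp: index_kron)
qed auto

lemma kron_add:
  fixes A B C :: "'a::comm_ring_1 mat"
  assumes "dim_row A = dim_row B" "dim_col A = dim_col B"
  shows "kron (A + B) C = kron A C + kron B C" and "kron C (A + B) = kron C A + kron C B"
proof -
  show "kron (A + B) C = kron A C + kron B C"
  proof (rule eq_matI)
    fix i j assume "i < dim_row (kron A C + kron B C)" "j < dim_col (kron A C + kron B C)"
    then have i: "i < dim_row B * dim_row C" and j: "j < dim_col B * dim_col C" by auto
    then show "kron (A + B) C $$ (i, j) = (kron A C + kron B C) $$ (i, j)"
      using div_mod_less[OF i] div_mod_less[OF j] assms by (simp add: index_kron distrib_right)
  qed (use assms in auto)
  show "kron C (A + B) = kron C A + kron C B"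
  proof (rule eq_matI)
    fix i j assume "i < dim_row (kron C A + kron C B)" "j < dim_col (kron C A + kron C B)"
    then have i: "i < dim_row C * dim_row B" and j: "j < dim_col C * dim_col B" by auto
    then show "kron C (A + B) $$ (i, j) = (kron C A + kron C B) $$ (i, j)"
      using div_mod_less[OF i] div_mod_less[OF j] assms by (simp add: index_kron distrib_left)
  qed (use assms in auto)
qed

lemma kron_one_1 [simp]: "kron (1\<^sub>m (Suc 0)) A = (A :: 'a::comm_ring_1 mat)" "kron A (1\<^sub>m (Suc 0)) = A"
  by (rule eq_matI; auto simp: index_kron)+


section \<open>Equivariance\<close>

definition Emat :: "nat \<Rightarrow> 'a::comm_ring_1 par \<Rightarrow> orient \<Rightarrow> 'a mat" where
  "Emat N P ori = mat N N (\<lambda>(k, i). case ori of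
      Up \<Rightarrow> if i = Suc k then 1 else 0
    | Down \<Rightarrow> if k = Suc i then - (pAi P * pQ P ^ k) else 0)"

definition Kmat :: "nat \<Rightarrow> 'a::comm_ring_1 par \<Rightarrow> orient \<Rightarrow> 'a mat" where
  "Kmat N P ori = mat N N (\<lambda>(k, i). if k = i then
      (case ori of Up \<Rightarrow> pA P * pQi P ^ i | Down \<Rightarrow> pAi P * pQ P ^ i) else 0)"

text \<open>
  The coproduct is \<open>\<Delta>(E) = 1 \<otimes> E + E \<otimes> K\<close>, and \<open>E\<close> acts on the dual by the transpose of \<open>- E K\<^sup>-\<^sup>1\<close>.
\<close>

fun Kact :: "nat \<Rightarrow> 'a::comm_ring_1 par \<Rightarrow> orient list \<Rightarrow> 'a mat" where
  "Kact N P [] = 1\<^sub>m 1"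
| "Kact N P (ori # s) = kron (Kmat N P ori) (Kact N P s)"

fun Eact :: "nat \<Rightarrow> 'a::comm_ring_1 par \<Rightarrow> orient list \<Rightarrow> 'a mat" where
  "Eact N P [] = 0\<^sub>m 1 1"
| "Eact N P (ori # s) = kron (1\<^sub>m N) (Eact N P s) + kron (Emat N P ori) (Kact N P s)"

lemma dim_EK [simp]:
  "dim_row (Emat N P ori) = N" "dim_col (Emat N P ori) = N"
  "dim_row (Kmat N P ori) = N" "dim_col (Kmat N P ori) = N"
  by (simp_all add: Emat_def Kmat_def)

lemma dim_Kact [simp]: "dim_row (Kact N P s) = N ^ length s" "dim_col (Kact N P s) = N ^ length s"
  by (induction s) auto

lemma dim_Eact [simp]: "dim_row (Eact N P s) = N ^ length s" "dim_col (Eact N P s) = N ^ length s"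
  by (induction s) auto

lemma Kact_append: "Kact N P (s @ t) = kron (Kact N P s) (Kact N P t)"
  by (induction s) (simp_all add: kron_assoc)

text \<open>Coassociativity of the iterated coproduct. It allows the piece in the middle of a slice
  to be treated separately from the strands around it.\<close>

lemma Eact_append:
  "Eact N P (s @ t) = kron (1\<^sub>m (N ^ length s)) (Eact N P t) + kron (Eact N P s) (Kact N P t)"
proof (induction s)
  case Nil
  have "kron (0\<^sub>m (Suc 0) (Suc 0)) (Kact N P t) = 0\<^sub>m (N ^ length t) (N ^ length t)"
    by (rule eq_matI) (auto simp: index_kron)
  then show ?case
    using right_add_zero_mat[of "Eact N P t" "N ^ length t" "N ^ length t"] by (simp add: carrier_matI)
next
  case (Cons a s)
  have "kron (1\<^sub>m N) (kron (1\<^sub>m (N ^ length s)) U) = kron (1\<^sub>m (N * N ^ length s)) U" for U :: "'a mat"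
    by (metis kron_assoc kron_one)
  then show ?case
    by (simp add: Cons Kact_append kron_add kron_assoc)
       (rule assoc_add_mat[of _ "N * (N ^ length s * N ^ length t)" "N * (N ^ length s * N ^ length t)"],
        auto intro!: carrier_matI simp: power_add)
qed


definition kdiag :: "'a::comm_ring_1 par \<Rightarrow> orient \<Rightarrow> nat \<Rightarrow> 'a" where
  "kdiag P ori i = (case ori of Up \<Rightarrow> pA P * pQi P ^ i | Down \<Rightarrow> pAi P * pQ P ^ i)"

definition eent :: "'a::comm_ring_1 par \<Rightarrow> orient \<Rightarrow> nat \<Rightarrow> nat \<Rightarrow> 'a" where
  "eent P ori k i = (case ori of
      Up \<Rightarrow> if i = Suc k then 1 else 0
    | Down \<Rightarrow> if k = Suc i then - (pAi P * pQ P ^ k) else 0)"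

lemma index_Emat [simp]: "k < N \<Longrightarrow> i < N \<Longrightarrow> Emat N P ori $$ (k, i) = eent P ori k i"
  by (simp add: Emat_def eent_def)

lemma index_Kmat [simp]: "k < N \<Longrightarrow> i < N \<Longrightarrow> Kmat N P ori $$ (k, i) = (if k = i then kdiag P ori i else 0)"
  by (simp add: Kmat_def kdiag_def)

lemma act_single [simp]: "Kact N P [ori] = Kmat N P ori" "Eact N P [ori] = Emat N P ori"
proof -
  have "kron (1\<^sub>m N) (0\<^sub>m (Suc 0) (Suc 0)) = (0\<^sub>m N N :: 'a mat)"
    by (rule eq_matI) (auto simp: index_kron)
  then show "Eact N P [ori] = Emat N P ori"
    using left_add_zero_mat[of "Emat N P ori" N N] by (simp add: carrier_matI)
qed (simp)

lemma act_pair: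
  "Kact N P [o1, o2] = kron (Kmat N P o1) (Kmat N P o2)"
  "Eact N P [o1, o2] = kron (1\<^sub>m N) (Emat N P o2) + kron (Emat N P o1) (Kmat N P o2)"
  by (simp_all only: Kact.simps(2)[of N P o1 "[o2]"] Eact.simps(2)[of N P o1 "[o2]"] act_single)

lemma sum_if_const: "(\<Sum>j\<in>S. if b then f j else 0) = (if b then sum f S else (0::'a::comm_monoid_add))"
  by simp

lemma mult_Eact_pair:
  fixes M :: "'a::comm_ring_1 mat"
  assumes "p < dim_row M" "a < N" "b < N" "dim_col M = N * N"
  shows "(M * Eact N P [o1, o2]) $$ (p, a * N + b) =
     (\<Sum>j<N. M $$ (p, a * N + j) * eent P o2 j b) + (\<Sum>i<N. M $$ (p, i * N + b) * (eent P o1 i a * kdiag P o2 b))"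
proof -
  have l: "a * N + b < N * N" using assms mult_add_less by blast
  have 1: "(M * kron (1\<^sub>m N) (Emat N P o2)) $$ (p, a * N + b) = (\<Sum>j<N. M $$ (p, a * N + j) * eent P o2 j b)"
    using assms l by (subst index_mult_kron) (auto simp: if_distrib if_distribR sum_if_const cong: if_cong)
  have 2: "(M * kron (Emat N P o1) (Kmat N P o2)) $$ (p, a * N + b)
      = (\<Sum>i<N. M $$ (p, i * N + b) * (eent P o1 i a * kdiag P o2 b))"
    using assms l by (subst index_mult_kron) (auto simp: if_distrib if_distribR sum_if_const cong: if_cong)
  show ?thesis
    unfolding act_pair
    by (subst mult_add_distrib_mat[of _ "dim_row M" "N * N" _ "N * N"])
       (use assms l 1 2 in \<open>auto intro!: carrier_matI\<close>)
qed

lemma Eact_pair_mult: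
  fixes M :: "'a::comm_ring_1 mat"
  assumes "s < dim_col M" "c < N" "d < N" "dim_row M = N * N"
  shows "(Eact N P [o1, o2] * M) $$ (c * N + d, s) =
     (\<Sum>j<N. eent P o2 d j * M $$ (c * N + j, s)) + (\<Sum>i<N. (eent P o1 c i * kdiag P o2 d) * M $$ (i * N + d, s))"
proof -
  have l: "c * N + d < N * N" using assms mult_add_less by blast
  have 1: "(kron (1\<^sub>m N) (Emat N P o2) * M) $$ (c * N + d, s) = (\<Sum>j<N. eent P o2 d j * M $$ (c * N + j, s))"
    using assms l by (subst index_kron_mult) (auto simp: if_distrib if_distribR sum_if_const cong: if_cong)
  have 2: "(kron (Emat N P o1) (Kmat N P o2) * M) $$ (c * N + d, s)
      = (\<Sum>i<N. (eent P o1 c i * kdiag P o2 d) * M $$ (i * N + d, s))"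
    using assms l by (subst index_kron_mult) (auto simp: if_distrib if_distribR sum_if_const cong: if_cong)
  show ?thesis
    unfolding act_pair
    by (subst add_mult_distrib_mat[of _ "N * N" "N * N" _ _ "dim_col M"])
       (use assms l 1 2 in \<open>auto intro!: carrier_matI\<close>)
qed

lemma mult_Kact_pair:
  fixes M :: "'a::comm_ring_1 mat"
  assumes "p < dim_row M" "a < N" "b < N" "dim_col M = N * N"
  shows "(M * Kact N P [o1, o2]) $$ (p, a * N + b) = M $$ (p, a * N + b) * (kdiag P o1 a * kdiag P o2 b)"
proof -
  have l: "a * N + b < N * N" using assms mult_add_less by blast
  have *: "(\<Sum>j<N. M $$ (p, i * N + j) * ((if i = a then kdiag P o1 a else 0) * (if j = b then kdiag P o2 b else 0)))
      = (if i = a then M $$ (p, a * N + b) * (kdiag P o1 a * kdiag P o2 b) else 0)" for i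
    using assms(3) by (cases "i = a") (simp_all add: if_distrib cong: if_cong)
  show ?thesis unfolding act_pair
    using assms l by (subst index_mult_kron) (simp_all add: *)
qed

lemma Kact_pair_mult:
  fixes M :: "'a::comm_ring_1 mat"
  assumes "s < dim_col M" "c < N" "d < N" "dim_row M = N * N"
  shows "(Kact N P [o1, o2] * M) $$ (c * N + d, s) = (kdiag P o1 c * kdiag P o2 d) * M $$ (c * N + d, s)"
proof -
  have l: "c * N + d < N * N" using assms mult_add_less by blast
  have *: "(\<Sum>j<N. (if c = i then kdiag P o1 i else 0) * (if d = j then kdiag P o2 j else 0) * M $$ (i * N + j, s))
      = (if c = i then (kdiag P o1 c * kdiag P o2 d) * M $$ (c * N + d, s) else 0)" for i
    using assms(3) by (cases "c = i") (simp_all add: if_distrib if_distribR cong: if_cong)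
  show ?thesis unfolding act_pair
    using assms l by (subst index_kron_mult) (simp_all add: *)
qed

section \<open>Labels of strands as base-\<open>N\<close> digits of matrix indices\<close>

fun idx :: "nat \<Rightarrow> nat list \<Rightarrow> nat" where
  "idx N [] = 0"
| "idx N (a # x) = a * N ^ length x + idx N x"

fun digits :: "nat \<Rightarrow> nat \<Rightarrow> nat \<Rightarrow> nat list" where
  "digits N 0 p = []"
| "digits N (Suc k) p = (p div N ^ k) # digits N k (p mod N ^ k)"

lemma labels_0 [simp]: "labels N 0 = {[]}"
  by (auto simp: labels_def)

lemma labels_length: "x \<in> labels N k \<Longrightarrow> length x = k"
  by (simp add: labels_def)

lemma labels_Cons [simp]: "a # x \<in> labels N (Suc k) \<longleftrightarrow> a < N \<and> x \<in> labels N k"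
  by (auto simp: labels_def)

lemma labels_append:
  "x \<in> labels N (k + l) \<longleftrightarrow> (\<exists>y z. x = y @ z \<and> y \<in> labels N k \<and> z \<in> labels N l)"
proof
  assume x: "x \<in> labels N (k + l)"
  then have "take k x \<in> labels N k" "drop k x \<in> labels N l"
    by (auto simp: labels_def dest: in_set_takeD in_set_dropD)
  then show "\<exists>y z. x = y @ z \<and> y \<in> labels N k \<and> z \<in> labels N l"
    by (metis append_take_drop_id)
qed (auto simp: labels_def)

lemma idx_less: "x \<in> labels N k \<Longrightarrow> idx N x < N ^ k"
proof (induction x arbitrary: k)
  case (Cons a x)
  then obtain k' where "k = Suc k'" by (cases k) auto
  then show ?case using Cons mult_add_less[of a N "idx N x" "N ^ k'"] labels_length[of x N k'] by simp
qed (auto simp: labels_def)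

lemma mult_add_div: "r < b \<Longrightarrow> (a * b + r) div b = a" "r < b \<Longrightarrow> (a * b + r) mod b = (r::nat)"
  by (cases "b = 0"; simp)+

lemma digits_idx: "x \<in> labels N k \<Longrightarrow> digits N k (idx N x) = x"
proof (induction x arbitrary: k)
  case (Cons a x)
  then obtain k' where k: "k = Suc k'" by (cases k) auto
  then have "x \<in> labels N k'" using Cons by simp
  then show ?case using Cons.IH k idx_less[of x N k'] labels_length[of x N k'] by (simp add: mult_add_div)
qed (auto simp: labels_def)

lemma digits_in_labels: "p < N ^ k \<Longrightarrow> digits N k p \<in> labels N k"
  by (induction k arbitrary: p) (simp_all add: div_mod_less)

lemma idx_digits: "p < N ^ k \<Longrightarrow> idx N (digits N k p) = p"
proof (induction k arbitrary: p)
  case (Suc k)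
  then have "p mod N ^ k < N ^ k" using div_mod_less(2)[of p N "N ^ k"] by simp
  then show ?case using Suc.IH[of "p mod N ^ k"] labels_length[OF digits_in_labels[of "p mod N ^ k" N k]]
      div_mult_mod_eq[of p "N ^ k"] by simp
qed simp

lemma idx_append: "idx N (x @ y) = idx N x * N ^ length y + idx N y"
  by (induction x) (auto simp: algebra_simps power_add)

lemma sum_labels:
  "(\<Sum>p<N ^ k. f p) = (\<Sum>x\<in>labels N k. f (idx N x))"
  by (rule sum.reindex_bij_witness[of _ "idx N" "digits N k"])
     (auto simp: idx_digits digits_idx digits_in_labels idx_less)

definition pmat :: "nat \<Rightarrow> 'a::comm_ring_1 par \<Rightarrow> piece \<Rightarrow> 'a mat" where
  "pmat N P G = mat (N ^ length (tgt G)) (N ^ length (src G))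
     (\<lambda>(p, s). pw P G (digits N (length (tgt G)) p) (digits N (length (src G)) s))"

lemma dim_pmat [simp]:
  "dim_row (pmat N P G) = N ^ length (tgt G)" "dim_col (pmat N P G) = N ^ length (src G)"
  by (simp_all add: pmat_def)

lemma index_pmat:
  "z \<in> labels N (length (tgt G)) \<Longrightarrow> x \<in> labels N (length (src G)) \<Longrightarrow>
   pmat N P G $$ (idx N z, idx N x) = pw P G z x"
  by (simp add: pmat_def digits_idx idx_less)

lemma index_pmat_pair:
  assumes "c < N" "d < N"
  shows "a < N \<Longrightarrow> b < N \<Longrightarrow> pmat N P PosX $$ (c * N + d, a * N + b) = pw P PosX [c, d] [a, b]"
    "a < N \<Longrightarrow> b < N \<Longrightarrow> pmat N P NegX $$ (c * N + d, a * N + b) = pw P NegX [c, d] [a, b]"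
    "pmat N P CupUD $$ (c * N + d, 0) = pw P CupUD [c, d] []"
    "pmat N P CupDU $$ (c * N + d, 0) = pw P CupDU [c, d] []"
    "pmat N P CapUD $$ (0, c * N + d) = pw P CapUD [] [c, d]"
    "pmat N P CapDU $$ (0, c * N + d) = pw P CapDU [] [c, d]"
proof -
  have l: "[x, y] \<in> labels N (Suc (Suc 0))" if "x < N" "y < N" for x y using that by simp
  show "a < N \<Longrightarrow> b < N \<Longrightarrow> pmat N P PosX $$ (c * N + d, a * N + b) = pw P PosX [c, d] [a, b]"
    "a < N \<Longrightarrow> b < N \<Longrightarrow> pmat N P NegX $$ (c * N + d, a * N + b) = pw P NegX [c, d] [a, b]"
    using index_pmat[of "[c, d]" N PosX "[a, b]"] index_pmat[of "[c, d]" N NegX "[a, b]"] assms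
    by (simp_all del: pw.simps)
  show "pmat N P CupUD $$ (c * N + d, 0) = pw P CupUD [c, d] []"
    "pmat N P CupDU $$ (c * N + d, 0) = pw P CupDU [c, d] []"
    "pmat N P CapUD $$ (0, c * N + d) = pw P CapUD [] [c, d]"
    "pmat N P CapDU $$ (0, c * N + d) = pw P CapDU [] [c, d]"
    using index_pmat[of "[c, d]" N CupUD "[]"] index_pmat[of "[c, d]" N CupDU "[]"]
      index_pmat[of "[]" N CapUD "[c, d]"] index_pmat[of "[]" N CapDU "[c, d]"] assms
    by (simp_all del: pw.simps)
qed

lemma eq_mat_pairI:
  fixes M M' :: "'a mat"
  assumes "dim_row M = N * N" "dim_row M' = N * N" "dim_col M = N * N" "dim_col M' = N * N"
    "\<And>a b c d. a < N \<Longrightarrow> b < N \<Longrightarrow> c < N \<Longrightarrow> d < N \<Longrightarrow>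
       M $$ (c * N + d, a * N + b) = M' $$ (c * N + d, a * N + b)"
  shows "M = M'"
proof (rule eq_matI)
  fix i j assume "i < dim_row M'" "j < dim_col M'"
  then have ij: "i < N * N" "j < N * N" using assms by auto
  show "M $$ (i, j) = M' $$ (i, j)"
    using assms(5)[OF div_mod_less(1,2)[OF ij(2)] div_mod_less(1,2)[OF ij(1)]] by simp
qed (use assms in auto)

section \<open>Elementary pieces: invertibility of crossings and commutation with E and K\<close>

lemma pmat_PosX_mult_NegX:
  assumes "valid (P :: 'a::comm_ring_1 par)"
  shows "pmat N P PosX * pmat N P NegX = 1\<^sub>m (N * N)"
proof (rule eq_mat_pairI[where N = N])
  fix a b c d assume l: "a < N" "b < N" "c < N" "d < N"
  note Q_cancel[OF assms, simp] A_cancel[OF assms, simp]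
  have ll: "c * N + d < N * N" "a * N + b < N * N" using l mult_add_less by blast+
  define F where "F i j = pw P PosX [c, d] [i, j] * pw P NegX [i, j] [a, b]" for i j
  have "(pmat N P PosX * pmat N P NegX) $$ (c * N + d, a * N + b)
      = (\<Sum>k<N * N. pmat N P PosX $$ (c * N + d, k) * pmat N P NegX $$ (k, a * N + b))"
    using ll by (simp add: scalar_prod_def atLeast0LessThan)
  also have "\<dots> = (\<Sum>k<N * N. F (k div N) (k mod N))"
  proof (rule sum.cong[OF refl], goal_cases)
    case (1 k)
    then have "k div N < N" "k mod N < N" using div_mod_less by auto
    then show ?case unfolding F_def using l
        index_pmat_pair(1)[of c N d "k div N" "k mod N" P] index_pmat_pair(2)[of "k div N" N "k mod N" a b P]
      by (simp del: pw.simps)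
  qed
  also have "\<dots> = (\<Sum>(i, j)\<in>{..<N} \<times> {..<N}. F i j)"
    by (simp add: sum_div_mod sum.cartesian_product)
  also have "\<dots> = (if a = c \<and> b = d then 1 else 0)"
  proof (cases "a \<le> c \<and> c + d = a + b")
    case False
    then have "F i j = 0" for i j by (auto simp: F_def)
    then show ?thesis using False by auto
  next
    case True
    then obtain m where m: "c = a + m" "b = d + m" by (metis add.assoc add_left_cancel le_Suc_ex add.commute)
    \<comment> \<open>On the support the intermediate labels are \<open>(b - t, a + t)\<close>,
      where \<open>t\<close> is the jump at the negative crossing and \<open>m\<close> the total
      jump.\<close>
    have "(\<Sum>(i, j)\<in>{..<N} \<times> {..<N}. F i j) = (\<Sum>(i, j)\<in>(\<lambda>t. (b - t, a + t)) ` {..m}. F i j)"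
    proof (rule sum.mono_neutral_right)
      show "\<forall>x\<in>{..<N} \<times> {..<N} - (\<lambda>t. (b - t, a + t)) ` {..m}. (case x of (i, j) \<Rightarrow> F i j) = 0"
      proof clarsimp
        fix i j assume "(i, j) \<notin> (\<lambda>t. (b - t, a + t)) ` {..m}"
        then have "\<not> (a \<le> j \<and> j \<le> c \<and> i + j = a + b)"
          using m by (auto simp: image_iff Bex_def dest!: spec[of _ "j - a"])
        then show "F i j = 0" by (auto simp: F_def)
      qed
    qed (use m l in auto)
    also have "\<dots> = (\<Sum>t\<le>m. F (b - t) (a + t))"
      by (subst sum.reindex) (auto simp: inj_on_def)
    also have "\<dots> = (\<Sum>t\<le>m. (pQ P ^ (d * c) * pQi P ^ (b * a)) * (fcoef P (m - t) (a + t) * gcoef P t a))"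
    proof (rule sum.cong[OF refl], goal_cases)
      case (1 t)
      then have t: "t \<le> m" by simp
      have "F (b - t) (a + t) = wpos P (b - t) (a + t) (m - t) * wneg P b a t"
        unfolding F_def using t m by simp
      also have "\<dots> = (pT P * pTi P) * (pA P ^ (a + b) * pAi P ^ (a + b)) *
          (pQ P ^ (d * c) * pQi P ^ (b * a)) * (fcoef P (m - t) (a + t) * gcoef P t a)"
      proof -
        have e: "b - t + (a + t) = a + b" "b - t - (m - t) = d" "a + t + (m - t) = c" "b + a = a + b"
          using t m by auto
        show ?thesis unfolding wpos_def wneg_def e by (simp only: mult_ac)
      qed
      finally show ?case using T_inv[OF assms] by simp
    qed
    also have "\<dots> = (pQ P ^ (d * c) * pQi P ^ (b * a)) * (if m = 0 then 1 else 0)"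
      unfolding sum_distrib_left[symmetric] gcoef_fcoef_sum[OF assms] ..
    finally show ?thesis using m by (auto simp: mult.commute[of d])
  qed
  also have "\<dots> = 1\<^sub>m (N * N) $$ (c * N + d, a * N + b)"
  proof -
    have "c * N + d = a * N + b \<longleftrightarrow> a = c \<and> b = d"
      using mult_add_div[OF l(4), of c] mult_add_div[OF l(2), of a] by metis
    then show ?thesis using ll by auto
  qed
  finally show "(pmat N P PosX * pmat N P NegX) $$ (c * N + d, a * N + b) = 1\<^sub>m (N * N) $$ (c * N + d, a * N + b)" .
qed auto

lemma pmat_NegX_mult_PosX:
  assumes "valid (P :: 'a::comm_ring_1 par)"
  shows "pmat N P NegX * pmat N P PosX = 1\<^sub>m (N * N)"
proof (rule eq_mat_pairI[where N = N])
  fix a b c d assume l: "a < N" "b < N" "c < N" "d < N"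
  note Q_cancel[OF assms, simp] A_cancel[OF assms, simp]
  have ll: "c * N + d < N * N" "a * N + b < N * N" using l mult_add_less by blast+
  define F where "F i j = pw P NegX [c, d] [i, j] * pw P PosX [i, j] [a, b]" for i j
  have "(pmat N P NegX * pmat N P PosX) $$ (c * N + d, a * N + b)
      = (\<Sum>k<N * N. pmat N P NegX $$ (c * N + d, k) * pmat N P PosX $$ (k, a * N + b))"
    using ll by (simp add: scalar_prod_def atLeast0LessThan)
  also have "\<dots> = (\<Sum>k<N * N. F (k div N) (k mod N))"
  proof (rule sum.cong[OF refl], goal_cases)
    case (1 k)
    then have "k div N < N" "k mod N < N" using div_mod_less by auto
    then show ?case unfolding F_def using l
        index_pmat_pair(2)[of c N d "k div N" "k mod N" P] index_pmat_pair(1)[of "k div N" N "k mod N" a b P]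
      by (simp del: pw.simps)
  qed
  also have "\<dots> = (\<Sum>(i, j)\<in>{..<N} \<times> {..<N}. F i j)"
    by (simp add: sum_div_mod sum.cartesian_product)
  also have "\<dots> = (if a = c \<and> b = d then 1 else 0)"
  proof (cases "b \<le> d \<and> c + d = a + b")
    case False
    then have "F i j = 0" for i j by (auto simp: F_def)
    then show ?thesis using False by auto
  next
    case True
    then obtain m where m: "d = b + m" "a = c + m" by (metis add.assoc add_left_cancel le_Suc_ex add.commute)
    have "(\<Sum>(i, j)\<in>{..<N} \<times> {..<N}. F i j) = (\<Sum>(i, j)\<in>(\<lambda>t. (b + (m - t), a - (m - t))) ` {..m}. F i j)"
    proof (rule sum.mono_neutral_right)
      show "\<forall>x\<in>{..<N} \<times> {..<N} - (\<lambda>t. (b + (m - t), a - (m - t))) ` {..m}. (case x of (i, j) \<Rightarrow> F i j) = 0"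
      proof
        fix x assume x: "x \<in> {..<N} \<times> {..<N} - (\<lambda>t. (b + (m - t), a - (m - t))) ` {..m}"
        obtain i j where ij: "x = (i, j)" by (cases x)
        have "(i, j) \<noteq> (b + (m - t), a - (m - t))" if "t \<le> m" for t using x ij that by auto
        have "\<not> (b \<le> i \<and> i \<le> d \<and> i + j = a + b)"
        proof
          assume "b \<le> i \<and> i \<le> d \<and> i + j = a + b"
          then have "d - i \<le> m" "b + (m - (d - i)) = i" "a - (m - (d - i)) = j" using m by auto
          with \<open>\<And>t. t \<le> m \<Longrightarrow> (i, j) \<noteq> (b + (m - t), a - (m - t))\<close>[of "d - i"] show False by simp
        qed
        then show "(case x of (i, j) \<Rightarrow> F i j) = 0" by (auto simp: F_def ij)
      qed
    qed (use m l in auto)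
    also have "\<dots> = (\<Sum>t\<le>m. F (b + (m - t)) (a - (m - t)))"
      by (subst sum.reindex) (auto simp: inj_on_def)
    also have "\<dots> = (\<Sum>t\<le>m. gcoef P t (b + (m - t)) * fcoef P (m - t) b)"
    proof (rule sum.cong[OF refl], goal_cases)
      case (1 t)
      then have t: "t \<le> m" by simp
      define i j where "i = b + (m - t)" and "j = a - (m - t)"
      have ij: "i + j = a + b" "i - b = m - t" "d - i = t" "a - (m - t) = j" "b + (m - t) = i" "i \<le> d" "j + i = a + b"
        using t m by (auto simp: i_def j_def)
      have "F i j = wneg P j i t * wpos P a b (m - t)"
      proof -
        have "b \<le> i" "c + d = i + j" using t m by (auto simp: i_def j_def)
        then show ?thesis unfolding F_def using ij(1,2,3,6) by simp
      qed
      also have "\<dots> = (pT P * pTi P) * (pA P ^ (a + b) * pAi P ^ (a + b)) *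
          (pQ P ^ (j * i) * pQi P ^ (j * i)) * (gcoef P t i * fcoef P (m - t) b)"
        unfolding wpos_def wneg_def ij by (simp only: mult_ac)
      finally show ?case using T_inv[OF assms] by (simp add: i_def j_def)
    qed
    finally show ?thesis using m unfolding gcoef_fcoef_sum[OF assms] by auto
  qed
  also have "\<dots> = 1\<^sub>m (N * N) $$ (c * N + d, a * N + b)"
  proof -
    have "c * N + d = a * N + b \<longleftrightarrow> a = c \<and> b = d"
      using mult_add_div[OF l(4), of c] mult_add_div[OF l(2), of a] by metis
    then show ?thesis using ll by auto
  qed
  finally show "(pmat N P NegX * pmat N P PosX) $$ (c * N + d, a * N + b) = 1\<^sub>m (N * N) $$ (c * N + d, a * N + b)" .
qed auto


text \<open>The first \<open>N\<close> labels span a submodule for the divided powers with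
  \<open>n < N\<close>, the only ones in the truncated R-matrix. The bound on \<open>n\<close>
  matters at roots of unity, where F^(r) sends v_0 to a nonzero multiple of v_r.\<close>

definition trunc :: "nat \<Rightarrow> 'a::comm_ring_1 par \<Rightarrow> bool" where
  "trunc N P \<longleftrightarrow> (\<forall>n j. n < N \<longrightarrow> j < N \<longrightarrow> N \<le> n + j \<longrightarrow> fcoef P n j = 0)"

text \<open>One matrix entry of the commutation with the coproduct of E. All terms vanish unless c +
  d + 1 = a + b and b \<le> c + 1; for b \<le> c the identity is \<open>fcoef_Suc\<close> times a
  common factor \<open>C\<close>.\<close>

lemma PosX_equivariant_core:
  assumes P: "valid (P :: 'a::comm_ring_1 par)" and tr: "trunc N P" and l: "a < N" "b < N" "c < N" "d < N"
  shows "(case b of 0 \<Rightarrow> 0 | Suc b' \<Rightarrow> pw P PosX [c, d] [a, b']) +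
      (case a of 0 \<Rightarrow> 0 | Suc a' \<Rightarrow> pw P PosX [c, d] [a', b]) * kdiag P Up b
    = (if Suc d < N then pw P PosX [c, Suc d] [a, b] else 0) +
      kdiag P Up d * (if Suc c < N then pw P PosX [Suc c, d] [a, b] else 0)"
proof -
  note Q_cancel[OF P, simp] A_cancel[OF P, simp]
  consider "Suc (c + d) \<noteq> a + b" | "Suc (c + d) = a + b" "Suc c < b" | "Suc (c + d) = a + b" "b = Suc c"
    | "Suc (c + d) = a + b" "b \<le> c" by linarith
  then show ?thesis
  proof cases
    case 1
    then show ?thesis by (cases a; cases b) auto
  next
    case 2
    then show ?thesis by (cases a; cases b) auto
  next
    \<comment> \<open>For b = c + 1 only the jump 0 contributes, once on each side, and necessarily
      a = d.\<close>
    case 3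
    then have ad: "a = d" by simp
    have "pA P * pQi P ^ a * (pT P * pAi P ^ (a + b) * pQ P ^ (a * b))
        = (pA P * pAi P) * (pQ P ^ a * pQi P ^ a) * (pT P * pAi P ^ (a + c) * pQ P ^ (a * c))"
      unfolding 3(2) by (simp add: power_add mult_ac)
    then have "kdiag P Up d * wpos P a b 0 = wpos P a c 0"
      using 3 ad P l by (simp add: wpos_def kdiag_def fcoef_0 A_inv)
    then show ?thesis using 3 ad l by (cases a) auto
  next
    case 4
    define n where "n = c - b"
    define a' where "a' = d + n"
    have e: "c = b + n" "a = Suc a'" "a' + b = c + d" using 4 by (auto simp: n_def a'_def)
    define C where "C = pT P * pAi P ^ (a' + b) * pQ P ^ (d * c)"
    have t1: "(case b of 0 \<Rightarrow> 0 | Suc b' \<Rightarrow> pw P PosX [c, d] [a, b'])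
        = C * (case b of 0 \<Rightarrow> 0 | Suc b' \<Rightarrow> fcoef P (Suc n) b')"
    proof (cases b)
      case (Suc b')
      have s: "c - b' = Suc n" "a - Suc n = d" "b' + Suc n = c" "a + b' = a' + b" "b' \<le> c" "c + d = a + b'"
        using Suc e a'_def by auto
      show ?thesis unfolding Suc nat.case pw.simps using s
        by (simp add: wpos_def C_def Suc[symmetric] del: add_Suc_right)
    qed simp
    have t2: "pw P PosX [c, d] [a', b] = C * fcoef P n b"
    proof -
      have s: "c - b = n" "a' - n = d" "b + n = c" "b \<le> c" "c + d = a' + b" using e a'_def by auto
      show ?thesis using s by (simp add: wpos_def C_def)
    qed
    have t3: "pw P PosX [c, Suc d] [a, b] = C * (pAi P * pQ P ^ c) * fcoef P n b"
    proof -
      have s: "c - b = n" "a - n = Suc d" "b + n = c" "b \<le> c" "c + Suc d = a + b" "a + b = Suc (a' + b)"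
        using e a'_def by auto
      show ?thesis unfolding pw.simps wpos_def s using s(4,5) by (simp add: C_def power_add mult_ac)
    qed
    have t4: "(if Suc c < N then pw P PosX [Suc c, d] [a, b] else 0)
        = C * (pAi P * pQ P ^ d) * fcoef P (Suc n) b"
    proof (cases "Suc c < N")
      case True
      have s: "Suc c - b = Suc n" "a - Suc n = d" "b + Suc n = Suc c" "b \<le> Suc c" "Suc c + d = a + b" "a + b = Suc (a' + b)"
        using e a'_def by auto
      show ?thesis unfolding pw.simps wpos_def s using s(4,5) True by (simp add: C_def power_add mult_ac)
    next
      case False
      \<comment> \<open>The label \<open>Suc c\<close>, which is b + n + 1, has left the module;
        since n + 1 \<le> a < N, the restricted condition \<open>trunc\<close> still applies to the
        jump \<open>Suc n\<close>.\<close>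
      then have "N \<le> Suc n + b" "Suc n < N" using l e a'_def by simp_all
      then have "fcoef P (Suc n) b = 0" using tr l unfolding trunc_def by blast
      then show ?thesis using False by simp
    qed
    have "Suc d < N" using e l a'_def by simp
    have kd: "kdiag P Up d * (C * (pAi P * pQ P ^ d) * x) = C * x" for x
    proof -
      have "kdiag P Up d * (C * (pAi P * pQ P ^ d) * x) = (pA P * pAi P) * (pQ P ^ d * pQi P ^ d) * (C * x)"
        by (simp only: kdiag_def orient.case mult_ac)
      then show ?thesis using A_inv[OF P] by simp
    qed
    have kb: "C * fcoef P n b * kdiag P Up b = C * (fcoef P n b * (pA P * pQi P ^ b))"
      by (simp add: kdiag_def mult_ac)
    have "fcoef P (Suc n) b - (case b of 0 \<Rightarrow> 0 | Suc b' \<Rightarrow> fcoef P (Suc n) b')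
        = fcoef P n b * (pA P * pQi P ^ b - pAi P * pQ P ^ c)"
      using fcoef_Suc[OF P, of n b] e by simp
    then have f: "(case b of 0 \<Rightarrow> 0 | Suc b' \<Rightarrow> fcoef P (Suc n) b') + fcoef P n b * (pA P * pQi P ^ b)
        = pAi P * pQ P ^ c * fcoef P n b + fcoef P (Suc n) b"
      by (simp add: algebra_simps)
    have "C * (case b of 0 \<Rightarrow> 0 | Suc b' \<Rightarrow> fcoef P (Suc n) b') + C * fcoef P n b * kdiag P Up b
        = C * (pAi P * pQ P ^ c * fcoef P n b) + C * fcoef P (Suc n) b"
      unfolding kb distrib_left[symmetric] f ..
    then show ?thesis
      unfolding t1 t4 kd using \<open>Suc d < N\<close> by (simp only: e(2) nat.case t2 t3[unfolded e(2)] if_True mult.assoc)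
  qed
qed

lemma if_one_mult: "(if b then 1 else 0) * x = (if b then x else (0::'a::comm_ring_1))"
  by simp

lemma power_two_nat: "(N::nat) ^ Suc (Suc 0) = N * N"
  by simp

lemma sum_shift_delta:
  fixes f :: "nat \<Rightarrow> 'a::comm_ring_1"
  shows "b < N \<Longrightarrow> (\<Sum>j<N. f j * (if b = Suc j then x else 0)) = (case b of 0 \<Rightarrow> 0 | Suc b' \<Rightarrow> f b' * x)"
    and "(\<Sum>j<N. (if j = Suc d then x else 0) * f j) = (if Suc d < N then x * f (Suc d) else 0)"
  by (cases b) (simp_all add: if_distrib if_distribR cong: if_cong)

lemma PosX_equivariant:
  assumes P: "valid (P :: 'a::comm_ring_1 par)" and tr: "trunc N P"
  shows "pmat N P PosX * Eact N P [Up, Up] = Eact N P [Up, Up] * pmat N P PosX"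
    and "pmat N P PosX * Kact N P [Up, Up] = Kact N P [Up, Up] * pmat N P PosX"
proof -
  show "pmat N P PosX * Eact N P [Up, Up] = Eact N P [Up, Up] * pmat N P PosX"
  proof (rule eq_mat_pairI[where N = N])
    fix a b c d assume l: "a < N" "b < N" "c < N" "d < N"
    have ll: "c * N + d < N * N" "a * N + b < N * N" using l mult_add_less by blast+
    have "(pmat N P PosX * Eact N P [Up, Up]) $$ (c * N + d, a * N + b)
        = (\<Sum>j<N. pw P PosX [c, d] [a, j] * (if b = Suc j then 1 else 0)) +
          (\<Sum>i<N. pw P PosX [c, d] [i, b] * (if a = Suc i then kdiag P Up b else 0))"
      using l ll by (subst mult_Eact_pair)
        (simp_all add: index_pmat_pair eent_def if_one_mult del: pw.simps cong: if_cong sum.cong_simp)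
    also have "\<dots> = (if Suc d < N then pw P PosX [c, Suc d] [a, b] else 0) +
      kdiag P Up d * (if Suc c < N then pw P PosX [Suc c, d] [a, b] else 0)"
      unfolding sum_shift_delta(1)[OF l(2)] sum_shift_delta(1)[OF l(1)]
      using PosX_equivariant_core[OF P tr l] by (cases a; cases b) (simp_all del: pw.simps)
    also have "\<dots> = (\<Sum>j<N. (if j = Suc d then 1 else 0) * pw P PosX [c, j] [a, b]) +
          (\<Sum>i<N. (if i = Suc c then kdiag P Up d else 0) * pw P PosX [i, d] [a, b])"
      unfolding sum_shift_delta(2) by (simp del: pw.simps)
    also have "\<dots> = (Eact N P [Up, Up] * pmat N P PosX) $$ (c * N + d, a * N + b)"
      using l ll by (subst Eact_pair_mult)
        (simp_all add: index_pmat_pair eent_def if_one_mult del: pw.simps cong: if_cong sum.cong_simp)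
    finally show "(pmat N P PosX * Eact N P [Up, Up]) $$ (c * N + d, a * N + b)
        = (Eact N P [Up, Up] * pmat N P PosX) $$ (c * N + d, a * N + b)" .
  qed auto
  show "pmat N P PosX * Kact N P [Up, Up] = Kact N P [Up, Up] * pmat N P PosX"
  proof (rule eq_mat_pairI[where N = N])
    fix a b c d assume l: "a < N" "b < N" "c < N" "d < N"
    have ll: "c * N + d < N * N" "a * N + b < N * N" using l mult_add_less by blast+
    have "pw P PosX [c, d] [a, b] * (kdiag P Up a * kdiag P Up b)
      = kdiag P Up c * kdiag P Up d * pw P PosX [c, d] [a, b]"
    proof (cases "c + d = a + b")
      case True
      have "kdiag P Up x * kdiag P Up y = pA P * pA P * pQi P ^ (x + y)" for x y
        by (simp add: kdiag_def power_add mult_ac)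
      then show ?thesis using True by (simp add: mult_ac)
    qed simp
    then show "(pmat N P PosX * Kact N P [Up, Up]) $$ (c * N + d, a * N + b)
        = (Kact N P [Up, Up] * pmat N P PosX) $$ (c * N + d, a * N + b)"
      using l ll by (simp add: mult_Kact_pair Kact_pair_mult index_pmat_pair del: pw.simps index_mult_mat Kact.simps)
  qed auto
qed

lemma equivariant_inverse:
  fixes U V W :: "'a::comm_ring_1 mat"
  assumes "U \<in> carrier_mat n n" "V \<in> carrier_mat n n" "W \<in> carrier_mat n n"
    "U * V = 1\<^sub>m n" "V * U = 1\<^sub>m n" "U * W = W * U"
  shows "V * W = W * V"
proof -
  note c = assms(1-3)
  have "V * W = V * W * (U * V)" using assms by simp
  also have "\<dots> = V * W * U * V"
    by (rule assoc_mult_mat[symmetric, of _ n n _ n _ n]) (use c in auto)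
  also have "V * W * U = V * (W * U)"
    by (rule assoc_mult_mat[of _ n n _ n _ n]) (use c in auto)
  also have "\<dots> = V * U * W" unfolding assms(6)[symmetric]
    by (rule assoc_mult_mat[symmetric, of _ n n _ n _ n]) (use c in auto)
  also have "\<dots> = W" using assms by simp
  finally show ?thesis .
qed

lemma NegX_equivariant:
  assumes P: "valid (P :: 'a::comm_ring_1 par)" and tr: "trunc N P"
  shows "pmat N P NegX * Eact N P [Up, Up] = Eact N P [Up, Up] * pmat N P NegX"
    and "pmat N P NegX * Kact N P [Up, Up] = Kact N P [Up, Up] * pmat N P NegX"
proof -
  have dims: "pmat N P PosX \<in> carrier_mat (N * N) (N * N)" "pmat N P NegX \<in> carrier_mat (N * N) (N * N)"
    "Eact N P [Up, Up] \<in> carrier_mat (N * N) (N * N)" "Kact N P [Up, Up] \<in> carrier_mat (N * N) (N * N)"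
    by (rule carrier_matI; simp del: Eact.simps Kact.simps)+
  note inv = pmat_PosX_mult_NegX[OF P] pmat_NegX_mult_PosX[OF P]
  show "pmat N P NegX * Eact N P [Up, Up] = Eact N P [Up, Up] * pmat N P NegX"
    by (rule equivariant_inverse[OF dims(1,2,3) inv PosX_equivariant(1)[OF P tr]])
  show "pmat N P NegX * Kact N P [Up, Up] = Kact N P [Up, Up] * pmat N P NegX"
    by (rule equivariant_inverse[OF dims(1,2,4) inv PosX_equivariant(2)[OF P tr]])
qed

lemma index_Eact_Nil_mult:
  fixes M :: "'a::comm_ring_1 mat"
  shows "dim_row M = 1 \<Longrightarrow> Eact N P [] * M = 0\<^sub>m 1 (dim_col M)" "dim_row M = 1 \<Longrightarrow> Kact N P [] * M = M"
    "dim_col M = 1 \<Longrightarrow> M * Eact N P [] = 0\<^sub>m (dim_row M) 1" "dim_col M = 1 \<Longrightarrow> M * Kact N P [] = M"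
proof -
  have c: "dim_row M = 1 \<Longrightarrow> M \<in> carrier_mat 1 (dim_col M)" "dim_col M = 1 \<Longrightarrow> M \<in> carrier_mat (dim_row M) 1"
    by (rule carrier_matI; simp)+
  show "dim_row M = 1 \<Longrightarrow> Eact N P [] * M = 0\<^sub>m 1 (dim_col M)" "dim_row M = 1 \<Longrightarrow> Kact N P [] * M = M"
    "dim_col M = 1 \<Longrightarrow> M * Eact N P [] = 0\<^sub>m (dim_row M) 1" "dim_col M = 1 \<Longrightarrow> M * Kact N P [] = M"
    unfolding Eact.simps Kact.simps
    using left_mult_zero_mat[OF c(1)] left_mult_one_mat[OF c(1)]
      right_mult_zero_mat[OF c(2)] right_mult_one_mat[OF c(2)] by blast+
qed

lemma eq_row_pairI:
  fixes M M' :: "'a mat"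
  assumes "dim_row M = 1" "dim_row M' = 1" "dim_col M = N * N" "dim_col M' = N * N"
    "\<And>a b. a < N \<Longrightarrow> b < N \<Longrightarrow> M $$ (0, a * N + b) = M' $$ (0, a * N + b)"
  shows "M = M'"
proof (rule eq_matI)
  fix i j assume "i < dim_row M'" "j < dim_col M'"
  then have ij: "i = 0" "j < N * N" using assms by auto
  show "M $$ (i, j) = M' $$ (i, j)"
    using assms(5)[OF div_mod_less(1,2)[OF ij(2)]] ij(1) by simp
qed (use assms in auto)

lemma eq_col_pairI:
  fixes M M' :: "'a mat"
  assumes "dim_col M = 1" "dim_col M' = 1" "dim_row M = N * N" "dim_row M' = N * N"
    "\<And>a b. a < N \<Longrightarrow> b < N \<Longrightarrow> M $$ (a * N + b, 0) = M' $$ (a * N + b, 0)"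
  shows "M = M'"
proof (rule eq_matI)
  fix i j assume "i < dim_row M'" "j < dim_col M'"
  then have ij: "j = 0" "i < N * N" using assms by auto
  show "M $$ (i, j) = M' $$ (i, j)"
    using assms(5)[OF div_mod_less(1,2)[OF ij(2)]] ij(1) by simp
qed (use assms in auto)

lemma sum_delta_eq:
  fixes f :: "nat \<Rightarrow> 'a::comm_ring_1"
  shows "a < N \<Longrightarrow> (\<Sum>j<N. (if a = j then f j else 0) * g j) = f a * g a"
    "a < N \<Longrightarrow> (\<Sum>j<N. (if j = a then f j else 0) * g j) = f a * g a"
    "a < N \<Longrightarrow> (\<Sum>j<N. g j * (if a = j then f j else 0)) = g a * f a"
    "a < N \<Longrightarrow> (\<Sum>j<N. g j * (if j = a then f j else 0)) = g a * f a"
  by (simp_all add: if_distrib if_distribR cong: if_cong)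

text \<open>A cap must be annihilated by E, whose counit is 0. The coproduct gives two terms
  supported on neighbouring labels, and the sign in the dual action makes them cancel; for
  \<open>CapUD\<close> the pivot supplies the matching power of Q.\<close>

lemma cap_equivariant:
  assumes P: "valid (P :: 'a::comm_ring_1 par)" and G: "G = CapUD \<or> G = CapDU"
  shows "pmat N P G * Eact N P (src G) = Eact N P [] * pmat N P G"
    and "pmat N P G * Kact N P (src G) = Kact N P [] * pmat N P G"
proof -
  note Q_cancel[OF P, simp] A_cancel[OF P, simp] Q_inv[OF P, simp] A_inv[OF P, simp]
  have dimG: "dim_row (pmat N P G) = 1" "dim_col (pmat N P G) = N * N" using G by auto
  have cancel: "pAi P * pQ P ^ x * (pA P * pQi P ^ x) = 1" "pA P * pQi P ^ x * (pAi P * pQ P ^ x) = 1" for x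
  proof -
    have "pA P * pQi P ^ x * (pAi P * pQ P ^ x) = (pA P * pAi P) * (pQ P ^ x * pQi P ^ x)" by (simp only: mult_ac)
    then show "pA P * pQi P ^ x * (pAi P * pQ P ^ x) = 1" by simp
    then show "pAi P * pQ P ^ x * (pA P * pQi P ^ x) = 1" by (simp only: mult.commute)
  qed
  have cancelS: "pAi P * (pQ P * pQ P ^ x) * (pA P * (pQi P * pQi P ^ x)) = 1" for x
    using cancel(1)[of "Suc x"] by simp
  have QQ: "pQi P ^ x * pQ P ^ x = 1" for x by (subst mult.commute) simp
  show "pmat N P G * Eact N P (src G) = Eact N P [] * pmat N P G"
  proof (rule eq_row_pairI[where N = N])
    fix a b assume l: "a < N" "b < N"
    have ll: "a * N + b < N * N" using l mult_add_less by blast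
    have *: "(pmat N P G * Eact N P (src G)) $$ (0, a * N + b) = 0" using G
    proof
      assume G: "G = CapUD"
      have 1: "(\<Sum>j<N. pmat N P CapUD $$ (0, a * N + j) * eent P Down j b)
          = (if a = Suc b then - (pG P * pQi P ^ a * (pAi P * pQ P ^ a)) else 0)"
      proof -
        have "(\<Sum>j<N. pmat N P CapUD $$ (0, a * N + j) * eent P Down j b)
          = (\<Sum>j<N. (if a = j then pG P * pQi P ^ a else 0) * eent P Down j b)"
          using l by (intro sum.cong) (auto simp: index_pmat_pair)
        also have "\<dots> = pG P * pQi P ^ a * eent P Down a b" by (rule sum_delta_eq(1)[OF l(1)])
        finally show ?thesis by (simp add: eent_def)
      qed
      have 2: "(\<Sum>i<N. pmat N P CapUD $$ (0, i * N + b) * (eent P Up i a * kdiag P Down b))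
         = (if a = Suc b then pG P * pQi P ^ b * (pAi P * pQ P ^ b) else 0)"
      proof -
        have "(\<Sum>i<N. pmat N P CapUD $$ (0, i * N + b) * (eent P Up i a * kdiag P Down b))
          = (\<Sum>i<N. (if i = b then pG P * pQi P ^ i else 0) * (eent P Up i a * kdiag P Down b))"
          using l by (intro sum.cong) (auto simp: index_pmat_pair)
        also have "\<dots> = pG P * pQi P ^ b * (eent P Up b a * kdiag P Down b)"
          by (rule sum_delta_eq(2)[OF l(2)])
        finally show ?thesis by (simp add: eent_def kdiag_def)
      qed
      have e: "pG P * pQi P ^ x * (pAi P * pQ P ^ x) = pG P * pAi P" for x
      proof -
        have "pG P * pQi P ^ x * (pAi P * pQ P ^ x) = (pQ P ^ x * pQi P ^ x) * (pG P * pAi P)"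
          by (simp only: mult_ac)
        then show ?thesis by simp
      qed
      show ?thesis unfolding G src.simps
        using l by (subst mult_Eact_pair) (simp_all add: 1 2 e power_two_nat del: power_Suc)
    next
      assume G: "G = CapDU"
      have 1: "(\<Sum>j<N. pmat N P CapDU $$ (0, a * N + j) * eent P Up j b) = (if b = Suc a then 1 else 0)"
      proof -
        have "(\<Sum>j<N. pmat N P CapDU $$ (0, a * N + j) * eent P Up j b)
          = (\<Sum>j<N. (if a = j then 1 else 0) * eent P Up j b)"
          using l by (intro sum.cong) (auto simp: index_pmat_pair)
        also have "\<dots> = 1 * eent P Up a b" by (rule sum_delta_eq(1)[OF l(1)])
        finally show ?thesis by (simp add: eent_def)
      qed
      have 2: "(\<Sum>i<N. pmat N P CapDU $$ (0, i * N + b) * (eent P Down i a * kdiag P Up b))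
         = (if b = Suc a then - 1 else 0)"
      proof -
        have "(\<Sum>i<N. pmat N P CapDU $$ (0, i * N + b) * (eent P Down i a * kdiag P Up b))
          = (\<Sum>i<N. (if i = b then 1 else 0) * (eent P Down i a * kdiag P Up b))"
          using l by (intro sum.cong) (auto simp: index_pmat_pair)
        also have "\<dots> = 1 * (eent P Down b a * kdiag P Up b)"
          by (rule sum_delta_eq(2)[OF l(2)])
        finally show ?thesis using cancel(1) by (simp add: eent_def kdiag_def del: power_Suc)
      qed
      show ?thesis unfolding G src.simps
        using l by (subst mult_Eact_pair) (simp_all add: 1 2 power_two_nat del: power_Suc)
    qed
    show "(pmat N P G * Eact N P (src G)) $$ (0, a * N + b) = (Eact N P [] * pmat N P G) $$ (0, a * N + b)"
      unfolding * using dimG ll by (simp add: index_Eact_Nil_mult del: Eact.simps)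
  qed (use G in auto)
  show "pmat N P G * Kact N P (src G) = Kact N P [] * pmat N P G"
    unfolding index_Eact_Nil_mult(2)[OF dimG(1)]
  proof (rule eq_row_pairI[where N = N])
    fix a b assume l: "a < N" "b < N"
    show "(pmat N P G * Kact N P (src G)) $$ (0, a * N + b) = pmat N P G $$ (0, a * N + b)"
      using G
    proof
      assume G: "G = CapUD"
      show ?thesis unfolding G src.simps using l
        by (subst mult_Kact_pair) (auto simp: index_pmat_pair kdiag_def cancel)
    next
      assume G: "G = CapDU"
      show ?thesis unfolding G src.simps using l
        by (subst mult_Kact_pair) (auto simp: index_pmat_pair kdiag_def cancel)
    qed
  qed (use G in auto)
qed

lemma cup_equivariant:
  assumes P: "valid (P :: 'a::comm_ring_1 par)" and G: "G = CupUD \<or> G = CupDU"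
  shows "pmat N P G * Eact N P [] = Eact N P (tgt G) * pmat N P G"
    and "pmat N P G * Kact N P [] = Kact N P (tgt G) * pmat N P G"
proof -
  note Q_cancel[OF P, simp] A_cancel[OF P, simp] Q_inv[OF P, simp] A_inv[OF P, simp]
  have dimG: "dim_col (pmat N P G) = 1" "dim_row (pmat N P G) = N * N" using G by auto
  have cancel: "pAi P * pQ P ^ x * (pA P * pQi P ^ x) = 1" "pA P * pQi P ^ x * (pAi P * pQ P ^ x) = 1" for x
  proof -
    have "pA P * pQi P ^ x * (pAi P * pQ P ^ x) = (pA P * pAi P) * (pQ P ^ x * pQi P ^ x)" by (simp only: mult_ac)
    then show "pA P * pQi P ^ x * (pAi P * pQ P ^ x) = 1" by simp
    then show "pAi P * pQ P ^ x * (pA P * pQi P ^ x) = 1" by (simp only: mult.commute)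
  qed
  show "pmat N P G * Eact N P [] = Eact N P (tgt G) * pmat N P G"
  proof (rule eq_col_pairI[where N = N])
    fix c d assume l: "c < N" "d < N"
    have ll: "c * N + d < N * N" using l mult_add_less by blast
    have *: "(Eact N P (tgt G) * pmat N P G) $$ (c * N + d, 0) = 0" using G
    proof
      assume G: "G = CupUD"
      have 1: "(\<Sum>j<N. eent P Down d j * pmat N P CupUD $$ (c * N + j, 0)) = (if d = Suc c then - (pAi P * pQ P ^ d) else 0)"
      proof -
        have "(\<Sum>j<N. eent P Down d j * pmat N P CupUD $$ (c * N + j, 0))
          = (\<Sum>j<N. eent P Down d j * (if c = j then 1 else 0))"
          using l by (intro sum.cong) (auto simp: index_pmat_pair)
        also have "\<dots> = eent P Down d c * 1" by (rule sum_delta_eq(3)[OF l(1)])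
        finally show ?thesis by (simp add: eent_def)
      qed
      have 2: "(\<Sum>i<N. (eent P Up c i * kdiag P Down d) * pmat N P CupUD $$ (i * N + d, 0))
         = (if d = Suc c then pAi P * pQ P ^ d else 0)"
      proof -
        have "(\<Sum>i<N. (eent P Up c i * kdiag P Down d) * pmat N P CupUD $$ (i * N + d, 0))
          = (\<Sum>i<N. (eent P Up c i * kdiag P Down d) * (if i = d then 1 else 0))"
          using l by (intro sum.cong) (auto simp: index_pmat_pair)
        also have "\<dots> = (eent P Up c d * kdiag P Down d) * 1"
          by (rule sum_delta_eq(4)[OF l(2)])
        finally show ?thesis by (simp add: eent_def kdiag_def)
      qed
      show ?thesis unfolding G tgt.simps
        using l by (subst Eact_pair_mult) (simp_all add: 1 2 power_two_nat del: power_Suc)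
    next
      assume G: "G = CupDU"
      have 1: "(\<Sum>j<N. eent P Up d j * pmat N P CupDU $$ (c * N + j, 0)) = (if c = Suc d then pGi P * pQ P ^ c else 0)"
      proof -
        have "(\<Sum>j<N. eent P Up d j * pmat N P CupDU $$ (c * N + j, 0))
          = (\<Sum>j<N. eent P Up d j * (if c = j then pGi P * pQ P ^ c else 0))"
          using l by (intro sum.cong) (auto simp: index_pmat_pair)
        also have "\<dots> = eent P Up d c * (pGi P * pQ P ^ c)" by (rule sum_delta_eq(3)[OF l(1)])
        finally show ?thesis by (simp add: eent_def)
      qed
      have 2: "(\<Sum>i<N. (eent P Down c i * kdiag P Up d) * pmat N P CupDU $$ (i * N + d, 0))
         = (if c = Suc d then - (pAi P * pQ P ^ c * (pA P * pQi P ^ d)) * (pGi P * pQ P ^ d) else 0)"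
      proof -
        have "(\<Sum>i<N. (eent P Down c i * kdiag P Up d) * pmat N P CupDU $$ (i * N + d, 0))
          = (\<Sum>i<N. (eent P Down c i * kdiag P Up d) * (if i = d then pGi P * pQ P ^ i else 0))"
          using l by (intro sum.cong) (auto simp: index_pmat_pair)
        also have "\<dots> = (eent P Down c d * kdiag P Up d) * (pGi P * pQ P ^ d)"
          by (rule sum_delta_eq(4)[OF l(2)])
        finally show ?thesis by (simp add: eent_def kdiag_def)
      qed
      have 3: "(pAi P * pQ P ^ Suc d * (pA P * pQi P ^ d)) * (pGi P * pQ P ^ d) = pGi P * pQ P ^ Suc d"
      proof -
        have "(pAi P * pQ P ^ Suc d * (pA P * pQi P ^ d)) * (pGi P * pQ P ^ d)
           = (pA P * pAi P) * (pQ P ^ d * pQi P ^ d) * (pGi P * pQ P ^ Suc d)"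
          by (simp only: mult_ac)
        then show ?thesis by simp
      qed
      show ?thesis unfolding G tgt.simps
        using l by (subst Eact_pair_mult) (simp_all add: 1 2 3 power_two_nat del: power_Suc)
    qed
    show "(pmat N P G * Eact N P []) $$ (c * N + d, 0) = (Eact N P (tgt G) * pmat N P G) $$ (c * N + d, 0)"
      unfolding * using dimG ll by (simp add: index_Eact_Nil_mult del: Eact.simps)
  qed (use G in auto)
  show "pmat N P G * Kact N P [] = Kact N P (tgt G) * pmat N P G"
    unfolding index_Eact_Nil_mult(4)[OF dimG(1)]
  proof (rule eq_col_pairI[where N = N])
    fix c d assume l: "c < N" "d < N"
    show "pmat N P G $$ (c * N + d, 0) = (Kact N P (tgt G) * pmat N P G) $$ (c * N + d, 0)"
      using G
    proof
      assume G: "G = CupUD"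
      show ?thesis unfolding G tgt.simps using l
        by (subst Kact_pair_mult) (auto simp: index_pmat_pair kdiag_def cancel)
    next
      assume G: "G = CupDU"
      show ?thesis unfolding G tgt.simps using l
        by (subst Kact_pair_mult) (auto simp: index_pmat_pair kdiag_def cancel)
    qed
  qed (use G in auto)
qed

lemma mat_mult_add:
  fixes A B C :: "'a::comm_ring_1 mat"
  assumes "dim_row B = dim_row C" "dim_col B = dim_col C"
  shows "dim_col A = dim_row B \<Longrightarrow> A * (B + C) = A * B + A * C"
    and "dim_row A = dim_col B \<Longrightarrow> (B + C) * A = B * A + C * A"
  by (rule mult_add_distrib_mat add_mult_distrib_mat; rule carrier_matI; use assms in simp; fail)+

lemma mat_mult_one:
  fixes A :: "'a::comm_ring_1 mat"
  shows "dim_row A = n \<Longrightarrow> 1\<^sub>m n * A = A" "dim_col A = n \<Longrightarrow> A * 1\<^sub>m n = A"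
  by (rule left_mult_one_mat right_mult_one_mat; rule carrier_matI; simp)+

lemma mat_mult_assoc:
  fixes A B C :: "'a::comm_ring_1 mat"
  assumes "dim_col A = dim_row B" "dim_col B = dim_row C"
  shows "A * B * C = A * (B * C)"
  by (rule assoc_mult_mat[of _ "dim_row A" "dim_row B" _ "dim_row C" _ "dim_col C"]; rule carrier_matI; use assms in simp)

lemma piece_equivariant:
  assumes "valid (P :: 'a::comm_ring_1 par)" "trunc N P"
  shows "pmat N P G * Eact N P (src G) = Eact N P (tgt G) * pmat N P G"
    and "pmat N P G * Kact N P (src G) = Kact N P (tgt G) * pmat N P G"
  using assms PosX_equivariant[of P N] NegX_equivariant[of P N] cap_equivariant[of P G N] cup_equivariant[of P G N]
  by (cases G; simp del: Eact.simps Kact.simps)+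

section \<open>Whole diagrams: equivariance, state sums as matrix entries, scalars\<close>

definition zslice :: "nat \<Rightarrow> 'a::comm_ring_1 par \<Rightarrow> slice \<Rightarrow> 'a mat" where
  "zslice N P = (\<lambda>(u, G, w). kron (1\<^sub>m (N ^ length u)) (kron (pmat N P G) (1\<^sub>m (N ^ length w))))"

lemma dim_zslice [simp]:
  "dim_row (zslice N P (u, G, w)) = N ^ length (u @ tgt G @ w)"
  "dim_col (zslice N P (u, G, w)) = N ^ length (u @ src G @ w)"
  by (simp_all add: zslice_def power_add mult.assoc)

lemma zslice_equivariant:
  assumes "valid (P :: 'a::comm_ring_1 par)" "trunc N P"
  shows "zslice N P (u, G, w) * Eact N P (u @ src G @ w) = Eact N P (u @ tgt G @ w) * zslice N P (u, G, w)"
    and "zslice N P (u, G, w) * Kact N P (u @ src G @ w) = Kact N P (u @ tgt G @ w) * zslice N P (u, G, w)"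
proof -
  note e = piece_equivariant[OF assms, of G]
  note s = zslice_def prod.case Eact_append Kact_append
  show "zslice N P (u, G, w) * Eact N P (u @ src G @ w) = Eact N P (u @ tgt G @ w) * zslice N P (u, G, w)"
    unfolding s by (simp add: mat_mult_add kron_add kron_mult mat_mult_one e)
  show "zslice N P (u, G, w) * Kact N P (u @ src G @ w) = Kact N P (u @ tgt G @ w) * zslice N P (u, G, w)"
    unfolding s by (simp add: kron_mult mat_mult_one e)
qed

lemma idx_inj: "x \<in> labels N k \<Longrightarrow> y \<in> labels N k \<Longrightarrow> idx N x = idx N y \<longleftrightarrow> x = y"
  by (metis digits_idx)

lemma index_zslice:
  assumes z: "z \<in> labels N (length (u @ tgt G @ w))" and x: "x \<in> labels N (length (u @ src G @ w))"
  shows "zslice N P (u, G, w) $$ (idx N z, idx N x) = sw P (u, G, w) z x"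
proof -
  obtain zu zm zw where z': "z = zu @ zm @ zw" "zu \<in> labels N (length u)"
      "zm \<in> labels N (length (tgt G))" "zw \<in> labels N (length w)"
    using z unfolding length_append labels_append by blast
  obtain xu xm xw where x': "x = xu @ xm @ xw" "xu \<in> labels N (length u)"
      "xm \<in> labels N (length (src G))" "xw \<in> labels N (length w)"
    using x unfolding length_append labels_append by blast
  note l = z'(2-4)[THEN labels_length] x'(2-4)[THEN labels_length]
  note i = z'(2-4)[THEN idx_less] x'(2-4)[THEN idx_less]
  have iz: "idx N z = idx N zu * (N ^ length (tgt G) * N ^ length w) + (idx N zm * N ^ length w + idx N zw)"
    unfolding z' idx_append length_append l power_add ..
  have ix: "idx N x = idx N xu * (N ^ length (src G) * N ^ length w) + (idx N xm * N ^ length w + idx N xw)"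
    unfolding x' idx_append length_append l power_add ..
  have lz: "idx N zm * N ^ length w + idx N zw < N ^ length (tgt G) * N ^ length w"
    and lx: "idx N xm * N ^ length w + idx N xw < N ^ length (src G) * N ^ length w"
    using i mult_add_less by blast+
  have "zslice N P (u, G, w) $$ (idx N z, idx N x) =
    1\<^sub>m (N ^ length u) $$ (idx N zu, idx N xu) *
      (pmat N P G $$ (idx N zm, idx N xm) * 1\<^sub>m (N ^ length w) $$ (idx N zw, idx N xw))"
  proof -
    have "idx N z < N ^ length u * (N ^ length (tgt G) * N ^ length w)"
      "idx N x < N ^ length u * (N ^ length (src G) * N ^ length w)"
      unfolding iz ix using i lz lx mult_add_less by blast+
    then have "zslice N P (u, G, w) $$ (idx N z, idx N x) =
      1\<^sub>m (N ^ length u) $$ (idx N zu, idx N xu) *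
      kron (pmat N P G) (1\<^sub>m (N ^ length w)) $$ (idx N zm * N ^ length w + idx N zw, idx N xm * N ^ length w + idx N xw)"
      unfolding zslice_def prod.case using lz lx
      by (subst index_kron) (simp_all add: iz ix mult_add_div)
    then show ?thesis using lz lx i by (subst (asm) index_kron) (simp_all add: mult_add_div)
  qed
  also have "\<dots> = (if zu = xu \<and> zw = xw then pw P G zm xm else 0)"
    using i z' x' by (simp add: idx_inj[of zu N "length u"] idx_inj[of zw N "length w"] index_pmat)
  also have "\<dots> = sw P (u, G, w) z x"
    unfolding z' x' using l by simp
  finally show ?thesis .
qed

context
  fixes N :: nat and R g :: "'a::comm_ring_1 mat" and P :: "'a par"
  assumes rep: "\<And>G. piece_op N R g G = pmat N P G"
begin

lemma slice_op_eq: "slice_op N R g sl = zslice N P sl"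
  by (cases sl) (simp add: slice_op_def zslice_def rep kron_assoc)

lemma dim_rt_op:
  "tangle s D t \<Longrightarrow> dim_row (rt_op N R g s D) = N ^ length t"
  "tangle s D t \<Longrightarrow> dim_col (rt_op N R g s D) = N ^ length s"
  by (induction s D t rule: tangle.induct) (auto simp: slice_op_eq)

lemma rt_op_equivariant:
  assumes P: "valid P" "trunc N P"
  shows "tangle s D t \<Longrightarrow> rt_op N R g s D * Eact N P s = Eact N P t * rt_op N R g s D"
    and "tangle s D t \<Longrightarrow> rt_op N R g s D * Kact N P s = Kact N P t * rt_op N R g s D"
proof (induction D arbitrary: s)
  case Nil
  case 1 then show ?case by (simp add: mat_mult_one)
  case 2 then show ?case by (simp add: mat_mult_one)
next
  case (Cons sl D)
  obtain u G w where sl: "sl = (u, G, w)" by (cases sl)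
  {
    case 1
    then have s: "s = u @ src G @ w" and t: "tangle (u @ tgt G @ w) D t" by (auto simp: sl)
    define M where "M = rt_op N R g (u @ tgt G @ w) D"
    have d: "dim_row M = N ^ length t" "dim_col M = N ^ length (u @ tgt G @ w)"
      using dim_rt_op[OF t] by (auto simp: M_def)
    have "rt_op N R g s (sl # D) * Eact N P s = M * zslice N P (u, G, w) * Eact N P (u @ src G @ w)"
      by (simp add: sl slice_op_eq M_def s)
    also have "\<dots> = M * (zslice N P (u, G, w) * Eact N P (u @ src G @ w))"
      using d by (subst mat_mult_assoc) auto
    also have "\<dots> = (M * Eact N P (u @ tgt G @ w)) * zslice N P (u, G, w)"
      unfolding zslice_equivariant(1)[OF P] using d by (subst mat_mult_assoc) auto
    also have "M * Eact N P (u @ tgt G @ w) = Eact N P t * M"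
      unfolding M_def by (rule Cons.IH(1)[OF t])
    also have "Eact N P t * M * zslice N P (u, G, w) = Eact N P t * (M * zslice N P (u, G, w))"
      using d by (subst mat_mult_assoc) auto
    finally show ?case by (simp add: sl slice_op_eq M_def)
  next
    case 2
    then have s: "s = u @ src G @ w" and t: "tangle (u @ tgt G @ w) D t" by (auto simp: sl)
    define M where "M = rt_op N R g (u @ tgt G @ w) D"
    have d: "dim_row M = N ^ length t" "dim_col M = N ^ length (u @ tgt G @ w)"
      using dim_rt_op[OF t] by (auto simp: M_def)
    have "rt_op N R g s (sl # D) * Kact N P s = M * zslice N P (u, G, w) * Kact N P (u @ src G @ w)"
      by (simp add: sl slice_op_eq M_def s)
    also have "\<dots> = M * (zslice N P (u, G, w) * Kact N P (u @ src G @ w))"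
      using d by (subst mat_mult_assoc) auto
    also have "\<dots> = (M * Kact N P (u @ tgt G @ w)) * zslice N P (u, G, w)"
      unfolding zslice_equivariant(2)[OF P] using d by (subst mat_mult_assoc) auto
    also have "M * Kact N P (u @ tgt G @ w) = Kact N P t * M"
      unfolding M_def by (rule Cons.IH(2)[OF t])
    also have "Kact N P t * M * zslice N P (u, G, w) = Kact N P t * (M * zslice N P (u, G, w))"
      using d by (subst mat_mult_assoc) auto
    finally show ?case by (simp add: sl slice_op_eq M_def)
  }
qed

text \<open>This replaces the operator by a sum over labellings, the form in which truncation,
  specialization and factorization can be argued state by state.\<close>

lemma index_rt_op:
  "tangle s D t \<Longrightarrow> x \<in> labels N (length s) \<Longrightarrow> y \<in> labels N (length t) \<Longrightarrow>
   rt_op N R g s D $$ (idx N y, idx N x) = Zsum N P D x y"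
proof (induction D arbitrary: s x)
  case Nil
  then show ?case using idx_less[of x N] idx_less[of y N] by (auto simp: idx_inj)
next
  case (Cons sl D)
  obtain u G w where sl: "sl = (u, G, w)" by (cases sl)
  then have s: "s = u @ src G @ w" and t: "tangle (u @ tgt G @ w) D t" using Cons.prems by auto
  define M where "M = rt_op N R g (u @ tgt G @ w) D"
  have d: "dim_row M = N ^ length t" "dim_col M = N ^ length (u @ tgt G @ w)"
    using dim_rt_op[OF t] by (auto simp: M_def)
  have x: "x \<in> labels N (length (u @ src G @ w))" using Cons.prems s by simp
  have "rt_op N R g s (sl # D) $$ (idx N y, idx N x) = (M * zslice N P (u, G, w)) $$ (idx N y, idx N x)"
    by (simp add: sl slice_op_eq M_def)
  also have "\<dots> = (\<Sum>k<N ^ length (u @ tgt G @ w). M $$ (idx N y, k) * zslice N P (u, G, w) $$ (k, idx N x))"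
    using d idx_less[OF x] idx_less[OF Cons.prems(3)]
    by (simp add: scalar_prod_def atLeast0LessThan del: length_append)
  also have "\<dots> = (\<Sum>z\<in>labels N (length (u @ tgt G @ w)). M $$ (idx N y, idx N z) * zslice N P (u, G, w) $$ (idx N z, idx N x))"
    by (rule sum_labels)
  also have "\<dots> = (\<Sum>z\<in>labels N (length (u @ tgt G @ w)). sw P (u, G, w) z x * Zsum N P D z y)"
  proof (rule sum.cong[OF refl], goal_cases)
    case (1 z)
    show ?case unfolding index_zslice[OF 1 x] M_def Cons.IH[OF t 1 Cons.prems(3)] by (rule mult.commute)
  qed
  finally show ?case by (simp only: sl Zsum.simps)
qed

text \<open>Commuting with K, whose eigenvalues are separated, forces a diagonal matrix; commuting
  with the shift E makes neighbouring diagonal entries equal. Separation is expressed by the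
  cancellation property \<open>k\<close>, since the coefficient ring may have zero divisors.\<close>

lemma rt_op_scalar:
  assumes P: "valid P" "trunc N P" and N: "0 < N" and D: "tangle [Up] D [Up]"
    and k: "\<And>i j x. i < N \<Longrightarrow> j < N \<Longrightarrow> i \<noteq> j \<Longrightarrow> x * kdiag P Up i = x * kdiag P Up j \<Longrightarrow> x = 0"
  shows "rt_op N R g [Up] D = Zsum N P D [0] [0] \<cdot>\<^sub>m 1\<^sub>m N"
proof -
  define M where "M = rt_op N R g [Up] D"
  have d: "dim_row M = N" "dim_col M = N" using dim_rt_op[OF D] by (auto simp: M_def)
  have E: "M * Emat N P Up = Emat N P Up * M" and K: "M * Kmat N P Up = Kmat N P Up * M"
    using rt_op_equivariant[OF P D] unfolding act_single M_def by auto
  have off: "M $$ (i, j) = 0" if ij: "i < N" "j < N" "i \<noteq> j" for i j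
  proof (rule k[OF ij])
    have "(M * Kmat N P Up) $$ (i, j) = M $$ (i, j) * kdiag P Up j"
      using d ij by (simp add: scalar_prod_def if_distrib cong: if_cong)
    moreover have "(Kmat N P Up * M) $$ (i, j) = kdiag P Up i * M $$ (i, j)"
      using d ij by (simp add: scalar_prod_def if_distrib if_distribR cong: if_cong)
    ultimately show "M $$ (i, j) * kdiag P Up i = M $$ (i, j) * kdiag P Up j"
      using K by (simp add: mult.commute)
  qed
  have diag: "M $$ (i, i) = M $$ (0, 0)" if "i < N" for i
    using that
  proof (induction i)
    case (Suc i)
    have "(M * Emat N P Up) $$ (i, Suc i) = (\<Sum>j<N. M $$ (i, j) * (if Suc i = Suc j then 1 else 0))"
      using d Suc.prems by (simp add: scalar_prod_def eent_def atLeast0LessThan)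
    also have "\<dots> = M $$ (i, i)"
      using sum_shift_delta(1)[of "Suc i" N "\<lambda>j. M $$ (i, j)" 1] Suc.prems by simp
    finally have 1: "(M * Emat N P Up) $$ (i, Suc i) = M $$ (i, i)" .
    have "(Emat N P Up * M) $$ (i, Suc i) = (\<Sum>j<N. (if j = Suc i then 1 else 0) * M $$ (j, Suc i))"
      using d Suc.prems by (simp add: scalar_prod_def eent_def atLeast0LessThan)
    also have "\<dots> = M $$ (Suc i, Suc i)"
      using sum_shift_delta(2)[where N = N and d = i and f = "\<lambda>j. M $$ (j, Suc i)" and x = 1] Suc.prems by simp
    finally show ?case using 1 E Suc by simp
  qed simp
  have "M $$ (0, 0) = Zsum N P D [0] [0]"
    using index_rt_op[OF D, of "[0]" "[0]"] N by (simp add: M_def)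
  then show ?thesis unfolding M_def[symmetric] using d off diag
    by (intro eq_matI) auto
qed

end

subsection \<open>The factor of a diagram with vanishing writhe\<close>

fun normT :: "'a::comm_ring_1 par \<Rightarrow> 'a par" where
  "normT (Par Q Qi A Ai G Gi T Ti) = Par Q Qi A Ai G Gi 1 1"

definition tfac :: "'a::comm_ring_1 par \<Rightarrow> slice \<Rightarrow> 'a" where
  "tfac P = (\<lambda>(u, G, w). case G of PosX \<Rightarrow> pT P | NegX \<Rightarrow> pTi P | _ \<Rightarrow> 1)"

lemma sw_normT: "sw P sl z x = tfac P sl * sw (normT P) sl z x"
proof -
  have "pw P G z x = tfac P (u, G, w) * pw (normT P) G z x" for u G w z x
    by (cases P, cases "(P, G, z, x)" rule: pw.cases)
       (simp_all add: tfac_def wpos_def wneg_def gcoef_def fcoef_def mult_ac)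
  then show ?thesis by (cases sl) simp
qed

text \<open>Every state contains \<open>pT\<close> once for each positive crossing and
  \<open>pTi\<close> once for each negative one, so the total exponent is the writhe. Here the
  framing hypothesis enters, and q^(\<alpha>^2/2) disappears.\<close>

lemma Zsum_normT:
  assumes "valid P" "writhe D = 0"
  shows "Zsum N P D x y = Zsum N (normT P) D x y"
proof -
  have Z: "Zsum N P D x y = prod_list (map (tfac P) D) * Zsum N (normT P) D x y" for D x y
  proof (induction D arbitrary: x)
    case (Cons sl D)
    obtain u G w where sl: "sl = (u, G, w)" by (cases sl)
    show ?case unfolding sl Zsum.simps sum_distrib_left
      by (rule sum.cong) (simp_all add: Cons sw_normT[of P] mult_ac del: sw.simps)
  qed simp
  have "\<exists>a b. writhe D = int a - int b \<and> prod_list (map (tfac P) D) = pT P ^ a * pTi P ^ b"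
  proof (induction D)
    case Nil
    then show ?case by (auto simp: writhe_def intro: exI[of _ 0])
  next
    case (Cons sl D)
    obtain u G w where sl: "sl = (u, G, w)" by (cases sl)
    from Cons obtain a b where ab: "writhe D = int a - int b"
      "prod_list (map (tfac P) D) = pT P ^ a * pTi P ^ b" by blast
    have w: "writhe (sl # D) = piece_sign G + writhe D" by (simp add: writhe_def sl)
    consider "G = PosX" | "G = NegX" | "piece_sign G = 0 \<and> tfac P sl = 1"
      by (cases G) (auto simp: sl tfac_def)
    then show ?case
    proof cases
      case 1
      then show ?thesis using ab w by (intro exI[of _ "Suc a"] exI[of _ b]) (simp add: sl tfac_def mult_ac)
    next
      case 2
      then show ?thesis using ab w by (intro exI[of _ a] exI[of _ "Suc b"]) (simp add: sl tfac_def mult_ac)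
    next
      case 3
      then show ?thesis using ab w by (intro exI[of _ a] exI[of _ b]) simp
    qed
  qed
  then obtain a where "prod_list (map (tfac P) D) = pT P ^ a * pTi P ^ a" using assms(2) by auto
  then have "prod_list (map (tfac P) D) = 1"
    using T_inv[OF assms(1)] by (simp add: power_mult_distrib[symmetric])
  then show ?thesis using Z by simp
qed

section \<open>States and strands\<close>

fun paths :: "nat \<Rightarrow> slice list \<Rightarrow> nat list list set" where
  "paths N [] = {[]}"
| "paths N ((u, G, w) # D) = (\<lambda>(z, ps). z # ps) ` (labels N (length (u @ tgt G @ w)) \<times> paths N D)"

fun pwt :: "'a::comm_ring_1 par \<Rightarrow> slice list \<Rightarrow> nat list \<Rightarrow> nat list \<Rightarrow> nat list list \<Rightarrow> 'a" where
  "pwt P [] x y [] = (if x = y then 1 else 0)"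
| "pwt P (sl # D) x y (z # ps) = sw P sl z x * pwt P D z y ps"
| "pwt P _ x y _ = 0"

lemma finite_paths [simp]: "finite (paths N D)"
  by (induction N D rule: paths.induct) auto

lemma Zsum_paths: "Zsum N P D x y = (\<Sum>ps\<in>paths N D. pwt P D x y ps)"
proof (induction D arbitrary: x)
  case (Cons sl D)
  obtain u G w where sl: "sl = (u, G, w)" by (cases sl)
  have "(\<Sum>ps\<in>paths N (sl # D). pwt P (sl # D) x y ps)
      = (\<Sum>(z, ps)\<in>labels N (length (u @ tgt G @ w)) \<times> paths N D. sw P sl z x * pwt P D z y ps)"
    unfolding sl paths.simps by (subst sum.reindex) (auto simp: inj_on_def case_prod_unfold)
  also have "\<dots> = (\<Sum>z\<in>labels N (length (u @ tgt G @ w)). sw P sl z x * Zsum N P D z y)"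
    by (simp add: sum.cartesian_product[symmetric] Cons sum_distrib_left del: sw.simps)
  finally show ?case by (simp add: sl del: sw.simps)
qed simp

lemma paths_mono: "N \<le> M \<Longrightarrow> paths N D \<subseteq> paths M D"
proof (induction D)
  case (Cons sl D)
  obtain u G w where sl: "sl = (u, G, w)" by (cases sl)
  have "labels N k \<subseteq> labels M k" for k using Cons.prems by (auto simp: labels_def)
  then show ?case unfolding sl paths.simps using Cons by (intro image_mono Sigma_mono) auto
qed simp

lemma paths_length: "ps \<in> paths N D \<Longrightarrow> length ps = length D"
  by (induction D arbitrary: ps) auto

lemma paths_nth:
  "ps \<in> paths N D \<Longrightarrow> l < length D \<Longrightarrow> D ! l = (u, G, w) \<Longrightarrow> ps ! l \<in> labels N (length (u @ tgt G @ w))"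
  by (induction D arbitrary: ps l) (auto simp: nth_Cons split: nat.splits)

lemma in_paths:
  assumes "length ps = length D"
    and "\<And>l u G w. l < length D \<Longrightarrow> D ! l = (u, G, w) \<Longrightarrow> ps ! l \<in> labels N (length (u @ tgt G @ w))"
  shows "ps \<in> paths N D"
  using assms
proof (induction D arbitrary: ps)
  case (Cons sl D)
  obtain u G w where sl: "sl = (u, G, w)" by (cases sl)
  obtain z qs where ps: "ps = z # qs" using Cons.prems(1) by (cases ps) auto
  have "z \<in> labels N (length (u @ tgt G @ w))" using Cons.prems(2)[of 0 u G w] by (simp add: sl ps)
  moreover have "qs \<in> paths N D"
    using Cons.prems(1) Cons.prems(2)[of "Suc _"] by (intro Cons.IH) (auto simp: ps)
  ultimately show ?case by (auto simp: sl ps)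
qed simp

text \<open>Isolates one slice: if its weight vanishes or lies in an ideal, so does the weight of
  the whole state.\<close>

lemma pwt_factor:
  "l < length D \<Longrightarrow> length ps = length D \<Longrightarrow>
   \<exists>r. pwt P D x y ps = sw P (D ! l) ((x # ps) ! Suc l) ((x # ps) ! l) * r"
proof (induction D arbitrary: ps x l)
  case (Cons sl D)
  obtain z qs where ps: "ps = z # qs" using Cons.prems by (cases ps) auto
  show ?case
  proof (cases l)
    case 0
    then show ?thesis by (auto simp: ps simp del: sw.simps)
  next
    case (Suc l')
    then obtain r where "pwt P D z y qs = sw P (D ! l') ((z # qs) ! Suc l') ((z # qs) ! l') * r"
      using Cons.IH[of l' qs z] Cons.prems ps by auto
    then show ?thesis
      by (intro exI[of _ "sw P sl z x * r"]) (simp add: ps Suc mult_ac del: sw.simps)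
  qed
qed simp

lemma pwt_nonzero_sw:
  "pwt P D x y ps \<noteq> 0 \<Longrightarrow> l < length D \<Longrightarrow> length ps = length D \<Longrightarrow>
   sw P (D ! l) ((x # ps) ! Suc l) ((x # ps) ! l) \<noteq> 0"
  using pwt_factor[of l D ps P x y] by (auto simp del: sw.simps)

lemma tangle_width:
  "tangle s D t \<Longrightarrow> l < length D \<Longrightarrow> D ! l = (u, G, w) \<Longrightarrow> ps \<in> paths N D \<Longrightarrow> length x = length s \<Longrightarrow>
   length ((x # ps) ! l) = length (u @ src G @ w) \<and> length ((x # ps) ! Suc l) = length (u @ tgt G @ w)"
proof (induction D arbitrary: s x ps l)
  case (Cons sl D)
  obtain u' G' w' where sl: "sl = (u', G', w')" by (cases sl)
  obtain z qs where ps: "ps = z # qs" "z \<in> labels N (length (u' @ tgt G' @ w'))" "qs \<in> paths N D"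
    using Cons.prems(4) by (auto simp: sl)
  have z: "length z = length (u' @ tgt G' @ w')" using ps(2) by (rule labels_length)
  show ?case
  proof (cases l)
    case 0
    then show ?thesis using Cons.prems z by (auto simp: sl ps)
  next
    case (Suc l')
    have "tangle (u' @ tgt G' @ w') D t" using Cons.prems by (simp add: sl)
    then show ?thesis using Cons.IH[of "u' @ tgt G' @ w'" l' qs z] Cons.prems z ps Suc by auto
  qed
qed simp

lemma sw_nonzeroE:
  assumes "sw P (u, G, w) z x \<noteq> 0" "length x = length (u @ src G @ w)" "length z = length (u @ tgt G @ w)"
  obtains xu xm zm xw where "x = xu @ xm @ xw" "z = xu @ zm @ xw" "length xu = length u"
    "length xm = length (src G)" "length zm = length (tgt G)" "length xw = length w" "pw P G zm xm \<noteq> 0"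
proof -
  define xu xm xw where "xu = take (length u) x" and "xm = take (length (src G)) (drop (length u) x)"
    and "xw = drop (length u + length (src G)) x"
  define zm where "zm = take (length (tgt G)) (drop (length u) z)"
  have c: "take (length u) z = xu" "drop (length u + length (tgt G)) z = xw" "pw P G zm xm \<noteq> 0"
    using assms(1) by (auto simp: xu_def xm_def xw_def zm_def split: if_splits)
  have "x = xu @ xm @ xw" unfolding xu_def xm_def xw_def
    by (metis add.commute append_take_drop_id drop_drop)
  moreover have "z = xu @ zm @ xw" unfolding c(1,2)[symmetric] zm_def
    by (metis add.commute append_take_drop_id drop_drop)
  ultimately show ?thesis using that c(3) assms(2,3) by (auto simp: xu_def xm_def xw_def zm_def)
qed

fun is_crossing :: "piece \<Rightarrow> bool" where
  "is_crossing PosX = True" | "is_crossing NegX = True" | "is_crossing _ = False"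

text \<open>The indices are exchanged because the strand entering at the left leaves at the right:
  labels are compared along strands, not positions.\<close>

fun crossrel :: "(nat \<Rightarrow> nat \<Rightarrow> bool) \<Rightarrow> slice \<Rightarrow> nat list \<Rightarrow> nat list \<Rightarrow> bool" where
  "crossrel \<rho> (u, G, w) x z \<longleftrightarrow> (is_crossing G \<longrightarrow>
     \<rho> (x ! length u) (z ! Suc (length u)) \<and> \<rho> (x ! Suc (length u)) (z ! length u))"

lemma length_two: "length x = Suc (Suc 0) \<Longrightarrow> \<exists>a b. x = [a, b]"
  by (auto simp: length_Suc_conv)

lemma pw_crossing_nonzero:
  assumes "is_crossing G" "pw P G zm xm \<noteq> 0"
  obtains a b c d where "xm = [a, b]" "zm = [c, d]" "c + d = a + b"
    "G = PosX \<longrightarrow> b \<le> c \<and> wpos P a b (c - b) \<noteq> 0" "G = NegX \<longrightarrow> a \<le> d \<and> wneg P b a (d - a) \<noteq> 0"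
  using assms by (cases "(P, G, zm, xm)" rule: pw.cases) (auto split: if_splits)

lemma pw_noncrossing_nonzero:
  assumes "\<not> is_crossing G" "pw P G zm xm \<noteq> 0"
  obtains (cup) c where "xm = []" "zm = [c, c]" "G = CupUD \<or> G = CupDU"
    | (cap) c where "zm = []" "xm = [c, c]" "G = CapUD \<or> G = CapDU"
  using assms by (cases "(P, G, zm, xm)" rule: pw.cases) (auto split: if_splits)

lemma slice_arcs_rel:
  assumes sw: "sw P (u, G, w) z x \<noteq> 0" and len: "length x = length (u @ src G @ w)" "length z = length (u @ tgt G @ w)"
    and refl: "\<And>a. \<rho> a a" and cr: "crossrel \<rho> (u, G, w) x z"
    and lab: "\<And>p. p < length x \<Longrightarrow> lab (l, p) = x ! p" "\<And>p. p < length z \<Longrightarrow> lab (Suc l, p) = z ! p"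
    and arc: "(e, e') \<in> slice_arcs l (u, G, w)"
  shows "\<rho> (lab e) (lab e')"
proof -
  obtain xu xm zm xw where s: "x = xu @ xm @ xw" "z = xu @ zm @ xw" "length xu = length u"
    "length xm = length (src G)" "length zm = length (tgt G)" "length xw = length w" "pw P G zm xm \<noteq> 0"
    by (rule sw_nonzeroE[OF sw len])
  from arc consider p where "p < length u" "e = (l, p)" "e' = (Suc l, p)"
    | p where "p < length w" "e = (l, length u + length (src G) + p)" "e' = (Suc l, length u + length (tgt G) + p)"
    | "(e, e') \<in> piece_arcs l (length u) G" by auto
  then show ?thesis
  proof cases
    case 1
    then have "lab e = lab e'" using s by (simp add: lab nth_append)
    then show ?thesis using refl by simp
  next
    case 2
    have "lab e = xw ! p" using 2 s lab(1)[of "length u + length (src G) + p"] by (auto simp: nth_append)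
    moreover have "lab e' = xw ! p" using 2 s lab(2)[of "length u + length (tgt G) + p"] by (auto simp: nth_append)
    ultimately show ?thesis using refl by simp
  next
    case 3
    show ?thesis
    proof (cases "is_crossing G")
      case True
      then have l2: "length xm = 2" "length zm = 2" using s by (cases G; simp)+
      have "(e, e') = ((l, length u), (Suc l, Suc (length u))) \<or> (e, e') = ((l, Suc (length u)), (Suc l, length u))"
        using 3 True by (cases G) auto
      then show ?thesis using cr True l2 s lab(1)[of "length u"] lab(1)[of "Suc (length u)"]
          lab(2)[of "length u"] lab(2)[of "Suc (length u)"] by auto
    next
      case False
      consider (cup) c where "xm = []" "zm = [c, c]" "G = CupUD \<or> G = CupDU"
        | (cap) c where "zm = []" "xm = [c, c]" "G = CapUD \<or> G = CapDU"
        using pw_noncrossing_nonzero[OF False s(7)] by blast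
      then show ?thesis
      proof cases
        case (cup c)
        then have "lab (Suc l, length u) = c" "lab (Suc l, Suc (length u)) = c"
          using s lab(2)[of "length u"] lab(2)[of "Suc (length u)"] by (auto simp: nth_append)
        moreover have "(e, e') = ((Suc l, length u), (Suc l, Suc (length u)))" using 3 cup by auto
        ultimately show ?thesis using refl by simp
      next
        case (cap c)
        then have "lab (l, length u) = c" "lab (l, Suc (length u)) = c"
          using s lab(1)[of "length u"] lab(1)[of "Suc (length u)"] by (auto simp: nth_append)
        moreover have "(e, e') = ((l, length u), (l, Suc (length u)))" using 3 cap by auto
        ultimately show ?thesis using refl by simp
      qed
    qed
  qed
qed

definition lab_of :: "nat list \<Rightarrow> nat list list \<Rightarrow> nat \<times> nat \<Rightarrow> nat" where
  "lab_of x ps = (\<lambda>(l, p). (x # ps) ! l ! p)"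

text \<open>Vertical strands, cups and caps keep the label, so a reflexive relation has to be
  checked only across crossings. It is applied to jumps of bounded size and to lying on the same
  side of a threshold.\<close>

lemma arcs_rel:
  assumes D: "tangle s D t" and ps: "ps \<in> paths N D" and x: "length x = length s"
    and nz: "pwt P D x y ps \<noteq> 0" and refl: "\<And>a. \<rho> a a"
    and cr: "\<And>l. l < length D \<Longrightarrow> crossrel \<rho> (D ! l) ((x # ps) ! l) ((x # ps) ! Suc l)"
    and e: "(e, e') \<in> arcs D"
  shows "\<rho> (lab_of x ps e) (lab_of x ps e')"
proof -
  obtain l where l: "l < length D" "(e, e') \<in> slice_arcs l (D ! l)"
    using e unfolding arcs_def by auto
  obtain u G w where sl: "D ! l = (u, G, w)" by (cases "D ! l")
  note len = tangle_width[OF D l(1) sl ps x]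
  show ?thesis
  proof (rule slice_arcs_rel[where \<rho> = \<rho> and l = l])
    show "sw P (u, G, w) ((x # ps) ! Suc l) ((x # ps) ! l) \<noteq> 0"
      using pwt_nonzero_sw[OF nz l(1) paths_length[OF ps]] unfolding sl .
    show "length ((x # ps) ! l) = length (u @ src G @ w)" "length ((x # ps) ! Suc l) = length (u @ tgt G @ w)"
      using len by blast+
    show "crossrel \<rho> (u, G, w) ((x # ps) ! l) ((x # ps) ! Suc l)" using cr[OF l(1)] unfolding sl .
    show "(e, e') \<in> slice_arcs l (u, G, w)" using l(2) unfolding sl .
  qed (auto simp: lab_of_def refl)
qed

lemma point_in_Field:
  assumes "l < length D" "D ! l = (u, G, w)" "p < length (u @ tgt G @ w)"
  shows "(Suc l, p) \<in> Field (arcs D)"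
proof -
  have "(Suc l, p) \<in> Field (slice_arcs l (u, G, w))"
  proof -
    consider "p < length u" | "length u \<le> p" "p < length u + length (tgt G)"
      | q where "p = length u + length (tgt G) + q" "q < length w"
      using assms(3) by (metis add.assoc le_Suc_ex length_append linorder_not_less nat_add_left_cancel_less)
    then show ?thesis
    proof cases
      case 1 then show ?thesis by (auto simp: Field_def Range_iff)
    next
      case 2
      then have "\<exists>e. (e, (Suc l, p)) \<in> piece_arcs l (length u) G \<or> ((Suc l, p), e) \<in> piece_arcs l (length u) G"
        by (cases G) (auto simp: less_Suc_eq)
      then show ?thesis by (auto simp: Field_def Range_iff Domain_iff)
    next
      case 3 then show ?thesis by (auto simp: Field_def Range_iff)
    qed
  qed
  moreover have "slice_arcs l (u, G, w) \<subseteq> arcs D" using assms unfolding arcs_def by (metis UN_upper lessThan_iff)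
  ultimately show ?thesis by (meson mono_Field subsetD)
qed

lemma paths_boundI:
  assumes ps: "ps \<in> paths M D" and b: "\<And>v. v \<in> Field (arcs D) \<Longrightarrow> lab_of x ps v < N"
  shows "ps \<in> paths N D"
proof (rule in_paths)
  show "length ps = length D" using ps by (rule paths_length)
  fix l u G w assume l: "l < length D" "D ! l = (u, G, w)"
  have L: "ps ! l \<in> labels M (length (u @ tgt G @ w))" by (rule paths_nth[OF ps l])
  have "ps ! l ! p < N" if "p < length (u @ tgt G @ w)" for p
    using b[OF point_in_Field[OF l that]] by (simp add: lab_of_def)
  then show "ps ! l \<in> labels N (length (u @ tgt G @ w))"
    using L labels_length[OF L] by (auto simp: labels_def in_set_conv_nth)
qed

lemma finite_arcs: "finite (arcs D)"
proof -
  have "finite (slice_arcs l sl)" for l sl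
  proof -
    obtain u G w where sl: "sl = (u, G, w)" by (cases sl)
    have "finite (piece_arcs l (length u) G)" by (cases G) auto
    then show ?thesis by (simp add: sl)
  qed
  then show ?thesis by (simp add: arcs_def)
qed

section \<open>Large labels lead into deep ideals\<close>

definition arc_count :: "slice list \<Rightarrow> nat" where
  "arc_count D = card (arcs D \<union> (arcs D)\<inverse>)"

text \<open>
  Along the single strand a label changes at most \<open>arc_count D\<close> times; so large labels force a crossing
  at which a label jumps by at least \<open>K\<close>.
\<close>

lemma pwt_in_ideal:
  fixes J :: "'a::comm_ring_1 set"
  assumes D: "closure_is_knot D" and ps: "ps \<in> paths M D"
    and zero: "0 \<in> J" and J: "\<And>a b. a \<in> J \<Longrightarrow> a * b \<in> J"
    and f: "\<And>n j. K \<le> n \<Longrightarrow> fcoef P n j \<in> J" and N: "arc_count D * (K - 1) < N"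
    and out: "ps \<notin> paths N D"
  shows "pwt P D [0] y ps \<in> J"
proof (rule ccontr)
  assume notin: "pwt P D [0] y ps \<notin> J"
  then have nz: "pwt P D [0] y ps \<noteq> 0" using zero by metis
  have T: "tangle [Up] D [Up]" using D by (simp add: closure_is_knot_def)
  \<comment> \<open>If the weight escapes \<open>J\<close>, all jumps are at most
    \<open>K - 1\<close>. The relation is symmetric so that arcs may be followed in either
    direction.\<close>
  define \<rho> where "\<rho> a b \<longleftrightarrow> a \<le> b + (K - 1) \<and> b \<le> a + (K - 1)" for a b :: nat
  define lab where "lab = lab_of [0] ps"
  have J': "b * a \<in> J" if "a \<in> J" for a b using J[OF that, of b] by (simp add: mult.commute)
  have cr: "crossrel \<rho> (D ! l) (([0] # ps) ! l) (([0] # ps) ! Suc l)" if l: "l < length D" for l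
  proof -
    obtain u G w where sl: "D ! l = (u, G, w)" by (cases "D ! l")
    define x z where "x = ([0] # ps) ! l" and "z = ([0] # ps) ! Suc l"
    have sJ: "sw P (u, G, w) z x \<notin> J"
      using pwt_factor[OF l paths_length[OF ps], of P "[0]" y] notin J unfolding sl x_def z_def by metis
    have len: "length x = length (u @ src G @ w)" "length z = length (u @ tgt G @ w)"
      using tangle_width[OF T l sl ps, of "[0]"] unfolding x_def z_def by auto
    have "sw P (u, G, w) z x \<noteq> 0" using sJ zero by metis
    then obtain xu xm zm xw where s: "x = xu @ xm @ xw" "z = xu @ zm @ xw" "length xu = length u"
      "length xm = length (src G)" "length zm = length (tgt G)" "length xw = length w" "pw P G zm xm \<noteq> 0"
      using len by (rule sw_nonzeroE)
    have pJ: "pw P G zm xm \<notin> J" using sJ s by simp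
    show ?thesis unfolding sl x_def[symmetric] z_def[symmetric] crossrel.simps
    proof
      assume G: "is_crossing G"
      obtain a b c d where abcd: "xm = [a, b]" "zm = [c, d]" "c + d = a + b"
        "G = PosX \<longrightarrow> b \<le> c \<and> wpos P a b (c - b) \<noteq> 0" "G = NegX \<longrightarrow> a \<le> d \<and> wneg P b a (d - a) \<noteq> 0"
        by (rule pw_crossing_nonzero[OF G s(7)])
      have "\<rho> a d \<and> \<rho> b c"
      proof (cases "G = PosX")
        case True
        have "wpos P a b (c - b) \<in> J" if "K \<le> c - b" using f[OF that, of b] J' by (auto simp: wpos_def)
        then have "\<not> K \<le> c - b" using pJ True abcd by (auto split: if_splits)
        then show ?thesis using abcd True by (auto simp: \<rho>_def)
      next
        case False
        then have G: "G = NegX" using G by (cases G) auto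
        have "wneg P b a (d - a) \<in> J" if "K \<le> d - a" using f[OF that, of a] J' by (auto simp: wneg_def gcoef_def)
        then have "\<not> K \<le> d - a" using pJ G abcd by (auto split: if_splits)
        then show ?thesis using abcd G by (auto simp: \<rho>_def)
      qed
      then show "\<rho> (x ! length u) (z ! Suc (length u)) \<and> \<rho> (x ! Suc (length u)) (z ! length u)"
        using s abcd by (simp add: nth_append)
    qed
  qed
  have arc: "\<rho> (lab e) (lab e')" if "(e, e') \<in> arcs D" for e e'
    unfolding lab_def by (rule arcs_rel[OF T ps _ nz _ cr that]) (auto simp: \<rho>_def)
  define E where "E = arcs D \<union> (arcs D)\<inverse>"
  have step: "lab v \<le> k * (K - 1)" if "((0, 0), v) \<in> E ^^ k" for k v
    using that
  proof (induction k arbitrary: v)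
    case 0
    then show ?case by (auto simp: lab_def lab_of_def)
  next
    case (Suc k)
    then obtain v' where v': "((0, 0), v') \<in> E ^^ k" "(v', v) \<in> E" by auto
    have "(v', v) \<in> arcs D \<or> (v, v') \<in> arcs D" using v'(2) unfolding E_def by auto
    then have "lab v \<le> lab v' + (K - 1)" using arc[of v' v] arc[of v v'] unfolding \<rho>_def by blast
    also have "\<dots> \<le> Suc k * (K - 1)" using Suc.IH[OF v'(1)] by simp
    finally show ?case .
  qed
  have "lab v < N" if "v \<in> Field (arcs D)" for v
  proof -
    have "((0, 0), v) \<in> E\<^sup>*" using D that unfolding closure_is_knot_def E_def by blast
    \<comment> \<open>In a finite graph, reachability is witnessed by a path with no more steps than
      edges; this turns the bound per step into the bound on \<open>N\<close>.\<close>
    then obtain k where k: "k \<le> card E" "((0, 0), v) \<in> E ^^ k"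
      using rtrancl_finite_eq_relpow[of E] finite_arcs[of D] unfolding E_def by auto
    have "lab v \<le> k * (K - 1)" by (rule step[OF k(2)])
    also have "\<dots> \<le> arc_count D * (K - 1)" using k(1) unfolding arc_count_def E_def by (rule mult_le_mono1)
    finally show ?thesis using N by simp
  qed
  then have "ps \<in> paths N D" unfolding lab_def by (rule paths_boundI[OF ps])
  then show False using out by simp
qed

lemma Zsum_diff_in_ideal:
  fixes J :: "'a::comm_ring_1 set"
  assumes D: "closure_is_knot D"
    and zero: "0 \<in> J" and J: "\<And>a b. a \<in> J \<Longrightarrow> a * b \<in> J" and add: "\<And>a b. a \<in> J \<Longrightarrow> b \<in> J \<Longrightarrow> a + b \<in> J"
    and f: "\<And>n j. K \<le> n \<Longrightarrow> fcoef P n j \<in> J" and N: "arc_count D * (K - 1) < N" "N \<le> M"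
  shows "Zsum M P D [0] y - Zsum N P D [0] y \<in> J"
proof -
  have "Zsum M P D [0] y - Zsum N P D [0] y = (\<Sum>ps\<in>paths M D - paths N D. pwt P D [0] y ps)"
    unfolding Zsum_paths using paths_mono[OF N(2)] by (subst sum_diff) auto
  also have "\<dots> \<in> J"
  proof -
    have "(\<Sum>ps\<in>S. pwt P D [0] y ps) \<in> J" if "finite S" "S \<subseteq> paths M D - paths N D" for S
      using that
    proof (induction S rule: finite_induct)
      case (insert ps S)
      have "pwt P D [0] y ps \<in> J" using insert.prems by (intro pwt_in_ideal[OF D _ zero J f N(1)]) auto
      then show ?case using insert add by simp
    qed (simp add: zero)
    then show ?thesis by simp
  qed
  finally show ?thesis .
qed


subsection \<open>Truncation to a finite-dimensional module\<close>

definition osign :: "orient \<Rightarrow> int" where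
  "osign ori = (case ori of Up \<Rightarrow> 1 | Down \<Rightarrow> - 1)"

text \<open>Downward strands count negatively, so the two ends of a cup or cap, which carry equal
  labels, cancel and only crossings can change the sum.\<close>

fun ssum :: "(nat \<Rightarrow> int) \<Rightarrow> orient list \<Rightarrow> nat list \<Rightarrow> int" where
  "ssum f (ori # s) (a # x) = osign ori * f a + ssum f s x"
| "ssum f _ _ = 0"

lemma ssum_append: "length x = length s \<Longrightarrow> ssum f (s @ t) (x @ y) = ssum f s x + ssum f t y"
  by (induction f s x rule: ssum.induct) auto

fun cross_gain :: "(nat \<Rightarrow> int) \<Rightarrow> slice \<Rightarrow> nat list \<Rightarrow> nat list \<Rightarrow> int" where
  "cross_gain f (u, G, w) x z = (if is_crossing G
     then f (z ! length u) + f (z ! Suc (length u)) - f (x ! length u) - f (x ! Suc (length u)) else 0)"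

lemma ssum_slice:
  assumes "sw P (u, G, w) z x \<noteq> 0" "length x = length (u @ src G @ w)" "length z = length (u @ tgt G @ w)"
  shows "ssum f (u @ tgt G @ w) z = ssum f (u @ src G @ w) x + cross_gain f (u, G, w) x z"
proof -
  obtain xu xm zm xw where s: "x = xu @ xm @ xw" "z = xu @ zm @ xw" "length xu = length u"
    "length xm = length (src G)" "length zm = length (tgt G)" "length xw = length w" "pw P G zm xm \<noteq> 0"
    by (rule sw_nonzeroE[OF assms])
  have "ssum f (tgt G) zm = ssum f (src G) xm + cross_gain f (u, G, w) x z"
  proof (cases "is_crossing G")
    case True
    then obtain a b c d where "xm = [a, b]" "zm = [c, d]" using s(7) by (elim pw_crossing_nonzero)
    then show ?thesis using True s by (cases G) (auto simp: nth_append osign_def)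
  next
    case False
    consider (cup) c where "xm = []" "zm = [c, c]" "G = CupUD \<or> G = CupDU"
      | (cap) c where "zm = []" "xm = [c, c]" "G = CapUD \<or> G = CapDU"
      using pw_noncrossing_nonzero[OF False s(7)] by blast
    then show ?thesis by cases (auto simp: osign_def)
  qed
  then show ?thesis using s by (simp add: ssum_append del: cross_gain.simps)
qed

text \<open>Stronger than \<open>trunc\<close>: no divided power leaves the first \<open>N\<close>
  labels, as happens at A = q^n with \<open>N\<close> equal to n + 1. It allows a larger state sum
  to be cut down to these labels.\<close>

definition trunc_all :: "nat \<Rightarrow> 'a::comm_ring_1 par \<Rightarrow> bool" where
  "trunc_all N P \<longleftrightarrow> (\<forall>n j. j < N \<longrightarrow> N \<le> n + j \<longrightarrow> fcoef P n j = 0)"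

lemma trunc_all_trunc: "trunc_all N P \<Longrightarrow> trunc N P"
  by (simp add: trunc_all_def trunc_def)

text \<open>A label could pass the threshold upwards only by a divided power, which
  \<open>trunc_all\<close> excludes; the other strand of the crossing can only lose.\<close>

lemma crossing_trunc:
  assumes tr: "trunc_all (Suc n) (P :: 'a::comm_ring_1 par)" and G: "is_crossing G" and nz: "pw P G zm xm \<noteq> 0"
  obtains a b c d where "xm = [a, b]" "zm = [c, d]" "n < c \<Longrightarrow> n < b" "n < d \<Longrightarrow> n < a"
proof -
  obtain a b c d where abcd: "xm = [a, b]" "zm = [c, d]" "c + d = a + b"
    "G = PosX \<longrightarrow> b \<le> c \<and> wpos P a b (c - b) \<noteq> 0" "G = NegX \<longrightarrow> a \<le> d \<and> wneg P b a (d - a) \<noteq> 0"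
    by (rule pw_crossing_nonzero[OF G nz])
  have "(n < c \<longrightarrow> n < b) \<and> (n < d \<longrightarrow> n < a)"
  proof (cases "G = PosX")
    case True
    then have "fcoef P (c - b) b \<noteq> 0" "b \<le> c" using abcd by (auto simp: wpos_def)
    then have "\<not> (b \<le> n \<and> n < c)" using tr unfolding trunc_all_def by (metis Suc_leI le_add_diff_inverse2 less_Suc_eq_le)
    then show ?thesis using abcd \<open>b \<le> c\<close> by auto
  next
    case False
    then have "G = NegX" using G by (cases G) auto
    then have "fcoef P (d - a) a \<noteq> 0" "a \<le> d" using abcd by (auto simp: wneg_def gcoef_def)
    then have "\<not> (a \<le> n \<and> n < d)" using tr unfolding trunc_all_def by (metis Suc_leI le_add_diff_inverse2 less_Suc_eq_le)
    then show ?thesis using abcd \<open>a \<le> d\<close> by auto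
  qed
  then show ?thesis using that abcd by blast
qed

text \<open>With \<open>f\<close> the indicator of lying above \<open>n\<close>, each crossing can
  only lower the sum. Equal sums at the two ends therefore force equality at each crossing, and then
  neither of its strands changes sides.\<close>

lemma ssum_path:
  assumes f: "f = (\<lambda>a. if n < a then 1 else 0)" and tr: "trunc_all (Suc n) (P :: 'a::comm_ring_1 par)"
  shows "tangle s D t \<Longrightarrow> ps \<in> paths N D \<Longrightarrow> length x = length s \<Longrightarrow> pwt P D x y ps \<noteq> 0 \<Longrightarrow>
    ssum f t y \<le> ssum f s x \<and> (ssum f t y = ssum f s x \<longrightarrow>
      (\<forall>l<length D. crossrel (\<lambda>a b. n < a \<longleftrightarrow> n < b) (D ! l) ((x # ps) ! l) ((x # ps) ! Suc l)))"
proof (induction D arbitrary: s x ps)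
  case Nil
  then show ?case by (auto split: if_splits)
next
  case (Cons sl D)
  obtain u G w where sl: "sl = (u, G, w)" by (cases sl)
  obtain z qs where ps: "ps = z # qs" "z \<in> labels N (length (u @ tgt G @ w))" "qs \<in> paths N D"
    using Cons.prems(2) by (auto simp: sl)
  have z: "length z = length (u @ tgt G @ w)" using ps(2) by (rule labels_length)
  have T: "tangle (u @ tgt G @ w) D t" "s = u @ src G @ w" using Cons.prems by (auto simp: sl)
  have nz: "sw P (u, G, w) z x \<noteq> 0" "pwt P D z y qs \<noteq> 0"
    using Cons.prems(4) by (auto simp: sl ps simp del: sw.simps)
  have len: "length x = length (u @ src G @ w)" using Cons.prems T by simp
  note IH = Cons.IH[OF T(1) ps(3) z nz(2)]
  have g: "cross_gain f (u, G, w) x z \<le> 0 \<and>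
    (cross_gain f (u, G, w) x z = 0 \<longrightarrow> crossrel (\<lambda>a b. n < a \<longleftrightarrow> n < b) (u, G, w) x z)"
  proof (cases "is_crossing G")
    case True
    obtain xu xm zm xw where s: "x = xu @ xm @ xw" "z = xu @ zm @ xw" "length xu = length u" "pw P G zm xm \<noteq> 0"
      by (rule sw_nonzeroE[OF nz(1) len z])
    obtain a b c d where abcd: "xm = [a, b]" "zm = [c, d]" "n < c \<Longrightarrow> n < b" "n < d \<Longrightarrow> n < a"
      using crossing_trunc[OF tr True s(4)] by metis
    have i: "x ! length u = a" "x ! Suc (length u) = b" "z ! length u = c" "z ! Suc (length u) = d"
      using s abcd by (auto simp: nth_append)
    show ?thesis using True abcd(3,4) by (auto simp: i f)
  qed simp
  have e: "ssum f (u @ tgt G @ w) z = ssum f s x + cross_gain f (u, G, w) x z"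
    unfolding T(2) by (rule ssum_slice[OF nz(1) len z])
  show ?case
  proof (intro conjI impI allI)
    show "ssum f t y \<le> ssum f s x" using IH e g by linarith
    fix l assume eq: "ssum f t y = ssum f s x" and l: "l < length (sl # D)"
    have c: "cross_gain f (u, G, w) x z = 0" "ssum f t y = ssum f (u @ tgt G @ w) z" using IH e g eq by linarith+
    show "crossrel (\<lambda>a b. n < a \<longleftrightarrow> n < b) ((sl # D) ! l) ((x # ps) ! l) ((x # ps) ! Suc l)"
    proof (cases l)
      case 0
      then show ?thesis using c g by (simp add: sl ps del: crossrel.simps)
    next
      case (Suc l')
      then show ?thesis using c IH l by (simp add: ps)
    qed
  qed
qed

text \<open>Both ends carry the label 0, so the sums at the ends agree and no strand changes sides
  in a state of nonzero weight. As every point is connected to the bottom end, the whole knot stays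
  below the threshold.\<close>

lemma Zsum_trunc:
  assumes D: "closure_is_knot D" and tr: "trunc_all (Suc n) (P :: 'a::comm_ring_1 par)" and N: "Suc n \<le> N"
  shows "Zsum N P D [0] [0] = Zsum (Suc n) P D [0] [0]"
  unfolding Zsum_paths
proof (rule sum.mono_neutral_right)
  show "\<forall>ps\<in>paths N D - paths (Suc n) D. pwt P D [0] [0] ps = 0"
  proof (intro ballI, rule ccontr)
    fix ps assume ps: "ps \<in> paths N D - paths (Suc n) D" and nz: "pwt P D [0] [0] ps \<noteq> 0"
    have T: "tangle [Up] D [Up]" using D by (simp add: closure_is_knot_def)
    have ps': "ps \<in> paths N D" using ps by simp
    have cr: "crossrel (\<lambda>a b. n < a \<longleftrightarrow> n < b) (D ! l) (([0] # ps) ! l) (([0] # ps) ! Suc l)" if "l < length D" for l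
      using ssum_path[OF refl tr T ps' _ nz] that by simp
    define lab where "lab = lab_of [0] ps"
    have arc: "n < lab e \<longleftrightarrow> n < lab e'" if "(e, e') \<in> arcs D" for e e'
      unfolding lab_def using arcs_rel[OF T ps' _ nz _ cr that] by simp
    have "lab v < Suc n" if v: "v \<in> Field (arcs D)" for v
    proof -
      have "((0, 0), v) \<in> (arcs D \<union> (arcs D)\<inverse>)\<^sup>*" using D v unfolding closure_is_knot_def by blast
      then have "\<not> n < lab v"
      proof (induction rule: rtrancl_induct)
        case base
        then show ?case by (simp add: lab_def lab_of_def)
      next
        case (step v w)
        then have "(v, w) \<in> arcs D \<or> (w, v) \<in> arcs D" by auto
        then show ?case using arc[of v w] arc[of w v] step(3) by blast
      qed
      then show ?thesis by simp
    qed
    then have "ps \<in> paths (Suc n) D" unfolding lab_def by (rule paths_boundI[OF ps'])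
    then show False using ps by simp
  qed
qed (use paths_mono[OF N] in auto)

section \<open>Factorization at a root of unity\<close>

text \<open>
  Write labels in base \<open>r\<close>. At a crossing the Lucas property kills all carries, so the sum of the
  last digits can only grow, by borrows; as the strand begins and ends with the same label, no
  borrows occur in a state of the whole diagram, and then all weights are multiplicative.
\<close>

definition root_factor :: "nat \<Rightarrow> 'a::comm_ring_1 par \<Rightarrow> 'a par \<Rightarrow> 'a par \<Rightarrow> bool" where
  "root_factor r P P0 P1 \<longleftrightarrow> valid P \<and> qroot r (pQ P) \<and>
     pQ P0 = pQ P \<and> pQi P0 = pQi P \<and> pA P0 = pA P \<and> pAi P0 = pAi P \<and>
     pQ P1 = 1 \<and> pQi P1 = 1 \<and> pA P1 = pA P ^ r \<and> pAi P1 = pAi P ^ r \<and>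
     pG P = pG P0 * pG P1 \<and> pGi P = pGi P0 * pGi P1 \<and>
     pT P = 1 \<and> pTi P = 1 \<and> pT P0 = 1 \<and> pTi P0 = 1 \<and> pT P1 = 1 \<and> pTi P1 = 1"

context
  fixes r :: nat and P P0 P1 :: "'a::comm_ring_1 par"
  assumes rf: "root_factor r P P0 P1"
begin

lemma r_pos: "0 < r" using rf by (simp add: root_factor_def qroot_def)

lemma Q_pow: "pQ P ^ (r * k + j) = pQ P ^ j"
  using rf by (simp add: root_factor_def qroot_power)

lemma Qi_pow: "pQi P ^ (r * k + j) = pQi P ^ j"
proof -
  have "pQi P ^ r = 1"
  proof -
    have v: "valid P" and q: "pQ P ^ r = 1" using rf by (auto simp: root_factor_def qroot_def)
    have "pQ P ^ r * pQi P ^ r = 1" by (rule Q_cancel(1)[OF v])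
    then show ?thesis using q by simp
  qed
  then show ?thesis by (simp add: power_add power_mult)
qed

lemma prod_digits:
  fixes f :: "nat \<Rightarrow> 'a"
  assumes "\<And>k. f (r + k) = f k"
  shows "(\<Prod>k<n0 + r * n1. f k) = (\<Prod>k<n0. f k) * (\<Prod>k<r. f k) ^ n1"
proof (induction n1)
  case (Suc n1)
  have "(\<Prod>k<r + m. f k) = (\<Prod>k<r. f k) * (\<Prod>k<m. f k)" for m
    by (induction m) (use assms in \<open>auto simp: mult_ac\<close>)
  from this[of "n0 + r * n1"] show ?case using Suc by (simp add: algebra_simps)
qed simp

lemma prod_shift:
  fixes f :: "nat \<Rightarrow> 'a"
  assumes "\<And>k. f (r + k) = f k"
  shows "(\<Prod>k<r. f (j + k)) = (\<Prod>k<r. f k)"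
proof (induction j)
  case (Suc j)
  have "(\<Prod>k<r. f (Suc j + k)) = (\<Prod>k<r. f (Suc (j + k)))" by simp
  also have "\<dots> = (\<Prod>k<r. f (j + k))"
  proof -
    obtain r' where r': "r = Suc r'" using r_pos by (cases r) auto
    have "f (Suc (j + r')) = f j" using assms[of j] r' by (simp add: add.commute)
    moreover have "(\<Prod>k<r. f (j + k)) = f j * (\<Prod>k<r'. f (Suc (j + k)))"
      unfolding r' by (subst prod.lessThan_Suc_shift) simp
    ultimately show ?thesis unfolding r' by (simp add: mult.commute)
  qed
  finally show ?case using Suc by simp
qed simp

text \<open>A block of \<open>r\<close> consecutive factors collapses to 1 - A^(-2r) by
  \<open>qroot_prod\<close>, wherever it starts; powers of Q depend on last digits only, and the
  binomial splits by Lucas' theorem.\<close>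

lemma fcoef_factor:
  assumes "n0 < r" "j0 < r"
  shows "fcoef P (n0 + r * n1) (j0 + r * j1) = (if n0 + j0 < r then fcoef P0 n0 j0 * fcoef P1 n1 j1 else 0)"
proof -
  have q: "qroot r (pQ P)" and P0: "pQ P0 = pQ P" "pQi P0 = pQi P" "pA P0 = pA P" "pAi P0 = pAi P"
    and P1: "pQ P1 = 1" "pQi P1 = 1" "pA P1 = pA P ^ r" "pAi P1 = pAi P ^ r"
    using rf by (auto simp: root_factor_def)
  define Q a where "Q = pQ P" and "a = (pAi P)\<^sup>2"
  have Qp: "Q ^ (r + k) = Q ^ k" for k using Q_pow[of 1] by (simp add: Q_def)
  have Qj: "Q ^ (j0 + r * j1 + k) = Q ^ (j0 + k)" for k
    using Q_pow[of j1 "j0 + k"] by (simp add: Q_def add_ac)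
  have pr: "(\<Prod>k<n0 + r * n1. 1 - Q ^ (j0 + r * j1 + k) * a) = (\<Prod>k<n0. 1 - Q ^ (j0 + k) * a) * (1 - a ^ r) ^ n1"
  proof -
    have "(\<Prod>k<n0 + r * n1. 1 - Q ^ (j0 + k) * a)
        = (\<Prod>k<n0. 1 - Q ^ (j0 + k) * a) * (\<Prod>k<r. 1 - Q ^ (j0 + k) * a) ^ n1"
      by (rule prod_digits) (use Qp in \<open>simp add: add.left_commute[of j0]\<close>)
    also have "(\<Prod>k<r. 1 - Q ^ (j0 + k) * a) = (\<Prod>k<r. 1 - Q ^ k * a)"
      by (rule prod_shift[of "\<lambda>k. 1 - Q ^ k * a"]) (simp add: Qp)
    also have "\<dots> = 1 - a ^ r" using qroot_prod[OF q, of a] by (simp add: Q_def mult.commute)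
    finally show ?thesis unfolding Qj .
  qed
  have qi: "pQi P ^ ((n0 + r * n1) * (j0 + r * j1)) = pQi P ^ (n0 * j0)"
    using Qi_pow[of "n1 * (j0 + r * j1) + n0 * j1" "n0 * j0"] by (simp add: algebra_simps)
  have e: "(n0 + r * n1) + (j0 + r * j1) = (n0 + j0) + r * (n1 + j1)" by (simp add: algebra_simps)
  show ?thesis
  proof (cases "n0 + j0 < r")
    case True
    have g: "gb Q ((n0 + r * n1) + (j0 + r * j1)) (n0 + r * n1) = gb Q (n0 + j0) n0 * gb 1 (n1 + j1) n1"
      unfolding e Q_def using True assms by (intro qroot_gb_Lucas[OF q]) auto
    have pw: "(a ^ r) = (pAi P ^ r)\<^sup>2" by (simp add: a_def power_mult[symmetric] mult.commute)
    have Ap: "pA P ^ (n0 + r * n1) = pA P ^ n0 * (pA P ^ r) ^ n1" by (simp add: power_add power_mult)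
    show ?thesis using True unfolding fcoef_def P0 P1 Q_def[symmetric] a_def[symmetric] pr g qi Ap
      by (simp add: pw mult_ac)
  next
    case False
    \<comment> \<open>After a carry the last digit of the upper index is n0 + j0 - r, which is
      smaller than n0; so the lower Lucas factor is zero.\<close>
    have "gb Q ((n0 + r * n1) + (j0 + r * j1)) (n0 + r * n1) = gb Q ((n0 + j0 - r) + r * (n1 + j1 + 1)) (n0 + r * n1)"
      using False e by (simp add: algebra_simps)
    also have "\<dots> = gb Q (n0 + j0 - r) n0 * gb 1 (n1 + j1 + 1) n1"
      unfolding Q_def using assms False by (intro qroot_gb_Lucas[OF q]) auto
    also have "\<dots> = 0" using assms False by (simp add: gb_eq_0)
    finally show ?thesis using False unfolding fcoef_def Q_def by simp
  qed
qed

text \<open>A full block of the extra factors contributes -1 by \<open>qroot_prod_neg\<close>, which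
  is also the contribution of a single factor at Q = 1.\<close>

lemma gcoef_factor:
  assumes "n0 < r" "j0 < r"
  shows "gcoef P (n0 + r * n1) (j0 + r * j1) = (if n0 + j0 < r then gcoef P0 n0 j0 * gcoef P1 n1 j1 else 0)"
proof -
  have q: "qroot r (pQ P)" "pQ P * pQi P = 1" and P0: "pQi P0 = pQi P" and P1: "pQi P1 = 1"
    using rf by (auto simp: root_factor_def valid_def)
  have "(\<Prod>k<n0 + r * n1. - (pQi P ^ k)) = (\<Prod>k<n0. - (pQi P ^ k)) * (\<Prod>k<r. - (pQi P ^ k)) ^ n1"
    by (rule prod_digits) (use Qi_pow[of 1] in simp)
  also have "(\<Prod>k<r. - (pQi P ^ k)) = - 1" by (rule qroot_prod_neg[OF q])
  finally show ?thesis
    unfolding gcoef_def fcoef_factor[OF assms] by (simp add: P0 P1 mult_ac)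
qed

section \<open>Base-\<open>r\<close> digits of the labels at a crossing\<close>

lemma digit_split: "x = x mod r + r * (x div r)"
  by simp

text \<open>The borrow: the last digit of the difference gains \<open>r\<close>, and this is what
  the digit sum detects.\<close>

lemma digit_sub_less:
  assumes "n \<le> i" "i mod r < n mod r"
  shows "(i - n) mod r = i mod r + r - n mod r"
proof -
  have "n div r < i div r"
  proof (rule ccontr)
    assume "\<not> n div r < i div r"
    then have "r * (i div r) \<le> r * (n div r)" by simp
    then show False using assms digit_split[of i] digit_split[of n] by linarith
  qed
  then obtain d where d: "i div r = Suc (n div r + d)" using less_iff_Suc_add by blast
  have "r * (i div r) = r + r * (n div r) + r * d" unfolding d by (simp add: algebra_simps)
  then have e: "i - n = (i mod r + r - n mod r) + r * d"
    using digit_split[of i] digit_split[of n] mod_less_divisor[OF r_pos, of n] by linarith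
  have "i mod r + r - n mod r < r" using assms mod_less_divisor[OF r_pos, of n] by linarith
  then show ?thesis unfolding e mod_mult_self2 by (rule mod_less)
qed

lemma digit_sub:
  assumes "n \<le> i" "n mod r \<le> i mod r"
  shows "(i - n) mod r = i mod r - n mod r" "(i - n) div r = i div r - n div r" "n div r \<le> i div r"
proof -
  show l: "n div r \<le> i div r" using assms(1) by (rule div_le_mono)
  then have "i - n = (i mod r - n mod r) + r * (i div r - n div r)"
    using digit_split[of i] digit_split[of n] assms by (simp add: algebra_simps diff_mult_distrib2)
  moreover have "i mod r - n mod r < r" using mod_less_divisor[OF r_pos, of i] by linarith
  ultimately show "(i - n) mod r = i mod r - n mod r" "(i - n) div r = i div r - n div r"
    by (metis mod_mult_self2 mod_less) (metis \<open>i - n = _\<close> \<open>_ < r\<close> add.commute add_0 div_less div_mult_self2 not_less_zero)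
qed

lemma digit_add:
  assumes "n mod r + j mod r < r"
  shows "(j + n) mod r = j mod r + n mod r" "(j + n) div r = j div r + n div r"
proof -
  have e: "j + n = (j mod r + n mod r) + r * (j div r + n div r)"
    using digit_split[of j] digit_split[of n] by (simp add: algebra_simps)
  show "(j + n) mod r = j mod r + n mod r" using assms by (subst e) simp
  show "(j + n) div r = j div r + n div r" using assms by (subst e) (simp add: div_mult_self2)
qed

text \<open>A nonzero coefficient excludes a carry in \<open>j + n\<close>. The sum of last digits
  is then changed only by the subtraction \<open>i - n\<close>: it grows by \<open>r\<close> if
  there is a borrow and stays the same otherwise.\<close>

lemma crossing_digits:
  assumes "n \<le> i" "fcoef P n j \<noteq> 0"
  shows "n mod r + j mod r < r"
    and "int (i mod r) + int (j mod r) \<le> int ((i - n) mod r) + int ((j + n) mod r)"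
    and "int ((i - n) mod r) + int ((j + n) mod r) = int (i mod r) + int (j mod r) \<Longrightarrow> n mod r \<le> i mod r"
proof -
  show c: "n mod r + j mod r < r"
    using assms(2) fcoef_factor[of "n mod r" "j mod r" "n div r" "j div r"] r_pos
    by (auto split: if_splits)
  note a = digit_add[OF c]
  show "int (i mod r) + int (j mod r) \<le> int ((i - n) mod r) + int ((j + n) mod r)"
    by (cases "n mod r \<le> i mod r")
       (use digit_sub[OF assms(1)] digit_sub_less[OF assms(1)] a mod_less_divisor[OF r_pos, of n] in auto)
  show "int ((i - n) mod r) + int ((j + n) mod r) = int (i mod r) + int (j mod r) \<Longrightarrow> n mod r \<le> i mod r"
    by (rule ccontr) (use digit_sub_less[OF assms(1)] a r_pos mod_less_divisor[OF r_pos, of n] in auto)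
qed

lemma A_pow_digits: "x ^ (i + j) = x ^ (i mod r + j mod r) * (x ^ r) ^ (i div r + j div r)" for x :: 'a
proof -
  have "i + j = (i mod r + j mod r) + r * (i div r + j div r)"
    using digit_split[of i] digit_split[of j] by (simp add: algebra_simps)
  then show ?thesis by (metis power_add power_mult)
qed

lemma wpos_factor:
  assumes n: "n \<le> i" "n mod r \<le> i mod r" and c: "n mod r + j mod r < r"
  shows "wpos P i j n = wpos P0 (i mod r) (j mod r) (n mod r) * wpos P1 (i div r) (j div r) (n div r)"
proof -
  note s = digit_sub[OF n] and a = digit_add[OF c]
  have "(i - n) * (j + n) = r * ((i - n) div r * (j + n) + (i - n) mod r * ((j + n) div r)) + ((i - n) mod r) * ((j + n) mod r)"
  proof -
    have "(i - n) * (j + n) = ((i - n) mod r + r * ((i - n) div r)) * ((j + n) mod r + r * ((j + n) div r))"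
      by simp
    also have "\<dots> = r * ((i - n) div r * ((j + n) mod r + r * ((j + n) div r)) + (i - n) mod r * ((j + n) div r)) + ((i - n) mod r) * ((j + n) mod r)"
      by (simp only: algebra_simps)
    finally show ?thesis by simp
  qed
  then have Q: "pQ P ^ ((i - n) * (j + n)) = pQ P ^ ((i mod r - n mod r) * (j mod r + n mod r))"
    using Q_pow s a by metis
  have f: "fcoef P n j = fcoef P0 (n mod r) (j mod r) * fcoef P1 (n div r) (j div r)"
    using fcoef_factor[of "n mod r" "j mod r" "n div r" "j div r"] r_pos c by simp
  show ?thesis
    unfolding wpos_def f Q A_pow_digits[of "pAi P" i j] using rf by (simp add: root_factor_def mult_ac)
qed

lemma wneg_factor:
  assumes n: "n \<le> i" "n mod r \<le> i mod r" and c: "n mod r + j mod r < r"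
  shows "wneg P i j n = wneg P0 (i mod r) (j mod r) (n mod r) * wneg P1 (i div r) (j div r) (n div r)"
proof -
  have "i * j = r * (i div r * j + i mod r * (j div r)) + (i mod r) * (j mod r)"
  proof -
    have "i * j = (i mod r + r * (i div r)) * (j mod r + r * (j div r))" by simp
    also have "\<dots> = r * (i div r * (j mod r + r * (j div r)) + i mod r * (j div r)) + (i mod r) * (j mod r)"
      by (simp only: algebra_simps)
    finally show ?thesis by simp
  qed
  then have Q: "pQi P ^ (i * j) = pQi P ^ ((i mod r) * (j mod r))" using Qi_pow by metis
  have f: "gcoef P n j = gcoef P0 (n mod r) (j mod r) * gcoef P1 (n div r) (j div r)"
    using gcoef_factor[of "n mod r" "j mod r" "n div r" "j div r"] r_pos c by simp
  show ?thesis
    unfolding wneg_def f Q A_pow_digits[of "pA P" i j] using rf by (simp add: root_factor_def mult_ac)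
qed

definition lo :: "nat list \<Rightarrow> nat list" where "lo = map (\<lambda>a. a mod r)"
definition hi :: "nat list \<Rightarrow> nat list" where "hi = map (\<lambda>a. a div r)"

definition fdig :: "nat \<Rightarrow> int" where "fdig a = int (a mod r)"

text \<open>When last digit sums are conserved, the support of a crossing weight is the product of
  the supports on the two digit levels. Both directions are used: for factoring nonzero weights and
  for showing that zero weights factor too.\<close>

lemma crossing_iff:
  assumes n: "int (c mod r) + int (d mod r) = int (i mod r) + int (j mod r)"
  shows "j \<le> c \<and> c + d = i + j \<and> (c - j) mod r + j mod r < r \<and> (c - j) mod r \<le> i mod r
    \<longleftrightarrow> j mod r \<le> c mod r \<and> c mod r + d mod r = i mod r + j mod r \<and> j div r \<le> c div r \<and> c div r + d div r = i div r + j div r"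
    (is "?L \<longleftrightarrow> ?R")
proof
  assume L: ?L
  then have cj: "c = j + (c - j)" by simp
  have "c mod r = j mod r + (c - j) mod r" "c div r = j div r + (c - j) div r"
    using digit_add[of "c - j" j] L cj by (metis add.commute)+
  moreover have "r * (c div r + d div r) = r * (i div r + j div r)"
    unfolding distrib_left
    using L n digit_split[of c] digit_split[of d] digit_split[of i] digit_split[of j] by linarith
  ultimately show ?R using n r_pos by simp
next
  assume R: ?R
  have j: "j \<le> c" using R digit_split[of c] digit_split[of j] by (metis add_mono mult_le_mono2)
  have "c + d = i + j"
  proof -
    have "c + d = (c mod r + d mod r) + r * (c div r + d div r)"
      using digit_split[of c] digit_split[of d] by (simp add: algebra_simps)
    also have "\<dots> = (i mod r + j mod r) + r * (i div r + j div r)" using R by simp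
    also have "\<dots> = i + j" using digit_split[of i] digit_split[of j] by (simp add: algebra_simps)
    finally show ?thesis .
  qed
  moreover have "(c - j) mod r = c mod r - j mod r" using digit_sub(1)[OF j] R by simp
  moreover have "c mod r < r" using r_pos by simp
  ultimately show ?L using R j by auto
qed

lemma pw_PosX_factor:
  assumes n: "fdig c + fdig d = fdig i + fdig j"
  shows "pw P PosX [c, d] [i, j] = pw P0 PosX (lo [c, d]) (lo [i, j]) * pw P1 PosX (hi [c, d]) (hi [i, j])"
proof (cases "pw P PosX [c, d] [i, j] = 0")
  case False
  then have L: "j \<le> c" "c + d = i + j" and nz: "fcoef P (c - j) j \<noteq> 0"
    by (auto simp: wpos_def split: if_splits)
  have i: "c - j \<le> i" "i - (c - j) = d" "j + (c - j) = c" using L by auto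
  note cd = crossing_digits[OF i(1) nz, unfolded i(2,3)]
  have bw: "(c - j) mod r \<le> i mod r" using cd(3) n by (simp add: fdig_def)
  have R: "j mod r \<le> c mod r \<and> c mod r + d mod r = i mod r + j mod r \<and> j div r \<le> c div r \<and> c div r + d div r = i div r + j div r"
    using crossing_iff[of c d i j] n L cd(1) bw by (simp add: fdig_def)
  have s: "(c - j) mod r = c mod r - j mod r" "(c - j) div r = c div r - j div r"
    using digit_sub[OF L(1)] R by auto
  show ?thesis using L R wpos_factor[OF i(1) bw cd(1)] by (simp add: lo_def hi_def s)
next
  case True
  show ?thesis
  proof (rule ccontr)
    assume ne: "\<not> ?thesis"
    then have R: "j mod r \<le> c mod r \<and> c mod r + d mod r = i mod r + j mod r \<and> j div r \<le> c div r \<and> c div r + d div r = i div r + j div r"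
      using True by (auto simp: lo_def hi_def split: if_splits)
    then have L: "j \<le> c" "c + d = i + j" "(c - j) mod r + j mod r < r" "(c - j) mod r \<le> i mod r"
      using crossing_iff[of c d i j] n by (auto simp: fdig_def)
    have s: "(c - j) mod r = c mod r - j mod r" "(c - j) div r = c div r - j div r"
      using digit_sub[OF L(1)] R by auto
    have "c - j \<le> i" using L by simp
    from wpos_factor[OF this L(4,3)] have "wpos P i j (c - j) \<noteq> 0"
      using ne True R by (auto simp: lo_def hi_def s)
    then show False using True L by simp
  qed
qed

lemma pw_NegX_factor:
  assumes n: "fdig c + fdig d = fdig i + fdig j"
  shows "pw P NegX [d, c] [j, i] = pw P0 NegX (lo [d, c]) (lo [j, i]) * pw P1 NegX (hi [d, c]) (hi [j, i])"
proof (cases "pw P NegX [d, c] [j, i] = 0")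
  case False
  then have L: "j \<le> c" "c + d = i + j" and nz: "fcoef P (c - j) j \<noteq> 0"
    by (auto simp: wneg_def gcoef_def split: if_splits)
  have i: "c - j \<le> i" "i - (c - j) = d" "j + (c - j) = c" using L by auto
  note cd = crossing_digits[OF i(1) nz, unfolded i(2,3)]
  have bw: "(c - j) mod r \<le> i mod r" using cd(3) n by (simp add: fdig_def)
  have R: "j mod r \<le> c mod r \<and> c mod r + d mod r = i mod r + j mod r \<and> j div r \<le> c div r \<and> c div r + d div r = i div r + j div r"
    using crossing_iff[of c d i j] n L cd(1) bw by (simp add: fdig_def)
  have s: "(c - j) mod r = c mod r - j mod r" "(c - j) div r = c div r - j div r"
    using digit_sub[OF L(1)] R by auto
  show ?thesis using L R wneg_factor[OF i(1) bw cd(1)] by (simp add: lo_def hi_def s add.commute)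
next
  case True
  show ?thesis
  proof (rule ccontr)
    assume ne: "\<not> ?thesis"
    then have R: "j mod r \<le> c mod r \<and> c mod r + d mod r = i mod r + j mod r \<and> j div r \<le> c div r \<and> c div r + d div r = i div r + j div r"
      using True by (auto simp: lo_def hi_def add.commute split: if_splits)
    then have L: "j \<le> c" "c + d = i + j" "(c - j) mod r + j mod r < r" "(c - j) mod r \<le> i mod r"
      using crossing_iff[of c d i j] n by (auto simp: fdig_def)
    have s: "(c - j) mod r = c mod r - j mod r" "(c - j) div r = c div r - j div r"
      using digit_sub[OF L(1)] R by auto
    have "c - j \<le> i" using L by simp
    from wneg_factor[OF this L(4,3)] have "wneg P i j (c - j) \<noteq> 0"
      using ne True R by (auto simp: lo_def hi_def s add.commute)
    then show False using True L by (simp add: add.commute)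
  qed
qed


text \<open>For cups and caps this rests on the splitting of the pivot and on powers of Q seeing
  only last digits; for crossings, on the conserved digit sum.\<close>

lemma slice_factor:
  assumes len: "length x = length (u @ src G @ w)" "length z = length (u @ tgt G @ w)"
    and eq: "ssum fdig (u @ tgt G @ w) z = ssum fdig (u @ src G @ w) x"
  shows "sw P (u, G, w) z x = sw P0 (u, G, w) (lo z) (lo x) * sw P1 (u, G, w) (hi z) (hi x)"
proof (cases "take (length u) z = take (length u) x \<and>
        drop (length u + length (tgt G)) z = drop (length u + length (src G)) x")
  case False
  have inj: "y = y'" if "lo y = lo y'" "hi y = hi y'" for y y'
  proof (rule nth_equalityI)
    show l: "length y = length y'" using that(1) by (metis length_map lo_def)
    fix k assume k: "k < length y"
    have "y ! k mod r = y' ! k mod r" "y ! k div r = y' ! k div r"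
      using that k l unfolding lo_def hi_def by (metis nth_map)+
    then show "y ! k = y' ! k" by (metis digit_split)
  qed
  have td: "take m (lo y) = lo (take m y)" "drop m (lo y) = lo (drop m y)"
    "take m (hi y) = hi (take m y)" "drop m (hi y) = hi (drop m y)" for m y
    by (simp_all add: lo_def hi_def take_map drop_map)
  \<comment> \<open>Labels outside the piece agree exactly if both their digit lists agree, so a
    mismatch kills one of the two factors as well.\<close>
  have "sw P0 (u, G, w) (lo z) (lo x) * sw P1 (u, G, w) (hi z) (hi x) = 0"
  proof (rule ccontr)
    assume "\<not> ?thesis"
    then have "take (length u) (lo z) = take (length u) (lo x)" "take (length u) (hi z) = take (length u) (hi x)"
      "drop (length u + length (tgt G)) (lo z) = drop (length u + length (src G)) (lo x)"
      "drop (length u + length (tgt G)) (hi z) = drop (length u + length (src G)) (hi x)"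
      by (auto split: if_splits)
    then show False using False inj unfolding td by blast
  qed
  moreover have "sw P (u, G, w) z x = 0" using False unfolding sw.simps by (rule if_not_P)
  ultimately show ?thesis by (simp only:)
next
  case True
  define xu xm xw where "xu = take (length u) x" and "xm = take (length (src G)) (drop (length u) x)"
    and "xw = drop (length u + length (src G)) x"
  define zm where "zm = take (length (tgt G)) (drop (length u) z)"
  have c: "take (length u) z = xu" "drop (length u + length (tgt G)) z = xw"
    using True by (auto simp: xu_def xw_def)
  have x: "x = xu @ xm @ xw" unfolding xu_def xm_def xw_def
    by (metis add.commute append_take_drop_id drop_drop)
  have z: "z = xu @ zm @ xw" unfolding c(1,2)[symmetric] zm_def
    by (metis add.commute append_take_drop_id drop_drop)
  have l: "length xu = length u" "length xm = length (src G)" "length zm = length (tgt G)" "length xw = length w"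
    using len by (auto simp: xu_def xm_def xw_def zm_def)
  have e: "ssum fdig (tgt G) zm = ssum fdig (src G) xm"
    using eq unfolding x z by (simp add: ssum_append l)
  have P01: "pQ P0 = pQ P" "pQi P0 = pQi P" "pQ P1 = 1" "pQi P1 = 1"
    "pG P = pG P0 * pG P1" "pGi P = pGi P0 * pGi P1" using rf by (auto simp: root_factor_def)
  have Qm: "pQ P ^ k = pQ P ^ (k mod r)" "pQi P ^ k = pQi P ^ (k mod r)" for k
    using Q_pow[of "k div r" "k mod r"] Qi_pow[of "k div r" "k mod r"] by auto
  have eqd: "a = b \<longleftrightarrow> a mod r = b mod r \<and> a div r = b div r" for a b :: nat by (metis digit_split)
  have "pw P G zm xm = pw P0 G (lo zm) (lo xm) * pw P1 G (hi zm) (hi xm)"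
  proof (cases G)
    case PosX
    then obtain a b c d where "xm = [a, b]" "zm = [c, d]" using l length_two by (metis list.size(3,4) src.simps(1) tgt.simps(1) add.right_neutral add_Suc_right)
    then show ?thesis using PosX e pw_PosX_factor[of c d a b] by (simp add: osign_def del: pw.simps)
  next
    case NegX
    then obtain a b c d where "xm = [a, b]" "zm = [c, d]" using l length_two by (metis list.size(3,4) src.simps(2) tgt.simps(2) add.right_neutral add_Suc_right)
    then show ?thesis using NegX e pw_NegX_factor[of d c b a] by (simp add: osign_def add.commute del: pw.simps)
  next
    case CupUD
    then obtain c d where "xm = []" "zm = [c, d]" using l length_two[of zm] by auto
    then show ?thesis using CupUD eqd[of c d] by (simp add: lo_def hi_def)
  next
    case CupDU
    then obtain c d where "xm = []" "zm = [c, d]" using l length_two[of zm] by auto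
    then show ?thesis using CupDU eqd[of c d] Qm(1)[of c] by (simp add: lo_def hi_def P01 mult_ac)
  next
    case CapUD
    then obtain c d where "zm = []" "xm = [c, d]" using l length_two[of xm] by auto
    then show ?thesis using CapUD eqd[of c d] Qm(2)[of c] by (simp add: lo_def hi_def P01 mult_ac)
  next
    case CapDU
    then obtain c d where "zm = []" "xm = [c, d]" using l length_two[of xm] by auto
    then show ?thesis using CapDU eqd[of c d] by (simp add: lo_def hi_def)
  qed
  moreover have "lo (y @ y') = lo y @ lo y'" "hi (y @ y') = hi y @ hi y'" "length (lo y) = length y" "length (hi y) = length y" for y y'
    by (simp_all add: lo_def hi_def)
  ultimately show ?thesis unfolding x z by (simp add: l)
qed

text \<open>Borrows are the only source of change, and they increase the sum.\<close>

lemma slice_monotone: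
  assumes len: "length x = length (u @ src G @ w)" "length z = length (u @ tgt G @ w)"
    and nz: "sw P (u, G, w) z x \<noteq> 0"
  shows "ssum fdig (u @ src G @ w) x \<le> ssum fdig (u @ tgt G @ w) z"
proof -
  obtain xu xm zm xw where s: "x = xu @ xm @ xw" "z = xu @ zm @ xw" "length xu = length u"
    "length xm = length (src G)" "length zm = length (tgt G)" "length xw = length w" "pw P G zm xm \<noteq> 0"
    by (rule sw_nonzeroE[OF nz len])
  have "0 \<le> cross_gain fdig (u, G, w) x z"
  proof (cases "is_crossing G")
    case True
    obtain a b c d where abcd: "xm = [a, b]" "zm = [c, d]" "c + d = a + b"
      "G = PosX \<longrightarrow> b \<le> c \<and> wpos P a b (c - b) \<noteq> 0" "G = NegX \<longrightarrow> a \<le> d \<and> wneg P b a (d - a) \<noteq> 0"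
      by (rule pw_crossing_nonzero[OF True s(7)])
    have "fdig a + fdig b \<le> fdig c + fdig d"
    proof (cases "G = PosX")
      case True
      then have "fcoef P (c - b) b \<noteq> 0" "c - b \<le> a" "a - (c - b) = d" "b + (c - b) = c"
        using abcd by (auto simp: wpos_def)
      then show ?thesis using crossing_digits(2)[of "c - b" a b] by (simp add: fdig_def)
    next
      case False
      then have "G = NegX" using True by (cases G) auto
      then have "fcoef P (d - a) a \<noteq> 0" "d - a \<le> b" "b - (d - a) = c" "a + (d - a) = d"
        using abcd by (auto simp: wneg_def gcoef_def)
      then show ?thesis using crossing_digits(2)[of "d - a" b a] by (simp add: fdig_def)
    qed
    moreover have "x ! length u = a" "x ! Suc (length u) = b" "z ! length u = c" "z ! Suc (length u) = d"
      using s abcd by (auto simp: nth_append)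
    ultimately show ?thesis using True by simp
  qed simp
  then show ?thesis using ssum_slice[OF nz len] by simp
qed

text \<open>Crossings with parameters \<open>P0\<close> conserve the sum of their own labels, which
  here are the last digits. Thus labellings violating conservation contribute nothing to the product
  side.\<close>

lemma slice_lo_conserve:
  assumes len: "length x = length (u @ src G @ w)" "length z = length (u @ tgt G @ w)"
    and nz: "sw P0 (u, G, w) (lo z) (lo x) \<noteq> 0"
  shows "ssum fdig (u @ tgt G @ w) z = ssum fdig (u @ src G @ w) x"
proof -
  have len': "length (lo x) = length (u @ src G @ w)" "length (lo z) = length (u @ tgt G @ w)"
    using len by (auto simp: lo_def)
  obtain xu xm zm xw where s: "lo x = xu @ xm @ xw" "lo z = xu @ zm @ xw" "length xu = length u"
    "length xm = length (src G)" "length zm = length (tgt G)" "length xw = length w" "pw P0 G zm xm \<noteq> 0"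
    by (rule sw_nonzeroE[OF nz len'])
  have "cross_gain int (u, G, w) (lo x) (lo z) = 0"
  proof (cases "is_crossing G")
    case True
    obtain a b c d where abcd: "xm = [a, b]" "zm = [c, d]" "c + d = a + b"
      by (rule pw_crossing_nonzero[OF True s(7)])
    then have "lo x ! length u = a" "lo x ! Suc (length u) = b" "lo z ! length u = c" "lo z ! Suc (length u) = d"
      using s by (auto simp: nth_append)
    then show ?thesis using True abcd(3) by simp
  qed simp
  moreover have "ssum int s (lo y) = ssum fdig s y" for s y
    by (induction fdig s y rule: ssum.induct) (auto simp: lo_def fdig_def)
  ultimately show ?thesis using ssum_slice[OF nz len', of int] by simp
qed

lemma labels_lo_hi: "bij_betw (\<lambda>x. (lo x, hi x)) (labels (r * M) k) (labels r k \<times> labels M k)"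
proof (rule bij_betwI[where g = "\<lambda>(y, y'). map2 (\<lambda>a b. a + r * b) y y'"])
  show "(\<lambda>x. (lo x, hi x)) \<in> labels (r * M) k \<rightarrow> labels r k \<times> labels M k"
    using r_pos by (auto simp: labels_def lo_def hi_def mult.commute[of r] intro!: less_mult_imp_div_less)
  show "(\<lambda>(y, y'). map2 (\<lambda>a b. a + r * b) y y') \<in> labels r k \<times> labels M k \<rightarrow> labels (r * M) k"
  proof clarify
    fix y y' assume "y \<in> labels r k" "y' \<in> labels M k"
    then show "map2 (\<lambda>a b. a + r * b) y y' \<in> labels (r * M) k"
      using mult_add_less[of _ M _ r] by (auto simp: labels_def set_zip subset_iff add.commute mult.commute[of r])
  qed
  show "(\<lambda>(y, y'). map2 (\<lambda>a b. a + r * b) y y') (lo x, hi x) = x" for x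
    by (auto simp: lo_def hi_def intro: nth_equalityI)
  fix y assume "y \<in> labels r k \<times> labels M k"
  then have "length (fst y) = k" "length (snd y) = k" "\<And>i. i < k \<Longrightarrow> fst y ! i < r"
    using nth_mem by (fastforce simp: labels_def)+
  then show "(lo ((\<lambda>(y, y'). map2 (\<lambda>a b. a + r * b) y y') y), hi ((\<lambda>(y, y'). map2 (\<lambda>a b. a + r * b) y y') y)) = y"
    using r_pos by (cases y) (auto simp: lo_def hi_def intro!: nth_equalityI)
qed

text \<open>The vanishing statement is there for the induction: intermediate labels of smaller digit
  sum are killed by the first slice, those of larger digit sum by the rest of the diagram, and only
  conserved sums remain to be factored.\<close>

lemma Zsum_factor:
  assumes "tangle s D t" "length x = length s" "length y = length t"
  shows "(ssum fdig t y < ssum fdig s x \<longrightarrow> Zsum (r * M) P D x y = 0) \<and>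
    (ssum fdig t y = ssum fdig s x \<longrightarrow>
      Zsum (r * M) P D x y = Zsum r P0 D (lo x) (lo y) * Zsum M P1 D (hi x) (hi y))"
  using assms
proof (induction D arbitrary: s x)
  case Nil
  have "lo x = lo y \<and> hi x = hi y \<longleftrightarrow> x = y"
  proof
    assume a: "lo x = lo y \<and> hi x = hi y"
    show "x = y"
    proof (rule nth_equalityI)
      show l: "length x = length y" using a by (metis length_map lo_def)
      fix k assume k: "k < length x"
      have "x ! k mod r = y ! k mod r" "x ! k div r = y ! k div r"
        using a k l unfolding lo_def hi_def by (metis nth_map)+
      then show "x ! k = y ! k" by (metis digit_split)
    qed
  qed simp
  then show ?case using Nil by auto
next
  case (Cons sl D)
  obtain u G w where sl: "sl = (u, G, w)" by (cases sl)
  define k where "k = length (u @ tgt G @ w)"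
  define F where "F z = ssum fdig (u @ tgt G @ w) z" for z
  have T: "tangle (u @ tgt G @ w) D t" and s: "s = u @ src G @ w" using Cons.prems by (auto simp: sl)
  have lx: "length x = length (u @ src G @ w)" using Cons.prems s by simp
  have lz: "length z = length (u @ tgt G @ w)" if "z \<in> labels (r * M) k" for z
    using labels_length[OF that] by (simp add: k_def)
  have IH: "F z > ssum fdig t y \<Longrightarrow> Zsum (r * M) P D z y = 0"
    "F z = ssum fdig t y \<Longrightarrow> Zsum (r * M) P D z y = Zsum r P0 D (lo z) (lo y) * Zsum M P1 D (hi z) (hi y)"
    if "z \<in> labels (r * M) k" for z
    using Cons.IH[OF T lz[OF that] Cons.prems(3)] unfolding F_def by auto
  have mono: "sw P (u, G, w) z x = 0" if "z \<in> labels (r * M) k" "F z < ssum fdig s x" for z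
    using slice_monotone[OF lx lz[OF that(1)]] that(2) unfolding F_def s by (metis not_less)
  have Z: "Zsum (r * M) P (sl # D) x y = (\<Sum>z\<in>labels (r * M) k. sw P (u, G, w) z x * Zsum (r * M) P D z y)"
    unfolding sl Zsum.simps k_def ..
  show ?case
  proof (intro conjI impI)
    assume lt: "ssum fdig t y < ssum fdig s x"
    show "Zsum (r * M) P (sl # D) x y = 0"
      unfolding Z
    proof (rule sum.neutral, intro ballI)
      fix z assume z: "z \<in> labels (r * M) k"
      show "sw P (u, G, w) z x * Zsum (r * M) P D z y = 0"
        using mono[OF z] IH(1)[OF z] lt by (cases "F z < ssum fdig s x") (auto simp del: sw.simps)
    qed
  next
    assume eq: "ssum fdig t y = ssum fdig s x"
    have "Zsum r P0 (sl # D) (lo x) (lo y) * Zsum M P1 (sl # D) (hi x) (hi y)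
       = (\<Sum>(z0, z1)\<in>labels r k \<times> labels M k.
           (sw P0 (u, G, w) z0 (lo x) * Zsum r P0 D z0 (lo y)) * (sw P1 (u, G, w) z1 (hi x) * Zsum M P1 D z1 (hi y)))"
      unfolding sl Zsum.simps k_def by (simp only: sum_product sum.cartesian_product)
    also have "\<dots> = (\<Sum>z\<in>labels (r * M) k.
           (sw P0 (u, G, w) (lo z) (lo x) * Zsum r P0 D (lo z) (lo y)) * (sw P1 (u, G, w) (hi z) (hi x) * Zsum M P1 D (hi z) (hi y)))"
      using sum.reindex_bij_betw[OF labels_lo_hi, where M1 = M and k1 = k and g = "\<lambda>(z0, z1). (sw P0 (u, G, w) z0 (lo x) * Zsum r P0 D z0 (lo y)) * (sw P1 (u, G, w) z1 (hi x) * Zsum M P1 D z1 (hi y))"]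
      by (simp del: sw.simps)
    also have "\<dots> = (\<Sum>z\<in>labels (r * M) k. sw P (u, G, w) z x * Zsum (r * M) P D z y)"
    proof (rule sum.cong[OF refl])
      fix z assume z: "z \<in> labels (r * M) k"
      show "(sw P0 (u, G, w) (lo z) (lo x) * Zsum r P0 D (lo z) (lo y)) * (sw P1 (u, G, w) (hi z) (hi x) * Zsum M P1 D (hi z) (hi y))
        = sw P (u, G, w) z x * Zsum (r * M) P D z y"
      proof (cases "F z = ssum fdig s x")
        case True
        then have "sw P (u, G, w) z x = sw P0 (u, G, w) (lo z) (lo x) * sw P1 (u, G, w) (hi z) (hi x)"
          unfolding F_def s by (intro slice_factor[OF lx lz[OF z]])
        then show ?thesis using IH(2)[OF z] True eq by (simp add: mult_ac del: sw.simps)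
      next
        case False
        then have "sw P0 (u, G, w) (lo z) (lo x) = 0"
          using slice_lo_conserve[OF lx lz[OF z]] unfolding F_def s by blast
        moreover have "sw P (u, G, w) z x * Zsum (r * M) P D z y = 0"
          using mono[OF z] IH(1)[OF z] False eq by (cases "F z < ssum fdig s x") (auto simp del: sw.simps)
        ultimately show ?thesis by (simp del: sw.simps)
      qed
    qed
    finally show "Zsum (r * M) P (sl # D) x y = Zsum r P0 (sl # D) (lo x) (lo y) * Zsum M P1 (sl # D) (hi x) (hi y)"
      unfolding Z by simp
  qed
qed

lemma Zsum_factor_knot:
  assumes "tangle [Up] D [Up]"
  shows "Zsum (r * M) P D [0] [0] = Zsum r P0 D [0] [0] * Zsum M P1 D [0] [0]"
  using Zsum_factor[OF assms, of "[0]" "[0]" M] by (simp add: lo_def hi_def)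

end

section \<open>Ring homomorphisms\<close>

definition rhom :: "('a::comm_ring_1 \<Rightarrow> 'b::comm_ring_1) \<Rightarrow> bool" where
  "rhom \<phi> \<longleftrightarrow> \<phi> 1 = 1 \<and> (\<forall>a b. \<phi> (a + b) = \<phi> a + \<phi> b) \<and> (\<forall>a b. \<phi> (a * b) = \<phi> a * \<phi> b)"

lemma rhomD:
  assumes "rhom \<phi>"
  shows "\<phi> 1 = 1" "\<phi> (a + b) = \<phi> a + \<phi> b" "\<phi> (a * b) = \<phi> a * \<phi> b" "\<phi> 0 = 0"
    "\<phi> (- a) = - \<phi> a" "\<phi> (a - b) = \<phi> a - \<phi> b" "\<phi> (a ^ n) = \<phi> a ^ n"
    "\<phi> (sum f S) = (\<Sum>x\<in>S. \<phi> (f x))" "\<phi> (prod g S) = (\<Prod>x\<in>S. \<phi> (g x))"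
proof -
  show 1: "\<phi> 1 = 1" and a: "\<phi> (a + b) = \<phi> a + \<phi> b" and m: "\<phi> (a * b) = \<phi> a * \<phi> b" for a b
    using assms by (auto simp: rhom_def)
  show z: "\<phi> 0 = 0" using a[of 0 0] by simp
  show n: "\<phi> (- a) = - \<phi> a" for a using a[of a "- a"] z by (simp add: eq_neg_iff_add_eq_0 add.commute)
  show "\<phi> (a - b) = \<phi> a - \<phi> b" using a[of a "- b"] n by simp
  show "\<phi> (a ^ n) = \<phi> a ^ n" by (induction n) (auto simp: 1 m)
  show "\<phi> (sum f S) = (\<Sum>x\<in>S. \<phi> (f x))" by (induction S rule: infinite_finite_induct) (auto simp: z a)
  show "\<phi> (prod g S) = (\<Prod>x\<in>S. \<phi> (g x))" by (induction S rule: infinite_finite_induct) (auto simp: 1 m)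
qed

lemma rhom_comp: "rhom \<phi> \<Longrightarrow> rhom \<psi> \<Longrightarrow> rhom (\<lambda>x. \<psi> (\<phi> x))"
  by (simp add: rhom_def)

context
  fixes \<phi> :: "'a::comm_ring_1 \<Rightarrow> 'b::comm_ring_1"
  assumes h: "rhom \<phi>"
begin

lemma gb_hom: "\<phi> (gb Q n k) = gb (\<phi> Q) n k"
  by (induction Q n k rule: gb.induct) (simp_all add: rhomD[OF h])

lemma fcoef_hom: "\<phi> (fcoef P n j) = fcoef (map_par \<phi> P) n j"
  by (cases P) (simp add: fcoef_def rhomD[OF h] gb_hom)

lemma pw_hom: "\<phi> (pw P G z x) = pw (map_par \<phi> P) G z x"
proof -
  have s: "\<phi> (pT P) = pT (map_par \<phi> P)" "\<phi> (pTi P) = pTi (map_par \<phi> P)" "\<phi> (pA P) = pA (map_par \<phi> P)"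
    "\<phi> (pAi P) = pAi (map_par \<phi> P)" "\<phi> (pQ P) = pQ (map_par \<phi> P)" "\<phi> (pQi P) = pQi (map_par \<phi> P)"
    "\<phi> (pG P) = pG (map_par \<phi> P)" "\<phi> (pGi P) = pGi (map_par \<phi> P)"
    by (cases P; simp)+
  show ?thesis
    by (cases "(P, G, z, x)" rule: pw.cases)
       (simp_all add: wpos_def wneg_def gcoef_def rhomD[OF h] fcoef_hom s)
qed

text \<open>A state sum is a polynomial expression in its parameters. The specializations at A =
  q^n, at roots of unity and under the substitution of A^r for A are all obtained from it.\<close>

lemma Zsum_hom: "\<phi> (Zsum N P D x y) = Zsum N (map_par \<phi> P) D x y"
proof (induction D arbitrary: x)
  case (Cons sl D)
  obtain u G w where sl: "sl = (u, G, w)" by (cases sl)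
  have "\<phi> (sw P sl z x) = sw (map_par \<phi> P) sl z x" for z
    by (simp add: sl pw_hom rhomD[OF h])
  then show ?case by (simp add: sl Cons rhomD[OF h] del: sw.simps)
qed (simp add: rhomD[OF h])

lemma valid_hom: "valid P \<Longrightarrow> valid (map_par \<phi> P)"
  by (cases P) (simp add: valid_def rhomD(1,3)[OF h, symmetric])

end

section \<open>The operators of the Reshetikhin--Turaev construction\<close>

lemma mat_inv_eq:
  assumes "U \<in> carrier_mat n n" "V \<in> carrier_mat n n" "U * V = 1\<^sub>m n" "V * U = 1\<^sub>m n"
  shows "mat_inv n U = (V :: 'a::comm_ring_1 mat)"
proof -
  interpret ring "ring_mat TYPE('a) n ()" by (rule ring_mat)
  show ?thesis unfolding mat_inv_def
    by (rule inv_char) (use assms in \<open>simp_all add: ring_mat_simps\<close>)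
qed

lemma swap_mat_mult:
  assumes "dim_row (M :: 'a::comm_ring_1 mat) = N * N" "c < N" "d < N" "s < dim_col M"
  shows "(swap_mat N * M) $$ (c * N + d, s) = M $$ (d * N + c, s)"
proof -
  have cd: "c * N + d < N * N" "d * N + c < N * N" using assms mult_add_less by blast+
  have "(swap_mat N * M) $$ (c * N + d, s)
      = (\<Sum>k<N * N. (if k = d * N + c then 1 else 0) * M $$ (k, s))"
    using assms cd
  proof (simp add: scalar_prod_def swap_mat_def atLeast0LessThan, intro sum.cong refl, goal_cases)
    case (1 k)
    have "d = k div N \<and> c = k mod N \<longleftrightarrow> k = d * N + c"
      using assms mult_add_div[of c N d] by auto
    then show ?case using assms by (auto simp: mult_add_div)
  qed
  also have "\<dots> = M $$ (d * N + c, s)"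
    using sum_delta_eq(2)[OF cd(2), of "\<lambda>_. 1" "\<lambda>k. M $$ (k, s)"] by simp
  finally show ?thesis .
qed

lemma swap_swap: "swap_mat N * swap_mat N = (1\<^sub>m (N * N) :: 'a::comm_ring_1 mat)"
proof (rule eq_mat_pairI[where N = N])
  fix a b c d assume l: "a < N" "b < N" "c < N" "d < N"
  have ll: "c * N + d < N * N" "a * N + b < N * N" "d * N + c < N * N" using l mult_add_less by blast+
  have "(swap_mat N * swap_mat N :: 'a mat) $$ (c * N + d, a * N + b) = swap_mat N $$ (d * N + c, a * N + b)"
    using l ll by (intro swap_mat_mult) (auto simp: swap_mat_def)
  also have "\<dots> = (if d = b \<and> c = a then 1 else 0)"
    using l ll by (simp add: swap_mat_def mult_add_div)
  also have "\<dots> = 1\<^sub>m (N * N) $$ (c * N + d, a * N + b)"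
    using mult_add_div[OF l(4), of c] mult_add_div[OF l(2), of a] ll by (auto split: if_splits)
  finally show "(swap_mat N * swap_mat N :: 'a mat) $$ (c * N + d, a * N + b) = 1\<^sub>m (N * N) $$ (c * N + d, a * N + b)" .
qed (auto simp: swap_mat_def)

text \<open>Only the entries of the R-matrix on the support of a jump have to be compared, in
  \<open>w\<close>. The negative crossing then follows from uniqueness of inverses, since
  \<open>pmat N P NegX\<close> inverts the positive one.\<close>

lemma piece_op_eq_pmat:
  fixes P :: "'a::comm_ring_1 par"
  assumes P: "valid P"
    and E: "\<And>m. m < N \<Longrightarrow> E m = mat N N (\<lambda>(k, i). if i = k + m then 1 else 0)"
    and F: "\<And>m. m < N \<Longrightarrow> F m = mat N N (\<lambda>(k, i). if k = m + i then \<phi> m i else 0)"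
    and w: "\<And>a b m. a < N \<Longrightarrow> m \<le> a \<Longrightarrow> b + m < N \<Longrightarrow> \<theta> (a - m) (b + m) * (c m * \<phi> m b) = wpos P a b m"
    and g: "g = mat N N (\<lambda>(k, i). if k = i then pG P * pQi P ^ i else 0)"
  shows "piece_op N (r_matrix N \<theta> c E F) g G = pmat N P G"
proof -
  define R where "R = r_matrix N \<theta> c E F"
  have R_carrier: "R \<in> carrier_mat (N * N) (N * N)" by (simp add: R_def r_matrix_def)
  have sw_carrier: "swap_mat N \<in> carrier_mat (N * N) (N * N)" by (simp add: swap_mat_def)
  have p_carrier: "pmat N P PosX \<in> carrier_mat (N * N) (N * N)" "pmat N P NegX \<in> carrier_mat (N * N) (N * N)"
    by (rule carrier_matI; simp)+
  have R: "swap_mat N * R = pmat N P PosX"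
  proof (rule eq_mat_pairI[where N = N])
    fix a b c' d assume l: "a < N" "b < N" "c' < N" "d < N"
    have ll: "c' * N + d < N * N" "a * N + b < N * N" "d * N + c' < N * N" using l mult_add_less by blast+
    have "(swap_mat N * R) $$ (c' * N + d, a * N + b) = R $$ (d * N + c', a * N + b)"
      using l ll R_carrier by (intro swap_mat_mult) auto
    also have "\<dots> = \<theta> d c' * (\<Sum>m<N. c m * ((if a = d + m then 1 else 0) * (if c' = m + b then \<phi> m b else 0)))"
      using l ll by (simp add: R_def r_matrix_def mult_add_div index_kron E F)
    also have "\<dots> = pw P PosX [c', d] [a, b]"
    proof (cases "b \<le> c' \<and> c' + d = a + b")
      case True
      then have "(\<Sum>m<N. c m * ((if a = d + m then 1 else 0) * (if c' = m + b then \<phi> m b else 0)))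
          = (\<Sum>m\<in>{c' - b}. c m * \<phi> m b)"
        using l by (intro sum.mono_neutral_cong_right) auto
      moreover have "a - (c' - b) = d" "b + (c' - b) = c'" "c' - b \<le> a" using True by auto
      ultimately show ?thesis using True w[of a "c' - b" b] l by simp
    next
      case False
      then have "(\<Sum>m<N. c m * ((if a = d + m then 1 else 0) * (if c' = m + b then \<phi> m b else 0))) = 0"
        by (intro sum.neutral) auto
      then show ?thesis using False by auto
    qed
    also have "\<dots> = pmat N P PosX $$ (c' * N + d, a * N + b)"
      using l by (intro index_pmat_pair(1)[symmetric])
    finally show "(swap_mat N * R) $$ (c' * N + d, a * N + b) = pmat N P PosX $$ (c' * N + d, a * N + b)" .
  qed (use R_carrier sw_carrier in auto)
  note as = assoc_mult_mat[of _ "N * N" "N * N" _ "N * N" _ "N * N"]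
  have R': "R = swap_mat N * pmat N P PosX"
    unfolding R[symmetric] using as[OF sw_carrier sw_carrier R_carrier] swap_swap[of N] R_carrier by (metis left_mult_one_mat)
  have inv: "mat_inv (N * N) R = pmat N P NegX * swap_mat N"
  proof (rule mat_inv_eq)
    have c: "swap_mat N * pmat N P PosX \<in> carrier_mat (N * N) (N * N)" "pmat N P NegX * swap_mat N \<in> carrier_mat (N * N) (N * N)"
      using sw_carrier p_carrier mult_carrier_mat by blast+
    show "R \<in> carrier_mat (N * N) (N * N)" "pmat N P NegX * swap_mat N \<in> carrier_mat (N * N) (N * N)"
      using R_carrier c by auto
    show "R * (pmat N P NegX * swap_mat N) = 1\<^sub>m (N * N)"
    proof -
      have "R * (pmat N P NegX * swap_mat N) = swap_mat N * (pmat N P PosX * (pmat N P NegX * swap_mat N))"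
        unfolding R' by (rule as[OF sw_carrier p_carrier(1) c(2)])
      also have "pmat N P PosX * (pmat N P NegX * swap_mat N) = pmat N P PosX * pmat N P NegX * swap_mat N"
        by (rule as[OF p_carrier sw_carrier, symmetric])
      also have "\<dots> = swap_mat N"
        unfolding pmat_PosX_mult_NegX[OF P] by (rule left_mult_one_mat[OF sw_carrier])
      finally show ?thesis unfolding swap_swap .
    qed
    show "pmat N P NegX * swap_mat N * R = 1\<^sub>m (N * N)"
      unfolding as[OF p_carrier(2) sw_carrier R_carrier] R by (rule pmat_NegX_mult_PosX[OF P])
  qed
  have neg: "mat_inv (N * N) R * swap_mat N = pmat N P NegX"
    unfolding inv as[OF p_carrier(2) sw_carrier sw_carrier] swap_swap by (rule right_mult_one_mat[OF p_carrier(2)])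
  have gi: "mat_inv N g = mat N N (\<lambda>(k, i). if k = i then pGi P * pQ P ^ i else 0)"
  proof (rule mat_inv_eq)
    have e: "pG P * pQi P ^ i * (pGi P * pQ P ^ i) = 1" for i
    proof -
      have "pG P * pQi P ^ i * (pGi P * pQ P ^ i) = (pG P * pGi P) * (pQ P ^ i * pQi P ^ i)" by (simp only: mult_ac)
      then show ?thesis using G_inv[OF P] Q_cancel[OF P] by simp
    qed
    have e': "pGi P * pQ P ^ i * (pG P * pQi P ^ i) = 1" for i using e[of i] by (simp only: mult.commute)
    have d: "mat N N (\<lambda>(k, i). if k = i then f i else 0) * mat N N (\<lambda>(k, i). if k = i then f' i else 0) = 1\<^sub>m N"
      if "\<And>i. f i * f' i = (1::'a)" for f f'
    proof (rule eq_matI)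
      fix i j assume "i < dim_row (1\<^sub>m N :: 'a mat)" "j < dim_col (1\<^sub>m N :: 'a mat)"
      then have ij: "i < N" "j < N" by auto
      have "(mat N N (\<lambda>(k, i). if k = i then f i else 0) * mat N N (\<lambda>(k, i). if k = i then f' i else 0)) $$ (i, j)
          = (\<Sum>k<N. (if i = k then f k else 0) * (if k = j then f' j else 0))"
        using ij by (simp add: scalar_prod_def atLeast0LessThan)
      also have "\<dots> = f i * (if i = j then f' j else 0)"
        by (rule sum_delta_eq(1)[OF ij(1)])
      finally show "(mat N N (\<lambda>(k, i). if k = i then f i else 0) * mat N N (\<lambda>(k, i). if k = i then f' i else 0)) $$ (i, j)
          = (1\<^sub>m N :: 'a mat) $$ (i, j)" using ij that by simp
    qed auto
    show "g * mat N N (\<lambda>(k, i). if k = i then pGi P * pQ P ^ i else 0) = 1\<^sub>m N"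
      "mat N N (\<lambda>(k, i). if k = i then pGi P * pQ P ^ i else 0) * g = 1\<^sub>m N"
      unfolding g by (rule d, rule e)+ (rule d, rule e')
  qed (auto simp: g)
  have dm: "p div N < N" "p mod N < N" if "p < N * N" for p using div_mod_less[OF that] by auto
  show ?thesis
  proof (cases G)
    case PosX then show ?thesis using R by (simp add: R_def)
  next
    case NegX then show ?thesis using neg by (simp add: R_def)
  next
    case CupUD then show ?thesis by (auto simp: pmat_def intro!: eq_matI)
  next
    case CupDU then show ?thesis by (auto simp: pmat_def gi dm intro!: eq_matI)
  next
    case CapUD then show ?thesis by (auto simp: pmat_def g dm intro!: eq_matI)
  next
    case CapDU then show ?thesis by (auto simp: pmat_def intro!: eq_matI)
  qed
qed

lemma pow_shift_mat:
  fixes f :: "nat \<Rightarrow> 'a::comm_ring_1"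
  shows "mat N N (\<lambda>(k, i). if i = k + 1 then 1 else 0) ^\<^sub>m m = (mat N N (\<lambda>(k, i). if i = k + m then 1 else 0) :: 'a mat)"
    and "mat N N (\<lambda>(k, i). if k = i + 1 then f i else 0) ^\<^sub>m m
      = mat N N (\<lambda>(k, i). if k = m + i then (\<Prod>t<m. f (i + t)) else 0)"
proof -
  show "mat N N (\<lambda>(k, i). if i = k + 1 then 1 else 0) ^\<^sub>m m = (mat N N (\<lambda>(k, i). if i = k + m then 1 else 0) :: 'a mat)"
  proof (induction m)
    case (Suc m)
    show ?case unfolding pow_mat.simps Suc
    proof (rule eq_matI, goal_cases)
      case (1 i j)
      then have ij: "i < N" "j < N" by auto
      have "(mat N N (\<lambda>(k, i). if i = k + m then 1 else 0) * mat N N (\<lambda>(k, i). if i = k + 1 then 1 else 0) :: 'a mat) $$ (i, j)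
          = (\<Sum>k<N. (if k = i + m then 1 else 0) * (if j = k + 1 then 1 else 0))"
        using ij by (simp add: scalar_prod_def atLeast0LessThan)
      also have "\<dots> = (if j = i + Suc m then 1 else 0)"
      proof (cases "i + m < N")
        case True
        then show ?thesis using sum_delta_eq(2)[OF True, of "\<lambda>_. 1" "\<lambda>k. if j = k + 1 then 1 else 0"] by simp
      next
        case False
        then show ?thesis using ij by (auto intro!: sum.neutral)
      qed
      finally show ?case using ij by simp
    qed auto
  qed (auto intro!: eq_matI)
  show "mat N N (\<lambda>(k, i). if k = i + 1 then f i else 0) ^\<^sub>m m
      = mat N N (\<lambda>(k, i). if k = m + i then (\<Prod>t<m. f (i + t)) else 0)"
  proof (induction m)
    case (Suc m)
    show ?case unfolding pow_mat.simps Suc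
    proof (rule eq_matI, goal_cases)
      case (1 i j)
      then have ij: "i < N" "j < N" by auto
      have "(mat N N (\<lambda>(k, i). if k = m + i then (\<Prod>t<m. f (i + t)) else 0) * mat N N (\<lambda>(k, i). if k = i + 1 then f i else 0)) $$ (i, j)
          = (\<Sum>k<N. (if i = m + k then (\<Prod>t<m. f (k + t)) else 0) * (if k = j + 1 then f j else 0))"
        using ij by (simp add: scalar_prod_def atLeast0LessThan)
      also have "\<dots> = (if i = Suc m + j then (\<Prod>t<Suc m. f (j + t)) else 0)"
      proof (cases "j + 1 < N")
        case True
        have p: "(\<Prod>t<Suc m. f (j + t)) = f j * (\<Prod>t<m. f (Suc (j + t)))"
          by (subst prod.lessThan_Suc_shift) simp
        show ?thesis using sum_delta_eq(4)[OF True, of "\<lambda>k. if i = m + k then (\<Prod>t<m. f (k + t)) else 0" "\<lambda>_. f j"] p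
          by (auto simp: mult.commute simp del: prod.lessThan_Suc)
      next
        case False
        then show ?thesis using ij by (auto intro!: sum.neutral)
      qed
      finally show ?case using ij by simp
    qed auto
  qed (auto intro!: eq_matI)
qed

lemma gb_prod: "(\<Prod>i=1..m. 1 - Q ^ i) * gb Q (m + b) m = (\<Prod>t<m. 1 - Q ^ (b + 1 + t))"
proof (induction m)
  case (Suc m)
  have "(\<Prod>i=1..Suc m. 1 - Q ^ i) * gb Q (Suc m + b) (Suc m)
      = (\<Prod>i=1..m. 1 - Q ^ i) * ((1 - Q ^ Suc m) * gb Q (Suc (m + b)) (Suc m))"
    by (simp del: gb.simps power_Suc add: mult_ac)
  also have "\<dots> = ((\<Prod>i=1..m. 1 - Q ^ i) * gb Q (m + b) m) * (1 - Q ^ Suc (m + b))"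
    unfolding gb_Suc_Suc_prod by (simp only: mult_ac)
  also have "\<dots> = (\<Prod>t<Suc m. 1 - Q ^ (b + 1 + t))" unfolding Suc by (simp add: add_ac)
  finally show ?case .
qed simp

text \<open>Each bracket is {i} = -q^(-i) (1 - Q^i), and the powers of q collected on the two sides
  differ by q^(mb). It relates \<open>gb\<close> to the quantum integers of the definitions without
  dividing by any of them.\<close>

lemma qbr_gb:
  fixes pw :: "int \<Rightarrow> 'a::idom_divide"
  assumes add: "\<And>a b. pw (a + b) = pw a * pw b" and zero: "pw 0 = 1"
  shows "(\<Prod>i=1..m. qbr pw (int i)) * gb (pw 2) (m + b) m = pw (int (m * b)) * (\<Prod>t<m. qbr pw (int (b + 1 + t)))"
proof -
  have mult: "pw (int k * a) = pw a ^ k" for k a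
    by (induction k) (simp_all add: zero add distrib_right)
  have q: "qbr pw (int i) = - pw (- int i) * (1 - pw 2 ^ i)" for i
  proof -
    have "pw (- int i) * pw 2 ^ i = pw (int i)"
      unfolding mult[symmetric] add[symmetric] by simp
    then show ?thesis by (simp add: qbr_def algebra_simps)
  qed
  have e: "(\<Prod>i=1..m. - pw (- int i)) = pw (int (m * b)) * (\<Prod>t<m. - pw (- int (b + 1 + t)))"
  proof (induction m)
    case (Suc m)
    have 1: "pw (- int (Suc m)) = pw (int b) * pw (- int (b + 1 + m))"
      unfolding add[symmetric] by (rule arg_cong[where f = pw]) simp
    have 2: "pw (int (Suc m * b)) = pw (int (m * b)) * pw (int b)"
      unfolding add[symmetric] by (rule arg_cong[where f = pw]) (simp add: algebra_simps)
    have "(\<Prod>i=1..Suc m. - pw (- int i)) = (\<Prod>i=1..m. - pw (- int i)) * - pw (- int (Suc m))" by simp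
    also have "\<dots> = pw (int (Suc m * b)) * ((\<Prod>t<m. - pw (- int (b + 1 + t))) * - pw (- int (b + 1 + m)))"
      unfolding Suc 1 2 by (simp only: mult_ac mult_minus_left mult_minus_right)
    finally show ?case by (simp only: prod.lessThan_Suc)
  qed (simp add: zero)
  have "(\<Prod>i=1..m. qbr pw (int i)) * gb (pw 2) (m + b) m
      = (\<Prod>i=1..m. - pw (- int i)) * ((\<Prod>i=1..m. 1 - pw 2 ^ i) * gb (pw 2) (m + b) m)"
    unfolding q prod.distrib by (simp only: mult.assoc)
  also have "\<dots> = pw (int (m * b)) * (\<Prod>t<m. - pw (- int (b + 1 + t)) * (1 - pw 2 ^ (b + 1 + t)))"
    unfolding gb_prod e prod.distrib by (simp only: mult.assoc)
  finally show ?thesis unfolding q[symmetric] .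
qed

section \<open>Linear extensions of characters\<close>

text \<open>\<open>ev\<close>, \<open>subst_A\<close>, \<open>exp_series\<close> and
  \<open>aug\<close> all extend a character of the exponents linearly, so their multiplicativity is
  proved once for all.\<close>

definition plin :: "('c::comm_ring_1 \<Rightarrow> 'd::comm_ring_1) \<Rightarrow> ('k::comm_monoid_add \<Rightarrow> 'd) \<Rightarrow> ('k \<Rightarrow>\<^sub>0 'c) \<Rightarrow> 'd" where
  "plin f \<chi> p = (\<Sum>k\<in>Poly_Mapping.keys p. f (Poly_Mapping.lookup p k) * \<chi> k)"

lemma poly_mapping_induct_add [case_names zero single add]:
  fixes p :: "'k \<Rightarrow>\<^sub>0 'c::comm_ring_1"
  assumes "Q 0" "\<And>k c. Q (Poly_Mapping.single k c)" "\<And>a b. Q a \<Longrightarrow> Q b \<Longrightarrow> Q (a + b)"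
  shows "Q p"
proof (induction p rule: update_induct)
  case const
  show ?case by (rule assms(1))
next
  case (update p k v)
  have "Poly_Mapping.update k v p = p + Poly_Mapping.single k v"
    using update(1) by (intro poly_mapping_eqI)
      (auto simp: lookup_update lookup_add lookup_single not_in_keys_iff_lookup_eq_zero when_def)
  then show ?case using assms(2,3) update by simp
qed

lemma rhom_plin:
  fixes f :: "'c::comm_ring_1 \<Rightarrow> 'd::comm_ring_1" and \<chi> :: "'k::comm_monoid_add \<Rightarrow> 'd"
  assumes f: "rhom f" and \<chi>: "\<chi> 0 = 1" "\<And>j k. \<chi> (j + k) = \<chi> j * \<chi> k"
  shows "rhom (plin f \<chi>)" and plin_single: "plin f \<chi> (Poly_Mapping.single k c) = f c * \<chi> k"
proof -
  note fD = rhomD[OF f]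
  have sup: "plin f \<chi> p = (\<Sum>k\<in>S. f (Poly_Mapping.lookup p k) * \<chi> k)"
    if "finite S" "Poly_Mapping.keys p \<subseteq> S" for p S
    unfolding plin_def using that
    by (intro sum.mono_neutral_left) (auto simp: not_in_keys_iff_lookup_eq_zero fD)
  have add: "plin f \<chi> (a + b) = plin f \<chi> a + plin f \<chi> b" for a b
  proof -
    define S where "S = Poly_Mapping.keys a \<union> Poly_Mapping.keys b"
    have "Poly_Mapping.keys (a + b) \<subseteq> S" unfolding S_def by (rule Poly_Mapping.keys_add)
    then show ?thesis
      by (subst (1 2 3) sup[of S]) (auto simp: S_def lookup_add fD distrib_right sum.distrib)
  qed
  have single: "plin f \<chi> (Poly_Mapping.single k c) = f c * \<chi> k" for k c
    by (subst sup[of "{k}"]) auto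
  then show "plin f \<chi> (Poly_Mapping.single k c) = f c * \<chi> k" .
  have z: "plin f \<chi> 0 = 0" by (simp add: plin_def)
  have mult: "plin f \<chi> (a * b) = plin f \<chi> a * plin f \<chi> b" for a b
  proof (induction a rule: poly_mapping_induct_add)
    case (single k c)
    show ?case
    proof (induction b rule: poly_mapping_induct_add)
      case (single k' c')
      show ?case by (simp add: mult_single \<open>\<And>k c. plin f \<chi> (Poly_Mapping.single k c) = f c * \<chi> k\<close> fD \<chi> mult_ac)
    qed (simp_all add: z add distrib_left)
  qed (simp_all add: z add distrib_right)
  have one: "plin f \<chi> 1 = 1" using single[of 0 1] by (simp add: fD \<chi>)
  show "rhom (plin f \<chi>)" using add mult one by (simp add: rhom_def)
qed

lemma rhom_Amon0: "rhom (Amon 0)"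
  by (simp add: rhom_def Amon_def single_add mult_single)

lemma rhom_of_int: "rhom (of_int :: int \<Rightarrow> 'a::comm_ring_1)"
  by (simp add: rhom_def)

lemma rhom_const_t: "rhom const_t"
  by (simp add: rhom_def const_t_def single_add mult_single)

lemma Amon_mult: "Amon a x * Amon b y = Amon (a + b) (x * y)"
  by (simp add: Amon_def mult_single)

lemma Amon_power: "Amon a x ^ n = Amon (int n * a) (x ^ n)"
  by (induction n) (simp_all add: Amon_mult algebra_simps, simp add: Amon_def)

lemma zeta_nonzero [simp]: "zeta r \<noteq> 0"
  by (simp add: zeta_def)

lemma zeta_pow_add: "zeta_pow r (a + b) = zeta_pow r a * zeta_pow r b"
  by (simp add: power_int_add)

lemma ev_plin: "ev r = plin (\<lambda>c. Amon 0 (of_int c)) (\<lambda>(a, b). Amon b (zeta_pow r a))"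
  by (rule ext) (simp add: ev_def plin_def Amon_mult case_prod_unfold)

lemma rhom_ev: "rhom (ev r)" and ev_single: "ev r (Poly_Mapping.single (a, b) c) = Amon b (of_int c * zeta_pow r a)"
proof -
  have f: "rhom (\<lambda>c. Amon 0 (of_int c))" using rhom_comp[OF rhom_of_int rhom_Amon0] by simp
  have c: "(\<lambda>(a, b). Amon b (zeta_pow r a)) 0 = 1"
    "(\<lambda>(a, b). Amon b (zeta_pow r a)) (j + k) = (\<lambda>(a, b). Amon b (zeta_pow r a)) j * (\<lambda>(a, b). Amon b (zeta_pow r a)) k" for j k
    by (auto simp: Amon_mult zeta_pow_add case_prod_unfold zero_prod_def) (simp add: Amon_def)
  show "rhom (ev r)" unfolding ev_plin by (rule rhom_plin(1)[OF f c])
  show "ev r (Poly_Mapping.single (a, b) c) = Amon b (of_int c * zeta_pow r a)"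
    unfolding ev_plin plin_single[OF f c] by (simp add: Amon_mult)
qed

lemma subst_A_plin: "subst_A r = plin (Amon 0) (\<lambda>b. Amon (int r * b) 1)"
  by (rule ext) (simp add: subst_A_def plin_def Amon_mult)

lemma rhom_subst_A: "rhom (subst_A r)" and subst_A_Amon: "subst_A r (Amon b c) = Amon (int r * b) c"
proof -
  have c: "(\<lambda>b. Amon (int r * b) 1) 0 = 1"
    "(\<lambda>b. Amon (int r * b) 1) (j + k) = (\<lambda>b. Amon (int r * b) 1) j * (\<lambda>b. Amon (int r * b) 1) k" for j k
    by (simp_all add: Amon_mult distrib_left) (simp add: Amon_def)
  show "rhom (subst_A r)" unfolding subst_A_plin by (rule rhom_plin(1)[OF rhom_Amon0 c])
  show "subst_A r (Amon b c) = Amon (int r * b) c"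
    unfolding subst_A_plin unfolding Amon_def[of b c] plin_single[OF rhom_Amon0 c] by (simp add: Amon_mult)
qed

definition expc :: "int \<times> int \<Rightarrow> rat poly fps" where
  "expc = (\<lambda>(a, b). Abs_fps (\<lambda>n. smult (1 / fact n) ([:of_int a, of_int b:] ^ n)))"

lemma smult_sum': "smult c (sum f S) = (\<Sum>x\<in>S. smult c (f x))"
  by (induction S rule: infinite_finite_induct) (auto simp: smult_add_right)

lemma expc_add: "expc (j + k) = expc j * expc k"
proof (rule fps_ext)
  fix n
  obtain a b c d where jk: "j = (a, b)" "k = (c, d)" by (cases j, cases k) auto
  define u v :: "rat poly" where "u = [:of_int a, of_int b:]" and "v = [:of_int c, of_int d:]"
  have "fps_nth (expc (j + k)) n = smult (1 / fact n) ((u + v) ^ n)"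
    by (simp add: expc_def jk u_def v_def)
  also have "\<dots> = (\<Sum>i\<le>n. smult (1 / fact n) (of_nat (n choose i) * u ^ i * v ^ (n - i)))"
    unfolding binomial_ring by (rule smult_sum')
  also have "\<dots> = (\<Sum>i\<le>n. smult (1 / fact i) (u ^ i) * smult (1 / fact (n - i)) (v ^ (n - i)))"
  proof (rule sum.cong[OF refl], goal_cases)
    case (1 i)
    then have "(of_nat (n choose i) :: rat) / fact n = 1 / (fact i * fact (n - i))"
      by (simp add: binomial_fact)
    then show ?case by (simp add: of_nat_poly mult_ac)
  qed
  also have "\<dots> = fps_nth (expc j * expc k) n"
    by (simp add: fps_mult_nth expc_def jk u_def v_def atLeast0AtMost)
  finally show "fps_nth (expc (j + k)) n = fps_nth (expc j * expc k) n" .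
qed

lemma expc_zero: "expc 0 = 1"
proof (rule fps_ext)
  show "fps_nth (expc 0) n = fps_nth 1 n" for n by (cases n) (auto simp: expc_def zero_prod_def)
qed

lemma exp_series_plin: "exp_series = plin of_int expc"
  by (rule ext) (simp add: exp_series_def plin_def expc_def case_prod_unfold)

lemma rhom_exp_series: "rhom exp_series"
  and exp_series_single: "exp_series (Poly_Mapping.single k c) = of_int c * expc k"
  unfolding exp_series_plin
  by (rule rhom_plin(1)[OF rhom_of_int expc_zero expc_add], rule plin_single[OF rhom_of_int expc_zero expc_add])

definition eval_alpha :: "nat \<Rightarrow> rat poly fps \<Rightarrow> rat fps" where
  "eval_alpha k x = Abs_fps (\<lambda>n. poly (fps_nth x n) (of_nat k))"

lemma rhom_eval_alpha: "rhom (eval_alpha k)"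
  unfolding rhom_def
proof (intro conjI allI)
  show "eval_alpha k 1 = 1" by (rule fps_ext) (simp add: eval_alpha_def)
  show "eval_alpha k (a + b) = eval_alpha k a + eval_alpha k b" for a b
    by (rule fps_ext) (simp add: eval_alpha_def)
  show "eval_alpha k (a * b) = eval_alpha k a * eval_alpha k b" for a b
    by (rule fps_ext) (simp add: eval_alpha_def fps_mult_nth poly_sum)
qed

lemma eval_expc: "eval_alpha n (expc (a, b)) = q_h (a + b * int n)"
  by (rule fps_ext) (simp add: eval_alpha_def expc_def q_h_def poly_power mult.commute)

section \<open>Specializations of the generic weights\<close>

text \<open>The slots for q^(\<alpha>^2/2) and its inverse are filled with 1: the symbol does not
  belong to the ring, and it cancels for vanishing writhe.\<close>

definition PG :: "laurent_qA par" where
  "PG = Par (Poly_Mapping.single (2, 0) 1) (Poly_Mapping.single (- 2, 0) 1)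
     (Poly_Mapping.single (0, 1) 1) (Poly_Mapping.single (0, - 1) 1)
     (Poly_Mapping.single (0, 1) 1) (Poly_Mapping.single (0, - 1) 1) 1 1"

definition PJ :: "nat \<Rightarrow> rat fps par" where
  "PJ n = Par (q_h 2) (q_h (- 2)) (q_h (int n)) (q_h (- int n)) (q_h (int n)) (q_h (- int n))
     (fps_exp (of_nat n * of_nat n / 2)) (fps_exp (- (of_nat n * of_nat n / 2)))"

definition PA :: "nat \<Rightarrow> laurentA par" where
  "PA r = Par (Amon 0 (zeta_pow r 2)) (Amon 0 (zeta_pow r (- 2))) (Amon 1 1) (Amon (- 1) 1)
     (Amon (1 - int r) 1) (Amon (int r - 1) 1) 1 1"

text \<open>The ADO operator is defined with the formal symbol as outer variable; this variant keeps
  it until \<open>normT\<close> removes it.\<close>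

definition PAt :: "nat \<Rightarrow> (int \<Rightarrow>\<^sub>0 laurentA) par" where
  "PAt r = (case map_par const_t (PA r) of Par Q Qi A Ai G Gi T Ti \<Rightarrow>
     Par Q Qi A Ai G Gi (Poly_Mapping.single 1 1) (Poly_Mapping.single (- 1) 1))"

lemma valid_PG: "valid PG"
  by (simp add: valid_def PG_def mult_single) (simp add: zero_prod_def[symmetric])

lemma q_h_add: "q_h (a + b) = q_h a * q_h b"
  by (simp add: q_h_def fps_exp_add_mult)

lemma q_h_0 [simp]: "q_h 0 = 1"
  by (simp add: q_h_def)

lemma q_h_power: "q_h a ^ k = q_h (int k * a)"
  by (simp add: q_h_def fps_exp_power_mult)

lemma valid_PJ: "valid (PJ n)"
  by (simp add: valid_def PJ_def q_h_add[symmetric] fps_exp_add_mult[symmetric])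

lemma map_PG_jones: "map_par (\<lambda>p. eval_alpha n (exp_series p)) PG = normT (PJ n)"
  using rhomD(1)[OF rhom_eval_alpha] rhomD(1)[OF rhom_exp_series]
  by (simp add: PG_def PJ_def exp_series_single eval_expc)

lemma Amon_0_1: "Amon 0 1 = 1"
  by (simp add: Amon_def)

lemma valid_PA: "valid (PA r)"
proof -
  have "zeta_pow r 2 * zeta_pow r (- 2) = 1" unfolding zeta_pow_add[symmetric] by simp
  then show ?thesis by (simp add: valid_def PA_def Amon_mult Amon_0_1)
qed

lemma PAt_simps [simp]:
  "pQ (PAt r) = const_t (pQ (PA r))" "pQi (PAt r) = const_t (pQi (PA r))"
  "pA (PAt r) = const_t (pA (PA r))" "pAi (PAt r) = const_t (pAi (PA r))"
  "pG (PAt r) = const_t (pG (PA r))" "pGi (PAt r) = const_t (pGi (PA r))"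
  "pT (PAt r) = Poly_Mapping.single 1 1" "pTi (PAt r) = Poly_Mapping.single (- 1) 1"
  by (simp_all add: PAt_def PA_def)

lemma valid_PAt: "valid (PAt r)"
  using valid_PA[of r] by (simp add: valid_def rhomD(1,3)[OF rhom_const_t, symmetric] mult_single)

lemma normT_PAt: "normT (PAt r) = map_par const_t (PA r)"
  by (simp add: PAt_def PA_def rhomD(1)[OF rhom_const_t])

lemma zeta_pow_eq_1:
  assumes "0 < b" "b < r"
  shows "zeta_pow r (2 * int b) \<noteq> 1"
proof
  assume "zeta_pow r (2 * int b) = 1"
  then have "cis (of_int (2 * int b) * (pi / real r)) = 1" unfolding zeta_def cis_power_int .
  then have "cos (2 * real b * (pi / real r)) = 1" by (metis cis.simps(1) of_int_mult of_int_numeral of_int_of_nat_eq one_complex.simps(1))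
  then obtain k :: int where "2 * real b * (pi / real r) = of_int k * 2 * pi"
    by (auto simp: cos_one_2pi_int)
  then have "real b = of_int k * real r" using assms by (simp add: field_simps)
  then have "int b = k * int r" by (metis of_int_eq_iff of_int_mult of_int_of_nat_eq)
  then have "int r dvd int b" by simp
  then show False using assms by (simp add: nat_dvd_not_less)
qed

lemma zeta_pow_2r: "0 < r \<Longrightarrow> zeta_pow r (2 * int r) = 1"
  unfolding zeta_def cis_power_int by (simp add: complex_eq_iff)

text \<open>Over the complex numbers the nonzero factor 1 - Q^b can be cancelled in
  \<open>gb_Suc_Suc_prod\<close>, whose right side contains 1 - Q^r = 0. The result is then
  transported to constant Laurent polynomials.\<close>

lemma qroot_zeta: "0 < r \<Longrightarrow> qroot r (Amon 0 (zeta_pow r 2))"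
proof -
  assume r: "0 < r"
  have pw: "zeta_pow r 2 ^ k = zeta_pow r (2 * int k)" for k
    by (simp add: power_int_mult)
  have one: "zeta_pow r 2 ^ r = 1" unfolding pw by (rule zeta_pow_2r[OF r])
  have "gb (zeta_pow r 2) r b = 0" if b: "0 < b" "b < r" for b
  proof -
    obtain b' r' where e: "b = Suc b'" "r = Suc r'" using b r by (metis gr0_implies_Suc)
    have "(1 - zeta_pow r 2 ^ b) * gb (zeta_pow r 2) r b = (1 - zeta_pow r 2 ^ r) * gb (zeta_pow r 2) r' b'"
      unfolding e by (rule gb_Suc_Suc_prod)
    then have "(1 - zeta_pow r 2 ^ b) * gb (zeta_pow r 2) r b = 0" using one by simp
    then show ?thesis using zeta_pow_eq_1[OF b] pw[of b] by auto
  qed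
  then have "gb (Amon 0 (zeta_pow r 2)) r b = 0" if "0 < b" "b < r" for b
    unfolding gb_hom[OF rhom_Amon0, symmetric] using that rhomD(4)[OF rhom_Amon0] by metis
  moreover have "Amon 0 (zeta_pow r 2) ^ r = 1"
    unfolding rhomD(7)[OF rhom_Amon0, symmetric] one by (rule Amon_0_1)
  ultimately show ?thesis using r unfolding qroot_def by blast
qed

lemma root_factor_ev:
  assumes "0 < r"
  shows "root_factor r (map_par (ev r) PG) (PA r) (map_par (\<lambda>p. subst_A r (ev 1 p)) PG)"
proof -
  have v: "valid (map_par (ev r) PG)" by (rule valid_hom[OF rhom_ev valid_PG])
  have z1: "zeta 1 = - 1" by (simp add: zeta_def complex_eq_iff)
  have p1: "zeta_pow 1 2 = 1" "zeta_pow 1 (- 2) = 1" unfolding z1 by simp_all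
  show ?thesis unfolding root_factor_def
    using v qroot_zeta[OF assms] p1 rhomD(1)[OF rhom_ev] rhomD(1)[OF rhom_subst_A]
    by (simp add: PG_def PA_def ev_single subst_A_Amon Amon_power Amon_mult Amon_0_1)
qed

lemma ev_factor:
  assumes "0 < r" "tangle [Up] D [Up]"
  shows "ev r (Zsum (r * M) PG D [0] [0]) = Zsum r (PA r) D [0] [0] * subst_A r (ev 1 (Zsum M PG D [0] [0]))"
proof -
  have "subst_A r (ev 1 (Zsum M PG D [0] [0])) = Zsum M (map_par (\<lambda>p. subst_A r (ev 1 p)) PG) D [0] [0]"
    by (rule Zsum_hom[OF rhom_comp[OF rhom_ev[of 1] rhom_subst_A[of r]]])
  moreover have "ev r (Zsum (r * M) PG D [0] [0]) = Zsum (r * M) (map_par (ev r) PG) D [0] [0]"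
    by (rule Zsum_hom[OF rhom_ev])
  ultimately show ?thesis
    using Zsum_factor_knot[OF root_factor_ev[OF assms(1)] assms(2), of M] by (simp only:)
qed

subsection \<open>Colored Jones polynomials\<close>

lemma pPJ [simp]: "pQ (PJ n) = q_h 2" "pQi (PJ n) = q_h (- 2)" "pA (PJ n) = q_h (int n)" "pAi (PJ n) = q_h (- int n)"
  "pG (PJ n) = q_h (int n)" "pT (PJ n) = fps_exp (of_nat n * of_nat n / 2)"
  by (simp_all add: PJ_def)

lemma jones_factor: "1 - q_h 2 ^ k * (q_h (- int n))\<^sup>2 = q_h (int k - int n) * qbr q_h (int n - int k)"
  unfolding qbr_def right_diff_distrib q_h_power q_h_add[symmetric] by (simp add: algebra_simps)

text \<open>At A = q^n the factor of the product with j + k = n is zero, and it occurs as soon as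
  the label passes \<open>n\<close>.\<close>

lemma trunc_PJ: "trunc_all (Suc n) (PJ n)"
  unfolding trunc_all_def
proof (intro allI impI)
  fix m j assume "j < Suc n" "Suc n \<le> m + j"
  then have "n - j \<in> {..<m}" "j + (n - j) = n" by auto
  moreover have "1 - q_h 2 ^ n * (q_h (- int n))\<^sup>2 = 0"
    unfolding jones_factor by (simp add: qbr_def)
  ultimately have "(\<Prod>k<m. 1 - q_h 2 ^ (j + k) * (q_h (- int n))\<^sup>2) = 0"
    by (intro prod_zero) (auto intro!: bexI[of _ "n - j"])
  then show "fcoef (PJ n) m j = 0" by (simp add: fcoef_def)
qed

lemma qbr_nonzero: "i \<noteq> 0 \<Longrightarrow> qbr q_h i \<noteq> 0" and subdegree_qbr: "i \<noteq> 0 \<Longrightarrow> subdegree (qbr q_h i) = 1"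
proof -
  assume i: "i \<noteq> 0"
  have 1: "fps_nth (qbr q_h i) 1 \<noteq> 0" "fps_nth (qbr q_h i) 0 = 0"
    using i by (simp_all add: qbr_def q_h_def)
  then show "qbr q_h i \<noteq> 0" by auto
  show "subdegree (qbr q_h i) = 1"
    by (rule subdegreeI) (use 1 in auto)
qed

lemma qint_mult: "qint q_h i * qbr q_h 1 = qbr q_h i"
proof (cases "i = 0")
  case True
  then show ?thesis by (simp add: qint_def qbr_def)
next
  case False
  then have "qbr q_h 1 dvd qbr q_h i"
    by (simp add: fps_dvd_iff qbr_nonzero subdegree_qbr)
  then show ?thesis unfolding qint_def by simp
qed

lemma qfact_mult: "qfact q_h m * qbr q_h 1 ^ m = (\<Prod>i=1..m. qbr q_h (int i))"
proof (induction m)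
  case (Suc m)
  have "qfact q_h (Suc m) * qbr q_h 1 ^ Suc m = (qfact q_h m * qbr q_h 1 ^ m) * (qint q_h (int (Suc m)) * qbr q_h 1)"
    by (simp add: qfact_def mult_ac)
  then show ?case unfolding Suc qint_mult by simp
qed (simp add: qfact_def)

text \<open>Quantum factorials are units among the power series, so the \<open>div\<close> in the
  definition of the R-matrix is an honest quotient.\<close>

lemma subdegree_qfact: "qfact q_h m \<noteq> 0 \<and> subdegree (qfact q_h m) = 0"
proof -
  have p: "(\<Prod>i=1..m. qbr q_h (int i)) \<noteq> 0 \<and> subdegree (\<Prod>i=1..m. qbr q_h (int i)) = m"
    by (induction m) (auto simp: qbr_nonzero subdegree_qbr)
  then have nz: "qfact q_h m \<noteq> 0" using qfact_mult[of m] by auto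
  then have "subdegree (qfact q_h m) + m = m"
    using p qfact_mult[of m, symmetric] by (simp add: qbr_nonzero subdegree_qbr)
  then show ?thesis using nz by simp
qed

lemma sum_shift_q: "(\<Prod>t<m. q_h (int n - int (b + t))) = q_h (int n) ^ m * q_h (- int (m * b)) * q_h (- (int m * (int m - 1) div 2))"
proof (induction m)
  case (Suc m)
  have e: "int (Suc m) * (int (Suc m) - 1) div 2 = int m + int m * (int m - 1) div 2"
  proof -
    have "int (Suc m) * (int (Suc m) - 1) = 2 * int m + int m * (int m - 1)" by (simp add: algebra_simps)
    then show ?thesis by simp
  qed
  show ?case unfolding prod.lessThan_Suc Suc e power_Suc q_h_power q_h_add[symmetric]
    by (rule arg_cong[where f = q_h]) (simp add: algebra_simps)
qed simp

text \<open>Multiplication by \<open>S\<close>, which is [m]! {1}^m, clears all quotients. The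
  coefficients of F^m become products of brackets: \<open>U\<close> yields the Gaussian binomial,
  and \<open>V\<close> the remaining product in \<open>fcoef\<close>.\<close>

lemma jones_fcoef:
  assumes "b + m \<le> n"
  shows "((qbr q_h 1 ^ m * q_h (int m * (int m - 1) div 2)) div qfact q_h m) *
     (\<Prod>t<m. qint q_h (int (b + t) + 1) * qint q_h (int n - int (b + t))) = fcoef (PJ n) m b"
proof -
  define D where "D = qbr q_h 1"
  define c where "c = (D ^ m * q_h (int m * (int m - 1) div 2)) div qfact q_h m"
  define \<phi> where "\<phi> = (\<Prod>t<m. qint q_h (int (b + t) + 1) * qint q_h (int n - int (b + t)))"
  define S where "S = (\<Prod>i=1..m. qbr q_h (int i))"
  define U V where "U = (\<Prod>t<m. qbr q_h (int (b + 1 + t)))" and "V = (\<Prod>t<m. qbr q_h (int n - int (b + t)))"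
  define w where "w = q_h (int m * (int m - 1) div 2)"
  have D: "D \<noteq> 0" unfolding D_def by (rule qbr_nonzero) simp
  have S: "S = qfact q_h m * D ^ m" unfolding S_def D_def qfact_mult ..
  have S0: "S \<noteq> 0" unfolding S using D subdegree_qfact[of m] by simp
  have "qfact q_h m dvd D ^ m * q_h (int m * (int m - 1) div 2)"
  proof (cases "D ^ m * w = 0")
    case False
    then show ?thesis unfolding w_def using subdegree_qfact[of m] by (simp add: fps_dvd_iff)
  next
    case True
    then show ?thesis unfolding w_def by (metis dvd_0_right)
  qed
  then have c: "c * qfact q_h m = D ^ m * w" unfolding c_def w_def by simp
  have \<phi>: "\<phi> * D ^ (m + m) = U * V"
  proof -
    have "\<phi> * D ^ (m + m) = (\<Prod>t<m. (qint q_h (int (b + t) + 1) * D) * (qint q_h (int n - int (b + t)) * D))"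
      unfolding \<phi>_def power_add by (simp add: prod.distrib mult_ac)
    also have "\<dots> = U * V"
      unfolding D_def qint_mult prod.distrib U_def V_def by (simp add: add_ac)
    finally show ?thesis .
  qed
  have g: "S * gb (q_h 2) (m + b) m = q_h (int (m * b)) * U"
    unfolding S_def U_def by (rule qbr_gb) (simp_all add: q_h_add)
  have pr: "(\<Prod>k<m. 1 - q_h 2 ^ (b + k) * (q_h (- int n))\<^sup>2) * (q_h (int n) ^ m * q_h (- int (m * b))) = w * V"
  proof -
    have "q_h (int (b + k) - int n) * q_h (int n - int (b + k)) = 1" for k
      unfolding q_h_add[symmetric] by simp
    then have "(\<Prod>k<m. 1 - q_h 2 ^ (b + k) * (q_h (- int n))\<^sup>2) * (\<Prod>t<m. q_h (int n - int (b + t))) = V"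
      unfolding jones_factor prod.distrib[symmetric] V_def by (intro prod.cong) (auto simp: mult_ac)
    then have "w * V = (w * q_h (- (int m * (int m - 1) div 2))) *
        ((\<Prod>k<m. 1 - q_h 2 ^ (b + k) * (q_h (- int n))\<^sup>2) * (q_h (int n) ^ m * q_h (- int (m * b))))"
      unfolding sum_shift_q by (simp only: mult_ac)
    moreover have "w * q_h (- (int m * (int m - 1) div 2)) = 1"
      unfolding w_def q_h_add[symmetric] by simp
    ultimately show ?thesis by simp
  qed
  have q2: "q_h (- 2) ^ (m * b) * q_h (int (m * b)) = q_h (- int (m * b))"
    unfolding q_h_power q_h_add[symmetric] by (rule arg_cong[where f = q_h]) simp
  have "fcoef (PJ n) m b * S = q_h (int n) ^ m * q_h (- 2) ^ (m * b) * (S * gb (q_h 2) (m + b) m)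
      * (\<Prod>k<m. 1 - q_h 2 ^ (b + k) * (q_h (- int n))\<^sup>2)"
    by (simp add: fcoef_def mult_ac)
  also have "\<dots> = (q_h (- 2) ^ (m * b) * q_h (int (m * b))) * U *
      (\<Prod>k<m. 1 - q_h 2 ^ (b + k) * (q_h (- int n))\<^sup>2) * q_h (int n) ^ m"
    unfolding g by (simp only: mult_ac)
  also have "\<dots> = U * ((\<Prod>k<m. 1 - q_h 2 ^ (b + k) * (q_h (- int n))\<^sup>2) * (q_h (int n) ^ m * q_h (- int (m * b))))"
    unfolding q2 by (simp only: mult_ac)
  also have "\<dots> = w * (U * V)" unfolding pr by (simp only: mult_ac)
  also have "\<dots> = (c * qfact q_h m) * D ^ m * \<phi>" unfolding c \<phi>[symmetric] power_add by (simp only: mult_ac)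
  also have "\<dots> = (c * \<phi>) * S" unfolding S by (simp only: mult_ac)
  finally show ?thesis using S0 unfolding c_def \<phi>_def D_def by simp
qed

lemma jones_piece: "piece_op (n + 1) (jones_R n) (jones_K n) G = pmat (n + 1) (PJ n) G"
  unfolding jones_R_def
proof (rule piece_op_eq_pmat[OF valid_PJ, where \<phi> = "\<lambda>m b. \<Prod>t<m. qint q_h (int (b + t) + 1) * qint q_h (int n - int (b + t))"])
  show "jones_E n ^\<^sub>m m = mat (n + 1) (n + 1) (\<lambda>(k, i). if i = k + m then 1 else 0)" for m
    unfolding jones_E_def by (rule pow_shift_mat(1))
  show "jones_F n ^\<^sub>m m = mat (n + 1) (n + 1) (\<lambda>(k, i). if k = m + i then \<Prod>t<m. qint q_h (int (i + t) + 1) * qint q_h (int n - int (i + t)) else 0)" for m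
    unfolding jones_F_def by (rule pow_shift_mat(2)[of "n + 1" "\<lambda>i. qint q_h (int i + 1) * qint q_h (int n - int i)"])
  show "jones_K n = mat (n + 1) (n + 1) (\<lambda>(k, i). if k = i then pG (PJ n) * pQi (PJ n) ^ i else 0)"
    unfolding jones_K_def pPJ q_h_power q_h_add[symmetric] by (rule cong_mat) (auto simp: mult.commute)
  fix a b m assume l: "a < n + 1" "m \<le> a" "b + m < n + 1"
  have \<theta>: "fps_exp ((of_nat n - 2 * of_nat (a - m)) * (of_nat n - 2 * of_nat (b + m)) / 2)
      = pT (PJ n) * pAi (PJ n) ^ (a + b) * pQ (PJ n) ^ ((a - m) * (b + m))"
  proof -
    obtain d where d: "a = d + m" using l(2) by (metis add.commute le_Suc_ex)
    show ?thesis unfolding pPJ q_h_def fps_exp_power_mult fps_exp_add_mult[symmetric] d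
      by (rule arg_cong[where f = fps_exp]) (simp add: field_simps)
  qed
  show "fps_exp ((of_nat n - 2 * of_nat (a - m)) * (of_nat n - 2 * of_nat (b + m)) / 2) *
      ((qbr q_h 1 ^ m * q_h (int m * (int m - 1) div 2)) div qfact q_h m *
       (\<Prod>t<m. qint q_h (int (b + t) + 1) * qint q_h (int n - int (b + t)))) = wpos (PJ n) a b m"
    unfolding \<theta> wpos_def using jones_fcoef[of b m n] l by simp
qed

text \<open>The freedom in \<open>M\<close> makes it possible to use the very state sum that
  represents the completed element at a deep level.\<close>

lemma colored_jones_eq:
  assumes D: "zero_framed_knot D" and M: "n < M"
  shows "colored_jones n D = eval_alpha n (exp_series (Zsum M PG D [0] [0]))"
proof -
  have K: "closure_is_knot D" "writhe D = 0" "tangle [Up] D [Up]"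
    using D by (auto simp: zero_framed_knot_def closure_is_knot_def)
  have R: "rt_op (n + 1) (jones_R n) (jones_K n) [Up] D = Zsum (n + 1) (PJ n) D [0] [0] \<cdot>\<^sub>m 1\<^sub>m (n + 1)"
  proof (rule rt_op_scalar[OF jones_piece valid_PJ _ _ K(3)])
    fix i j and x :: "rat fps" assume ij: "i < n + 1" "j < n + 1" "i \<noteq> j"
      and x: "x * kdiag (PJ n) Up i = x * kdiag (PJ n) Up j"
    have k: "kdiag (PJ n) Up k = fps_exp (of_nat n - 2 * of_nat k)" for k
      by (simp add: kdiag_def q_h_power q_h_add[symmetric]) (simp add: q_h_def)
    have "kdiag (PJ n) Up i \<noteq> kdiag (PJ n) Up j" unfolding k using ij by simp
    then show "x = 0" using x by simp
  qed (use trunc_all_trunc[OF trunc_PJ] in auto)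
  have "colored_jones n D = Zsum (n + 1) (PJ n) D [0] [0]"
    unfolding colored_jones_def R
  proof (rule the_equality)
    fix c assume "Zsum (n + 1) (PJ n) D [0] [0] \<cdot>\<^sub>m 1\<^sub>m (n + 1) = c \<cdot>\<^sub>m 1\<^sub>m (n + 1)"
    then have "(Zsum (n + 1) (PJ n) D [0] [0] \<cdot>\<^sub>m 1\<^sub>m (n + 1)) $$ (0, 0) = (c \<cdot>\<^sub>m 1\<^sub>m (n + 1)) $$ (0, 0)" by simp
    then show "c = Zsum (n + 1) (PJ n) D [0] [0]" by simp
  qed simp
  also have "\<dots> = Zsum M (PJ n) D [0] [0]"
    using Zsum_trunc[OF K(1) trunc_PJ, of n M] M by simp
  also have "\<dots> = Zsum M (normT (PJ n)) D [0] [0]" by (rule Zsum_normT[OF valid_PJ K(2)])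
  also have "\<dots> = eval_alpha n (exp_series (Zsum M PG D [0] [0]))"
    unfolding map_PG_jones[symmetric] by (rule Zsum_hom[OF rhom_comp[OF rhom_exp_series rhom_eval_alpha], symmetric])
  finally show ?thesis .
qed

subsection \<open>ADO invariants\<close>

lemma zeta_alpha_eq:
  "zeta_alpha r (- int b) m = Amon 1 1 ^ m * Amon 0 (\<Prod>k<m. zeta_pow r (- int (b + k))) *
     (\<Prod>k<m. 1 - Amon 0 (zeta_pow r 2) ^ (b + k) * (Amon (- 1) 1)\<^sup>2)"
proof -
  have "Amon 1 (zeta_pow r (- int b - int k)) - Amon (- 1) (zeta_pow r (- (- int b - int k)))
     = Amon 1 1 * Amon 0 (zeta_pow r (- int (b + k))) * (1 - Amon 0 (zeta_pow r 2) ^ (b + k) * (Amon (- 1) 1)\<^sup>2)" for k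
  proof -
    have 1: "zeta_pow r 2 ^ (b + k) = zeta_pow r (int (2 * (b + k)))"
      unfolding of_nat_mult of_nat_numeral power_int_mult power_int_of_nat ..
    have 2: "zeta_pow r (- int (b + k)) * zeta_pow r (int (2 * (b + k))) = zeta_pow r (int (b + k))"
      unfolding zeta_pow_add[symmetric] by simp
    have "Amon 0 (zeta_pow r 2) ^ (b + k) = Amon 0 (zeta_pow r (int (2 * (b + k))))"
      unfolding Amon_power 1 by simp
    then have "Amon 1 1 * Amon 0 (zeta_pow r (- int (b + k))) * (1 - Amon 0 (zeta_pow r 2) ^ (b + k) * (Amon (- 1) 1)\<^sup>2)
      = Amon 1 (zeta_pow r (- int (b + k))) - Amon (- 1) (zeta_pow r (- int (b + k)) * zeta_pow r (int (2 * (b + k))))"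
      unfolding Amon_power by (simp only: right_diff_distrib Amon_mult mult_1_right) (simp add: mult_ac)
    also have "\<dots> = Amon 1 (zeta_pow r (- int b - int k)) - Amon (- 1) (zeta_pow r (- (- int b - int k)))"
      unfolding 2 by (simp add: add.commute)
    finally show ?thesis ..
  qed
  then have "zeta_alpha r (- int b) m = (\<Prod>k<m. Amon 1 1 * Amon 0 (zeta_pow r (- int (b + k))) *
      (1 - Amon 0 (zeta_pow r 2) ^ (b + k) * (Amon (- 1) 1)\<^sup>2))"
    unfolding zeta_alpha_def by (simp only:)
  then show ?thesis
    by (simp add: prod.distrib rhomD(9)[OF rhom_Amon0] del: of_nat_add)
qed

lemma qbr_zeta_nonzero:
  assumes "0 < i" "i < r"
  shows "qbr (zeta_pow r) (int i) \<noteq> 0"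
proof
  assume "qbr (zeta_pow r) (int i) = 0"
  then have "zeta_pow r (int i) * zeta_pow r (int i) = zeta_pow r (- int i) * zeta_pow r (int i)"
    by (simp add: qbr_def)
  then have "zeta_pow r (2 * int i) = 1" unfolding zeta_pow_add[symmetric] by simp
  then show False using zeta_pow_eq_1[OF assms] by simp
qed

text \<open>For m + b < r none of the quantum factorials involved is zero, so the quotient in
  \<open>qbinom\<close> is the recursive binomial up to a power of zeta.\<close>

lemma qbinom_zeta:
  assumes "m + b < r"
  shows "gb (zeta_pow r 2) (m + b) m = zeta_pow r (int (m * b)) * qbinom (zeta_pow r) (m + b) m"
proof -
  define S where "S = (\<Prod>i=1..m. qbr (zeta_pow r) (int i))"
  define U where "U = (\<Prod>t<m. qbr (zeta_pow r) (int (b + 1 + t)))"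
  have "qbr (zeta_pow r) (int i) \<noteq> 0" if "i \<in> {1..m}" for i
    using that assms by (intro qbr_zeta_nonzero) auto
  then have S0: "S \<noteq> 0" unfolding S_def by simp
  have g: "S * gb (zeta_pow r 2) (m + b) m = zeta_pow r (int (m * b)) * U"
    unfolding S_def U_def by (rule qbr_gb) (simp_all add: zeta_pow_add)
  have add: "(\<Prod>i=1..b + m. f i) = (\<Prod>i=1..b. f i) * (\<Prod>t<m. f (b + 1 + t))" for f :: "nat \<Rightarrow> complex"
    by (induction m) (simp_all add: mult_ac)
  have "qbinom (zeta_pow r) (m + b) m * S = U"
  proof (cases "m = 0")
    case True
    \<comment> \<open>For r = 1 the bracket {1} is zero. Then m = b = 0 is forced, all products are
      empty, and this case covers it.\<close>
    have "qbr (zeta_pow r) (int i) / qbr (zeta_pow r) 1 \<noteq> 0" if "i \<in> {1..b}" for i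
      using that qbr_zeta_nonzero[of i r] qbr_zeta_nonzero[of 1 r] assms by auto
    then have "qfact (zeta_pow r) b \<noteq> 0" unfolding qfact_def qint_def by simp
    moreover have "qfact (zeta_pow r) 0 = 1" "S = 1" "U = 1" using True by (simp_all add: qfact_def S_def U_def)
    ultimately show ?thesis using True by (simp add: qbinom_def)
  next
    case False
    define d where "d = qbr (zeta_pow r) 1"
    have d: "d \<noteq> 0" using qbr_zeta_nonzero[of 1 r] assms False by (simp add: d_def)
    have fb: "qfact (zeta_pow r) b \<noteq> 0"
      unfolding qfact_def qint_def d_def[symmetric] using d assms by (auto simp: qbr_zeta_nonzero)
    have fm: "qfact (zeta_pow r) m = S / d ^ m"
      unfolding qfact_def qint_def d_def[symmetric] S_def by (simp add: prod_dividef)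
    have "qfact (zeta_pow r) (m + b) = qfact (zeta_pow r) b * (U / d ^ m)"
      unfolding qfact_def add.commute[of m b] add qint_def d_def[symmetric] U_def by (simp add: prod_dividef)
    then show ?thesis unfolding qbinom_def using fb fm S0 d by simp
  qed
  then show ?thesis using g S0 by (metis mult.assoc mult.commute mult_left_cancel)
qed

lemma ado_fcoef:
  assumes "m + b < r"
  shows "Amon 0 (zeta_pow r (int m * (int m - 1) div 2)) *
    (Amon 0 (qbinom (zeta_pow r) (m + b) m) * zeta_alpha r (- int b) m) = fcoef (PA r) m b"
proof -
  have pr: "(\<Prod>k<m. zeta_pow r (- int (b + k))) = zeta_pow r (- int (m * b)) * zeta_pow r (- (int m * (int m - 1) div 2))"
  proof (induction m)
    case (Suc m)
    have e: "int (Suc m) * (int (Suc m) - 1) div 2 = int m + int m * (int m - 1) div 2"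
    proof -
      have "int (Suc m) * (int (Suc m) - 1) = 2 * int m + int m * (int m - 1)" by (simp add: algebra_simps)
      then show ?thesis by simp
    qed
    show ?case unfolding prod.lessThan_Suc Suc e zeta_pow_add[symmetric]
      by (rule arg_cong[where f = "zeta_pow r"]) (simp add: algebra_simps)
  qed simp
  have z: "zeta_pow r (int m * (int m - 1) div 2) * zeta_pow r (- (int m * (int m - 1) div 2)) = 1"
    unfolding zeta_pow_add[symmetric] by simp
  have q: "zeta_pow r (- 2) ^ (m * b) = zeta_pow r (- int (m * b)) * zeta_pow r (- int (m * b))"
  proof -
    have "zeta_pow r (- 2) ^ (m * b) = zeta_pow r (- 2 * int (m * b))"
      unfolding power_int_mult power_int_of_nat ..
    moreover have "- 2 * int (m * b) = - int (m * b) + - int (m * b)" by simp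
    ultimately show ?thesis by (simp only: zeta_pow_add)
  qed
  have g: "gb (Amon 0 (zeta_pow r 2)) (m + b) m = Amon 0 (zeta_pow r (int (m * b)) * qbinom (zeta_pow r) (m + b) m)"
    unfolding gb_hom[OF rhom_Amon0, symmetric] qbinom_zeta[OF assms] ..
  have zz: "zeta_pow r (- int (m * b)) * zeta_pow r (int (m * b)) = 1"
    unfolding zeta_pow_add[symmetric] by simp
  define T where "T = (\<Prod>k<m. 1 - Amon 0 (zeta_pow r 2) ^ (b + k) * (Amon (- 1) 1)\<^sup>2)"
  define B where "B = qbinom (zeta_pow r) (m + b) m"
  define u where "u = zeta_pow r (- int (m * b))"
  have "Amon 0 (zeta_pow r (int m * (int m - 1) div 2)) * (Amon 0 B * zeta_alpha r (- int b) m)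
     = Amon 1 1 ^ m * Amon 0 ((zeta_pow r (int m * (int m - 1) div 2) * zeta_pow r (- (int m * (int m - 1) div 2))) * u * B) * T"
    unfolding zeta_alpha_eq pr T_def[symmetric] u_def by (simp only: rhomD(3)[OF rhom_Amon0] mult_ac)
  also have "\<dots> = Amon 1 1 ^ m * Amon 0 (u * B) * T" unfolding z by simp
  also have "\<dots> = Amon 1 1 ^ m * (Amon 0 (zeta_pow r (- 2) ^ (m * b)) * Amon 0 (zeta_pow r (int (m * b)) * B)) * T"
  proof -
    have "zeta_pow r (- 2) ^ (m * b) * (zeta_pow r (int (m * b)) * B) = u * (u * zeta_pow r (int (m * b))) * B"
      unfolding q u_def by (simp only: mult_ac)
    also have "\<dots> = u * B" using zz by (simp only: u_def mult_1_right)
    finally have eq: "zeta_pow r (- 2) ^ (m * b) * (zeta_pow r (int (m * b)) * B) = u * B" .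
    show ?thesis unfolding rhomD(3)[OF rhom_Amon0, symmetric] eq ..
  qed
  also have "\<dots> = fcoef (PA r) m b"
  proof -
    have s: "pQ (PA r) = Amon 0 (zeta_pow r 2)" "pQi (PA r) = Amon 0 (zeta_pow r (- 2))" "pA (PA r) = Amon 1 1" "pAi (PA r) = Amon (- 1) 1"
      by (simp_all only: PA_def par.sel)
    show ?thesis unfolding fcoef_def s g T_def B_def rhomD(7)[OF rhom_Amon0, symmetric] by (simp only: mult.assoc)
  qed
  finally show ?thesis unfolding B_def .
qed

lemma fcoef_PAt: "fcoef (PAt r) n j = const_t (fcoef (PA r) n j)"
proof -
  have "fcoef (PAt r) n j = fcoef (normT (PAt r)) n j" by (cases "PAt r") (simp add: fcoef_def)
  then show ?thesis unfolding normT_PAt using fcoef_hom[OF rhom_const_t] by simp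
qed

text \<open>Two digits below \<open>r\<close> with sum at least \<open>r\<close> produce a carry, so
  Lucas' theorem makes the binomial vanish.\<close>

lemma trunc_PAt: "0 < r \<Longrightarrow> trunc r (PAt r)"
  unfolding trunc_def
proof (intro allI impI)
  fix n j assume r: "0 < r" and l: "n < r" "j < r" "r \<le> n + j"
  have q: "qroot r (pQ (PA r))" using qroot_zeta[OF r] by (simp add: PA_def)
  have "gb (pQ (PA r)) ((n + j - r) + r * 1) (n + r * 0) = gb (pQ (PA r)) (n + j - r) n * gb 1 1 0"
    by (rule qroot_gb_Lucas[OF q]) (use l in auto)
  then have "gb (pQ (PA r)) (n + j) n = 0" using l by (simp add: gb_eq_0)
  then show "fcoef (PAt r) n j = 0" unfolding fcoef_PAt by (simp add: fcoef_def rhomD(4)[OF rhom_const_t])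
qed

lemma ado_piece: "piece_op r (ado_R r) (ado_pivot r) G = pmat r (PAt r) G"
  unfolding ado_R_def
proof (rule piece_op_eq_pmat[OF valid_PAt, where \<phi> = "\<lambda>m b. const_t (Amon 0 (qbinom (zeta_pow r) (m + b) m) * zeta_alpha r (- int b) m)"])
  show "ado_E r ^\<^sub>m m = mat r r (\<lambda>(k, i). if i = k + m then 1 else 0)" for m
    unfolding ado_E_def by (rule pow_shift_mat(1))
  show "ado_F r m = mat r r (\<lambda>(k, i). if k = m + i then const_t (Amon 0 (qbinom (zeta_pow r) (m + i) m) * zeta_alpha r (- int i) m) else 0)" for m
    unfolding ado_F_def ..
  have e: "Amon (1 - int r) (zeta_pow r (- 2 * int i * (1 - int r))) = Amon (1 - int r) 1 * Amon 0 (zeta_pow r (- 2)) ^ i" if "i < r" for i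
  proof -
    \<comment> \<open>The exponents differ by a multiple of 2r, so the entries of K^(1-r) decrease
      by the same power of Q as those of K.\<close>
    have "zeta_pow r (- 2 * int i * (1 - int r)) = zeta_pow r (- 2 * int i) * zeta_pow r (2 * int r * int i)"
      unfolding zeta_pow_add[symmetric] by (rule arg_cong[where f = "zeta_pow r"]) (simp add: algebra_simps)
    also have "zeta_pow r (2 * int r * int i) = 1"
      using that zeta_pow_2r[of r] by (simp only: power_int_mult) simp
    also have "zeta_pow r (- 2 * int i) = zeta_pow r (- 2) ^ i"
      unfolding power_int_mult power_int_of_nat ..
    finally show ?thesis by (simp add: Amon_power Amon_mult)
  qed
  show "ado_pivot r = mat r r (\<lambda>(k, i). if k = i then pG (PAt r) * pQi (PAt r) ^ i else 0)"
  proof -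
    have s: "pG (PAt r) = const_t (Amon (1 - int r) 1)" "pQi (PAt r) = const_t (Amon 0 (zeta_pow r (- 2)))"
      by (simp_all only: PAt_simps PA_def par.sel)
    have e': "const_t (Amon (1 - int r) (zeta_pow r (- 2 * int i * (1 - int r)))) = pG (PAt r) * pQi (PAt r) ^ i" if "i < r" for i
      unfolding e[OF that] s rhomD(7)[OF rhom_const_t, symmetric] rhomD(3)[OF rhom_const_t, symmetric] ..
    show ?thesis unfolding ado_pivot_def
      by (rule cong_mat) (simp_all only: prod.case e' cong: if_cong)
  qed
  fix a b m assume l: "a < r" "m \<le> a" "b + m < r"
  have "Amon (- int (a - m + (b + m))) (zeta_pow r (2 * int (a - m) * int (b + m)))
     = Amon (- 1) 1 ^ (a + b) * Amon 0 (zeta_pow r 2) ^ ((a - m) * (b + m))"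
  proof -
    have "zeta_pow r (2 * int (a - m) * int (b + m)) = zeta_pow r 2 ^ ((a - m) * (b + m))"
      by (simp only: mult.assoc power_int_mult of_nat_mult[symmetric] power_int_of_nat)
    moreover have "a - m + (b + m) = a + b" using l by simp
    ultimately show ?thesis by (simp only: Amon_power Amon_mult) simp
  qed
  then have \<theta>: "Poly_Mapping.single 1 (Amon (- int (a - m + (b + m))) (zeta_pow r (2 * int (a - m) * int (b + m))))
     = pT (PAt r) * pAi (PAt r) ^ (a + b) * pQ (PAt r) ^ ((a - m) * (b + m))"
    by (simp add: PA_def rhomD(3,7)[OF rhom_const_t, symmetric] mult.assoc) (simp add: const_t_def mult_single)
  show "Poly_Mapping.single 1 (Amon (- int (a - m + (b + m))) (zeta_pow r (2 * int (a - m) * int (b + m)))) *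
      (const_t (Amon 0 (zeta_pow r (int m * (int m - 1) div 2))) *
       const_t (Amon 0 (qbinom (zeta_pow r) (m + b) m) * zeta_alpha r (- int b) m)) = wpos (PAt r) a b m"
    unfolding \<theta> wpos_def fcoef_PAt using ado_fcoef[of m b r] l
    by (simp only: rhomD(3)[OF rhom_const_t, symmetric] add.commute)
qed

lemma ADO_eq:
  assumes D: "zero_framed_knot D" and r: "0 < r"
  shows "ADO r D = Zsum r (PA r) D [0] [0]"
proof -
  have K: "closure_is_knot D" "writhe D = 0" "tangle [Up] D [Up]"
    using D by (auto simp: zero_framed_knot_def closure_is_knot_def)
  have Z: "Zsum r (PAt r) D [0] [0] = const_t (Zsum r (PA r) D [0] [0])"
    unfolding Zsum_normT[OF valid_PAt K(2)] normT_PAt by (rule Zsum_hom[OF rhom_const_t, symmetric])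
  have R: "rt_op r (ado_R r) (ado_pivot r) [Up] D = Zsum r (PAt r) D [0] [0] \<cdot>\<^sub>m 1\<^sub>m r"
  proof (rule rt_op_scalar[OF ado_piece valid_PAt trunc_PAt[OF r] r K(3)])
    fix i j and x :: "int \<Rightarrow>\<^sub>0 laurentA" assume ij: "i < r" "j < r" "i \<noteq> j"
      and x: "x * kdiag (PAt r) Up i = x * kdiag (PAt r) Up j"
    have k: "kdiag (PAt r) Up k = const_t (Amon 1 (zeta_pow r (- 2) ^ k))" for k
    proof -
      have "kdiag (PAt r) Up k = const_t (Amon 1 1 * Amon 0 (zeta_pow r (- 2)) ^ k)"
        by (simp add: kdiag_def PA_def rhomD[OF rhom_const_t])
      then show ?thesis unfolding Amon_power Amon_mult by simp
    qed
    have pw: "zeta_pow r (- 2) ^ k = zeta_pow r (- 2 * int k)" for k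
      unfolding power_int_mult power_int_of_nat ..
    \<comment> \<open>Two eigenvalues of K differ by A times a nonzero complex number
      \<open>c\<close>. Such a monomial is a unit, which gives the required cancellation.\<close>
    define c where "c = zeta_pow r (- 2) ^ i - zeta_pow r (- 2) ^ j"
    have c: "c \<noteq> 0"
    proof
      assume "c = 0"
      then have e: "zeta_pow r (- 2 * int i) = zeta_pow r (- 2 * int j)" unfolding c_def pw by simp
      have "zeta_pow r (2 * int (l - l')) = 1" if "zeta_pow r (- 2 * int l) = zeta_pow r (- 2 * int l')" "l' < l" for l l'
      proof -
        have "zeta_pow r (2 * int (l - l')) = zeta_pow r (2 * int l) * zeta_pow r (- 2 * int l')"
          unfolding zeta_pow_add[symmetric] using that(2) by (simp add: of_nat_diff algebra_simps)
        also have "\<dots> = zeta_pow r (2 * int l + - 2 * int l)" unfolding that(1)[symmetric] zeta_pow_add ..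
        finally show ?thesis by simp
      qed
      note * = this[OF e] this[OF e[symmetric]]
      have "i - j < r" "j - i < r" using ij by auto
      then show False
        using zeta_pow_eq_1[of "i - j" r] zeta_pow_eq_1[of "j - i" r] * ij(3) by (cases "j < i") (simp_all del: of_nat_diff)
    qed
    have "x * const_t (Amon 1 c) = 0"
    proof -
      have "Amon 1 c = Amon 1 (zeta_pow r (- 2) ^ i) - Amon 1 (zeta_pow r (- 2) ^ j)"
        unfolding c_def Amon_def by (simp add: single_diff)
      then show ?thesis using x unfolding k by (simp add: rhomD(6)[OF rhom_const_t] right_diff_distrib)
    qed
    then have "x * (const_t (Amon 1 c) * const_t (Amon (- 1) (1 / c))) = 0"
      unfolding mult.assoc[symmetric] by simp
    then show "x = 0" unfolding rhomD(3)[OF rhom_const_t, symmetric] Amon_mult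
      using c rhomD(1)[OF rhom_const_t] by (simp add: Amon_0_1)
  qed
  have inj: "const_t p = const_t p' \<Longrightarrow> p = p'" for p p'
    unfolding const_t_def by (rule injD[OF inj_single])
  show ?thesis unfolding ADO_def R Z
  proof (rule the_equality)
    fix c assume "const_t (Zsum r (PA r) D [0] [0]) \<cdot>\<^sub>m 1\<^sub>m r = const_t c \<cdot>\<^sub>m 1\<^sub>m r"
    then have "(const_t (Zsum r (PA r) D [0] [0]) \<cdot>\<^sub>m 1\<^sub>m r) $$ (0, 0) = (const_t c \<cdot>\<^sub>m 1\<^sub>m r) $$ (0, 0)" by simp
    then show "c = Zsum r (PA r) D [0] [0]" using r by (intro inj) simp
  qed simp
qed

section \<open>Ideals and radicals\<close>

text \<open>Ideals with respect to the operations of the type. For \<open>RqA\<close>, whose carrier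
  is the whole type, \<open>tideal_ideal\<close> and \<open>ideal_tideal\<close> pass between this
  notion and \<open>ideal\<close>.\<close>

definition tideal :: "'a::comm_ring_1 set \<Rightarrow> bool" where
  "tideal I \<longleftrightarrow> 0 \<in> I \<and> (\<forall>a\<in>I. \<forall>b\<in>I. a + b \<in> I) \<and> (\<forall>a\<in>I. \<forall>b. b * a \<in> I)"

lemma tidealD:
  assumes "tideal I"
  shows "0 \<in> I" "a \<in> I \<Longrightarrow> b \<in> I \<Longrightarrow> a + b \<in> I" "a \<in> I \<Longrightarrow> b * a \<in> I" "a \<in> I \<Longrightarrow> a * b \<in> I"
    "a \<in> I \<Longrightarrow> - a \<in> I" "a \<in> I \<Longrightarrow> b \<in> I \<Longrightarrow> a - b \<in> I"
proof -
  show 1: "0 \<in> I" "a \<in> I \<Longrightarrow> b \<in> I \<Longrightarrow> a + b \<in> I" "a \<in> I \<Longrightarrow> b * a \<in> I" for a b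
    using assms by (auto simp: tideal_def)
  show "a \<in> I \<Longrightarrow> a * b \<in> I" using 1(3)[of a b] by (simp add: mult.commute)
  show 2: "a \<in> I \<Longrightarrow> - a \<in> I" for a using 1(3)[of a "- 1"] by simp
  show "a \<in> I \<Longrightarrow> b \<in> I \<Longrightarrow> a - b \<in> I" using 1(2)[of a "- b"] 2[of b] by simp
qed

lemma tideal_sum: "tideal I \<Longrightarrow> (\<And>x. x \<in> S \<Longrightarrow> f x \<in> I) \<Longrightarrow> sum f S \<in> I"
  by (induction S rule: infinite_finite_induct) (auto intro: tidealD)

definition ideal2 :: "'a::comm_ring_1 \<Rightarrow> 'a \<Rightarrow> 'a set" where
  "ideal2 x y = {u * x + v * y | u v. True}"

lemma tideal_ideal2: "tideal (ideal2 x y)"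
  unfolding tideal_def
proof (intro conjI ballI allI)
  show "0 \<in> ideal2 x y" unfolding ideal2_def by (auto intro!: exI[of _ 0])
  fix a assume "a \<in> ideal2 x y"
  then obtain u v where a: "a = u * x + v * y" by (auto simp: ideal2_def)
  have "c * a = (c * u) * x + (c * v) * y" for c by (simp add: a algebra_simps)
  then show "c * a \<in> ideal2 x y" for c unfolding ideal2_def by blast
  fix b assume "b \<in> ideal2 x y"
  then obtain u' v' where b: "b = u' * x + v' * y" by (auto simp: ideal2_def)
  have "a + b = (u + u') * x + (v + v') * y" by (simp add: a b algebra_simps)
  then show "a + b \<in> ideal2 x y" unfolding ideal2_def by blast
qed

lemma ideal2_gen: "x \<in> ideal2 x y" "y \<in> ideal2 x y"
proof -
  have "x = 1 * x + 0 * y" "y = 0 * x + 1 * y" by simp_all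
  then show "x \<in> ideal2 x y" "y \<in> ideal2 x y" unfolding ideal2_def by blast+
qed

lemma ideal2_least: "tideal I \<Longrightarrow> x \<in> I \<Longrightarrow> y \<in> I \<Longrightarrow> ideal2 x y \<subseteq> I"
  unfolding ideal2_def using tidealD(2,3) by blast

text \<open>The ideal generated by \<open>c\<close> and \<open>I\<close>; with \<open>c\<close> a
  power of a prime it expresses divisibility in the quotient by \<open>I\<close>.\<close>

definition plus_mult :: "'a::comm_ring_1 \<Rightarrow> 'a set \<Rightarrow> 'a set" where
  "plus_mult c I = {a. \<exists>b. a - c * b \<in> I}"

lemma tideal_plus_mult: "tideal I \<Longrightarrow> tideal (plus_mult c I)"
  unfolding tideal_def[of "plus_mult c I"]
proof (intro conjI ballI allI)
  assume I: "tideal I"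
  show "0 \<in> plus_mult c I" unfolding plus_mult_def using tidealD(1)[OF I] by (auto intro: exI[of _ 0])
  fix x assume "x \<in> plus_mult c I"
  then obtain u where x: "x - c * u \<in> I" by (auto simp: plus_mult_def)
  show "z * x \<in> plus_mult c I" for z
    unfolding plus_mult_def using tidealD(3)[OF I x, of z] by (auto intro!: exI[of _ "z * u"] simp: algebra_simps)
  fix y assume "y \<in> plus_mult c I"
  then obtain v where y: "y - c * v \<in> I" by (auto simp: plus_mult_def)
  have "(x + y) - c * (u + v) \<in> I" using tidealD(2)[OF I x y] by (simp add: algebra_simps)
  then show "x + y \<in> plus_mult c I" by (auto simp: plus_mult_def)
qed

lemma plus_mult_gen: "tideal I \<Longrightarrow> c \<in> plus_mult c I" "tideal I \<Longrightarrow> I \<subseteq> plus_mult c I"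
proof -
  assume I: "tideal I"
  have "c - c * 1 \<in> I" using tidealD(1)[OF I] by simp
  then show "c \<in> plus_mult c I" unfolding plus_mult_def by blast
  have "a - c * 0 \<in> I" if "a \<in> I" for a using that by simp
  then show "I \<subseteq> plus_mult c I" unfolding plus_mult_def by blast
qed

definition radi :: "'a::comm_ring_1 set \<Rightarrow> 'a set" where
  "radi I = {z. \<exists>n. z ^ n \<in> I}"

lemma tideal_radi: "tideal I \<Longrightarrow> tideal (radi I)"
  unfolding tideal_def[of "radi I"]
proof (intro conjI ballI allI)
  assume I: "tideal I"
  show "0 \<in> radi I" unfolding radi_def using tidealD(1)[OF I] by (auto intro!: exI[of _ 1])
  fix a assume "a \<in> radi I"
  then obtain n where a: "a ^ n \<in> I" by (auto simp: radi_def)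
  show "z * a \<in> radi I" for z
    unfolding radi_def using tidealD(3)[OF I a, of "z ^ n"] by (auto intro!: exI[of _ n] simp: power_mult_distrib)
  fix b assume "b \<in> radi I"
  then obtain m where b: "b ^ m \<in> I" by (auto simp: radi_def)
  have "(a + b) ^ (n + m) \<in> I"
    unfolding binomial_ring
  proof (rule tideal_sum[OF I], goal_cases)
    case (1 k)
    show ?case
    proof (cases "n \<le> k")
      case True
      then have "a ^ k = a ^ n * a ^ (k - n)" by (simp add: power_add[symmetric])
      then have "a ^ k \<in> I" using tidealD(4)[OF I a] by simp
      then show ?thesis using tidealD(3,4)[OF I] by blast
    next
      case False
      then have "n + m - k = m + (n - k)" by simp
      then have "b ^ (n + m - k) = b ^ m * b ^ (n - k)" by (simp only: power_add)
      then have "b ^ (n + m - k) \<in> I" using tidealD(4)[OF I b] by simp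
      then show ?thesis using tidealD(3)[OF I] by blast
    qed
  qed
  then show "a + b \<in> radi I" unfolding radi_def by blast
qed

lemma radi_sub: "I \<subseteq> radi I"
  unfolding radi_def by (auto intro: exI[of _ 1])

lemma radi_power: "a ^ n \<in> radi I \<Longrightarrow> a \<in> radi I"
  unfolding radi_def by (auto simp: power_mult[symmetric])

lemma radi_powerI: "a ^ n \<in> I \<Longrightarrow> a \<in> radi I"
  unfolding radi_def by blast

lemma tideal_power_mono: "tideal I \<Longrightarrow> a ^ n \<in> I \<Longrightarrow> n \<le> m \<Longrightarrow> a ^ m \<in> I"
  by (metis le_add_diff_inverse power_add tidealD(4))

text \<open>The \<open>m\<close>-th power of the ideal generated by \<open>x\<close> and
  \<open>y\<close>.\<close>

definition pideal :: "'a::comm_ring_1 \<Rightarrow> 'a \<Rightarrow> nat \<Rightarrow> 'a set" where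
  "pideal x y m = {\<Sum>i\<le>m. c i * (x ^ i * y ^ (m - i)) | c. True}"

lemma tideal_pideal: "tideal (pideal x y m)"
  unfolding tideal_def
proof (intro conjI ballI allI)
  show "0 \<in> pideal x y m" unfolding pideal_def by (auto intro!: exI[of _ "\<lambda>_. 0"])
  fix a assume "a \<in> pideal x y m"
  then obtain c where a: "a = (\<Sum>i\<le>m. c i * (x ^ i * y ^ (m - i)))" by (auto simp: pideal_def)
  show "z * a \<in> pideal x y m" for z
    unfolding pideal_def a by (auto intro!: exI[of _ "\<lambda>i. z * c i"] simp: sum_distrib_left mult.assoc)
  fix b assume "b \<in> pideal x y m"
  then obtain d where b: "b = (\<Sum>i\<le>m. d i * (x ^ i * y ^ (m - i)))" by (auto simp: pideal_def)
  show "a + b \<in> pideal x y m"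
    unfolding pideal_def a b by (auto intro!: exI[of _ "\<lambda>i. c i + d i"] simp: sum.distrib distrib_right)
qed

lemma pideal_gen: "i \<le> m \<Longrightarrow> x ^ i * y ^ (m - i) \<in> pideal x y m"
proof -
  assume i: "i \<le> m"
  have "(\<Sum>k\<le>m. (if k = i then 1 else 0) * (x ^ k * y ^ (m - k))) = (\<Sum>k\<in>{i}. x ^ k * y ^ (m - k))"
    using i by (intro sum.mono_neutral_cong_right) auto
  then show ?thesis unfolding pideal_def by (auto intro!: exI[of _ "\<lambda>k. if k = i then 1 else 0"])
qed

lemma pideal_least:
  assumes "tideal I" "\<And>i. i \<le> m \<Longrightarrow> x ^ i * y ^ (m - i) \<in> I"
  shows "pideal x y m \<subseteq> I"
proof
  fix a assume "a \<in> pideal x y m"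
  then obtain c where a: "a = (\<Sum>i\<le>m. c i * (x ^ i * y ^ (m - i)))" by (auto simp: pideal_def)
  show "a \<in> I" unfolding a
    by (rule tideal_sum[OF assms(1)], rule tidealD(3)[OF assms(1)], rule assms(2)) simp
qed

lemma pideal_mult: "a \<in> pideal x y m \<Longrightarrow> b \<in> ideal2 x y \<Longrightarrow> a * b \<in> pideal x y (Suc m)"
proof -
  assume a: "a \<in> pideal x y m" and "b \<in> ideal2 x y"
  then obtain u v where b: "b = u * x + v * y" by (auto simp: ideal2_def)
  note T = tideal_pideal[of x y "Suc m"]
  have "z * (x ^ i * y ^ (m - i)) * b \<in> pideal x y (Suc m)" if "i \<le> m" for i z
  proof -
    have "z * (x ^ i * y ^ (m - i)) * b = z * u * (x ^ Suc i * y ^ (Suc m - Suc i)) + z * v * (x ^ i * y ^ (Suc m - i))"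
      unfolding b using that by (simp add: algebra_simps Suc_diff_le)
    moreover have "x ^ Suc i * y ^ (Suc m - Suc i) \<in> pideal x y (Suc m)" "x ^ i * y ^ (Suc m - i) \<in> pideal x y (Suc m)"
      using that by (intro pideal_gen; simp)+
    ultimately show ?thesis using tidealD(2)[OF T] tidealD(3)[OF T] by metis
  qed
  moreover obtain c where "a = (\<Sum>i\<le>m. c i * (x ^ i * y ^ (m - i)))" using a by (auto simp: pideal_def)
  ultimately show ?thesis by (simp only: sum_distrib_right) (rule tideal_sum[OF T], simp)
qed

text \<open>A monomial of degree at least 2k in two letters contains one of them at least k
  times.\<close>

lemma pideal_sub_ideal2: "2 * k \<le> m \<Longrightarrow> pideal x y m \<subseteq> ideal2 (x ^ k) (y ^ k)"
proof (rule pideal_least[OF tideal_ideal2])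
  fix i assume m: "2 * k \<le> m" "i \<le> m"
  note T = tideal_ideal2[of "x ^ k" "y ^ k"]
  show "x ^ i * y ^ (m - i) \<in> ideal2 (x ^ k) (y ^ k)"
  proof (cases "k \<le> i")
    case True
    then show ?thesis using tideal_power_mono[OF T _ True] ideal2_gen(1) tidealD(4)[OF T] by blast
  next
    case False
    then have "k \<le> m - i" using m by simp
    then show ?thesis using tideal_power_mono[OF T] ideal2_gen(2) tidealD(3)[OF T] by blast
  qed
qed

section \<open>Separation modulo monic polynomials\<close>

lemma monic_division:
  fixes p Y' :: "'a::idom poly"
  assumes "lead_coeff Y' = 1"
  shows "\<exists>v r. p = Y' * v + r \<and> (\<forall>j\<ge>degree Y'. coeff r j = 0)"
proof -
  have Y0: "Y' \<noteq> 0" using assms by auto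
  obtain v r where vr: "pseudo_divmod p Y' = (v, r)" by fastforce
  have 1: "p = Y' * v + r" using pseudo_divmod(1)[OF Y0 vr] assms by simp
  show ?thesis
  proof (cases "degree Y' = 0")
    case True
    then obtain c where "Y' = [:c:]" by (rule degree_eq_zeroE)
    then have "Y' = 1" using assms by (simp add: one_pCons)
    then show ?thesis by (intro exI[of _ p] exI[of _ 0]) simp
  next
    case False
    then have "\<forall>j\<ge>degree Y'. coeff r j = 0"
      using pseudo_divmod(2)[OF Y0 vr] by (auto intro: coeff_eq_0)
    then show ?thesis using 1 by blast
  qed
qed

text \<open>Normal forms for the quotient by a monic polynomial in each variable. Under
  \<open>io\<close> below, the inner variable, with exponent \<open>i\<close>, is q and the outer
  one, with exponent \<open>j\<close>, is A.\<close>

definition box :: "nat \<Rightarrow> nat \<Rightarrow> int poly poly \<Rightarrow> bool" where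
  "box d1 d2 r \<longleftrightarrow> (\<forall>j i. d2 \<le> j \<or> d1 \<le> i \<longrightarrow> coeff (coeff r j) i = 0)"

context
  fixes X' :: "int poly" and Y' :: "int poly poly"
  assumes X': "lead_coeff X' = 1" and Y': "lead_coeff Y' = 1"
begin

lemma box_exists: "\<exists>r. box (degree X') (degree Y') r \<and> p - r \<in> ideal2 [:X':] Y'"
proof -
  obtain v r where vr: "p = Y' * v + r" "\<And>j. degree Y' \<le> j \<Longrightarrow> coeff r j = 0"
    using monic_division[OF Y', of p] by blast
  have "\<exists>u s. c = X' * u + s \<and> (\<forall>j\<ge>degree X'. coeff s j = 0)" for c
    by (rule monic_division[OF X'])
  then obtain U S where US: "\<And>c. c = X' * U c + S c" "\<And>c j. degree X' \<le> j \<Longrightarrow> coeff (S c) j = 0"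
    by metis
  define n where "n = degree Y'"
  define s where "s = (\<Sum>j<n. monom (S (coeff r j)) j)"
  define u where "u = (\<Sum>j<n. monom (U (coeff r j)) j)"
  have cs: "coeff s j = (if j < n then S (coeff r j) else 0)" for j
    by (simp add: s_def coeff_sum)
  have cu: "coeff u j = (if j < n then U (coeff r j) else 0)" for j
    by (simp add: u_def coeff_sum)
  have "r = smult X' u + s"
  proof (rule poly_eqI)
    fix j show "coeff r j = coeff (smult X' u + s) j"
      using US(1)[of "coeff r j"] vr(2)[of j] by (auto simp: cs cu n_def)
  qed
  then have "p - s = u * [:X':] + v * Y'" using vr(1) by (simp add: mult.commute)
  moreover have "box (degree X') (degree Y') s" unfolding box_def using US(2) by (auto simp: cs n_def)
  ultimately show ?thesis unfolding ideal2_def by blast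
qed

text \<open>After reducing \<open>u\<close> modulo \<open>Y'\<close>, the outer degree leaves no
  room for the multiple \<open>t\<close> of \<open>Y'\<close>; so \<open>r\<close> is a multiple of
  \<open>X'\<close> alone, and the inner degree then forces it to be 0.\<close>

lemma box_unique:
  assumes r: "box (degree X') (degree Y') r" "r \<in> ideal2 [:X':] Y'"
  shows "r = 0"
proof -
  obtain u v where uv: "r = u * [:X':] + v * Y'" using r(2) by (auto simp: ideal2_def)
  obtain w u' where w: "u = Y' * w + u'" "\<And>j. degree Y' \<le> j \<Longrightarrow> coeff u' j = 0"
    using monic_division[OF Y', of u] by blast
  define t where "t = v + w * [:X':]"
  have e: "r - smult X' u' = Y' * t" unfolding uv w(1) t_def by (simp add: algebra_simps)
  have "t = 0"
  proof (rule ccontr)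
    assume t: "t \<noteq> 0"
    have Y0: "Y' \<noteq> 0" using Y' by auto
    have "coeff (Y' * t) (degree Y' + degree t) \<noteq> 0"
      using t Y0 by (simp add: coeff_mult_degree_sum)
    moreover have "coeff (r - smult X' u') (degree Y' + degree t) = 0"
    proof -
      have "coeff r (degree Y' + degree t) = 0"
        using r(1) unfolding box_def by (intro poly_eqI) auto
      then show ?thesis using w(2) by simp
    qed
    ultimately show False unfolding e by simp
  qed
  then have r': "r = smult X' u'" using e by simp
  have X0: "X' \<noteq> 0" using X' by auto
  show ?thesis
  proof (rule poly_eqI, rule ccontr)
    fix j assume "coeff r j \<noteq> coeff 0 j"
    then have c: "coeff r j = X' * coeff u' j" "coeff u' j \<noteq> 0" using r' by auto
    have "coeff (coeff r j) (degree X' + degree (coeff u' j)) \<noteq> 0"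
      unfolding c(1) using c(2) X0 by (simp add: coeff_mult_degree_sum)
    then show False using r(1) unfolding box_def by auto
  qed
qed

text \<open>By the normal forms, the quotient is a free abelian group of finite rank. The normal
  form of \<open>a\<close> is divisible by every power of \<open>p\<close>, hence zero.\<close>

lemma poly_separated:
  assumes p: "2 \<le> (p :: nat)" and a: "\<And>l. a \<in> plus_mult (of_nat (p ^ l)) (ideal2 [:X':] Y')"
  shows "a \<in> ideal2 [:X':] Y'"
proof -
  note T = tideal_ideal2[of "[:X':]" Y']
  obtain r where r: "box (degree X') (degree Y') r" "a - r \<in> ideal2 [:X':] Y'" using box_exists by blast
  have dv: "\<exists>s. r = of_nat (p ^ l) * s" for l
  proof -
    obtain b where b: "a - of_nat (p ^ l) * b \<in> ideal2 [:X':] Y'" using a unfolding plus_mult_def by blast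
    obtain s where s: "box (degree X') (degree Y') s" "b - s \<in> ideal2 [:X':] Y'" using box_exists by blast
    have "r - of_nat (p ^ l) * s = (a - of_nat (p ^ l) * b) - (a - r) + of_nat (p ^ l) * (b - s)"
      by (simp add: algebra_simps)
    also have "\<dots> \<in> ideal2 [:X':] Y'"
      by (rule tidealD(2)[OF T tidealD(6)[OF T b r(2)] tidealD(3)[OF T s(2)]])
    finally have "r - of_nat (p ^ l) * s = 0"
    proof (rule box_unique[rotated])
      show "box (degree X') (degree Y') (r - of_nat (p ^ l) * s)"
        using r(1) s(1) unfolding box_def by (simp add: of_nat_poly)
    qed
    then show ?thesis by (intro exI[of _ s]) simp
  qed
  have "r = 0"
  proof (rule poly_eqI, rule poly_eqI)
    fix j i
    define c where "c = coeff (coeff r j) i"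
    \<comment> \<open>The exponent |c| suffices: the integer c is divisible by p^|c| and smaller
      than it in absolute value.\<close>
    obtain s where s: "r = of_nat (p ^ nat \<bar>c\<bar>) * s" using dv by blast
    have c: "c = int (p ^ nat \<bar>c\<bar>) * coeff (coeff s j) i"
      by (subst c_def, subst s) (simp add: of_nat_poly)
    have lt: "\<bar>c\<bar> < int (p ^ nat \<bar>c\<bar>)"
    proof -
      have "nat \<bar>c\<bar> < 2 ^ nat \<bar>c\<bar>" by (rule less_exp)
      also have "\<dots> \<le> p ^ nat \<bar>c\<bar>" using p by (rule power_mono) simp
      finally have "int (nat \<bar>c\<bar>) < int (p ^ nat \<bar>c\<bar>)" by (rule of_nat_less_iff[THEN iffD2])
      then show ?thesis by (simp only: int_nat_eq abs_ge_zero if_True)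
    qed
    have "c = 0"
    proof (rule ccontr)
      assume "c \<noteq> 0"
      have "int (p ^ nat \<bar>c\<bar>) dvd c" using c by (metis dvd_triv_left)
      then have "\<bar>int (p ^ nat \<bar>c\<bar>)\<bar> \<le> \<bar>c\<bar>" by (rule dvd_imp_le_int[OF \<open>c \<noteq> 0\<close>])
      then show False using lt by simp
    qed
    then show "coeff (coeff r j) i = coeff (coeff 0 j) i" by (simp add: c_def)
  qed
  then show ?thesis using r(2) by simp
qed

end

lemma rhom_poly_eval:
  fixes f :: "'c::comm_ring_1 \<Rightarrow> 'd::comm_ring_1"
  assumes f: "rhom f"
  shows "rhom (\<lambda>p. poly (map_poly f p) x)"
proof -
  define h where "h p = poly (map_poly f p) x" for p
  note fD = rhomD[OF f]
  have pC: "h (pCons a p) = f a + x * h p" for a p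
    unfolding h_def by (subst map_poly_pCons) (simp_all add: fD)
  have z: "h 0 = 0" by (simp add: h_def)
  have add: "h (p + q) = h p + h q" for p q
    by (induction p q rule: poly_induct2) (simp_all add: z pC fD algebra_simps)
  have sm: "h (smult a q) = f a * h q" for a q
    by (induction q) (simp_all add: z pC fD algebra_simps)
  have mult: "h (p * q) = h p * h q" for p q
    by (induction p) (simp_all add: z pC add sm fD algebra_simps mult_pCons_left)
  have one: "h 1 = 1" unfolding one_pCons by (simp add: pC z fD)
  show ?thesis using add mult one unfolding rhom_def h_def by blast
qed

section \<open>Laurent polynomials as a localization of polynomials in q and A\<close>

definition qmon :: "int \<Rightarrow> int \<Rightarrow> laurent_qA" where
  "qmon a b = Poly_Mapping.single (a, b) 1"

lemma qmon_mult: "qmon a b * qmon c d = qmon (a + c) (b + d)"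
  by (simp add: qmon_def mult_single)

lemma qmon_0 [simp]: "qmon 0 0 = 1"
  by (simp add: qmon_def zero_prod_def[symmetric])

lemma qmon_power: "qmon a b ^ n = qmon (int n * a) (int n * b)"
  by (induction n) (simp_all add: qmon_mult algebra_simps)

lemma of_int_single: "(of_int c :: laurent_qA) = Poly_Mapping.single (0, 0) c"
proof -
  have n: "(of_nat k :: laurent_qA) = Poly_Mapping.single (0, 0) (int k)" for k
  proof (induction k)
    case (Suc k)
    have one: "(1 :: laurent_qA) = Poly_Mapping.single (0, 0) 1" by (simp add: zero_prod_def[symmetric])
    have "(of_nat (Suc k) :: laurent_qA) = Poly_Mapping.single (0, 0) 1 + Poly_Mapping.single (0, 0) (int k)"
      unfolding of_nat_Suc Suc one ..
    then show ?case by (simp only: single_add[symmetric] of_nat_Suc)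
  qed simp
  show ?thesis by (cases c) (simp_all add: n single_uminus del: of_nat_Suc)
qed

lemma single_qmon: "Poly_Mapping.single (a, b) c = of_int c * qmon a b"
  by (simp add: of_int_single qmon_def mult_single)

definition io0 :: "int poly \<Rightarrow> laurent_qA" where
  "io0 c = poly (map_poly of_int c) (qmon 1 0)"

definition io :: "int poly poly \<Rightarrow> laurent_qA" where
  "io p = poly (map_poly io0 p) (qmon 0 1)"

lemma rhom_io0: "rhom io0"
  unfolding io0_def[abs_def] by (rule rhom_poly_eval[OF rhom_of_int])

lemma rhom_io: "rhom io"
  unfolding io_def[abs_def] by (rule rhom_poly_eval[OF rhom_io0])

definition pq :: "int poly poly" where "pq = [:[:0, 1:]:]"
definition pA' :: "int poly poly" where "pA' = [:0, 1:]"

lemma io_gens: "io pq = qmon 1 0" "io pA' = qmon 0 1"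
proof -
  have 0: "io0 0 = 0" "io0 1 = 1" using rhomD(1,4)[OF rhom_io0] by auto
  have 1: "io0 [:0, 1:] = qmon 1 0" unfolding io0_def by (subst map_poly_pCons) (auto simp: map_poly_pCons)
  show "io pq = qmon 1 0" unfolding io_def pq_def by (subst map_poly_pCons) (auto simp: 0 1)
  show "io pA' = qmon 0 1" unfolding io_def pA'_def by (subst map_poly_pCons) (auto simp: 0 map_poly_pCons)
qed

lemma io_of_int: "io (of_int c) = of_int c"
proof -
  have n: "io (of_nat k) = of_nat k" for k
    by (induction k) (simp_all add: rhomD[OF rhom_io])
  show ?thesis by (cases c) (simp_all add: n rhomD[OF rhom_io] del: of_nat_Suc)
qed

lemma io_qmon: "io (pq ^ s * pA' ^ t) = qmon (int s) (int t)"
  by (simp add: rhomD[OF rhom_io] io_gens qmon_power qmon_mult)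

text \<open>Stated for all sufficiently large exponents, so that a single monomial can clear several
  elements at once.\<close>

lemma clear_denominators: "\<exists>s t. \<forall>s'\<ge>s. \<forall>t'\<ge>t. \<exists>p. qmon (int s') (int t') * a = io p"
proof (induction a rule: poly_mapping_induct_add)
  case zero
  then show ?case using rhomD(4)[OF rhom_io] by (metis mult_zero_right)
next
  case (single k c)
  obtain a b where k: "k = (a, b)" by (cases k)
  have "qmon (int s') (int t') * Poly_Mapping.single k c = io (of_int c * (pq ^ nat (int s' + a) * pA' ^ nat (int t' + b)))"
    if "nat (- a) \<le> s'" "nat (- b) \<le> t'" for s' t'
  proof -
    have "0 \<le> int s' + a" "0 \<le> int t' + b" using that by linarith+
    then have "io (of_int c * (pq ^ nat (int s' + a) * pA' ^ nat (int t' + b))) = of_int c * qmon (int s' + a) (int t' + b)"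
      unfolding rhomD(3)[OF rhom_io, of "of_int c"] io_qmon io_of_int by simp
    then show ?thesis unfolding k single_qmon by (simp add: qmon_mult[symmetric] mult_ac)
  qed
  then show ?case by blast
next
  case (add a b)
  then obtain s t s2 t2 where
    1: "\<And>s' t'. s \<le> s' \<Longrightarrow> t \<le> t' \<Longrightarrow> \<exists>p. qmon (int s') (int t') * a = io p" and
    2: "\<And>s' t'. s2 \<le> s' \<Longrightarrow> t2 \<le> t' \<Longrightarrow> \<exists>p. qmon (int s') (int t') * b = io p" by metis
  show ?case
  proof (rule exI[of _ "max s s2"], rule exI[of _ "max t t2"], intro allI impI)
    fix s' t' assume "max s s2 \<le> s'" "max t t2 \<le> t'"
    then obtain p p' where "qmon (int s') (int t') * a = io p" "qmon (int s') (int t') * b = io p'"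
      using 1[of s' t'] 2[of s' t'] by auto
    then have "qmon (int s') (int t') * (a + b) = io (p + p')" by (simp add: distrib_left rhomD[OF rhom_io])
    then show "\<exists>p. qmon (int s') (int t') * (a + b) = io p" by blast
  qed
qed

lemma degree_map_poly_le: "f 0 = 0 \<Longrightarrow> degree (map_poly f p) \<le> degree p"
  by (rule degree_le) (simp add: coeff_map_poly coeff_eq_0)

lemma io_inj: "io p = 0 \<Longrightarrow> p = 0"
proof -
  assume p: "io p = 0"
  have c0: "io0 0 = 0" using rhomD(4)[OF rhom_io0] .
  have i0: "io0 c = (\<Sum>i\<le>degree c. of_int (coeff c i) * qmon (int i) 0)" for c
  proof -
    have "io0 c = (\<Sum>i\<le>degree (map_poly of_int c :: laurent_qA poly). coeff (map_poly of_int c) i * qmon 1 0 ^ i)"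
      unfolding io0_def poly_altdef ..
    also have "\<dots> = (\<Sum>i\<le>degree c. coeff (map_poly of_int c) i * qmon 1 0 ^ i)"
      by (intro sum.mono_neutral_left) (auto simp: coeff_eq_0 c0 intro: order_trans[OF _ degree_map_poly_le])
    finally show ?thesis by (simp add: coeff_map_poly qmon_power)
  qed
  have "io p = (\<Sum>j\<le>degree (map_poly io0 p). coeff (map_poly io0 p) j * qmon 0 1 ^ j)"
    unfolding io_def poly_altdef ..
  also have "\<dots> = (\<Sum>j\<le>degree p. coeff (map_poly io0 p) j * qmon 0 1 ^ j)"
    by (intro sum.mono_neutral_left) (auto simp: coeff_eq_0 c0 intro: order_trans[OF _ degree_map_poly_le])
  also have "\<dots> = (\<Sum>j\<le>degree p. \<Sum>i\<le>degree (coeff p j). Poly_Mapping.single (int i, int j) (coeff (coeff p j) i))"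
    by (simp add: coeff_map_poly c0 i0 qmon_power sum_distrib_right mult.assoc qmon_mult single_qmon)
  finally have e: "io p = \<dots>" .
  show "p = 0"
  proof (rule poly_eqI, rule poly_eqI)
    fix j i
    have "Poly_Mapping.lookup (io p) (int i, int j)
      = (\<Sum>j'\<le>degree p. \<Sum>i'\<le>degree (coeff p j'). if j' = j then (if i' = i then coeff (coeff p j') i' else 0) else 0)"
      unfolding e lookup_sum by (intro sum.cong refl) (auto simp: lookup_single when_def)
    also have "\<dots> = (\<Sum>j'\<le>degree p. if j' = j then (\<Sum>i'\<le>degree (coeff p j'). if i' = i then coeff (coeff p j') i' else 0) else 0)"
      by (intro sum.cong refl) simp
    also have "\<dots> = coeff (coeff p j) i"
      by (auto simp: coeff_eq_0)
    finally show "coeff (coeff p j) i = coeff (coeff 0 j) i" using p by simp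
  qed
qed

definition unitmod :: "'a::comm_ring_1 set \<Rightarrow> 'a \<Rightarrow> bool" where
  "unitmod J z \<longleftrightarrow> (\<exists>e. z * e - 1 \<in> J)"

lemma unitmod_mult: "tideal J \<Longrightarrow> unitmod J a \<Longrightarrow> unitmod J b \<Longrightarrow> unitmod J (a * b)"
  unfolding unitmod_def
proof (elim exE)
  fix e f assume J: "tideal J" and e: "a * e - 1 \<in> J" and f: "b * f - 1 \<in> J"
  have "a * b * (e * f) - 1 = (a * e - 1) * (b * f) + (b * f - 1)" by (simp add: algebra_simps)
  then show "\<exists>g. a * b * g - 1 \<in> J" using tidealD(2,4)[OF J] e f by metis
qed

lemma unitmod_one: "tideal J \<Longrightarrow> unitmod J 1"
  unfolding unitmod_def by (auto intro!: exI[of _ 1] tidealD(1))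

lemma unitmod_minus: "unitmod J a \<Longrightarrow> unitmod J (- a)"
  unfolding unitmod_def by (metis mult_minus_left mult_minus_right minus_minus)

lemma unitmod_power: "tideal J \<Longrightarrow> unitmod J a \<Longrightarrow> unitmod J (a ^ n)"
  by (induction n) (simp_all add: unitmod_one unitmod_mult)

lemma unitmod_prod: "tideal J \<Longrightarrow> (\<And>x. x \<in> S \<Longrightarrow> unitmod J (f x)) \<Longrightarrow> unitmod J (prod f S)"
  by (induction S rule: infinite_finite_induct) (simp_all add: unitmod_one unitmod_mult)

text \<open>If q and A are already units modulo the polynomial ideal, inverting them does not change
  the quotient, and separation is inherited from polynomials.\<close>

lemma laurent_separated:
  assumes mon: "lead_coeff X' = 1" "lead_coeff Y' = 1"
    and un: "unitmod (ideal2 [:X':] Y') pq" "unitmod (ideal2 [:X':] Y') pA'"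
    and p: "2 \<le> (p :: nat)" and a: "\<And>l. a \<in> plus_mult (of_nat (p ^ l)) (ideal2 (io [:X':]) (io Y'))"
  shows "a \<in> ideal2 (io [:X':]) (io Y')"
proof -
  define J where "J = ideal2 [:X':] Y'"
  define I where "I = ideal2 (io [:X':]) (io Y')"
  note TJ = tideal_ideal2[of "[:X':]" Y', folded J_def] and TI = tideal_ideal2[of "io [:X':]" "io Y'", folded I_def]
  obtain s t P where P: "qmon (int s) (int t) * a = io P" using clear_denominators[of a] by blast
  have "P \<in> J" unfolding J_def
  proof (rule poly_separated[OF mon p])
    fix l
    have "qmon (int s) (int t) * a \<in> plus_mult (of_nat (p ^ l)) I"
      using a unfolding I_def[symmetric] by (rule tidealD(3)[OF tideal_plus_mult[OF TI]])
    then obtain b where "io P - of_nat (p ^ l) * b \<in> I" unfolding plus_mult_def P by blast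
    then obtain u v where uv: "io P - of_nat (p ^ l) * b = u * io [:X':] + v * io Y'" unfolding I_def ideal2_def by blast
    obtain s1 t1 where 1: "\<And>s' t'. s1 \<le> s' \<Longrightarrow> t1 \<le> t' \<Longrightarrow> \<exists>p. qmon (int s') (int t') * b = io p"
      using clear_denominators[of b] by metis
    obtain s2 t2 where 2: "\<And>s' t'. s2 \<le> s' \<Longrightarrow> t2 \<le> t' \<Longrightarrow> \<exists>p. qmon (int s') (int t') * u = io p"
      using clear_denominators[of u] by metis
    obtain s3 t3 where 3: "\<And>s' t'. s3 \<le> s' \<Longrightarrow> t3 \<le> t' \<Longrightarrow> \<exists>p. qmon (int s') (int t') * v = io p"
      using clear_denominators[of v] by metis
    define s' t' where "s' = s1 + s2 + s3" and "t' = t1 + t2 + t3"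
    obtain b' u' v' where b': "qmon (int s') (int t') * b = io b'" and u': "qmon (int s') (int t') * u = io u'"
      and v': "qmon (int s') (int t') * v = io v'"
      using 1[of s' t'] 2[of s' t'] 3[of s' t'] unfolding s'_def t'_def by auto
    define m where "m = pq ^ s' * pA' ^ t'"
    have m: "io m = qmon (int s') (int t')" unfolding m_def by (rule io_qmon)
    have n: "io (of_nat k) = of_nat k" for k using io_of_int[of "int k"] by simp
    have "io m * io P - of_nat (p ^ l) * (io m * b) = (io m * u) * io [:X':] + (io m * v) * io Y'"
    proof -
      have "io m * io P - of_nat (p ^ l) * (io m * b) = io m * (io P - of_nat (p ^ l) * b)" by (simp add: algebra_simps)
      then show ?thesis unfolding uv by (simp add: algebra_simps)
    qed
    then have "io (m * P - of_nat (p ^ l) * b' - (u' * [:X':] + v' * Y')) = 0"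
      unfolding m b' u' v' unfolding rhomD[OF rhom_io] n m by simp
    then have "m * P - of_nat (p ^ l) * b' = u' * [:X':] + v' * Y'" using io_inj by fastforce
    then have mP: "m * P - of_nat (p ^ l) * b' \<in> J" unfolding J_def ideal2_def by blast
    have "unitmod J m" unfolding m_def J_def
      by (intro unitmod_mult unitmod_power tideal_ideal2 un)
    then obtain e where e: "m * e - 1 \<in> J" unfolding unitmod_def by blast
    have "P - of_nat (p ^ l) * (e * b') = e * (m * P - of_nat (p ^ l) * b') - (m * e - 1) * P"
      by (simp add: algebra_simps)
    also have "\<dots> \<in> J" using tidealD(3,4,6)[OF TJ] mP e by metis
    finally show "P \<in> plus_mult (of_nat (p ^ l)) (ideal2 [:X':] Y')"
      unfolding plus_mult_def J_def[symmetric] by blast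
  qed
  then obtain u v where "P = u * [:X':] + v * Y'" unfolding J_def ideal2_def by blast
  then have "io P = io u * io [:X':] + io v * io Y'" by (simp only: rhomD[OF rhom_io])
  then have "io P \<in> I" unfolding I_def ideal2_def by blast
  then have "qmon (- int s) (- int t) * io P \<in> I" by (rule tidealD(3)[OF TI])
  moreover have "qmon (- int s) (- int t) * io P = a"
    unfolding P[symmetric] mult.assoc[symmetric] qmon_mult by simp
  ultimately show ?thesis unfolding I_def by simp
qed

text \<open>Modulo \<open>XM M\<close>, q^2 is an M-th root of unity, and \<open>YM M\<close> is
  {\<alpha>; M} up to a unit. The two elements replace the infinitely many generators of
  \<open>In\<close> and make the quotients finitely generated abelian groups.\<close>

definition XM :: "nat \<Rightarrow> laurent_qA" where "XM M = qmon (2 * int M) 0 - 1"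
definition YM :: "nat \<Rightarrow> laurent_qA" where "YM M = (\<Prod>i<M. qmon 0 2 - qmon (2 * int i) 0)"

lemma XY_separated:
  assumes M: "0 < M" and p: "2 \<le> (p :: nat)" and a: "\<And>l. a \<in> plus_mult (of_nat (p ^ l)) (ideal2 (XM M ^ k) (YM M ^ k))"
  shows "a \<in> ideal2 (XM M ^ k) (YM M ^ k)"
proof -
  define X1 :: "int poly" where "X1 = monom 1 (2 * M) + - 1"
  define F :: "nat \<Rightarrow> int poly poly" where "F = (\<lambda>i. [:- monom 1 (2 * i), 0, 1:])"
  define X' where "X' = X1 ^ k"
  define Y' where "Y' = (\<Prod>i<M. F i) ^ k"
  have dm: "degree (monom (1::int) (2 * M)) = 2 * M" by (rule degree_monom_eq) simp
  have dX: "degree X1 = 2 * M"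
    unfolding X1_def using M dm by (subst degree_add_eq_left) simp_all
  have "lead_coeff X1 = 1" unfolding dX unfolding X1_def using M by (cases "2 * M") auto
  then have mX: "lead_coeff X' = 1" unfolding X'_def by (simp add: lead_coeff_power)
  have Fi: "F i = [:- monom 1 (2 * i), 0, 1:]" for i using fun_cong[OF F_def, of i] .
  have "lead_coeff (F i) = 1" for i unfolding Fi by simp
  then have "lead_coeff (\<Prod>i<m. F i) = 1" for m
    by (induction m) (simp_all add: lead_coeff_mult del: lead_coeff_pCons)
  then have mY: "lead_coeff Y' = 1" unfolding Y'_def by (simp add: lead_coeff_power)
  have mq: "[:monom 1 n:] = pq ^ n" for n
  proof (induction n)
    case (Suc n)
    have "[:monom 1 (Suc n):] = pq * [:monom 1 n:]" unfolding pq_def by (simp add: monom_Suc)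
    then show ?case unfolding Suc power_Suc .
  qed (simp add: monom_0 one_pCons)
  have X1q: "[:X1:] = pq ^ (2 * M) - 1"
    unfolding X1_def mq[symmetric] by (simp add: one_pCons)
  have Xq: "[:X':] = (pq ^ (2 * M) - 1) ^ k"
    unfolding X'_def X1q[symmetric]
  proof (induction k)
    case (Suc k)
    have "[:X1 ^ Suc k:] = [:X1:] * [:X1 ^ k:]" by simp
    then show ?case unfolding Suc power_Suc .
  qed (simp add: one_pCons)
  have Fq: "F i = pA' ^ 2 - pq ^ (2 * i)" for i
    unfolding Fi mq[symmetric] pA'_def power2_eq_square by simp
  have ioX: "io [:X':] = XM M ^ k"
    unfolding Xq by (simp add: rhomD[OF rhom_io] io_gens qmon_power XM_def)
  have ioY: "io Y' = YM M ^ k"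
    unfolding Y'_def Fq by (simp add: rhomD[OF rhom_io] io_gens qmon_power YM_def)
  define J where "J = ideal2 [:X':] Y'"
  have TJ: "tideal J" unfolding J_def by (rule tideal_ideal2)
  \<comment> \<open>The constant term of (q^(2M) - 1)^k in q is a sign, so q divides 1 modulo
    \<open>J\<close>.\<close>
  have uq: "unitmod J pq"
  proof -
    define w where "w = pq ^ (2 * M)"
    have "\<exists>g. (w - 1) ^ k * (- 1) ^ k = 1 - w * g"
    proof (induction k)
      case 0 then show ?case by (auto intro: exI[of _ 0])
    next
      case (Suc k)
      then obtain g where g: "(w - 1) ^ k * (- 1) ^ k = 1 - w * g" by blast
      have "(w - 1) ^ Suc k * (- 1) ^ Suc k = (1 - w) * ((w - 1) ^ k * (- 1) ^ k)" by (simp add: algebra_simps)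
      also have "\<dots> = 1 - w * (1 + g - w * g)" unfolding g by (simp add: algebra_simps)
      finally show ?case by blast
    qed
    then obtain g where g: "(w - 1) ^ k * (- 1) ^ k = 1 - w * g" by blast
    have "(w - 1) ^ k \<in> J" unfolding J_def Xq[symmetric] w_def by (rule ideal2_gen)
    then have "- ((w - 1) ^ k * (- 1) ^ k) \<in> J" using tidealD(4,5)[OF TJ] by blast
    moreover have "w = pq * pq ^ (2 * M - 1)" unfolding w_def using M by (simp add: power_Suc[symmetric] del: power_Suc)
    ultimately have "pq * (pq ^ (2 * M - 1) * g) - 1 \<in> J" unfolding g by (simp add: mult.assoc)
    then show ?thesis unfolding unitmod_def by blast
  qed
  \<comment> \<open>At A = 0 the product becomes \<open>c\<close>, built from negated powers of q
    and hence a unit modulo \<open>J\<close> by \<open>uq\<close>; so A divides a unit modulo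
    \<open>J\<close>.\<close>
  have uA: "unitmod J pA'"
  proof -
    define c where "c = (\<Prod>i<M. - (pq ^ (2 * i)))"
    have "\<exists>g. (\<Prod>i<m. F i) = pA' * g + (\<Prod>i<m. - (pq ^ (2 * i)))" for m
    proof (induction m)
      case 0 then show ?case by (auto intro: exI[of _ 0])
    next
      case (Suc m)
      then obtain g where g: "(\<Prod>i<m. F i) = pA' * g + (\<Prod>i<m. - (pq ^ (2 * i)))" by blast
      have "(\<Prod>i<Suc m. F i) = pA' * (g * F m + (\<Prod>i<m. - (pq ^ (2 * i))) * pA') + (\<Prod>i<Suc m. - (pq ^ (2 * i)))"
        by (simp add: g) (simp add: Fq algebra_simps power2_eq_square)
      then show ?case by blast
    qed
    then obtain g where g: "(\<Prod>i<M. F i) = pA' * g + c" unfolding c_def by blast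
    have "\<exists>h. (pA' * g + c) ^ k = pA' * h + c ^ k"
    proof (induction k)
      case 0 then show ?case by (auto intro: exI[of _ 0])
    next
      case (Suc k)
      then obtain h where h: "(pA' * g + c) ^ k = pA' * h + c ^ k" by blast
      have "(pA' * g + c) ^ Suc k = pA' * (g * (pA' * h + c ^ k) + c * h) + c ^ Suc k"
        unfolding power_Suc h by (simp add: algebra_simps)
      then show ?case by blast
    qed
    then obtain h where h: "Y' = pA' * h + c ^ k" unfolding Y'_def g by blast
    have "unitmod J (- (c ^ k))" unfolding c_def
      by (intro unitmod_minus unitmod_power unitmod_prod TJ uq)
    then obtain e where e: "- (c ^ k) * e - 1 \<in> J" unfolding unitmod_def by blast
    have "Y' \<in> J" unfolding J_def by (rule ideal2_gen)
    then have "Y' * e + (- (c ^ k) * e - 1) \<in> J" using tidealD(2,4)[OF TJ] e by blast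
    moreover have "Y' * e + (- (c ^ k) * e - 1) = pA' * (h * e) - 1" unfolding h by (simp add: algebra_simps)
    ultimately show ?thesis unfolding unitmod_def by metis
  qed
  show ?thesis
    using laurent_separated[OF mX mY uq[unfolded J_def] uA[unfolded J_def] p, of a] a unfolding ioX ioY by blast
qed

section \<open>The completion embeds into power series\<close>

lemma pideal_0: "a \<in> pideal x y 0"
  unfolding pideal_def by (rule CollectI, rule exI[of _ "\<lambda>_. a"]) simp

lemma RqA_simps [simp]: "carrier RqA = UNIV" "monoid.mult RqA = (*)" "monoid.one RqA = 1" "ring.zero RqA = 0" "ring.add RqA = (+)"
  by (simp_all add: RqA_def ring_of_type_algebra_def fun_eq_iff)

lemma cring_RqA: "cring RqA"
  unfolding RqA_def by (rule cring_from_type_algebra)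

lemma tideal_ideal: "tideal I \<Longrightarrow> ideal I RqA"
proof -
  assume I: "tideal I"
  interpret cring RqA by (rule cring_RqA)
  show ?thesis
  proof (rule idealI)
    show "ring RqA" by (rule ring_axioms)
    show "subgroup I (add_monoid RqA)"
    proof (rule group.subgroupI)
      show "group (add_monoid RqA)" by (rule add.group_axioms)
      show "I \<subseteq> carrier (add_monoid RqA)" by simp
      show "I \<noteq> {}" using tidealD(1)[OF I] by blast
      show "inv\<^bsub>add_monoid RqA\<^esub> a \<in> I" if "a \<in> I" for a
      proof -
        have "inv\<^bsub>add_monoid RqA\<^esub> a = - a"
          by (rule group.inv_equality[OF add.group_axioms]) auto
        then show ?thesis using tidealD(5)[OF I that] by simp
      qed
      show "a \<otimes>\<^bsub>add_monoid RqA\<^esub> b \<in> I" if "a \<in> I" "b \<in> I" for a b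
        using tidealD(2)[OF I that] by simp
    qed
    show "x \<otimes>\<^bsub>RqA\<^esub> a \<in> I" "a \<otimes>\<^bsub>RqA\<^esub> x \<in> I" if "a \<in> I" "x \<in> carrier RqA" for a x
      using tidealD(3,4)[OF I that(1)] by auto
  qed
qed

lemma ideal_tideal: "ideal I RqA \<Longrightarrow> tideal I"
proof -
  assume id: "ideal I RqA"
  note s = ideal.axioms(1)[OF id]
  show ?thesis unfolding tideal_def
    using additive_subgroup.zero_closed[OF s] additive_subgroup.a_closed[OF s] ideal.I_l_closed[OF id] by simp
qed

lemma ideal_In: "ideal (In n) RqA"
proof -
  interpret cring RqA by (rule cring_RqA)
  show ?thesis unfolding In_def by (rule genideal_ideal) simp
qed

lemma tideal_In: "tideal (In n)"
  by (rule ideal_tideal[OF ideal_In])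

lemma q_alpha_In: "q_alpha l n \<in> In n"
proof -
  interpret cring RqA by (rule cring_RqA)
  show ?thesis unfolding In_def using genideal_self[of "range (\<lambda>l. q_alpha l n)"] by auto
qed

lemma In_least:
  assumes "tideal J" "\<And>l. q_alpha l n \<in> J"
  shows "In n \<subseteq> J"
proof -
  interpret cring RqA by (rule cring_RqA)
  show ?thesis unfolding In_def using assms by (intro genideal_minimal tideal_ideal) auto
qed

section \<open>Comparison of the ideals \<open>In\<close> with the two elements at level
  \<open>M\<close>\<close>

definition qB :: "int \<Rightarrow> laurent_qA" where "qB j = qmon j 1 - qmon (- j) (- 1)"

lemma q_alpha_qB: "q_alpha l n = (\<Prod>i<n. qB (l - int i))"
  by (simp add: q_alpha_def qB_def qmon_def)

lemma q_alpha_add: "q_alpha l (n + m) = q_alpha l n * q_alpha (l - int n) m"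
proof -
  have "(\<Prod>i<n + m. qB (l - int i)) = (\<Prod>i<n. qB (l - int i)) * (\<Prod>i<m. qB (l - int n - int i))"
    by (induction m) (simp_all add: mult_ac algebra_simps)
  then show ?thesis by (simp add: q_alpha_qB)
qed

lemma In_antimono: "n \<le> m \<Longrightarrow> In m \<subseteq> In n"
proof (rule In_least[OF tideal_In])
  fix l assume "n \<le> m"
  then obtain d where "m = n + d" using le_Suc_ex by blast
  then show "q_alpha l m \<in> In n"
    using tidealD(4)[OF tideal_In q_alpha_In] by (simp add: q_alpha_add)
qed

definition Qn :: "nat \<Rightarrow> laurent_qA" where "Qn i = qmon (2 * int i) 0 - 1"

text \<open>The generators of length n + 1 at l + 1 and at l share the factor
  \<open>q_alpha l n\<close>. Their other factors, weighted by a power of q, combine to a unit times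
  q^(2(n+1)) - 1, so A is eliminated from one factor.\<close>

lemma q_alpha_difference:
  assumes I: "tideal I" and c: "\<And>l. c * q_alpha l (Suc n) \<in> I"
  shows "(c * Qn (Suc n)) * q_alpha l n \<in> I"
proof -
  have 1: "q_alpha (l + 1) (Suc n) = qB (l + 1) * q_alpha l n"
    using q_alpha_add[of "l + 1" 1 n] by (simp add: q_alpha_qB)
  have 2: "q_alpha l (Suc n) = q_alpha l n * qB (l - int n)"
    using q_alpha_add[of l n 1] by (simp add: q_alpha_qB)
  define u where "u = qmon (- l - 1 - int (Suc n)) (- 1)"
  have e: "qmon (- int (Suc n)) 0 * qB (l + 1) - qB (l - int n) = u * Qn (Suc n)"
    unfolding qB_def Qn_def u_def by (simp add: right_diff_distrib qmon_mult algebra_simps)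
      (rule arg_cong2[where f = qmon]; simp)
  have "u * (c * Qn (Suc n) * q_alpha l n) = (u * Qn (Suc n)) * (c * q_alpha l n)"
    by (simp only: mult_ac)
  also have "\<dots> = qmon (- int (Suc n)) 0 * (c * q_alpha (l + 1) (Suc n)) - c * q_alpha l (Suc n)"
    unfolding e[symmetric] 1 2 left_diff_distrib by (simp only: mult_ac)
  also have "\<dots> \<in> I" using tidealD(3,6)[OF I] c by blast
  finally have "qmon (l + 1 + int (Suc n)) 1 * (u * (c * Qn (Suc n) * q_alpha l n)) \<in> I"
    by (rule tidealD(3)[OF I])
  moreover have "qmon (l + 1 + int (Suc n)) 1 * u = 1" unfolding u_def qmon_mult by simp
  ultimately show ?thesis unfolding mult.assoc[symmetric] by simp
qed

text \<open>Repeating the difference step, with the factors gained so far collected in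
  \<open>c\<close>, trades all brackets for an element that involves q alone.\<close>

lemma Qn_prod_In: "(\<Prod>i=1..n. Qn i) \<in> In n"
proof -
  have "\<forall>l. c * q_alpha l m \<in> I \<Longrightarrow> c * (\<Prod>i=1..m. Qn i) \<in> I" if I: "tideal I" for c I and m :: nat
  proof (induction m arbitrary: c)
    case 0
    then show ?case by (simp add: q_alpha_def)
  next
    case (Suc m)
    have "\<forall>l. (c * Qn (Suc m)) * q_alpha l m \<in> I"
      using q_alpha_difference[OF I] Suc.prems by blast
    then have "c * Qn (Suc m) * (\<Prod>i=1..m. Qn i) \<in> I" by (rule Suc.IH)
    moreover have "c * (\<Prod>i=1..Suc m. Qn i) = c * Qn (Suc m) * (\<Prod>i=1..m. Qn i)"
      by (simp add: mult_ac)
    ultimately show ?case by (simp only:)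
  qed
  from this[OF tideal_In, of 1 n n] show ?thesis using q_alpha_In by simp
qed

lemma qmon_power_diff_dvd: "qmon (2 * int i) 0 - 1 dvd (qmon (2 * int (i * k)) 0 - 1 :: laurent_qA)"
proof -
  have e: "qmon (2 * int (i * k)) 0 = qmon (2 * int i) 0 ^ k"
    unfolding qmon_power by (simp add: mult_ac)
  define z where "z = qmon (2 * int i) 0"
  have "z - 1 dvd z ^ k - 1"
  proof (induction k)
    case (Suc k)
    have "z ^ Suc k - 1 = z * (z ^ k - 1) + (z - 1)" by (simp add: algebra_simps)
    then show ?case using Suc by (metis dvd_add dvd_mult dvd_refl)
  qed simp
  then show ?thesis unfolding e z_def .
qed

text \<open>For i from 1 to n, q^(2i) - 1 divides q^(2 n!) - 1; this is the reason for working at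
  level n!.\<close>

lemma XM_power_In: "XM (fact n) ^ n \<in> In n"
proof -
  have "(\<Prod>i=1..n. Qn i) dvd (\<Prod>i=1..n. XM (fact n))"
  proof (rule prod_dvd_prod)
    fix i assume "i \<in> {1..n}"
    then have "i dvd fact n" by (intro dvd_fact) auto
    then obtain k where k: "fact n = i * k" by (elim dvdE)
    show "Qn i dvd XM (fact n)" unfolding Qn_def XM_def k by (rule qmon_power_diff_dvd)
  qed
  then obtain c where "XM (fact n) ^ n = (\<Prod>i=1..n. Qn i) * c" by (auto elim: dvdE)
  then show ?thesis using tidealD(4)[OF tideal_In Qn_prod_In] by simp
qed

lemma YM_q_alpha: "YM n = qmon (\<Sum>i<n. int i) (int n) * q_alpha 0 n"
proof (induction n)
  case (Suc n)
  have "qmon 0 2 - qmon (2 * int n) 0 = qmon (int n) 1 * qB (- int n)"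
    unfolding qB_def by (simp add: right_diff_distrib qmon_mult)
  then have "YM (Suc n) = (qmon (\<Sum>i<n. int i) (int n) * qmon (int n) 1) * (q_alpha 0 n * qB (- int n))"
    using Suc by (simp add: YM_def mult_ac)
  also have "q_alpha 0 n * qB (- int n) = q_alpha 0 (Suc n)" by (simp add: q_alpha_qB)
  finally show ?case by (simp add: qmon_mult add.commute)
qed (simp add: YM_def q_alpha_def)

lemma YM_In: "n \<le> M \<Longrightarrow> YM M \<in> In n"
  unfolding YM_q_alpha using In_antimono[of n M] q_alpha_In[of 0 M] tidealD(3)[OF tideal_In] by blast

definition FM :: "nat \<Rightarrow> int \<Rightarrow> laurent_qA" where
  "FM M s = (\<Prod>i<M. qmon 0 2 - qmon (2 * (s + int i)) 0)"

text \<open>Moving the window of M factors by one exchanges A^2 - q^(2s) for A^2 - q^(2(s+M)), which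
  agrees with it modulo q^(2M) - 1.\<close>

lemma FM_shift: "XM M dvd FM M (s + 1) - FM M s"
proof (cases M)
  case (Suc m)
  define W where "W = (\<Prod>i<m. qmon 0 2 - qmon (2 * (s + 1 + int i)) 0)"
  have 1: "FM M (s + 1) = W * (qmon 0 2 - qmon (2 * (s + int M)) 0)"
    unfolding FM_def Suc W_def by (simp add: algebra_simps)
  have 2: "FM M s = (qmon 0 2 - qmon (2 * s) 0) * W"
    unfolding FM_def Suc W_def by (subst prod.lessThan_Suc_shift) (simp add: algebra_simps)
  have "FM M (s + 1) - FM M s = XM M * (- W * qmon (2 * s) 0)"
    unfolding 1 2 XM_def by (simp add: algebra_simps qmon_mult)
  then show ?thesis by simp
qed (simp add: FM_def)

lemma FM_YM: "XM M dvd FM M s - YM M"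
proof -
  have 0: "FM M 0 = YM M" by (simp add: FM_def YM_def)
  have "XM M dvd FM M (int k) - FM M 0" for k
  proof (induction k)
    case (Suc k)
    have "FM M (int (Suc k)) - FM M 0 = (FM M (int k + 1) - FM M (int k)) + (FM M (int k) - FM M 0)" by (simp add: add.commute)
    then show ?case using Suc FM_shift[of M "int k"] by (metis dvd_add)
  qed simp
  moreover have "XM M dvd FM M (- int k) - FM M 0" for k
  proof (induction k)
    case (Suc k)
    have "FM M (- int (Suc k)) - FM M 0 = (FM M (- int k) - FM M 0) - (FM M (- int (Suc k) + 1) - FM M (- int (Suc k)))"
      by simp
    then show ?case using Suc FM_shift[of M "- int (Suc k)"] by (metis dvd_diff)
  qed simp
  ultimately show ?thesis unfolding 0[symmetric] by (cases s rule: int_cases2) auto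
qed

text \<open>Any M consecutive brackets are, up to a unit, a window of factors A^2 - q^(2i), and all
  windows are congruent to \<open>YM M\<close> modulo \<open>XM M\<close>.\<close>

lemma q_alpha_block: "q_alpha l M \<in> ideal2 (XM M) (YM M)"
proof -
  note T = tideal_ideal2[of "XM M" "YM M"]
  have "qB (l - int i) = qmon (l - int i) (- 1) * (qmon 0 2 - qmon (2 * (- l + int i)) 0)" for i
    unfolding qB_def by (simp add: right_diff_distrib qmon_mult algebra_simps)
  then have q: "q_alpha l M = (\<Prod>i<M. qmon (l - int i) (- 1)) * FM M (- l)"
    unfolding q_alpha_qB FM_def by (simp add: prod.distrib)
  obtain c where c: "FM M (- l) - YM M = XM M * c" using FM_YM[of M "- l"] by (elim dvdE)
  have "FM M (- l) = c * XM M + 1 * YM M" using c by (simp add: algebra_simps)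
  then have "FM M (- l) \<in> ideal2 (XM M) (YM M)" unfolding ideal2_def by blast
  then show ?thesis unfolding q by (rule tidealD(3)[OF T])
qed

text \<open>A product of 2k blocks lies in the 2k-th power of the ideal generated by
  \<open>XM M\<close> and \<open>YM M\<close>, to which \<open>pideal_sub_ideal2\<close>
  applies.\<close>

lemma In_sub: "M * (2 * k) \<le> n \<Longrightarrow> In n \<subseteq> ideal2 (XM M ^ k) (YM M ^ k)"
proof -
  assume n: "M * (2 * k) \<le> n"
  have "q_alpha l (M * m) \<in> pideal (XM M) (YM M) m" for l m
  proof (induction m)
    case 0
    show ?case by (simp add: pideal_0)
  next
    case (Suc m)
    have "q_alpha l (M * Suc m) = q_alpha l (M * m) * q_alpha (l - int (M * m)) M"
      using q_alpha_add[of l "M * m" M] by (simp add: add.commute)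
    then show ?case using pideal_mult[OF Suc q_alpha_block] by simp
  qed
  then have "q_alpha l (M * (2 * k)) \<in> ideal2 (XM M ^ k) (YM M ^ k)" for l
    using pideal_sub_ideal2[of k "2 * k"] by blast
  then have "In (M * (2 * k)) \<subseteq> ideal2 (XM M ^ k) (YM M ^ k)" by (intro In_least tideal_ideal2)
  then show ?thesis using In_antimono[OF n] by blast
qed

subsection \<open>From one root of unity to another\<close>

lemma freshman:
  fixes z :: "'a::comm_ring_1"
  assumes p: "prime (p::nat)"
  shows "\<exists>b. (z - 1) ^ p = (z ^ p - 1) + of_nat p * b"
proof -
  define t where "t k = of_nat (p choose k) * z ^ k * (- 1) ^ (p - k)" for k
  have p0: "0 < p" using p prime_gt_0_nat by blast
  have "(z - 1) ^ p = (\<Sum>k\<le>p. t k)"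
    using binomial_ring[of z "- 1" p] by (simp add: t_def)
  also have "\<dots> = (\<Sum>k\<in>{0, p}. t k) + (\<Sum>k\<in>{..p} - {0, p}. t k)"
    by (subst sum.subset_diff[of "{0, p}"]) (auto simp: add.commute)
  also have "(\<Sum>k\<in>{0, p}. t k) = z ^ p + (- 1) ^ p" using p0 by (simp add: t_def add.commute)
  finally have e: "(z - 1) ^ p = z ^ p + (- 1) ^ p + (\<Sum>k\<in>{..p} - {0, p}. t k)" .
  have "\<exists>b. t k = of_nat p * b" if "k \<in> {..p} - {0, p}" for k
  proof -
    have "p dvd p choose k" using p that by (intro dvd_choose_prime) auto
    then obtain d where "p choose k = p * d" by (elim dvdE)
    then show ?thesis unfolding t_def by (intro exI[of _ "of_nat d * z ^ k * (- 1) ^ (p - k)"]) (simp add: mult.assoc)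
  qed
  then obtain b where "\<And>k. k \<in> {..p} - {0, p} \<Longrightarrow> t k = of_nat p * b k" by metis
  then have s: "(\<Sum>k\<in>{..p} - {0, p}. t k) = of_nat p * (\<Sum>k\<in>{..p} - {0, p}. b k)"
    unfolding sum_distrib_left by (intro sum.cong) auto
  \<comment> \<open>The prime 2 is exceptional only in the sign, where 1 = -1 + 2.\<close>
  have "\<exists>c. (- 1) ^ p = - 1 + of_nat p * (c :: 'a)"
  proof (cases "p = 2")
    case True then show ?thesis by (intro exI[of _ 1]) simp
  next
    case False
    then have "odd p" using p by (metis prime_odd_nat prime_ge_2_nat le_neq_implies_less)
    then show ?thesis by (intro exI[of _ 0]) simp
  qed
  then obtain c where "(- 1) ^ p = - 1 + of_nat p * (c :: 'a)" by blast
  then show ?thesis unfolding e s by (intro exI[of _ "c + (\<Sum>k\<in>{..p} - {0, p}. b k)"]) (simp add: algebra_simps)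
qed

text \<open>The factors split into \<open>p\<close> windows of length \<open>M\<close>, each
  congruent to \<open>YM M\<close> modulo \<open>XM M\<close>.\<close>

lemma YM_mult: "\<exists>c. YM (M * p) = YM M ^ p + XM M * c"
proof (induction p)
  case 0
  then show ?case by (intro exI[of _ 0]) (simp add: YM_def)
next
  case (Suc p)
  then obtain c where c: "YM (M * p) = YM M ^ p + XM M * c" by blast
  have "YM (M * Suc p) = YM (M * p) * FM M (int (M * p))"
  proof -
    have "YM (n + m) = YM n * FM m (int n)" for n m
      unfolding YM_def FM_def by (induction m) (simp_all add: mult_ac)
    from this[of "M * p" M] show ?thesis by (simp add: add.commute)
  qed
  moreover obtain d where d: "FM M (int (M * p)) - YM M = XM M * d"
    using FM_YM[of M "int (M * p)"] unfolding dvd_def by blast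
  moreover have "FM M (int (M * p)) = YM M + XM M * d" using d by (simp add: algebra_simps)
  ultimately have "YM (M * Suc p) = YM M ^ Suc p + XM M * (c * YM M + (YM M ^ p + XM M * c) * d)"
    unfolding c by (simp add: algebra_simps)
  then show ?case by blast
qed

text \<open>Convergence of \<open>a\<close> to 0 for the powers of the ideal generated by
  \<open>u\<close> and \<open>v\<close>; the ideals of k-th powers define the same topology.\<close>

definition near :: "(nat \<Rightarrow> laurent_qA) \<Rightarrow> laurent_qA \<Rightarrow> laurent_qA \<Rightarrow> bool" where
  "near a u v \<longleftrightarrow> (\<forall>k. \<exists>N. \<forall>n\<ge>N. a n \<in> ideal2 (u ^ k) (v ^ k))"

text \<open>
  The \<open>p\<close>-adic step of Habiro: \<open>u\<close> and \<open>v\<close> are nilpotent modulo \<open>p\<close> and the ideal at level \<open>M\<close>, and the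
  quotient at level \<open>M\<close> is \<open>p\<close>-adically separated.
\<close>

lemma near_step:
  assumes coh: "\<And>n m. n \<le> m \<Longrightarrow> a m - a n \<in> In n" and near: "near a u v"
    and p: "2 \<le> (p::nat)" and M: "0 < M"
    and nil: "\<And>I. tideal I \<Longrightarrow> of_nat p \<in> I \<Longrightarrow> XM M \<in> I \<Longrightarrow> YM M \<in> I \<Longrightarrow> u \<in> radi I \<and> v \<in> radi I"
  shows "near a (XM M) (YM M)"
  unfolding near_def
proof (intro allI exI impI)
  fix k n assume n: "M * (2 * k) \<le> n"
  define I where "I = ideal2 (XM M ^ k) (YM M ^ k)"
  have TI: "tideal I" unfolding I_def by (rule tideal_ideal2)
  show "a n \<in> ideal2 (XM M ^ k) (YM M ^ k)"
  proof (rule XY_separated[OF M p])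
    fix l
    define J where "J = plus_mult (of_nat (p ^ l)) I"
    have TJ: "tideal J" unfolding J_def by (rule tideal_plus_mult[OF TI])
    have gens: "of_nat (p ^ l) \<in> J" "XM M ^ k \<in> J" "YM M ^ k \<in> J"
      using plus_mult_gen[OF TI, of "of_nat (p ^ l)"] ideal2_gen unfolding J_def I_def by blast+
    \<comment> \<open>Only powers of p, \<open>XM M\<close> and \<open>YM M\<close> are known to lie
      in \<open>J\<close>, so \<open>nil\<close> is applied to the radical of \<open>J\<close>;
      taking the radical twice is harmless.\<close>
    have "u \<in> radi (radi J) \<and> v \<in> radi (radi J)"
    proof (rule nil[OF tideal_radi[OF TJ]])
      show "of_nat p \<in> radi J" using gens(1) by (intro radi_powerI[of _ l]) simp
      show "XM M \<in> radi J" "YM M \<in> radi J" using gens by (auto intro: radi_powerI)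
    qed
    then obtain s t where "u ^ s \<in> J" "v ^ t \<in> J"
      unfolding radi_def by (auto simp: power_mult[symmetric])
    then have uv: "u ^ (s + t) \<in> J" "v ^ (s + t) \<in> J" using tideal_power_mono[OF TJ] by auto
    obtain N where N: "\<And>m. N \<le> m \<Longrightarrow> a m \<in> ideal2 (u ^ (s + t)) (v ^ (s + t))"
      using near unfolding near_def by blast
    \<comment> \<open>A late member of the sequence lies in \<open>J\<close>. Coherence and
      \<open>In_sub\<close> carry this back to the index \<open>n\<close>, which does not depend on
      \<open>l\<close>.\<close>
    have "a (n + N) \<in> J" using N[of "n + N"] ideal2_least[OF TJ uv] by auto
    moreover have "a (n + N) - a n \<in> J"
      using coh[of n "n + N"] In_sub[OF n] plus_mult_gen(2)[OF TI] unfolding J_def I_def by auto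
    ultimately have "a (n + N) - (a (n + N) - a n) \<in> J" by (rule tidealD(6)[OF TJ])
    then show "a n \<in> plus_mult (of_nat (p ^ l)) (ideal2 (XM M ^ k) (YM M ^ k))" unfolding J_def I_def by simp
  qed
qed

text \<open>Each step strips a prime factor from \<open>M\<close>. The start at level 1 uses the
  prime 2: modulo 2, (q - 1)^2 is q^2 - 1 and (A - 1)^2 is A^2 - 1.\<close>

lemma near_all:
  assumes coh: "\<And>n m. n \<le> m \<Longrightarrow> a m - a n \<in> In n" and near: "near a (qmon 1 0 - 1) (qmon 0 1 - 1)"
  shows "0 < M \<Longrightarrow> near a (XM M) (YM M)"
proof (induction M rule: less_induct)
  case (less M)
  show ?case
  proof (cases "M = 1")
    case True
    show ?thesis
    proof (rule near_step[OF coh near, of 2])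
      fix I :: "laurent_qA set" assume I: "tideal I" "of_nat 2 \<in> I" "XM M \<in> I" "YM M \<in> I"
      have "(qmon 1 0 - 1) ^ 2 = XM M - of_nat 2 * (qmon 1 0 - 1)"
        unfolding XM_def True by (simp add: power2_eq_square algebra_simps qmon_mult)
      also have "\<dots> \<in> I" using I tidealD(4,6)[OF I(1)] by blast
      finally have 1: "qmon 1 0 - 1 \<in> radi I" by (rule radi_powerI)
      have "(qmon 0 1 - 1) ^ 2 = YM M - of_nat 2 * (qmon 0 1 - 1)"
        unfolding YM_def True by (simp add: power2_eq_square algebra_simps qmon_mult)
      also have "\<dots> \<in> I" using I tidealD(4,6)[OF I(1)] by blast
      finally show "qmon 1 0 - 1 \<in> radi I \<and> qmon 0 1 - 1 \<in> radi I" using 1 radi_powerI by blast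
    qed (use less.prems in auto)
  next
    case False
    then obtain p where p: "prime p" "p dvd M" using prime_factor_nat by blast
    then obtain m where m: "M = m * p" by (metis dvd_def mult.commute)
    have m': "0 < m" "m < M" using less.prems m prime_gt_1_nat[OF p(1)] by auto
    show ?thesis
    proof (rule near_step[OF coh less.IH[OF m'(2,1)]])
      show "2 \<le> p" by (rule prime_ge_2_nat[OF p(1)])
      fix I :: "laurent_qA set" assume I: "tideal I" "of_nat p \<in> I" "XM M \<in> I" "YM M \<in> I"
      note R = tideal_radi[OF I(1)]
      obtain b where b: "XM m ^ p = (qmon (2 * int m) 0 ^ p - 1) + of_nat p * b"
        unfolding XM_def using freshman[OF p(1), of "qmon (2 * int m) 0"] by blast
      have "qmon (2 * int m) 0 ^ p - 1 = XM M" unfolding XM_def m qmon_power by (simp add: mult_ac)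
      then have "XM m ^ p \<in> I" unfolding b using I tidealD(2,4)[OF I(1)] by metis
      then have X: "XM m \<in> radi I" by (rule radi_powerI)
      obtain c where "YM M = YM m ^ p + XM m * c" unfolding m using YM_mult by blast
      then have "YM m ^ p = YM M - XM m * c" by simp
      also have "\<dots> \<in> radi I" using X I(4) radi_sub tidealD(4,6)[OF R] by blast
      finally have "YM m \<in> radi I" by (rule radi_power)
      then show "XM m \<in> radi I \<and> YM m \<in> radi I" using X by blast
    qed (use less.prems in auto)
  qed
qed

lemma near_In:
  assumes coh: "\<And>n m. n \<le> m \<Longrightarrow> a m - a n \<in> In n" and near: "near a (qmon 1 0 - 1) (qmon 0 1 - 1)"
  shows "a n \<in> In n"
proof (cases "n = 0")
  case True
  \<comment> \<open>The empty product is 1, so \<open>In 0\<close> is the whole ring.\<close>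
  have "q_alpha 0 0 \<in> In 0" by (rule q_alpha_In)
  then have "a n * 1 \<in> In 0" by (intro tidealD(3)[OF tideal_In]) (simp add: q_alpha_def)
  then show ?thesis using True by simp
next
  case False
  define M :: nat where "M = fact n"
  have "0 < M" by (simp add: M_def)
  then obtain N where N: "\<And>m. N \<le> m \<Longrightarrow> a m \<in> ideal2 (XM M ^ n) (YM M ^ n)"
    using near_all[OF coh near] unfolding near_def by blast
  have "n \<le> M" unfolding M_def by (rule fact_ge_self)
  then have "YM M ^ 1 \<in> In n" using YM_In by simp
  then have "YM M ^ n \<in> In n" by (rule tideal_power_mono[OF tideal_In]) (use False in simp)
  moreover have "XM M ^ n \<in> In n" unfolding M_def by (rule XM_power_In)
  ultimately have "ideal2 (XM M ^ n) (YM M ^ n) \<subseteq> In n" by (intro ideal2_least tideal_In)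
  then have "a (n + N) \<in> In n" using N[of "n + N"] by auto
  then have "a (n + N) - (a (n + N) - a n) \<in> In n" by (rule tidealD(6)[OF tideal_In]) (rule coh, simp)
  then show ?thesis by simp
qed

subsection \<open>The expansion at the trivial character\<close>

text \<open>The augmentation q = A = 1, which computes the value of \<open>exp_series\<close> at h =
  0.\<close>

definition aug :: "laurent_qA \<Rightarrow> int" where
  "aug = plin id (\<lambda>_. 1)"

lemma rhom_aug: "rhom aug" and aug_single: "aug (Poly_Mapping.single k c) = c"
proof -
  have f: "rhom (id :: int \<Rightarrow> int)" by (simp add: rhom_def)
  show "rhom aug" unfolding aug_def by (rule rhom_plin(1)[OF f]) simp_all
  show "aug (Poly_Mapping.single k c) = c"
    unfolding aug_def using plin_single[OF f, of "\<lambda>_. 1" k c] by simp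
qed

lemma aug_kernel: "c - of_int (aug c) \<in> ideal2 (qmon 1 0 - 1) (qmon 0 1 - 1)"
proof (induction c rule: poly_mapping_induct_add)
  note T = tideal_ideal2[of "qmon 1 0 - 1" "qmon 0 1 - 1"]
  {
    case zero
    then show ?case using tidealD(1)[OF T] rhomD(4)[OF rhom_aug] by simp
  next
    case (add a b)
    have "a + b - of_int (aug (a + b)) = (a - of_int (aug a)) + (b - of_int (aug b))"
      by (simp add: rhomD(2)[OF rhom_aug])
    then show ?case using tidealD(2)[OF T add] by (simp only:)
  next
    case (single k c)
    obtain x y where k: "k = (x, y)" by (cases k)
    have dv: "z - 1 \<in> ideal2 (qmon 1 0 - 1) (qmon 0 1 - 1) \<Longrightarrow> z ^ n - 1 \<in> ideal2 (qmon 1 0 - 1) (qmon 0 1 - 1)" for z n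
    proof (induction n)
      case (Suc n)
      have "z ^ Suc n - 1 = z * (z ^ n - 1) + (z - 1)" by (simp add: algebra_simps)
      then show ?case using Suc tidealD(2,3)[OF T] by metis
    qed (use tidealD(1)[OF T] in simp)
    have neg: "z' - 1 \<in> ideal2 (qmon 1 0 - 1) (qmon 0 1 - 1)"
      if "z - 1 \<in> ideal2 (qmon 1 0 - 1) (qmon 0 1 - 1)" "z' * z = 1" for z z'
    proof -
      have "z' - 1 = - z' * (z - 1)" using that(2) by (simp add: algebra_simps)
      then show ?thesis by (simp only:) (rule tidealD(3)[OF T that(1)])
    qed
    have q: "qmon x 0 - 1 \<in> ideal2 (qmon 1 0 - 1) (qmon 0 1 - 1)" for x
    proof (cases x rule: int_cases2)
      case (nonneg n)
      then show ?thesis using dv[OF ideal2_gen(1), of n] by (simp add: qmon_power)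
    next
      case (nonpos n)
      have "qmon (int n) 0 - 1 \<in> ideal2 (qmon 1 0 - 1) (qmon 0 1 - 1)"
        using dv[OF ideal2_gen(1), of n] by (simp add: qmon_power)
      then show ?thesis by (rule neg) (simp add: nonpos qmon_mult)
    qed
    have A: "qmon 0 x - 1 \<in> ideal2 (qmon 1 0 - 1) (qmon 0 1 - 1)" for x
    proof (cases x rule: int_cases2)
      case (nonneg n)
      then show ?thesis using dv[OF ideal2_gen(2), of n] by (simp add: qmon_power)
    next
      case (nonpos n)
      have "qmon 0 (int n) - 1 \<in> ideal2 (qmon 1 0 - 1) (qmon 0 1 - 1)"
        using dv[OF ideal2_gen(2), of n] by (simp add: qmon_power)
      then show ?thesis by (rule neg) (simp add: nonpos qmon_mult)
    qed
    have "Poly_Mapping.single k c - of_int (aug (Poly_Mapping.single k c))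
       = of_int c * (qmon x 0 * (qmon 0 y - 1) + (qmon x 0 - 1))"
      unfolding aug_single unfolding k single_qmon by (simp add: algebra_simps qmon_mult)
    then show ?case
      by (simp only:) (rule tidealD(3)[OF T tidealD(2)[OF T tidealD(3)[OF T A] q]])
  }
qed

lemma exp_series_nth_0: "fps_nth (exp_series c) 0 = of_int (aug c)"
proof (induction c rule: poly_mapping_induct_add)
  case (single k c)
  obtain x y where k: "k = (x, y)" by (cases k)
  have n: "fps_nth (of_int c * f) 0 = of_int c * fps_nth f 0" for f :: "rat poly fps"
    by (simp add: fps_of_int[symmetric])
  show ?case unfolding exp_series_single aug_single n by (simp add: k expc_def)
qed (simp_all add: rhomD[OF rhom_aug] rhomD[OF rhom_exp_series])

text \<open>The images of q - 1 and A - 1 begin with h and \<alpha> h. On the n-th power of the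
  augmentation ideal the coefficient of h^n is thus a polynomial in \<alpha> whose coefficients are
  the augmentations of the \<open>c i\<close>. If it vanishes, all \<open>c i\<close> lie in the
  augmentation ideal and one more power is gained.\<close>

lemma exp_series_pideal:
  assumes "\<And>i. i < n \<Longrightarrow> fps_nth (exp_series a) i = 0"
  shows "a \<in> pideal (qmon 1 0 - 1) (qmon 0 1 - 1) n"
  using assms
proof (induction n)
  case 0
  show ?case by (rule pideal_0)
next
  case (Suc n)
  define x y where "x = qmon 1 0 - 1" and "y = qmon 0 1 - 1"
  have "a \<in> pideal x y n" unfolding x_def y_def using Suc by simp
  then obtain c where a: "a = (\<Sum>i\<le>n. c i * (x ^ i * y ^ (n - i)))" by (auto simp: pideal_def)
  have ex: "fps_nth (exp_series x) 0 = 0" "fps_nth (exp_series x) 1 = 1"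
    "fps_nth (exp_series y) 0 = 0" "fps_nth (exp_series y) 1 = [:0, 1:]"
    unfolding x_def y_def rhomD(6)[OF rhom_exp_series] rhomD(1)[OF rhom_exp_series]
    by (simp_all add: qmon_def exp_series_single expc_def one_pCons)
  define f g where "f = fps_shift 1 (exp_series x)" and "g = fps_shift 1 (exp_series y)"
  have fg: "exp_series x = fps_X * f" "exp_series y = fps_X * g"
    by (rule fps_ext, use ex in \<open>simp add: f_def g_def\<close>)+
  have nth: "fps_nth (exp_series (c i * (x ^ i * y ^ (n - i)))) n = monom (of_int (aug (c i))) (n - i)" if "i \<le> n" for i
  proof -
    have "fps_X ^ n = (fps_X ^ i * fps_X ^ (n - i) :: rat poly fps)" using that by (simp add: power_add[symmetric])
    then have "exp_series (c i * (x ^ i * y ^ (n - i))) = fps_X ^ n * (exp_series (c i) * (f ^ i * g ^ (n - i)))"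
      unfolding rhomD[OF rhom_exp_series] fg by (simp add: power_mult_distrib mult_ac)
    then have "fps_nth (exp_series (c i * (x ^ i * y ^ (n - i)))) n = fps_nth (exp_series (c i) * (f ^ i * g ^ (n - i))) 0"
      by (simp add: fps_X_power_mult_nth)
    also have "\<dots> = of_int (aug (c i)) * [:0, 1:] ^ (n - i)"
      using ex by (simp add: exp_series_nth_0 fps_power_zeroth f_def g_def)
    also have "\<dots> = monom (of_int (aug (c i))) (n - i)"
      by (simp add: monom_altdef of_int_poly)
    finally show ?thesis .
  qed
  have "aug (c i) = 0" if i: "i \<le> n" for i
  proof -
    have "0 = fps_nth (exp_series a) n" using Suc.prems by simp
    also have "\<dots> = (\<Sum>j\<le>n. monom (of_int (aug (c j))) (n - j))"
      unfolding a rhomD(8)[OF rhom_exp_series] fps_sum_nth using nth by (intro sum.cong) auto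
    finally have "coeff 0 (n - i) = coeff (\<Sum>j\<le>n. monom (of_int (aug (c j)) :: rat) (n - j)) (n - i)" by simp
    also have "\<dots> = (\<Sum>j\<le>n. if j = i then of_int (aug (c j)) else 0)"
      unfolding coeff_sum using i by (intro sum.cong) auto
    finally show ?thesis using i by simp
  qed
  then have ci: "c i \<in> ideal2 x y" if "i \<le> n" for i using aug_kernel[of "c i"] that unfolding x_def y_def by simp
  have "c i * (x ^ i * y ^ (n - i)) \<in> pideal x y (Suc n)" if "i \<le> n" for i
    using pideal_mult[OF pideal_gen[OF that] ci[OF that]] by (simp add: mult.commute)
  then have "a \<in> pideal x y (Suc n)" unfolding a by (intro tideal_sum tideal_pideal) auto
  then show ?case unfolding x_def y_def .
qed

theorem coherent_exp_series_zero:
  assumes coh: "\<And>n m. n \<le> m \<Longrightarrow> a m - a n \<in> In n"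
    and z: "\<And>n i. i < n \<Longrightarrow> fps_nth (exp_series (a n)) i = 0"
  shows "a n \<in> In n"
proof (rule near_In[OF coh])
  show "near a (qmon 1 0 - 1) (qmon 0 1 - 1)"
    unfolding near_def
  proof (intro allI exI impI)
    fix k n :: nat assume n: "2 * k \<le> n"
    have "a n \<in> pideal (qmon 1 0 - 1) (qmon 0 1 - 1) n" by (rule exp_series_pideal[OF z])
    then show "a n \<in> ideal2 ((qmon 1 0 - 1) ^ k) ((qmon 0 1 - 1) ^ k)"
      using pideal_sub_ideal2[OF n] by blast
  qed
qed

text \<open>A bracket {\<alpha> + j} has no constant term in h, so a product of n of them is
  divisible by h^n.\<close>

lemma exp_series_In: "a \<in> In n \<Longrightarrow> i < n \<Longrightarrow> fps_nth (exp_series a) i = 0"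
proof -
  define J where "J = {a. \<forall>i<n. fps_nth (exp_series a) i = 0}"
  have TJ: "tideal J"
    unfolding tideal_def J_def by (auto simp: rhomD[OF rhom_exp_series] fps_mult_nth intro!: sum.neutral)
  have "q_alpha l n \<in> J" for l
  proof -
    have "fps_nth (exp_series (qB j)) 0 = 0" for j
      unfolding exp_series_nth_0 qB_def qmon_def rhomD(6)[OF rhom_aug] aug_single by simp
    moreover define f where "f = (\<lambda>j. fps_shift 1 (exp_series (qB j)))"
    ultimately have f: "exp_series (qB j) = fps_X * f j" for j
      by (intro fps_ext) simp
    have "exp_series (q_alpha l n) = fps_X ^ n * (\<Prod>i<n. f (l - int i))"
      unfolding q_alpha_qB rhomD(9)[OF rhom_exp_series] f prod.distrib by simp
    then show ?thesis unfolding J_def by (simp add: fps_X_power_mult_nth)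
  qed
  then have "In n \<subseteq> J" by (rule In_least[OF TJ])
  then show "a \<in> In n \<Longrightarrow> i < n \<Longrightarrow> fps_nth (exp_series a) i = 0" unfolding J_def by blast
qed

section \<open>Inverse limits\<close>

text \<open>Record rings with the operations of the type and possibly a smaller carrier: quotients
  come from the record structure, calculations from the type class.\<close>

locale type_ring =
  fixes R :: "'b::comm_ring_1 ring"
  assumes cring: "cring R"
    and ops: "monoid.mult R = (*)" "monoid.one R = 1" "ring.zero R = 0" "ring.add R = (+)"
begin

lemma closed:
  "1 \<in> carrier R" "0 \<in> carrier R" "a \<in> carrier R \<Longrightarrow> b \<in> carrier R \<Longrightarrow> a + b \<in> carrier R"
  "a \<in> carrier R \<Longrightarrow> b \<in> carrier R \<Longrightarrow> a * b \<in> carrier R"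
  "a \<in> carrier R \<Longrightarrow> - a \<in> carrier R" "a \<in> carrier R \<Longrightarrow> b \<in> carrier R \<Longrightarrow> a - b \<in> carrier R"
  "a \<in> carrier R \<Longrightarrow> a ^ n \<in> carrier R"
proof -
  interpret cring R by (rule cring)
  show 1: "1 \<in> carrier R" "0 \<in> carrier R" "a \<in> carrier R \<Longrightarrow> b \<in> carrier R \<Longrightarrow> a + b \<in> carrier R"
    "a \<in> carrier R \<Longrightarrow> b \<in> carrier R \<Longrightarrow> a * b \<in> carrier R" for a b
    using one_closed zero_closed a_closed m_closed unfolding ops by auto
  show 2: "a \<in> carrier R \<Longrightarrow> - a \<in> carrier R" for a
  proof -
    assume a: "a \<in> carrier R"
    then have "a + \<ominus>\<^bsub>R\<^esub> a = 0" using r_neg unfolding ops by blast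
    then have "- a = \<ominus>\<^bsub>R\<^esub> a" by (simp add: eq_neg_iff_add_eq_0 neg_eq_iff_add_eq_0)
    then show ?thesis using a_inv_closed[OF a] by simp
  qed
  show "a \<in> carrier R \<Longrightarrow> b \<in> carrier R \<Longrightarrow> a - b \<in> carrier R" using 1(3)[of a "- b"] 2 by simp
  show "a \<in> carrier R \<Longrightarrow> a ^ n \<in> carrier R" by (induction n) (auto intro: 1)
qed

lemma idealD:
  assumes "ideal J R"
  shows "0 \<in> J" "a \<in> J \<Longrightarrow> b \<in> J \<Longrightarrow> a + b \<in> J" "a \<in> J \<Longrightarrow> b \<in> carrier R \<Longrightarrow> b * a \<in> J"
    "a \<in> J \<Longrightarrow> b \<in> carrier R \<Longrightarrow> a * b \<in> J"
    "a \<in> J \<Longrightarrow> - a \<in> J" "a \<in> J \<Longrightarrow> b \<in> J \<Longrightarrow> a - b \<in> J" "a \<in> J \<Longrightarrow> a \<in> carrier R"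
proof -
  note s = ideal.axioms(1)[OF assms]
  show 1: "0 \<in> J" "a \<in> J \<Longrightarrow> b \<in> J \<Longrightarrow> a + b \<in> J" "a \<in> J \<Longrightarrow> b \<in> carrier R \<Longrightarrow> b * a \<in> J" for a b
    using additive_subgroup.zero_closed[OF s] additive_subgroup.a_closed[OF s] ideal.I_l_closed[OF assms]
    unfolding ops by auto
  show "a \<in> J \<Longrightarrow> b \<in> carrier R \<Longrightarrow> a * b \<in> J" using 1(3)[of a b] by (simp add: mult.commute)
  show 2: "a \<in> J \<Longrightarrow> - a \<in> J" for a using 1(3)[of a "- 1"] closed by simp
  show "a \<in> J \<Longrightarrow> b \<in> J \<Longrightarrow> a - b \<in> J" using 1(2)[of a "- b"] 2 by simp
  show "a \<in> J \<Longrightarrow> a \<in> carrier R" using ideal.Icarr[OF assms] .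
qed

lemma coset_def': "J +>\<^bsub>R\<^esub> a = {i + a | i. i \<in> J}"
  unfolding a_r_coset_def' ops by auto

lemma coset_subset:
  assumes J: "ideal J R" "ideal J' R" "J' \<subseteq> J"
  shows "J' +>\<^bsub>R\<^esub> b \<subseteq> J +>\<^bsub>R\<^esub> a \<longleftrightarrow> b - a \<in> J"
proof
  assume "J' +>\<^bsub>R\<^esub> b \<subseteq> J +>\<^bsub>R\<^esub> a"
  moreover have "b \<in> J' +>\<^bsub>R\<^esub> b" unfolding coset_def' using idealD(1)[OF J(2)] by force
  ultimately obtain i where "i \<in> J" "b = i + a" unfolding coset_def' by auto
  then show "b - a \<in> J" by simp
next
  assume d: "b - a \<in> J"
  show "J' +>\<^bsub>R\<^esub> b \<subseteq> J +>\<^bsub>R\<^esub> a"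
  proof
    fix x assume "x \<in> J' +>\<^bsub>R\<^esub> b"
    then obtain i where i: "i \<in> J'" "x = i + b" unfolding coset_def' by auto
    have "i + (b - a) \<in> J" using i J(3) idealD(2)[OF J(1) _ d] by blast
    moreover have "x = (i + (b - a)) + a" using i by simp
    ultimately show "x \<in> J +>\<^bsub>R\<^esub> a" unfolding coset_def' by blast
  qed
qed

lemma coset_eq:
  assumes "ideal J R"
  shows "J +>\<^bsub>R\<^esub> a = J +>\<^bsub>R\<^esub> b \<longleftrightarrow> a - b \<in> J"
proof -
  have "a - b \<in> J \<Longrightarrow> b - a \<in> J" using idealD(5)[OF assms, of "a - b"] by simp
  then show ?thesis using coset_subset[OF assms assms subset_refl] by blast
qed

end

locale ideal_chain = type_ring R for R :: "'b::comm_ring_1 ring" +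
  fixes I :: "nat \<Rightarrow> 'b set"
  assumes ideals: "ideal (I n) R" and decreasing: "I (Suc n) \<subseteq> I n"
begin

text \<open>Elements of the limit are handled through representatives: \<open>carrier_L\<close>
  shows that every element arises from a coherent sequence, and \<open>limit_eq\<close> decides
  equality.\<close>

definition coherent :: "(nat \<Rightarrow> 'b) \<Rightarrow> bool" where
  "coherent a \<longleftrightarrow> (\<forall>n. a n \<in> carrier R \<and> a (Suc n) - a n \<in> I n)"

definition limit :: "(nat \<Rightarrow> 'b) \<Rightarrow> nat \<Rightarrow> 'b set" where
  "limit a = (\<lambda>n. I n +>\<^bsub>R\<^esub> a n)"

abbreviation L where "L \<equiv> inverse_limit R I"

lemma antimono: "n \<le> m \<Longrightarrow> I m \<subseteq> I n"
  by (rule lift_Suc_antimono_le[of I]) (use decreasing in auto)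

lemma coherent_le: "coherent a \<Longrightarrow> n \<le> m \<Longrightarrow> a m - a n \<in> I n"
proof -
  assume c: "coherent a" and "n \<le> m"
  from this(2) show "a m - a n \<in> I n"
  proof (induction rule: dec_induct)
    case base
    then show ?case using idealD(1)[OF ideals] by simp
  next
    case (step m)
    have "a (Suc m) - a m \<in> I n" using step(1) c antimono[of n m] unfolding coherent_def by auto
    from idealD(2)[OF ideals this step(3)] show ?case by simp
  qed
qed

lemma carrier_L: "carrier L = limit ` Collect coherent"
proof (rule equalityI; rule subsetI)
  fix s assume "s \<in> carrier L"
  then have s: "s n \<in> carrier (R Quot I n)" "s (Suc n) \<subseteq> s n" for n
    by (auto simp: inverse_limit_def)
  have "\<exists>a. a \<in> carrier R \<and> s n = I n +>\<^bsub>R\<^esub> a" for n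
    using s(1)[of n] unfolding FactRing_def A_RCOSETS_def' by auto
  then obtain a where a: "\<And>n. a n \<in> carrier R" "\<And>n. s n = I n +>\<^bsub>R\<^esub> a n" by metis
  have "a (Suc n) - a n \<in> I n" for n
    using s(2)[of n] unfolding a(2) coset_subset[OF ideals ideals decreasing] .
  then have "coherent a" using a by (simp add: coherent_def)
  then show "s \<in> limit ` Collect coherent" using a(2) by (auto simp: limit_def intro!: image_eqI[of _ _ a])
next
  fix s assume "s \<in> limit ` Collect coherent"
  then obtain a where a: "coherent a" "s = limit a" by auto
  then show "s \<in> carrier L"
    using coset_subset[OF ideals ideals decreasing]
    unfolding inverse_limit_def FactRing_def A_RCOSETS_def' limit_def coherent_def by auto
qed

lemma limit_eq: "limit a = limit b \<longleftrightarrow> (\<forall>n. a n - b n \<in> I n)"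
  unfolding limit_def fun_eq_iff coset_eq[OF ideals] ..

lemma mult_L: "coherent a \<Longrightarrow> coherent b \<Longrightarrow> limit a \<otimes>\<^bsub>L\<^esub> limit b = limit (\<lambda>n. a n * b n)"
proof -
  assume ab: "coherent a" "coherent b"
  have "[mod I n:] (I n +>\<^bsub>R\<^esub> a n) \<Otimes>\<^bsub>R\<^esub> (I n +>\<^bsub>R\<^esub> b n) = I n +>\<^bsub>R\<^esub> (a n * b n)" for n
    using ideal.rcoset_mult_add[OF ideals, of "a n" "b n" n] ab unfolding coherent_def ops by simp
  then show ?thesis by (simp add: inverse_limit_def FactRing_def limit_def)
qed

lemma one_L: "\<one>\<^bsub>L\<^esub> = limit (\<lambda>_. 1)"
  by (simp add: inverse_limit_def FactRing_def limit_def ops)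

lemma coherent_mult: "coherent a \<Longrightarrow> coherent b \<Longrightarrow> coherent (\<lambda>n. a n * b n)"
proof -
  assume ab: "coherent a" "coherent b"
  have "a (Suc n) * b (Suc n) - a n * b n = (a (Suc n) - a n) * b (Suc n) + a n * (b (Suc n) - b n)" for n
    by (simp add: algebra_simps)
  then show ?thesis using ab idealD[OF ideals] closed unfolding coherent_def by simp
qed

lemma coherent_const: "c \<in> carrier R \<Longrightarrow> coherent (\<lambda>_. c)"
  unfolding coherent_def using idealD(1)[OF ideals] by simp

lemma comm_monoid_L: "comm_monoid L"
proof (rule comm_monoidI)
  have c: "coherent a \<Longrightarrow> coherent b \<Longrightarrow> limit a \<otimes>\<^bsub>L\<^esub> limit b \<in> carrier L" for a b
    unfolding carrier_L using coherent_mult mult_L by auto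
  show "x \<otimes>\<^bsub>L\<^esub> y \<in> carrier L" if "x \<in> carrier L" "y \<in> carrier L" for x y
    using that c unfolding carrier_L by auto
  show "\<one>\<^bsub>L\<^esub> \<in> carrier L" unfolding carrier_L one_L using coherent_const[OF closed(1)] by blast
  show "x \<otimes>\<^bsub>L\<^esub> y \<otimes>\<^bsub>L\<^esub> z = x \<otimes>\<^bsub>L\<^esub> (y \<otimes>\<^bsub>L\<^esub> z)" if "x \<in> carrier L" "y \<in> carrier L" "z \<in> carrier L" for x y z
    using that unfolding carrier_L by (auto simp: mult_L coherent_mult mult.assoc)
  show "\<one>\<^bsub>L\<^esub> \<otimes>\<^bsub>L\<^esub> x = x" if "x \<in> carrier L" for x
    using that unfolding carrier_L one_L by (auto simp: mult_L coherent_const[OF closed(1)])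
  show "x \<otimes>\<^bsub>L\<^esub> y = y \<otimes>\<^bsub>L\<^esub> x" if "x \<in> carrier L" "y \<in> carrier L" for x y
    using that unfolding carrier_L by (auto simp: mult_L mult.commute)
qed

text \<open>The inverse is the geometric series.\<close>

lemma unit_L:
  assumes w: "coherent w" and u: "v \<in> carrier R" "1 - w 1 * v \<in> I 1"
    and pow: "\<And>e n. e \<in> I 1 \<Longrightarrow> e ^ n \<in> I n"
  shows "limit w \<in> Units L"
proof -
  note D = idealD[OF ideals]
  have wc: "w n \<in> carrier R" for n using w by (simp add: coherent_def)
  \<comment> \<open>The error of the approximate inverse \<open>v\<close>. It lies in
    \<open>I 1\<close> for n \<ge> 1, so its n-th power lies in \<open>I n\<close> and the geometric
    series may stop after n terms.\<close>
  define e where "e n = 1 - w n * v" for n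
  have e: "e n \<in> I 1" if "1 \<le> n" for n
  proof -
    have "(1 - w 1 * v) - (w n - w 1) * v \<in> I 1"
      by (rule D(6)[OF u(2) D(4)[OF coherent_le[OF w that] u(1)]])
    then show ?thesis by (simp add: e_def algebra_simps)
  qed
  have ec: "e n \<in> carrier R" for n unfolding e_def using closed wc u by simp
  define y where "y n = v * (\<Sum>k<n. e n ^ k)" for n
  have "(\<Sum>k<m. e n ^ k) \<in> carrier R" for n m
    by (induction m) (auto intro: closed ec)
  then have yc: "y n \<in> carrier R" for n unfolding y_def using closed u by simp
  have wy: "1 - w n * y n \<in> I n" for n
  proof (cases "n = 0")
    case True
    \<comment> \<open>Exponent 0 in \<open>pow\<close> shows that \<open>I 0\<close> contains 1 and
      is therefore everything.\<close>
    have "1 ^ 0 \<in> I 0" using pow[of 0 0] D(1) by simp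
    then have "(1 - w n * y n) * 1 \<in> I 0" using closed wc yc by (intro D(3)) auto
    then show ?thesis using True by simp
  next
    case False
    have "1 - w n * y n = 1 - (1 - e n) * (\<Sum>k<n. e n ^ k)" by (simp add: y_def e_def mult.assoc)
    also have "\<dots> = e n ^ n" by (simp add: one_diff_power_eq[symmetric])
    finally show ?thesis using pow[OF e] False by simp
  qed
  have y: "coherent y"
    unfolding coherent_def
  proof (intro allI conjI yc)
    fix n
    have 1: "1 - w (Suc n) * y (Suc n) \<in> I n" using wy[of "Suc n"] decreasing by blast
    have 2: "w (Suc n) - w n \<in> I n" using w by (simp add: coherent_def)
    have "(1 - w (Suc n) * y (Suc n)) + (w (Suc n) - w n) * y (Suc n) \<in> I n"
      by (rule D(2)[OF 1 D(4)[OF 2 yc]])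
    then have s: "1 - w n * y (Suc n) \<in> I n" by (simp add: algebra_simps)
    \<comment> \<open>Coherence is uniqueness of inverses: both \<open>y n\<close> and
      \<open>y (Suc n)\<close> invert \<open>w n\<close> modulo \<open>I n\<close>.\<close>
    have "y (Suc n) * (1 - w n * y n) - y n * (1 - w n * y (Suc n)) \<in> I n"
      by (rule D(6)[OF D(3)[OF wy yc] D(3)[OF s yc]])
    then show "y (Suc n) - y n \<in> I n" by (simp add: algebra_simps)
  qed
  have "limit w \<otimes>\<^bsub>L\<^esub> limit y = \<one>\<^bsub>L\<^esub>"
    unfolding mult_L[OF w y] one_L limit_eq using D(5)[OF wy] by simp
  moreover have "limit y \<otimes>\<^bsub>L\<^esub> limit w = \<one>\<^bsub>L\<^esub>"
    unfolding mult_L[OF y w] one_L limit_eq using D(5)[OF wy] by (simp add: mult.commute)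
  ultimately show ?thesis unfolding Units_def carrier_L using w y by auto
qed

end

text \<open>The image of a coset under \<phi> need not be a coset. Adding \<open>J n\<close>
  completes it, and on representatives the map is just \<phi>.\<close>

lemma limit_map_limit:
  assumes A: "ideal_chain R I" and B: "ideal_chain S J"
    and \<phi>: "\<And>a b. \<phi> (a + b) = \<phi> a + \<phi> b" and sub: "\<phi> ` I (k n) \<subseteq> J n"
  shows "limit_map S J k \<phi> (ideal_chain.limit R I a) n = J n +>\<^bsub>S\<^esub> \<phi> (a (k n))"
proof -
  interpret A: ideal_chain R I by (rule A)
  interpret B: ideal_chain S J by (rule B)
  have z: "\<phi> 0 = 0" using \<phi>[of 0 0] by simp
  show ?thesis
  proof (rule equalityI; rule subsetI)
    fix x assume "x \<in> limit_map S J k \<phi> (A.limit a) n"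
    then obtain j i where x: "j \<in> J n" "i \<in> I (k n)" "x = j + \<phi> (i + a (k n))"
      unfolding limit_map_def A.limit_def set_add_def' A.coset_def' B.ops by auto
    have "j + \<phi> i \<in> J n" using x sub by (intro B.idealD(2)[OF B.ideals]) auto
    then show "x \<in> J n +>\<^bsub>S\<^esub> \<phi> (a (k n))" unfolding B.coset_def' x(3) \<phi> add.assoc[symmetric] by blast
  next
    fix x assume "x \<in> J n +>\<^bsub>S\<^esub> \<phi> (a (k n))"
    then obtain j where x: "j \<in> J n" "x = j + \<phi> (0 + a (k n))" unfolding B.coset_def' by auto
    moreover have "0 \<in> I (k n)" by (rule A.idealD(1)[OF A.ideals])
    ultimately show "x \<in> limit_map S J k \<phi> (A.limit a) n"
      unfolding limit_map_def A.limit_def set_add_def' A.coset_def' B.ops by blast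
  qed
qed


section \<open>The completions of the coefficient rings\<close>

lemma type_ring_RqA: "type_ring RqA"
  using cring_RqA by (simp add: type_ring_def)

interpretation hatR: ideal_chain RqA In
  by (intro ideal_chain.intro type_ring_RqA ideal_chain_axioms.intro ideal_In In_antimono) simp

lemma Rr_ops [simp]: "monoid.mult (Rr r) = (*)" "monoid.one (Rr r) = 1" "ring.zero (Rr r) = 0" "ring.add (Rr r) = (+)"
  by (simp_all add: Rr_def ring_of_type_algebra_def fun_eq_iff)

definition Cr :: "nat \<Rightarrow> laurentA set" where
  "Cr r = generate_ring ring_of_type_algebra {Amon 0 (zeta r), Amon 1 1, Amon (- 1) 1}"

lemma carrier_Rr [simp]: "carrier (Rr r) = Cr r"
  by (simp add: Rr_def Cr_def)

lemma type_ring_Rr: "type_ring (Rr r)"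
proof -
  interpret U: cring "ring_of_type_algebra :: laurentA ring" by (rule cring_from_type_algebra)
  have ring: "ring (Rr r)"
    unfolding Rr_def by (rule U.generate_ring_is_ring) (simp add: ring_of_type_algebra_def)
  then interpret ring "Rr r" .
  have "cring (Rr r)"
    by (intro cring.intro ring comm_monoid.intro comm_monoid_axioms.intro monoid_axioms) (simp add: mult.commute)
  then show ?thesis by (simp add: type_ring_def)
qed

interpretation C: type_ring "Rr r" for r
  by (rule type_ring_Rr)

lemma Cr_gen: "Amon 0 (zeta r) \<in> Cr r" "Amon 1 1 \<in> Cr r" "Amon (- 1) 1 \<in> Cr r"
  unfolding Cr_def by (auto intro: generate_ring.incl)

lemma Cr_closed: "1 \<in> Cr r" "0 \<in> Cr r" "a \<in> Cr r \<Longrightarrow> b \<in> Cr r \<Longrightarrow> a + b \<in> Cr r"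
  "a \<in> Cr r \<Longrightarrow> b \<in> Cr r \<Longrightarrow> a * b \<in> Cr r" "a \<in> Cr r \<Longrightarrow> - a \<in> Cr r"
  "a \<in> Cr r \<Longrightarrow> b \<in> Cr r \<Longrightarrow> a - b \<in> Cr r" "a \<in> Cr r \<Longrightarrow> a ^ n \<in> Cr r"
  using C.closed[where r = r] by simp_all

lemma Cr_Amon: "Amon k 1 \<in> Cr r"
proof (cases k rule: int_cases2)
  case (nonneg n)
  then show ?thesis using Cr_closed(7)[OF Cr_gen(2), of n r] by (simp add: Amon_power)
next
  case (nonpos n)
  then show ?thesis using Cr_closed(7)[OF Cr_gen(3), of n r] by (simp add: Amon_power)
qed

lemma Cr_zeta: "0 < r \<Longrightarrow> Amon 0 (zeta_pow r k) \<in> Cr r"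
proof -
  assume r: "0 < r"
  have p: "Amon 0 (zeta_pow r (int n)) \<in> Cr r" for n
    using Cr_closed(7)[OF Cr_gen(1), of r n] by (simp add: Amon_power power_int_of_nat)
  \<comment> \<open>The ring is generated without the inverse of zeta; negative powers are rewritten
    as positive ones by zeta^(2r) = 1.\<close>
  have "zeta_pow r (- int n) = zeta_pow r (int ((2 * r - 1) * n))" for n
  proof -
    have "int ((2 * r - 1) * n) = 2 * int r * int n + - int n" using r by (simp add: of_nat_diff algebra_simps)
    then have "zeta_pow r (int ((2 * r - 1) * n)) = zeta_pow r (2 * int r * int n) * zeta_pow r (- int n)"
      by (simp only: zeta_pow_add)
    moreover have "zeta_pow r (2 * int r * int n) = 1"
      using zeta_pow_2r[OF r] by (simp only: power_int_mult) simp
    ultimately show ?thesis by simp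
  qed
  then have n: "Amon 0 (zeta_pow r (- int n)) \<in> Cr r" for n using p by metis
  show ?thesis using p n by (cases k rule: int_cases2) auto
qed

definition dA :: "nat \<Rightarrow> laurentA" where "dA r = Amon (int r) 1 - Amon (- int r) 1"

text \<open>The n-th power of a principal ideal, written through the power of its generator;
  \<open>ideal_power_eq\<close> identifies it with \<open>ideal_power\<close>.\<close>

definition pw_ideal :: "nat \<Rightarrow> nat \<Rightarrow> nat \<Rightarrow> laurentA set" where
  "pw_ideal m r n = {c * dA r ^ n | c. c \<in> Cr m}"

lemma dA_Cr: "dA r \<in> Cr m"
  unfolding dA_def by (intro Cr_closed Cr_Amon)

lemma ideal_pw_ideal: "ideal (pw_ideal m r n) (Rr m)"
proof -
  interpret cring "Rr m" by (rule C.cring)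
  have "pw_ideal m r n = PIdl\<^bsub>Rr m\<^esub> (dA r ^ n)" by (auto simp: pw_ideal_def cgenideal_def)
  then show ?thesis using cgenideal_ideal[of "dA r ^ n"] Cr_closed(7)[OF dA_Cr] by simp
qed

lemma ideal_power_eq: "ideal_power (Rr m) (ideal_A m r) n = pw_ideal m r n"
proof -
  interpret cring "Rr m" by (rule C.cring)
  have 1: "ideal_A m r = pw_ideal m r 1"
    unfolding ideal_A_def dA_def[symmetric] using cgenideal_eq_genideal[of "dA r"] dA_Cr[of r m]
    by (auto simp: pw_ideal_def cgenideal_def)
  show ?thesis
  proof (induction n)
    case 0
    show ?case by (auto simp: ideal_power_def nat_pow_def ideals_set_def pw_ideal_def)
  next
    case (Suc n)
    have "ideal_power (Rr m) (ideal_A m r) (Suc n) = ideal_prod (Rr m) (pw_ideal m r n) (pw_ideal m r 1)"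
      using Suc unfolding 1[symmetric] by (simp add: ideal_power_def nat_pow_def ideals_set_def)
    also have "\<dots> = pw_ideal m r (Suc n)"
    proof (rule equalityI; rule subsetI)
      fix x assume "x \<in> ideal_prod (Rr m) (pw_ideal m r n) (pw_ideal m r 1)"
      then show "x \<in> pw_ideal m r (Suc n)"
      proof (induction rule: ideal_prod.induct)
        case (prod i j)
        then obtain c c' where "i = c * dA r ^ n" "j = c' * dA r" "c \<in> Cr m" "c' \<in> Cr m"
          by (auto simp: pw_ideal_def)
        then have "i * j = (c * c') * dA r ^ Suc n" "c * c' \<in> Cr m" using Cr_closed(4) by (auto simp: mult_ac)
        then show ?case unfolding pw_ideal_def by auto
      next
        case (sum s1 s2)
        then show ?case using C.idealD(2)[OF ideal_pw_ideal] by simp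
      qed
    next
      fix x assume "x \<in> pw_ideal m r (Suc n)"
      then obtain c where c: "x = c * dA r ^ Suc n" "c \<in> Cr m" by (auto simp: pw_ideal_def)
      have "c * dA r ^ n \<in> pw_ideal m r n" "1 * dA r ^ 1 \<in> pw_ideal m r 1"
        using c Cr_closed(1) unfolding pw_ideal_def by blast+
      from ideal_prod.prod[OF this, of "Rr m"] show "x \<in> ideal_prod (Rr m) (pw_ideal m r n) (pw_ideal m r 1)"
        by (simp add: c mult_ac)
    qed
    finally show ?case .
  qed
qed

lemma pw_ideal_chain: "ideal_chain (Rr m) (pw_ideal m r)"
proof (intro ideal_chain.intro type_ring_Rr ideal_chain_axioms.intro ideal_pw_ideal subsetI)
  fix n x assume "x \<in> pw_ideal m r (Suc n)"
  then obtain c where "x = (c * dA r) * dA r ^ n" "c \<in> Cr m" by (auto simp: pw_ideal_def mult_ac)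
  then show "x \<in> pw_ideal m r n" unfolding pw_ideal_def using Cr_closed(4)[OF _ dA_Cr] by blast
qed

interpretation A: ideal_chain "Rr m" "pw_ideal m r" for m r
  by (rule pw_ideal_chain)

lemma ideal_power_fun: "ideal_power (Rr m) (ideal_A m r) = pw_ideal m r"
  by (rule ext) (rule ideal_power_eq)

lemma Rr_hat_eq: "Rr_hat r = A.L r r"
  by (simp add: Rr_hat_def ideal_power_fun)

lemma ev_Cr: "0 < r \<Longrightarrow> ev r p \<in> Cr r"
proof (induction p rule: poly_mapping_induct_add)
  case (single k c)
  obtain a b where k: "k = (a, b)" by (cases k)
  have i: "Amon 0 (of_int c) \<in> Cr r"
  proof -
    have n: "Amon 0 (of_nat n) \<in> Cr r" for n
      by (induction n) (simp_all add: rhomD[OF rhom_Amon0] Cr_closed)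
    show ?thesis by (cases c) (use n Cr_closed(5)[OF n] in \<open>simp_all add: rhomD(5,6)[OF rhom_Amon0, symmetric] del: of_nat_Suc\<close>)
  qed
  have "ev r (Poly_Mapping.single k c) = Amon 0 (of_int c) * (Amon b 1 * Amon 0 (zeta_pow r a))"
    unfolding k ev_single Amon_mult by simp
  then show ?case using i Cr_Amon Cr_zeta[OF single.prems] Cr_closed(4) by simp
qed (simp_all add: rhomD[OF rhom_ev] Cr_closed)

text \<open>At q = zeta a block of \<open>r\<close> consecutive brackets is a unit times 1 - x^r by
  \<open>qroot_prod\<close>, hence a unit times A^r - A^(-r), wherever the block starts.\<close>

lemma ev_In:
  assumes r: "0 < r"
  shows "ev r ` In (r * n) \<subseteq> pw_ideal r r n"
proof -
  define J where "J = {a. ev r a \<in> pw_ideal r r n}"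
  note D = C.idealD[OF ideal_pw_ideal]
  have TJ: "tideal J"
    unfolding tideal_def J_def using D(1,2,3) ev_Cr[OF r] by (auto simp: rhomD[OF rhom_ev])
  have block: "ev r (q_alpha l r) \<in> pw_ideal r r 1" for l
  proof -
    define x where "x = Amon (- 2) (zeta_pow r (- 2 * l))"
    have q: "qB (l - int i) = qmon (l - int i) 1 * (1 - qmon (- 2 * l) (- 2) * qmon 2 0 ^ i)" for i
      unfolding qB_def qmon_power by (simp add: right_diff_distrib qmon_mult algebra_simps)
    have e: "ev r (qmon a b) = Amon b (zeta_pow r a)" for a b unfolding qmon_def ev_single by simp
    have "ev r (q_alpha l r) = (\<Prod>i<r. ev r (qmon (l - int i) 1)) * (\<Prod>i<r. 1 - x * Amon 0 (zeta_pow r 2) ^ i)"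
      unfolding q_alpha_qB q prod.distrib[symmetric] rhomD[OF rhom_ev] e x_def ..
    also have "(\<Prod>i<r. 1 - x * Amon 0 (zeta_pow r 2) ^ i) = 1 - x ^ r"
      by (rule qroot_prod[OF qroot_zeta[OF r]])
    also have "x ^ r = Amon (- 2 * int r) 1"
    proof -
      have "zeta_pow r (- 2 * l) ^ r = zeta_pow r (2 * int r * - l)"
        unfolding power_int_of_nat[symmetric] power_int_mult[symmetric] by (rule arg_cong[where f = "zeta_pow r"]) simp
      also have "\<dots> = 1" using zeta_pow_2r[OF r] by (simp only: power_int_mult) simp
      finally show ?thesis unfolding x_def Amon_power by (simp add: mult.commute)
    qed
    also have "1 - Amon (- 2 * int r) 1 = Amon (- int r) 1 * dA r"
      unfolding dA_def right_diff_distrib Amon_mult Amon_0_1[symmetric] by simp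
    finally have "ev r (q_alpha l r) = ((\<Prod>i<r. ev r (qmon (l - int i) 1)) * Amon (- int r) 1) * dA r ^ 1"
      by (simp add: mult.assoc)
    moreover have "(\<Prod>i<m. ev r (qmon (l - int i) 1)) \<in> Cr r" for m
      by (induction m) (simp_all add: Cr_closed ev_Cr[OF r])
    ultimately show ?thesis unfolding pw_ideal_def using Cr_closed(4)[OF _ Cr_Amon] by blast
  qed
  have "ev r (q_alpha l (r * k)) \<in> pw_ideal r r k" for l k
  proof (induction k)
    case 0
    have "ev r (q_alpha l (r * 0)) = 1 * dA r ^ 0" by (simp add: q_alpha_def rhomD[OF rhom_ev])
    then show ?case unfolding pw_ideal_def using Cr_closed(1) by blast
  next
    case (Suc k)
    obtain c c' where c: "ev r (q_alpha l (r * k)) = c * dA r ^ k" "c \<in> Cr r"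
        "ev r (q_alpha (l - int (r * k)) r) = c' * dA r ^ 1" "c' \<in> Cr r"
      using Suc block[of "l - int (r * k)"] unfolding pw_ideal_def by blast
    have "ev r (q_alpha l (r * Suc k)) = (c * c') * dA r ^ Suc k"
      using q_alpha_add[of l "r * k" r] c by (simp add: rhomD[OF rhom_ev] add.commute mult_ac)
    then show ?case unfolding pw_ideal_def using Cr_closed(4)[OF c(2,4)] by blast
  qed
  then have "In (r * n) \<subseteq> J" by (intro In_least[OF TJ]) (simp add: J_def)
  then show ?thesis unfolding J_def by blast
qed

lemma subst_A_Cr: "p \<in> Cr 1 \<Longrightarrow> subst_A r p \<in> Cr 1"
  unfolding Cr_def
proof (induction rule: generate_ring.induct)
  case (incl h)
  have z: "zeta (Suc 0) = - 1" by (simp add: zeta_def complex_eq_iff)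
  have m: "Amon 0 (- 1) = - 1" using rhomD(1,5)[OF rhom_Amon0] by simp
  have "subst_A r h \<in> Cr 1"
    using incl Cr_Amon[of _ 1] Cr_closed(1,5) by (auto simp: z m rhomD[OF rhom_subst_A] subst_A_Amon)
  then show ?case unfolding Cr_def .
next
  case one
  have "subst_A r 1 \<in> Cr 1" using Cr_closed(1) by (simp add: rhomD[OF rhom_subst_A])
  then show ?case unfolding Cr_def by (simp add: ring_of_type_algebra_def)
next
  case (a_inv h)
  interpret U: cring "ring_of_type_algebra :: laurentA ring" by (rule cring_from_type_algebra)
  have "h + \<ominus>\<^bsub>ring_of_type_algebra\<^esub> h = 0"
    using U.r_neg[of h] by (simp add: ring_of_type_algebra_def)
  then have e: "\<ominus>\<^bsub>ring_of_type_algebra\<^esub> h = - h" by (simp add: eq_neg_iff_add_eq_0 add.commute)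
  have "subst_A r (- h) \<in> Cr 1" using a_inv Cr_closed(5) unfolding Cr_def[symmetric] by (simp add: rhomD[OF rhom_subst_A])
  then show ?case unfolding e Cr_def .
next
  case (eng_add h1 h2)
  have "subst_A r (h1 + h2) \<in> Cr 1" using eng_add Cr_closed(3) unfolding Cr_def[symmetric] by (simp add: rhomD[OF rhom_subst_A])
  then show ?case unfolding Cr_def by (simp add: ring_of_type_algebra_def)
next
  case (eng_mult h1 h2)
  have "subst_A r (h1 * h2) \<in> Cr 1" using eng_mult Cr_closed(4) unfolding Cr_def[symmetric] by (simp add: rhomD[OF rhom_subst_A])
  then show ?case unfolding Cr_def by (simp add: ring_of_type_algebra_def)
qed

lemma Cr_1_sub: "0 < r \<Longrightarrow> Cr 1 \<subseteq> Cr r"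
proof -
  assume r: "0 < r"
  interpret U: cring "ring_of_type_algebra :: laurentA ring" by (rule cring_from_type_algebra)
  have z: "zeta (Suc 0) = - 1" by (simp add: zeta_def complex_eq_iff)
  have m: "Amon 0 (- 1) = - 1" using rhomD(1,5)[OF rhom_Amon0] by simp
  show ?thesis unfolding Cr_def[of 1]
  proof (rule U.generate_ring_min_subring1)
    show "subring (Cr r) ring_of_type_algebra"
      unfolding Cr_def by (rule U.generate_ring_is_subring) (simp add: ring_of_type_algebra_def)
    show "{Amon 0 (zeta 1), Amon 1 1, Amon (- 1) 1} \<subseteq> Cr r"
      using Cr_Amon Cr_closed(1,5) by (simp add: z m)
  qed (simp add: ring_of_type_algebra_def)
qed

lemma subst_A_pw: "subst_A r ` pw_ideal 1 1 n \<subseteq> pw_ideal 1 r n"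
proof -
  have "subst_A r (dA 1) = dA r" by (simp add: dA_def rhomD[OF rhom_subst_A] subst_A_Amon)
  then show ?thesis unfolding pw_ideal_def using subst_A_Cr by (auto simp: rhomD[OF rhom_subst_A])
qed

lemma pw_ideal_sub: "0 < r \<Longrightarrow> pw_ideal 1 r n \<subseteq> pw_ideal r r n"
  unfolding pw_ideal_def using Cr_1_sub by blast

section \<open>The comparison\<close>

text \<open>Needed to place the ADO invariant in the subring \<open>Rr r\<close>, over which the
  completion is formed.\<close>

lemma Zsum_closed:
  fixes P :: "'a::comm_ring_1 par"
  assumes S: "0 \<in> S" "1 \<in> S" "\<And>a b. a \<in> S \<Longrightarrow> b \<in> S \<Longrightarrow> a + b \<in> S"
      "\<And>a b. a \<in> S \<Longrightarrow> b \<in> S \<Longrightarrow> a * b \<in> S" "\<And>a. a \<in> S \<Longrightarrow> - a \<in> S"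
    and p: "pQ P \<in> S" "pQi P \<in> S" "pA P \<in> S" "pAi P \<in> S" "pG P \<in> S" "pGi P \<in> S" "pT P \<in> S" "pTi P \<in> S"
  shows "Zsum N P D x y \<in> S"
proof -
  have pow: "a ^ n \<in> S" if "a \<in> S" for a n by (induction n) (auto intro: S that)
  have diff: "a - b \<in> S" if "a \<in> S" "b \<in> S" for a b using S(3)[OF that(1) S(5)[OF that(2)]] by simp
  have prod: "(\<Prod>i<(n::nat). f i) \<in> S" if "\<And>i. f i \<in> S" for f n by (induction n) (auto intro: S that)
  have gb: "gb (pQ P) n k \<in> S" for n k
    by (induction "pQ P" n k rule: gb.induct) (simp_all add: S p pow del: power_Suc)
  have fcoef: "fcoef P n j \<in> S" for n j
    unfolding fcoef_def by (intro S(4) prod diff S(2) pow p gb)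
  have pw: "pw P G z x \<in> S" for G z x
    by (cases "(P, G, z, x)" rule: pw.cases)
      (auto simp: wpos_def wneg_def gcoef_def intro!: S(1,2,4,5) pow p fcoef prod)
  have sw: "sw P s z x \<in> S" for s z x by (cases s) (simp add: pw S)
  have sum: "(\<Sum>i\<in>B. f i) \<in> S" if "\<And>i. f i \<in> S" for f :: "nat list \<Rightarrow> 'a" and B
    by (induction B rule: infinite_finite_induct) (auto intro: S that)
  show ?thesis
  proof (induction D arbitrary: x)
    case Nil
    then show ?case by (simp add: S)
  next
    case (Cons s D)
    then show ?case by (cases s) (auto simp del: sw.simps intro!: sum S(4) sw)
  qed
qed

text \<open>There is a single state, and with all labels 0 each piece contributes 1 or one of the
  invertible parameters.\<close>

lemma Zsum_1_unit:
  assumes "valid P" "tangle s D t"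
  shows "Zsum 1 P D (replicate (length s) 0) (replicate (length t) 0) dvd 1"
  using assms(2)
proof (induction D arbitrary: s)
  case Nil
  then show ?case by simp
next
  case (Cons a D)
  obtain u G w where a: "a = (u, G, w)" by (cases a)
  have s: "s = u @ src G @ w" and D: "tangle (u @ tgt G @ w) D t" using Cons.prems a by auto
  have l: "labels 1 k = {replicate k 0}" for k
    by (auto simp: labels_def subset_iff intro: replicate_eqI)
  have "pT P dvd 1" "pTi P dvd 1" "pG P dvd 1" "pGi P dvd 1"
    using assms(1) unfolding valid_def dvd_def by (metis mult.commute)+
  then have "pw P G (replicate (length (tgt G)) 0) (replicate (length (src G)) 0) dvd 1"
    by (cases G) (simp_all add: wpos_def wneg_def fcoef_def gcoef_def)
  moreover have "sw P (u, G, w) (replicate (length (u @ tgt G @ w)) 0) (replicate (length s) 0) =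
      pw P G (replicate (length (tgt G)) 0) (replicate (length (src G)) 0)"
    unfolding s by (simp add: replicate_add)
  ultimately have "sw P (u, G, w) (replicate (length (u @ tgt G @ w)) 0) (replicate (length s) 0) dvd 1"
    by simp
  from mult_dvd_mono[OF this Cons.IH[OF D]] show ?case unfolding a Zsum.simps l by simp
qed

text \<open>Up to a unit, the product in \<open>fcoef\<close> is a generator {\<alpha> - j; n} of
  \<open>In n\<close>: a jump by n costs n brackets.\<close>

lemma fcoef_PG_In: "K \<le> n \<Longrightarrow> fcoef PG n j \<in> In K"
proof -
  assume "K \<le> n"
  have f: "1 - pQ PG ^ (j + k) * (pAi PG)\<^sup>2 = qmon (int j + int k) (- 1) * qB (- int j - int k)" for k
  proof -
    have "pQ PG ^ (j + k) * (pAi PG)\<^sup>2 = qmon (2 * (int j + int k)) (- 2)"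
      unfolding PG_def par.sel qmon_def[symmetric] qmon_power qmon_mult by (simp add: algebra_simps)
    then show ?thesis unfolding qB_def right_diff_distrib qmon_mult by (simp add: qmon_0 algebra_simps)
  qed
  have "(\<Prod>k<n. 1 - pQ PG ^ (j + k) * (pAi PG)\<^sup>2) = (\<Prod>k<n. qmon (int j + int k) (- 1)) * q_alpha (- int j) n"
    unfolding f prod.distrib q_alpha_qB ..
  also have "\<dots> \<in> In n"
    by (rule hatR.idealD(3)[OF hatR.ideals q_alpha_In]) simp
  finally have "fcoef PG n j \<in> In n"
    unfolding fcoef_def by (rule hatR.idealD(3)[OF hatR.ideals]) simp
  then show ?thesis using hatR.antimono[OF \<open>K \<le> n\<close>] by blast
qed

lemma Zsum_PG_diff:
  assumes "closure_is_knot D" "arc_count D * (n - 1) < N" "N \<le> M"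
  shows "Zsum M PG D [0] y - Zsum N PG D [0] y \<in> In n"
proof (rule Zsum_diff_in_ideal[OF assms(1) _ _ _ fcoef_PG_In assms(2,3)])
  note I = hatR.idealD[OF hatR.ideals]
  show "0 \<in> In n" by (rule I(1))
  show "a * b \<in> In n" if "a \<in> In n" for a b by (rule I(4)[OF that]) simp
  show "a + b \<in> In n" if "a \<in> In n" "b \<in> In n" for a b by (rule I(2)[OF that])
qed

section \<open>Injectivity of \<open>f_map\<close> and \<open>f_Rhat\<close>, and the maps of limits
  on representatives\<close>

lemma inj_f_map: "inj f_map"
proof (rule injI)
  fix x y assume e: "f_map x = f_map y"
  have "fps_nth x i = fps_nth y i" for i
  proof -
    have "poly (fps_nth x i) (of_nat k) = poly (fps_nth y i) (of_nat k)" if "1 \<le> k" for k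
      using arg_cong[OF fun_cong[OF e, of k], of "\<lambda>z. fps_nth z i"] that by (simp add: f_map_def)
    then have s: "of_nat ` {1..} \<subseteq> {z. poly (fps_nth x i - fps_nth y i) z = 0}" by auto
    have "infinite (of_nat ` {1::nat..} :: rat set)"
      by (subst finite_image_iff) (auto simp: inj_on_def infinite_Ici)
    then have "infinite {z. poly (fps_nth x i - fps_nth y i) z = 0}" using s finite_subset by blast
    then have "fps_nth x i - fps_nth y i = 0" using poly_roots_finite by blast
    then show ?thesis by simp
  qed
  then show "x = y" by (simp add: fps_eq_iff)
qed

text \<open>Level \<open>n\<close> determines all coefficients below h^n, so a coefficient may be
  read off at any deeper level.\<close>

lemma Rhat_series_limit:
  assumes a: "hatR.coherent a"
  shows "i < n \<Longrightarrow> fps_nth (Rhat_series (hatR.limit a)) i = fps_nth (exp_series (a n)) i"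
proof -
  define x where "x = Abs_fps (\<lambda>i. fps_nth (exp_series (a (Suc i))) i)"
  have E: "fps_nth (exp_series b) i = fps_nth (exp_series (a n)) i" if "b - a n \<in> In m" "i < m" for b m n i
    using exp_series_In[OF that] by (simp add: rhomD[OF rhom_exp_series])
  have x: "fps_nth x i = fps_nth (exp_series (a n)) i" if "i < n" for i n
    using E[OF hatR.coherent_le[OF a, of "Suc i" n], of i] that by (simp add: x_def)
  have L: "hatR.limit a n = {e + a n | e. e \<in> In n}" for n
    by (simp add: hatR.limit_def hatR.coset_def')
  have "Rhat_series (hatR.limit a) = x"
    unfolding Rhat_series_def
  proof (rule the_equality)
    have "fps_nth x i = fps_nth (exp_series b) i" if "b \<in> hatR.limit a n" "i < n" for b n i
      using that x[OF that(2)] E[of b n n i] unfolding L by auto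
    then show "\<forall>n. \<forall>b\<in>hatR.limit a n. fps_cutoff n x = fps_cutoff n (exp_series b)"
      by (auto simp: fps_eq_iff)
  next
    fix y assume y: "\<forall>n. \<forall>b\<in>hatR.limit a n. fps_cutoff n y = fps_cutoff n (exp_series b)"
    have "a n \<in> hatR.limit a n" for n
      unfolding L using hatR.idealD(1)[OF hatR.ideals] by (auto intro!: exI[of _ 0])
    then have c: "fps_cutoff n y = fps_cutoff n (exp_series (a n))" for n using y by blast
    have "fps_nth y i = fps_nth x i" for i
      using arg_cong[OF c[of "Suc i"], of "\<lambda>z. fps_nth z i"] by (simp add: x_def)
    then show "y = x" by (simp add: fps_eq_iff)
  qed
  then show "i < n \<Longrightarrow> fps_nth (Rhat_series (hatR.limit a)) i = fps_nth (exp_series (a n)) i"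
    using x by simp
qed

text \<open>Equal families give equal series by \<open>inj_f_map\<close>; the difference of coherent
  representatives then has vanishing series, and \<open>coherent_exp_series_zero\<close>
  applies.\<close>

lemma inj_on_f_Rhat: "inj_on f_Rhat (carrier Rhat)"
proof (rule inj_onI)
  fix x y assume xy: "x \<in> carrier Rhat" "y \<in> carrier Rhat" "f_Rhat x = f_Rhat y"
  obtain a b where ab: "hatR.coherent a" "x = hatR.limit a" "hatR.coherent b" "y = hatR.limit b"
    using xy(1,2) unfolding Rhat_def hatR.carrier_L by auto
  have s: "Rhat_series x = Rhat_series y"
    using xy(3) injD[OF inj_f_map] unfolding f_Rhat_def by blast
  have "a n - b n \<in> In n" for n
  proof (rule coherent_exp_series_zero)
    fix n m :: nat assume "n \<le> m"
    then have "(a m - a n) - (b m - b n) \<in> In n"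
      by (intro hatR.idealD(6)[OF hatR.ideals] hatR.coherent_le ab)
    then show "(a m - b m) - (a n - b n) \<in> In n" by (simp add: algebra_simps)
  next
    fix n i :: nat assume "i < n"
    then show "fps_nth (exp_series (a n - b n)) i = 0"
      using Rhat_series_limit[OF ab(1), of i n] Rhat_series_limit[OF ab(3), of i n] s
      by (simp add: rhomD[OF rhom_exp_series] ab)
  qed
  then show "x = y" unfolding ab hatR.limit_eq by blast
qed

lemma coherent_map:
  assumes A: "ideal_chain R I" and B: "ideal_chain S J" and a: "ideal_chain.coherent R I a"
    and \<phi>: "\<And>a b. \<phi> (a - b) = \<phi> a - \<phi> b" "\<And>a. a \<in> carrier R \<Longrightarrow> \<phi> a \<in> carrier S"
    and sub: "\<And>n. \<phi> ` I (k n) \<subseteq> J n" and k: "\<And>n. k n \<le> k (Suc n)"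
  shows "ideal_chain.coherent S J (\<lambda>n. \<phi> (a (k n)))"
proof -
  interpret A: ideal_chain R I by (rule A)
  interpret B: ideal_chain S J by (rule B)
  show ?thesis
    unfolding B.coherent_def
  proof (intro allI conjI)
    fix n
    show "\<phi> (a (k n)) \<in> carrier S" using a by (simp add: \<phi> A.coherent_def)
    show "\<phi> (a (k (Suc n))) - \<phi> (a (k n)) \<in> J n"
      using A.coherent_le[OF a k[of n]] sub[of n] unfolding \<phi>(1)[symmetric] by blast
  qed
qed

lemma limit_map_limit':
  assumes "ideal_chain R I" "ideal_chain S J" "\<And>a b. \<phi> (a + b) = \<phi> a + \<phi> b" "\<And>n. \<phi> ` I (k n) \<subseteq> J n"
  shows "limit_map S J k \<phi> (ideal_chain.limit R I a) = ideal_chain.limit S J (\<lambda>n. \<phi> (a (k n)))"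
  unfolding ideal_chain.limit_def[OF assms(2)]
  by (rule ext) (rule limit_map_limit[where k = k, OF assms(1-3) assms(4)])

lemma ev_hat_limit: "0 < r \<Longrightarrow> ev_hat r (hatR.limit a) = A.limit r r (\<lambda>n. ev r (a (r * n)))"
  unfolding ev_hat_def ideal_power_fun
  by (rule limit_map_limit'[OF hatR.ideal_chain_axioms pw_ideal_chain rhomD(2)[OF rhom_ev] ev_In])

lemma coherent_ev: "0 < r \<Longrightarrow> hatR.coherent a \<Longrightarrow> A.coherent r r (\<lambda>n. ev r (a (r * n)))"
  by (rule coherent_map[OF hatR.ideal_chain_axioms pw_ideal_chain _ rhomD(6)[OF rhom_ev]])
    (use ev_In ev_Cr in auto)

lemma FC_limit:
  assumes r: "0 < r" and a: "hatR.coherent a"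
  shows "FC r (hatR.limit a) = A.limit r r (\<lambda>n. subst_A r (ev 1 (a n)))"
    and "A.coherent r r (\<lambda>n. subst_A r (ev 1 (a n)))"
proof -
  have o: "(0::nat) < 1" by simp
  have "g_sub r (A.limit 1 1 b) = A.limit 1 r (\<lambda>n. subst_A r (b n))" for b
    unfolding g_sub_def ideal_power_fun
    by (rule limit_map_limit'[OF pw_ideal_chain pw_ideal_chain rhomD(2)[OF rhom_subst_A] subst_A_pw])
  moreover have "limit_map (Rr r) (pw_ideal r r) (\<lambda>n. n) (\<lambda>a. a) (A.limit 1 r b) = A.limit r r b" for b
    by (rule limit_map_limit'[OF pw_ideal_chain pw_ideal_chain]) (use pw_ideal_sub[OF r] in auto)
  ultimately show "FC r (hatR.limit a) = A.limit r r (\<lambda>n. subst_A r (ev 1 (a n)))"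
    unfolding FC_def ideal_power_fun ev_hat_limit[OF o] by simp
  have 1: "A.coherent 1 1 (\<lambda>n. ev 1 (a n))" using coherent_ev[OF o a] by simp
  have 2: "A.coherent 1 r (\<lambda>n. subst_A r (ev 1 (a n)))"
    by (rule coherent_map[where k = "\<lambda>n. n", OF pw_ideal_chain pw_ideal_chain 1 rhomD(6)[OF rhom_subst_A] _ subst_A_pw])
      (use subst_A_Cr in auto)
  show "A.coherent r r (\<lambda>n. subst_A r (ev 1 (a n)))"
    by (rule coherent_map[where k = "\<lambda>n. n" and \<phi> = "\<lambda>a. a", OF pw_ideal_chain pw_ideal_chain 2])
      (use Cr_1_sub[OF r] pw_ideal_sub[OF r] in auto)
qed

lemma subst_ev_In: "0 < r \<Longrightarrow> p \<in> In n \<Longrightarrow> subst_A r (ev 1 p) \<in> pw_ideal r r n"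
  using ev_In[of 1 n] subst_A_pw[of r n] pw_ideal_sub[of r n] by auto

lemma subst_ev_Cr: "0 < r \<Longrightarrow> subst_A r (ev 1 p) \<in> Cr r"
  using ev_Cr[of 1 p] subst_A_Cr[of "ev 1 p" r] Cr_1_sub[of r] by auto

lemma Zsum_PA_Cr: "0 < r \<Longrightarrow> Zsum N (PA r) D x y \<in> Cr r"
proof -
  assume r: "0 < r"
  have m: "Amon b (zeta_pow r k) \<in> Cr r" for b k
    using Cr_closed(4)[OF Cr_Amon[of b] Cr_zeta[OF r, of k]] by (simp add: Amon_mult)
  show ?thesis
    unfolding PA_def by (rule Zsum_closed) (unfold par.sel, (intro Cr_closed Cr_Amon m; assumption)+)
qed

lemma pw_ideal_power: "e \<in> pw_ideal m r 1 \<Longrightarrow> e ^ n \<in> pw_ideal m r n"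
  unfolding pw_ideal_def using Cr_closed(7) by (auto simp: power_mult_distrib)

section \<open>The universal element of a knot and its specializations\<close>

lemma closure_is_knot_tangle: "closure_is_knot D \<Longrightarrow> tangle [Up] D [Up]"
  by (simp add: closure_is_knot_def)

text \<open>The first summand meets the jump estimate at level \<open>n\<close> and the rest makes
  the bound exceed \<open>n\<close>, so that deep levels contain all labels for any given color.
  Monotonicity gives coherence.\<close>

definition bound :: "slice list \<Rightarrow> nat \<Rightarrow> nat" where
  "bound D n = arc_count D * n + n + 1"

definition universal :: "slice list \<Rightarrow> nat \<Rightarrow> laurent_qA" where
  "universal D n = Zsum (bound D n) PG D [0] [0]"

lemma bound_mono: "n \<le> m \<Longrightarrow> bound D n \<le> bound D m"
  by (simp add: bound_def add_mono)

lemma bound_less: "arc_count D * (n - 1) < bound D n"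
proof -
  have "arc_count D * (n - 1) \<le> arc_count D * n" by simp
  then show ?thesis unfolding bound_def by linarith
qed

lemma coherent_universal: "closure_is_knot D \<Longrightarrow> hatR.coherent (universal D)"
  unfolding hatR.coherent_def universal_def
  using Zsum_PG_diff[OF _ bound_less bound_mono] by simp

lemma f_Rhat_universal:
  assumes D: "zero_framed_knot D"
  shows "f_Rhat (hatR.limit (universal D)) = jones_family D"
proof
  fix k
  have c: "hatR.coherent (universal D)" using D coherent_universal by (simp add: zero_framed_knot_def)
  have "poly (fps_nth (Rhat_series (hatR.limit (universal D))) i) (of_nat k) = fps_nth (colored_jones k D) i" for i
  proof -
    have "k < bound D (Suc (i + k))" by (simp add: bound_def)
    from colored_jones_eq[OF D this] Rhat_series_limit[OF c, of i "Suc (i + k)"] show ?thesis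
      by (simp add: eval_alpha_def universal_def)
  qed
  then show "f_Rhat (hatR.limit (universal D)) k = jones_family D k"
    by (simp add: f_Rhat_def f_map_def jones_family_def fps_eq_iff)
qed

text \<open>Modulo \<open>In 1\<close> even a jump by 1 is negligible, so the element is represented
  there by the sum with the single label 0. The inverse of that sum is the approximate inverse
  required by \<open>unit_L\<close>.\<close>

lemma FC_unit:
  assumes D: "closure_is_knot D" and r: "0 < r"
  shows "FC r (hatR.limit (universal D)) \<in> Units (Rr_hat r)"
proof -
  note c = coherent_universal[OF D]
  have "Zsum 1 PG D [0] [0] dvd 1"
    using Zsum_1_unit[OF valid_PG closure_is_knot_tangle[OF D]] by simp
  then obtain v where v: "Zsum 1 PG D [0] [0] * v = 1" unfolding dvd_def by metis
  define v' where "v' = subst_A r (ev 1 v)"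
  have v': "v' \<in> carrier (Rr r)" using subst_ev_Cr[OF r] by (simp add: v'_def)
  have d: "universal D 1 - Zsum 1 PG D [0] [0] \<in> In 1"
    unfolding universal_def by (rule Zsum_PG_diff[OF D]) (simp_all add: bound_def)
  have "- (universal D 1 - Zsum 1 PG D [0] [0]) * v = 1 - universal D 1 * v"
    using v by (simp add: algebra_simps)
  then have "1 - universal D 1 * v \<in> In 1"
    using hatR.idealD(4)[OF hatR.ideals hatR.idealD(5)[OF hatR.ideals d], of v] by simp
  then have u: "1 - subst_A r (ev 1 (universal D 1)) * v' \<in> pw_ideal r r 1"
    using subst_ev_In[OF r] unfolding v'_def by (force simp: rhomD[OF rhom_ev] rhomD[OF rhom_subst_A])
  show ?thesis
    unfolding FC_limit(1)[OF r c] Rr_hat_eq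
    by (rule A.unit_L[OF FC_limit(2)[OF r c] v' u pw_ideal_power])
qed

lemma ev_hat_universal:
  assumes D: "zero_framed_knot D" and r: "0 < r"
  shows "ADO_hat r D \<in> carrier (Rr_hat r)"
    and "ev_hat r (hatR.limit (universal D)) = ADO_hat r D \<otimes>\<^bsub>Rr_hat r\<^esub> FC r (hatR.limit (universal D))"
proof -
  have K: "closure_is_knot D" using D by (simp add: zero_framed_knot_def)
  note c = coherent_universal[OF K]
  define z where "z = ADO r D"
  have z: "z \<in> Cr r" unfolding z_def ADO_eq[OF D r] by (rule Zsum_PA_Cr[OF r])
  then have cz: "A.coherent r r (\<lambda>_. z)" by (intro A.coherent_const) simp
  have A: "ADO_hat r D = A.limit r r (\<lambda>_. z)"
    by (simp add: ADO_hat_def to_limit_def ideal_power_fun A.limit_def z_def)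
  show "ADO_hat r D \<in> carrier (Rr_hat r)" unfolding A Rr_hat_eq A.carrier_L using cz by blast
  have "ev r (universal D (r * n)) - z * subst_A r (ev 1 (universal D n)) \<in> pw_ideal r r n" for n
  proof -
    note I = C.idealD[OF ideal_pw_ideal]
    \<comment> \<open>One cutoff for both comparisons: level \<open>r * n\<close> before evaluation
      at zeta_2r and level \<open>n\<close> before evaluation at zeta_2.\<close>
    define M where "M = bound D (r * n)"
    have rM: "bound D (r * n) \<le> r * M" and nM: "bound D n \<le> M"
      using r bound_mono[of n "r * n" D] by (simp_all add: M_def)
    have "Zsum (r * M) PG D [0] [0] - universal D (r * n) \<in> In (r * n)"
      unfolding universal_def by (rule Zsum_PG_diff[OF K bound_less rM])
    then have "ev r (Zsum (r * M) PG D [0] [0] - universal D (r * n)) \<in> pw_ideal r r n"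
      using ev_In[OF r] by blast
    then have 1: "ev r (Zsum (r * M) PG D [0] [0]) - ev r (universal D (r * n)) \<in> pw_ideal r r n"
      by (simp add: rhomD[OF rhom_ev])
    have "Zsum M PG D [0] [0] - universal D n \<in> In n"
      unfolding universal_def by (rule Zsum_PG_diff[OF K bound_less nM])
    from subst_ev_In[OF r this]
    have 2: "subst_A r (ev 1 (Zsum M PG D [0] [0])) - subst_A r (ev 1 (universal D n)) \<in> pw_ideal r r n"
      by (simp add: rhomD[OF rhom_ev] rhomD[OF rhom_subst_A])
    \<comment> \<open>\<open>ev_factor\<close> is exact for the state sums with cutoffs
      \<open>r * M\<close> and \<open>M\<close>; the two approximation errors are combined so that
      these sums cancel.\<close>
    have "z * (subst_A r (ev 1 (Zsum M PG D [0] [0])) - subst_A r (ev 1 (universal D n)))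
        - (ev r (Zsum (r * M) PG D [0] [0]) - ev r (universal D (r * n))) \<in> pw_ideal r r n"
      by (rule I(6)[OF I(3)[OF 2] 1]) (simp add: z)
    then show ?thesis
      unfolding ev_factor[OF r closure_is_knot_tangle[OF K]] z_def ADO_eq[OF D r]
      by (simp add: algebra_simps)
  qed
  then show "ev_hat r (hatR.limit (universal D)) = ADO_hat r D \<otimes>\<^bsub>Rr_hat r\<^esub> FC r (hatR.limit (universal D))"
    unfolding FC_limit(1)[OF r c] A Rr_hat_eq A.mult_L[OF cz FC_limit(2)[OF r c]] ev_hat_limit[OF r] A.limit_eq
    by blast
qed

text \<open>The conjuncts besides the final equation give it its content: \<open>f_Rhat_inv\<close>
  is a true inverse on the image, the Jones family lies in that image, and the inverse taken in
  \<open>g_map\<close> is that of a unit.\<close>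

theorem theorem62:
  "inj f_map \<and> inj_on f_Rhat (carrier Rhat) \<and>
   (\<forall>D. zero_framed_knot D \<longrightarrow>
      jones_family D \<in> f_Rhat ` carrier Rhat \<and>
      (\<forall>r\<ge>1. FC r (f_Rhat_inv (jones_family D)) \<in> Units (Rr_hat r)) \<and>
      ADO_family D = Phi (jones_family D))"
proof (intro conjI allI impI)
  show "inj f_map" by (rule inj_f_map)
  show "inj_on f_Rhat (carrier Rhat)" by (rule inj_on_f_Rhat)
next
  fix D assume D: "zero_framed_knot D"
  then have K: "closure_is_knot D" by (simp add: zero_framed_knot_def)
  define x where "x = hatR.limit (universal D)"
  have x: "x \<in> carrier Rhat" unfolding Rhat_def x_def hatR.carrier_L using coherent_universal[OF K] by blast
  have f: "f_Rhat x = jones_family D" unfolding x_def by (rule f_Rhat_universal[OF D])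
  show "jones_family D \<in> f_Rhat ` carrier Rhat" using x f by (metis imageI)
  have inv: "f_Rhat_inv (jones_family D) = x"
    unfolding f_Rhat_inv_def f[symmetric] by (rule inv_into_f_f[OF inj_on_f_Rhat x])
  have U: "FC r x \<in> Units (Rr_hat r)" if "1 \<le> r" for r
    unfolding x_def by (rule FC_unit[OF K]) (use that in simp)
  then show "FC r (f_Rhat_inv (jones_family D)) \<in> Units (Rr_hat r)" if "1 \<le> r" for r
    unfolding inv using that by blast
  have "ADO_hat r D = ev_hat r x \<otimes>\<^bsub>Rr_hat r\<^esub> inv\<^bsub>Rr_hat r\<^esub> FC r x" if r: "1 \<le> r" for r
  proof -
    interpret comm_monoid "Rr_hat r" unfolding Rr_hat_eq by (rule A.comm_monoid_L)
    have "0 < r" using r by simp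
    note e = ev_hat_universal[OF D this, folded x_def]
    show ?thesis
      unfolding e(2) using e(1) U[OF r] Units_closed[OF U[OF r]] by (simp add: m_assoc)
  qed
  then show "ADO_family D = Phi (jones_family D)"
    unfolding ADO_family_def Phi_def inv g_map_def by (auto simp: restrict_def fun_eq_iff)
qed

end
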